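(* Let $H$ be a BiHom-Hopf algebra with a bijective antipode $S$. Then $({}_{H}^{H}\mathfrak{M}_{H}^{H},\otimes_{H})$ is a strict braided monoidal category with braiding $\widetilde{\sigma}:M\otimes_{H}N\to N\otimes_{H}M$, $$\widetilde{\sigma}(m\otimes n)=[\alpha^{-2}\omega^{-2}(m_{[-1]1})\cdot\alpha_{N}^{-2}\omega_{N}^{-1}(n_{(0)})]\cdot S\beta^{-1}\psi^{-2}(n_{(1)1})\otimes S\alpha^{-1}\omega^{-2}(m_{[-1]2})\cdot[\beta_{M}^{-2}\psi_{M}^{-1}(m_{[0]})\cdot\beta^{-2}\psi^{-2}(n_{(1)2})]$$ and inverse $$\widetilde{\sigma}^{-1}(n\otimes m)=[\alpha^{-2}\psi^{-2}(n_{(1)2})\cdot\alpha_{M}^{-2}\psi_{M}^{-1}(m_{[0]})]\cdot S^{-1}\beta^{-1}\psi^{-2}(m_{[-1]2})\otimes S^{-1}\alpha^{-1}\omega^{-2}(n_{(1)1})\cdot[\beta_{N}^{-2}\omega_{N}^{-1}(n_{(0)})\cdot\beta^{-2}\omega^{-2}(m_{[-1]1})],$$ for all $M,N\in{}_{H}^{H}\mathfrak{M}_{H}^{H}$, $m\in M$ and $n\in N$.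
   Context: All spaces are over a field $\Bbbk$; Sweedler notation $\Delta(h)=h_1\otimes h_2$ (summation suppressed). BiHom-bialgebra: $H=(H,\mu,1,\Delta,\varepsilon,\alpha,\beta,\omega,\psi)$ with $\alpha,\beta,\omega,\psi$ pairwise commuting linear automorphisms of $H$ such that: (algebra) $\alpha(1)=\beta(1)=1$, $a1=\alpha(a)$, $1a=\beta(a)$, $\alpha(a)(bc)=(ab)\beta(c)$, and $\alpha,\beta$ are multiplicative; (coalgebra) $\varepsilon\omega=\varepsilon\psi=\varepsilon$, $c_1\varepsilon(c_2)=\omega(c)$, $\varepsilon(c_1)c_2=\psi(c)$, $\omega(c_1)\otimes\Delta(c_2)=\Delta(c_1)\otimes\psi(c_2)$, and $\omega,\psi$ are comultiplicative; $\Delta(hg)=h_1g_1\otimes h_2g_2$, $\varepsilon(hg)=\varepsilon(h)\varepsilon(g)$, $\Delta(1)=1\otimes1$, $\varepsilon(1)=1_{\Bbbk}$; $\alpha,\beta$ preserve $\Delta,\varepsilon$; $\omega,\psi$ preserve $\mu$ and $1$. A BiHom-Hopf algebra is a BiHom-bialgebra with a linear map $S:H\to H$ (antipode) commuting with $\alpha,\beta,\omega,\psi$ and satisfying $h_1S(h_2)=S(h_1)h_2=\varepsilon(h)1$. Modules and comodules: each is a space $M$ with pairwise commuting linear automorphisms $\alpha_M,\beta_M,\omega_M,\psi_M$, and actions and coactions are compatible with each of them, i.e. $\theta(h)\cdot\theta_M(m)=\theta_M(h\cdot m)$, $\theta_M(m)\cdot\theta(h)=\theta_M(m\cdot h)$,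 and $\rho\circ\theta_M=(\theta_M\otimes\theta)\circ\rho$ (or $(\theta\otimes\theta_M)\circ\rho$ for left coactions), for $\theta\in\{\alpha,\beta,\omega,\psi\}$. In addition: left $H$-module: $\alpha(h)\cdot(g\cdot m)=(hg)\cdot\beta_M(m)$, $1\cdot m=\beta_M(m)$; right $H$-module: $(m\cdot h)\cdot\beta(g)=\alpha_M(m)\cdot(hg)$, $m\cdot1=\alpha_M(m)$; $H$-bimodule: both, with $\alpha(a)\cdot(m\cdot b)=(a\cdot m)\cdot\beta(b)$; right $H$-comodule, $\rho^r(m)=m_{(0)}\otimes m_{(1)}\in M\otimes H$: $\omega_M(m_{(0)})\otimes\Delta(m_{(1)})=\rho^r(m_{(0)})\otimes\psi(m_{(1)})$, $m_{(0)}\varepsilon(m_{(1)})=\omega_M(m)$; left $H$-comodule, $\rho^l(m)=m_{[-1]}\otimes m_{[0]}\in H\otimes M$: $\omega(m_{[-1]})\otimes\rho^l(m_{[0]})=\Delta(m_{[-1]})\otimes\psi_M(m_{[0]})$, $\varepsilon(m_{[-1]})m_{[0]}=\psi_M(m)$; $H$-bicomodule: both, with $\omega(m_{[-1]})\otimes m_{[0](0)}\otimes m_{[0](1)}=m_{(0)[-1]}\otimes m_{(0)[0]}\otimes\psi(m_{(1)})$. We write $m_{[-1]1}\otimes m_{[-1]2}=\Delta(m_{[-1]})$ and $n_{(1)1}\otimes n_{(1)2}=\Delta(n_{(1)})$. A BiHom-four-angle Hopf module is an $H$-bimodule and $H$-bicomodule $M$ (with the same four automorphisms) satisfying, for all $h\in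 H$, $m\in M$: $\rho^l(h\cdot m)=h_1m_{[-1]}\otimes h_2\cdot m_{[0]}$, $\rho^r(h\cdot m)=h_1\cdot m_{(0)}\otimes h_2m_{(1)}$, $\rho^l(m\cdot h)=m_{[-1]}h_1\otimes m_{[0]}\cdot h_2$, $\rho^r(m\cdot h)=m_{(0)}\cdot h_1\otimes m_{(1)}h_2$. ${}_{H}^{H}\mathfrak{M}_{H}^{H}$ is the category of these, with morphisms the linear maps commuting with the four automorphisms that are linear and colinear on both sides. Monoidal product: $M\otimes_HN$ is the quotient of $M\otimes N$ by the relations $m\cdot h\otimes\beta_N(n)=\alpha_M(m)\otimes h\cdot n$, with componentwise automorphisms and, for $T=\alpha^{a}\beta^{b}\omega^{c}\psi^{d}$ with fixed arbitrary $a,b,c,d\in\mathbb{Z}$, $h\cdot(m\otimes n)=T^{-1}\alpha^{-1}(h)\cdot m\otimes\beta_N(n)$, $(m\otimes n)\cdot h=\alpha_M(m)\otimes n\cdot T^{-1}\beta^{-1}(h)$, $\rho^l(m\otimes n)=T(m_{[-1]}n_{[-1]})\otimes m_{[0]}\otimes n_{[0]}$, $\rho^r(m\otimes n)=m_{(0)}\otimes n_{(0)}\otimes T(m_{(1)}n_{(1)})$. A monoidal category is strict if all its constraints are identities.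
   Formalization: "Strict" is corrected: plain rebracketing is not well defined on these quotients in general, so the constraints are instead the explicit isomorphisms (m⊗n)⊗p = Tα(m)⊗(n⊗T⁻¹β⁻¹(p)), h⊗m = T(h·m), m⊗h = T(m·h), with all coherence axioms. *)

theory Defs
  imports "HOL-Algebra.Module" "HOL-Library.FuncSet"
begin

section \<open>Braided monoidal categories\<close>

text \<open>
  Morphisms carry their source and target, so composition needs no object arguments.
\<close>

locale category =
  fixes Obj :: "'o set"
    and Hom :: "'o \<Rightarrow> 'o \<Rightarrow> 'm set"
    and Id :: "'o \<Rightarrow> 'm"
    and Comp :: "'m \<Rightarrow> 'm \<Rightarrow> 'm"  (infixr "\<cdot>" 55)
  assumes hom_disjoint: "\<lbrakk>f \<in> Hom A B; f \<in> Hom A' B'\<rbrakk> \<Longrightarrow> A = A' \<and> B = B'"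
    and id_in_hom: "A \<in> Obj \<Longrightarrow> Id A \<in> Hom A A"
    and comp_in_hom: "\<lbrakk>A \<in> Obj; B \<in> Obj; C \<in> Obj; f \<in> Hom A B; g \<in> Hom B C\<rbrakk> \<Longrightarrow> g \<cdot> f \<in> Hom A C"
    and id_right: "\<lbrakk>A \<in> Obj; B \<in> Obj; f \<in> Hom A B\<rbrakk> \<Longrightarrow> f \<cdot> Id A = f"
    and id_left: "\<lbrakk>A \<in> Obj; B \<in> Obj; f \<in> Hom A B\<rbrakk> \<Longrightarrow> Id B \<cdot> f = f"
    and comp_assoc: "\<lbrakk>A \<in> Obj; B \<in> Obj; C \<in> Obj; D \<in> Obj; f \<in> Hom A B; g \<in> Hom B C; h \<in> Hom C D\<rbrakk>
      \<Longrightarrow> h \<cdot> (g \<cdot> f) = (h \<cdot> g) \<cdot> f"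
begin

definition inverse_arrows :: "'o \<Rightarrow> 'o \<Rightarrow> 'm \<Rightarrow> 'm \<Rightarrow> bool" where
  "inverse_arrows A B f g \<longleftrightarrow> f \<in> Hom A B \<and> g \<in> Hom B A \<and> g \<cdot> f = Id A \<and> f \<cdot> g = Id B"

definition iso_arrow :: "'o \<Rightarrow> 'o \<Rightarrow> 'm \<Rightarrow> bool" where
  "iso_arrow A B f \<longleftrightarrow> (\<exists>g. inverse_arrows A B f g)"

definition inverse_arrow :: "'o \<Rightarrow> 'o \<Rightarrow> 'm \<Rightarrow> 'm" where
  "inverse_arrow A B f = (THE g. inverse_arrows A B f g)"

end

locale monoidal_category = category Obj Hom Id Comp
  for Obj :: "'o set" and Hom :: "'o \<Rightarrow> 'o \<Rightarrow> 'm set" and Id and Comp (infixr "\<cdot>" 55) +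
  fixes TO :: "'o \<Rightarrow> 'o \<Rightarrow> 'o"  (infixr "\<star>" 60)
    and TM :: "'m \<Rightarrow> 'm \<Rightarrow> 'm"  (infixr "\<bullet>" 60)
    and I :: 'o
    and Assoc :: "'o \<Rightarrow> 'o \<Rightarrow> 'o \<Rightarrow> 'm"
    and LUnit :: "'o \<Rightarrow> 'm"
    and RUnit :: "'o \<Rightarrow> 'm"
  assumes unit_obj: "I \<in> Obj"
    and tensor_obj: "\<lbrakk>A \<in> Obj; B \<in> Obj\<rbrakk> \<Longrightarrow> A \<star> B \<in> Obj"
    and tensor_hom: "\<lbrakk>A \<in> Obj; A' \<in> Obj; B \<in> Obj; B' \<in> Obj; f \<in> Hom A A'; g \<in> Hom B B'\<rbrakk>
      \<Longrightarrow> f \<bullet> g \<in> Hom (A \<star> B) (A' \<star> B')"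
    and tensor_id: "\<lbrakk>A \<in> Obj; B \<in> Obj\<rbrakk> \<Longrightarrow> Id A \<bullet> Id B = Id (A \<star> B)"
    and tensor_comp: "\<lbrakk>A \<in> Obj; A' \<in> Obj; A'' \<in> Obj; B \<in> Obj; B' \<in> Obj; B'' \<in> Obj;
        f \<in> Hom A A'; f' \<in> Hom A' A''; g \<in> Hom B B'; g' \<in> Hom B' B''\<rbrakk>
      \<Longrightarrow> (f' \<cdot> f) \<bullet> (g' \<cdot> g) = (f' \<bullet> g') \<cdot> (f \<bullet> g)"
    and assoc_iso: "\<lbrakk>A \<in> Obj; B \<in> Obj; C \<in> Obj\<rbrakk>
      \<Longrightarrow> iso_arrow ((A \<star> B) \<star> C) (A \<star> (B \<star> C)) (Assoc A B C)"
    and lunit_iso: "A \<in> Obj \<Longrightarrow> iso_arrow (I \<star> A) A (LUnit A)"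
    and runit_iso: "A \<in> Obj \<Longrightarrow> iso_arrow (A \<star> I) A (RUnit A)"
    and assoc_natural: "\<lbrakk>A \<in> Obj; A' \<in> Obj; B \<in> Obj; B' \<in> Obj; C \<in> Obj; C' \<in> Obj;
        f \<in> Hom A A'; g \<in> Hom B B'; h \<in> Hom C C'\<rbrakk>
      \<Longrightarrow> Assoc A' B' C' \<cdot> ((f \<bullet> g) \<bullet> h) = (f \<bullet> (g \<bullet> h)) \<cdot> Assoc A B C"
    and lunit_natural: "\<lbrakk>A \<in> Obj; A' \<in> Obj; f \<in> Hom A A'\<rbrakk> \<Longrightarrow> LUnit A' \<cdot> (Id I \<bullet> f) = f \<cdot> LUnit A"
    and runit_natural: "\<lbrakk>A \<in> Obj; A' \<in> Obj; f \<in> Hom A A'\<rbrakk> \<Longrightarrow> RUnit A' \<cdot> (f \<bullet> Id I) = f \<cdot> RUnit A"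
    and pentagon: "\<lbrakk>A \<in> Obj; B \<in> Obj; C \<in> Obj; D \<in> Obj\<rbrakk>
      \<Longrightarrow> (Id A \<bullet> Assoc B C D) \<cdot> Assoc A (B \<star> C) D \<cdot> (Assoc A B C \<bullet> Id D)
        = Assoc A B (C \<star> D) \<cdot> Assoc (A \<star> B) C D"
    and triangle: "\<lbrakk>A \<in> Obj; B \<in> Obj\<rbrakk>
      \<Longrightarrow> (Id A \<bullet> LUnit B) \<cdot> Assoc A I B = RUnit A \<bullet> Id B"

locale braided_monoidal_category =
  monoidal_category Obj Hom Id Comp TO TM I Assoc LUnit RUnit
  for Obj :: "'o set" and Hom :: "'o \<Rightarrow> 'o \<Rightarrow> 'm set" and Id and Comp (infixr "\<cdot>" 55)
    and TO (infixr "\<star>" 60) and TM (infixr "\<bullet>" 60) and I and Assoc and LUnit and RUnit +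
  fixes Braid :: "'o \<Rightarrow> 'o \<Rightarrow> 'm"
  assumes braid_iso: "\<lbrakk>A \<in> Obj; B \<in> Obj\<rbrakk> \<Longrightarrow> iso_arrow (A \<star> B) (B \<star> A) (Braid A B)"
    and braid_natural: "\<lbrakk>A \<in> Obj; A' \<in> Obj; B \<in> Obj; B' \<in> Obj; f \<in> Hom A A'; g \<in> Hom B B'\<rbrakk>
      \<Longrightarrow> Braid A' B' \<cdot> (f \<bullet> g) = (g \<bullet> f) \<cdot> Braid A B"
    and hexagon1: "\<lbrakk>A \<in> Obj; B \<in> Obj; C \<in> Obj\<rbrakk>
      \<Longrightarrow> Assoc B C A \<cdot> Braid A (B \<star> C) \<cdot> Assoc A B C
        = (Id B \<bullet> Braid A C) \<cdot> Assoc B A C \<cdot> (Braid A B \<bullet> Id C)"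
    and hexagon2: "\<lbrakk>A \<in> Obj; B \<in> Obj; C \<in> Obj\<rbrakk>
      \<Longrightarrow> inverse_arrow ((C \<star> A) \<star> B) (C \<star> (A \<star> B)) (Assoc C A B) \<cdot> Braid (A \<star> B) C
          \<cdot> inverse_arrow ((A \<star> B) \<star> C) (A \<star> (B \<star> C)) (Assoc A B C)
        = (Braid A C \<bullet> Id B) \<cdot> inverse_arrow ((A \<star> C) \<star> B) (A \<star> (C \<star> B)) (Assoc A C B)
          \<cdot> (Id A \<bullet> Braid B C)"


section \<open>Linear maps and tensor products\<close>

definition linear_maps ::
  "('k, 'z) ring_scheme \<Rightarrow> ('k, 'u, 'x) module_scheme \<Rightarrow> ('k, 'v, 'y) module_scheme \<Rightarrow> ('u \<Rightarrow> 'v) set"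
where
  "linear_maps K V W = {f \<in> carrier V \<rightarrow> carrier W.
     (\<forall>x\<in>carrier V. \<forall>y\<in>carrier V. f (x \<oplus>\<^bsub>V\<^esub> y) = f x \<oplus>\<^bsub>W\<^esub> f y) \<and>
     (\<forall>c\<in>carrier K. \<forall>x\<in>carrier V. f (c \<odot>\<^bsub>V\<^esub> x) = c \<odot>\<^bsub>W\<^esub> f x)}"

definition bilinear_maps ::
  "('k, 'z) ring_scheme \<Rightarrow> ('k, 'u, 'x) module_scheme \<Rightarrow> ('k, 'v, 'y) module_scheme
   \<Rightarrow> ('k, 'w, 't) module_scheme \<Rightarrow> ('u \<Rightarrow> 'v \<Rightarrow> 'w) set"
where
  "bilinear_maps K U V W = {f. (\<forall>u\<in>carrier U. f u \<in> linear_maps K V W) \<and>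
     (\<forall>v\<in>carrier V. (\<lambda>u. f u v) \<in> linear_maps K U W)}"

definition linear_automorphisms ::
  "('k, 'z) ring_scheme \<Rightarrow> ('k, 'u, 'x) module_scheme \<Rightarrow> ('u \<Rightarrow> 'u) set"
where
  "linear_automorphisms K V = {f \<in> linear_maps K V V. bij_betw f (carrier V) (carrier V)}"

text \<open>
  All vector spaces have their carrier in one type that is closed under finite formal sums of
  pairs. Hence tensor products and their quotients live in the same type again, and the modules
  over a fixed \<open>H\<close> form a single category. The parameter \<open>'a\<close> is an arbitrary type of atoms.
\<close>

datatype 'a universe = Atom 'a | Formal "('a universe \<times> 'a universe) list"

fun summands :: "'a universe \<Rightarrow> ('a universe \<times> 'a universe) list" where
  "summands (Formal xs) = xs"
| "summands (Atom a) = []"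

text \<open>
  The list \<open>[(v1, w1), ..., (vn, wn)]\<close> stands for the sum of the pure tensors of \<open>vi\<close> and \<open>wi\<close>;
  scalars are absorbed into the factors. \<open>tensor_eq K V W R\<close> is equality of such sums
  in the quotient of the tensor product of \<open>V\<close> and \<open>W\<close> over \<open>K\<close> by the identifications of
  the pure tensors that are related by \<open>R\<close>.
\<close>

inductive tensor_eq ::
  "('k, 'z) ring_scheme \<Rightarrow> ('k, 'u, 'x) module_scheme \<Rightarrow> ('k, 'v, 'y) module_scheme
   \<Rightarrow> (('u \<times> 'v) \<times> ('u \<times> 'v)) set \<Rightarrow> ('u \<times> 'v) list \<Rightarrow> ('u \<times> 'v) list \<Rightarrow> bool"
  for K V W R
where
  refl: "set xs \<subseteq> carrier V \<times> carrier W \<Longrightarrow> tensor_eq K V W R xs xs"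
| sym: "tensor_eq K V W R xs ys \<Longrightarrow> tensor_eq K V W R ys xs"
| trans: "\<lbrakk>tensor_eq K V W R xs ys; tensor_eq K V W R ys zs\<rbrakk> \<Longrightarrow> tensor_eq K V W R xs zs"
| append: "\<lbrakk>tensor_eq K V W R xs xs'; tensor_eq K V W R ys ys'\<rbrakk>
    \<Longrightarrow> tensor_eq K V W R (xs @ ys) (xs' @ ys')"
| commute: "\<lbrakk>set xs \<subseteq> carrier V \<times> carrier W; set ys \<subseteq> carrier V \<times> carrier W\<rbrakk>
    \<Longrightarrow> tensor_eq K V W R (xs @ ys) (ys @ xs)"
| zero: "w \<in> carrier W \<Longrightarrow> tensor_eq K V W R [(\<zero>\<^bsub>V\<^esub>, w)] []"
| add_left: "\<lbrakk>v \<in> carrier V; v' \<in> carrier V; w \<in> carrier W\<rbrakk>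
    \<Longrightarrow> tensor_eq K V W R [(v \<oplus>\<^bsub>V\<^esub> v', w)] [(v, w), (v', w)]"
| add_right: "\<lbrakk>v \<in> carrier V; w \<in> carrier W; w' \<in> carrier W\<rbrakk>
    \<Longrightarrow> tensor_eq K V W R [(v, w \<oplus>\<^bsub>W\<^esub> w')] [(v, w), (v, w')]"
| scalar: "\<lbrakk>c \<in> carrier K; v \<in> carrier V; w \<in> carrier W\<rbrakk>
    \<Longrightarrow> tensor_eq K V W R [(c \<odot>\<^bsub>V\<^esub> v, w)] [(v, c \<odot>\<^bsub>W\<^esub> w)]"
| relation: "\<lbrakk>((v, w), (v', w')) \<in> R; v \<in> carrier V; w \<in> carrier W; v' \<in> carrier V; w' \<in> carrier W\<rbrakk>
    \<Longrightarrow> tensor_eq K V W R [(v, w)] [(v', w')]"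

text \<open>
  The elements of a quotient are chosen representatives rather than equivalence classes, because
  classes would leave the type.
\<close>

definition tensor_class ::
  "('k, 'z) ring_scheme \<Rightarrow> ('k, 'a universe, 'x) module_scheme \<Rightarrow> ('k, 'a universe, 'y) module_scheme
   \<Rightarrow> (('a universe \<times> 'a universe) \<times> ('a universe \<times> 'a universe)) set
   \<Rightarrow> ('a universe \<times> 'a universe) list \<Rightarrow> 'a universe"
where
  "tensor_class K V W R xs = Formal (SOME ys. tensor_eq K V W R xs ys)"

text \<open>The fields \<open>mult\<close> and \<open>one\<close> of the record type \<open>module\<close> play no role for a vector space.\<close>

definition quotient_tensor ::
  "('k, 'z) ring_scheme \<Rightarrow> ('k, 'a universe, 'x) module_scheme \<Rightarrow> ('k, 'a universe, 'y) module_scheme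
   \<Rightarrow> (('a universe \<times> 'a universe) \<times> ('a universe \<times> 'a universe)) set
   \<Rightarrow> ('k, 'a universe) module"
where
  "quotient_tensor K V W R =
    \<lparr>carrier = tensor_class K V W R ` lists (carrier V \<times> carrier W),
     mult = undefined, one = undefined,
     zero = tensor_class K V W R [],
     add = (\<lambda>x y. tensor_class K V W R (summands x @ summands y)),
     smult = (\<lambda>c x. tensor_class K V W R (map (\<lambda>(v, w). (c \<odot>\<^bsub>V\<^esub> v, w)) (summands x)))\<rparr>"

definition tensor ::
  "('k, 'z) ring_scheme \<Rightarrow> ('k, 'a universe, 'x) module_scheme \<Rightarrow> ('k, 'a universe, 'y) module_scheme
   \<Rightarrow> ('k, 'a universe) module"
where "tensor K V W = quotient_tensor K V W {}"

definition pure ::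
  "('k, 'z) ring_scheme \<Rightarrow> ('k, 'a universe, 'x) module_scheme \<Rightarrow> ('k, 'a universe, 'y) module_scheme
   \<Rightarrow> 'a universe \<Rightarrow> 'a universe \<Rightarrow> 'a universe"
where "pure K V W v w = tensor_class K V W {} [(v, w)]"

text \<open>
  Sweedler notation: if \<open>x\<close> is the sum of pure tensors of \<open>vi\<close> and \<open>wi\<close>, then \<open>sweedler W x F\<close>
  is the sum of the \<open>F vi wi\<close> in \<open>W\<close>. For bilinear \<open>F\<close> respecting the relations this depends only
  on \<open>x\<close> as an element of the (quotient) tensor product, see \<open>sweedler_class\<close> below.
\<close>

definition sum_pairs :: "('u, 'x) ring_scheme \<Rightarrow> ('v \<Rightarrow> 'w \<Rightarrow> 'u) \<Rightarrow> ('v \<times> 'w) list \<Rightarrow> 'u" where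
  "sum_pairs W F xs = foldr (\<lambda>(v, w) s. F v w \<oplus>\<^bsub>W\<^esub> s) xs \<zero>\<^bsub>W\<^esub>"

definition sweedler ::
  "('u, 'x) ring_scheme \<Rightarrow> 'a universe \<Rightarrow> ('a universe \<Rightarrow> 'a universe \<Rightarrow> 'u) \<Rightarrow> 'u"
where "sweedler W x F = sum_pairs W F (summands x)"

lemma sum_pairs_closed:
  assumes "abelian_group W" "set xs \<subseteq> A \<times> B" "\<And>v w. v \<in> A \<Longrightarrow> w \<in> B \<Longrightarrow> F v w \<in> carrier W"
  shows "sum_pairs W F xs \<in> carrier W"
proof -
  interpret abelian_group W by fact
  show ?thesis
    using assms(2,3) by (induction xs) (auto simp: sum_pairs_def)
qed

lemma sum_pairs_append:
  assumes "abelian_group W" "set xs \<subseteq> A \<times> B" "set ys \<subseteq> A \<times> B"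
    "\<And>v w. v \<in> A \<Longrightarrow> w \<in> B \<Longrightarrow> F v w \<in> carrier W"
  shows "sum_pairs W F (xs @ ys) = sum_pairs W F xs \<oplus>\<^bsub>W\<^esub> sum_pairs W F ys"
proof -
  interpret abelian_group W by fact
  have cl: "sum_pairs W F zs \<in> carrier W" if "set zs \<subseteq> A \<times> B" for zs
    using assms(1) that assms(4) by (rule sum_pairs_closed)
  have ys: "sum_pairs W F ys \<in> carrier W"
    using cl assms(3) by blast
  show ?thesis
    using assms(2)
  proof (induction xs)
    case Nil
    then show ?case using ys by (simp add: sum_pairs_def)
  next
    case (Cons p xs)
    obtain v w where p: "p = (v, w)" by (cases p)
    have c: "F v w \<in> carrier W" "sum_pairs W F xs \<in> carrier W"
      using Cons.prems assms(4) cl[of xs] by (auto simp: p)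
    have st: "sum_pairs W F ((v, w) # zs) = F v w \<oplus>\<^bsub>W\<^esub> sum_pairs W F zs" for zs
      by (simp add: sum_pairs_def)
    show ?case
      using Cons c ys by (simp add: p st a_assoc)
  qed
qed

lemma tensor_eq_carrier:
  assumes "module K V" "module K W" "tensor_eq K V W R xs ys"
  shows "set xs \<subseteq> carrier V \<times> carrier W \<and> set ys \<subseteq> carrier V \<times> carrier W"
proof -
  interpret V: module K V by fact
  interpret W: module K W by fact
  show ?thesis
    using assms(3) by induction auto
qed

lemma sum_pairs_cong:
  assumes "module K V" "module K W" "module K U" "F \<in> bilinear_maps K V W U"
    and bal: "\<And>v w v' w'. ((v, w), (v', w')) \<in> R \<Longrightarrow> v \<in> carrier V \<Longrightarrow> w \<in> carrier W
      \<Longrightarrow> v' \<in> carrier V \<Longrightarrow> w' \<in> carrier W \<Longrightarrow> F v w = F v' w'"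
    and eq: "tensor_eq K V W R xs ys"
  shows "sum_pairs U F xs = sum_pairs U F ys"
proof -
  interpret V: module K V by fact
  interpret W: module K W by fact
  interpret U: module K U by fact
  have cl: "F v w \<in> carrier U" if "v \<in> carrier V" "w \<in> carrier W" for v w
    using assms(4) that by (auto simp: bilinear_maps_def linear_maps_def)
  have ag: "abelian_group U" by unfold_locales
  have app: "sum_pairs U F (zs @ zs') = sum_pairs U F zs \<oplus>\<^bsub>U\<^esub> sum_pairs U F zs'"
    if "set zs \<subseteq> carrier V \<times> carrier W" "set zs' \<subseteq> carrier V \<times> carrier W" for zs zs'
    using ag that cl by (rule sum_pairs_append)
  have scl: "sum_pairs U F zs \<in> carrier U" if "set zs \<subseteq> carrier V \<times> carrier W" for zs
    using ag that cl by (rule sum_pairs_closed)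
  have addl: "F (v \<oplus>\<^bsub>V\<^esub> v') w = F v w \<oplus>\<^bsub>U\<^esub> F v' w"
    if "v \<in> carrier V" "v' \<in> carrier V" "w \<in> carrier W" for v v' w
    using assms(4) that by (auto simp: bilinear_maps_def linear_maps_def)
  have addr: "F v (w \<oplus>\<^bsub>W\<^esub> w') = F v w \<oplus>\<^bsub>U\<^esub> F v w'"
    if "v \<in> carrier V" "w' \<in> carrier W" "w \<in> carrier W" for v w w'
    using assms(4) that by (auto simp: bilinear_maps_def linear_maps_def)
  have scal: "F (c \<odot>\<^bsub>V\<^esub> v) w = F v (c \<odot>\<^bsub>W\<^esub> w)"
    if "c \<in> carrier K" "v \<in> carrier V" "w \<in> carrier W" for c v w
    using assms(4) that by (auto simp: bilinear_maps_def linear_maps_def)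
  have zero: "F \<zero>\<^bsub>V\<^esub> w = \<zero>\<^bsub>U\<^esub>" if "w \<in> carrier W" for w
  proof -
    have "F \<zero>\<^bsub>V\<^esub> w \<oplus>\<^bsub>U\<^esub> F \<zero>\<^bsub>V\<^esub> w = F \<zero>\<^bsub>V\<^esub> w"
      using addl[of "\<zero>\<^bsub>V\<^esub>" "\<zero>\<^bsub>V\<^esub>" w] that by simp
    then show ?thesis
      using cl[of "\<zero>\<^bsub>V\<^esub>" w] that by simp
  qed
  have one: "sum_pairs U F [(v, w)] = F v w" if "v \<in> carrier V" "w \<in> carrier W" for v w
    using cl[OF that] by (simp add: sum_pairs_def)
  have two: "sum_pairs U F [(v, w), (v', w')] = F v w \<oplus>\<^bsub>U\<^esub> F v' w'"
    if "v \<in> carrier V" "w \<in> carrier W" "v' \<in> carrier V" "w' \<in> carrier W" for v w v' w'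
    using cl[OF that(1,2)] cl[OF that(3,4)] by (simp add: sum_pairs_def)
  show ?thesis
    using eq
  proof induction
    case (refl xs)
    show ?case by (rule HOL.refl)
  next
    case (sym xs ys)
    then show ?case by (rule_tac HOL.sym)
  next
    case (trans xs ys zs)
    then show ?case by (rule_tac HOL.trans)
  next
    case (append xs xs' ys ys')
    have "set xs \<subseteq> carrier V \<times> carrier W" "set xs' \<subseteq> carrier V \<times> carrier W"
      "set ys \<subseteq> carrier V \<times> carrier W" "set ys' \<subseteq> carrier V \<times> carrier W"
      using tensor_eq_carrier[OF assms(1,2)] append.hyps by blast+
    then show ?case
      using append.IH by (simp only: app)
  next
    case (commute xs ys)
    then show ?case
      by (simp only: app U.a_comm[OF scl scl])
  next
    case (zero w)
    then show ?case
      by (simp add: one \<open>\<And>w. w \<in> carrier W \<Longrightarrow> F \<zero>\<^bsub>V\<^esub> w = \<zero>\<^bsub>U\<^esub>\<close>) (simp add: sum_pairs_def)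
  next
    case (add_left v v' w)
    then show ?case by (simp only: one two addl V.a_closed)
  next
    case (add_right v w w')
    then show ?case by (simp only: one two addr W.a_closed)
  next
    case (scalar c v w)
    then show ?case by (simp only: one scal V.smult_closed W.smult_closed)
  next
    case (relation v w v' w')
    then show ?case using bal by (simp only: one)
  qed
qed

lemma sweedler_class:
  assumes "module K V" "module K W" "module K U" "F \<in> bilinear_maps K V W U"
    and "\<And>v w v' w'. ((v, w), (v', w')) \<in> R \<Longrightarrow> v \<in> carrier V \<Longrightarrow> w \<in> carrier W
      \<Longrightarrow> v' \<in> carrier V \<Longrightarrow> w' \<in> carrier W \<Longrightarrow> F v w = F v' w'"
    and xs: "set xs \<subseteq> carrier V \<times> carrier W"
  shows "sweedler U (tensor_class K V W R xs) F = sum_pairs U F xs"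
proof -
  have "tensor_eq K V W R xs (SOME ys. tensor_eq K V W R xs ys)"
    using tensor_eq.refl[OF xs] by (rule someI)
  from sum_pairs_cong[OF assms(1-5) this] show ?thesis
    by (simp add: sweedler_def tensor_class_def)
qed


section \<open>BiHom-Hopf algebras\<close>

record ('k, 'u) bihom_space = "('k, 'u) module" +
  \<alpha> :: "'u \<Rightarrow> 'u"
  \<beta> :: "'u \<Rightarrow> 'u"
  \<omega> :: "'u \<Rightarrow> 'u"
  \<psi> :: "'u \<Rightarrow> 'u"

locale bihom_space = field K + module K V
  for K :: "('k, 'z) ring_scheme" and V :: "('k, 'u, 'x) bihom_space_scheme" +
  assumes structure_automorphisms: "{\<alpha> V, \<beta> V, \<omega> V, \<psi> V} \<subseteq> linear_automorphisms K V"
    and structure_commute: "\<lbrakk>\<theta> \<in> {\<alpha> V, \<beta> V, \<omega> V, \<psi> V}; \<theta>' \<in> {\<alpha> V, \<beta> V, \<omega> V, \<psi> V}; x \<in> carrier V\<rbrakk>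
      \<Longrightarrow> \<theta> (\<theta>' x) = \<theta>' (\<theta> x)"

definition int_iterate :: "'u set \<Rightarrow> ('u \<Rightarrow> 'u) \<Rightarrow> int \<Rightarrow> 'u \<Rightarrow> 'u" where
  "int_iterate A f n = (if 0 \<le> n then f ^^ nat n else inv_into A f ^^ nat (- n))"

text \<open>\<open>twist V (a, b, c, d)\<close> is the automorphism \<open>\<alpha>\<^sup>a \<beta>\<^sup>b \<omega>\<^sup>c \<psi>\<^sup>d\<close> of \<open>V\<close>.\<close>

fun twist :: "('k, 'u, 'x) bihom_space_scheme \<Rightarrow> int \<times> int \<times> int \<times> int \<Rightarrow> 'u \<Rightarrow> 'u" where
  "twist V (a, b, c, d) x =
    int_iterate (carrier V) (\<alpha> V) a (int_iterate (carrier V) (\<beta> V) b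
      (int_iterate (carrier V) (\<omega> V) c (int_iterate (carrier V) (\<psi> V) d x)))"

text \<open>Multiplication and unit are the fields \<open>mult\<close> and \<open>one\<close> inherited from \<open>module\<close>.\<close>

record ('k, 'u) bihom_bialgebra = "('k, 'u) bihom_space" +
  comult :: "'u \<Rightarrow> 'u"  ("\<Delta>\<index>")
  counit :: "'u \<Rightarrow> 'k"  ("\<epsilon>\<index>")

text \<open>
  Identities in threefold tensor products are stated in the right bracketing.
\<close>

locale bihom_bialgebra = bihom_space K H
  for K :: "('k, 'z) ring_scheme" and H :: "('k, 'a universe, 'x) bihom_bialgebra_scheme" +
  assumes mult_bilinear: "mult H \<in> bilinear_maps K H H H"
    and one_closed: "\<one>\<^bsub>H\<^esub> \<in> carrier H"
    and comult_linear: "comult H \<in> linear_maps K H (tensor K H H)"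
    and counit_closed: "counit H \<in> carrier H \<rightarrow> carrier K"
    and counit_add: "\<lbrakk>x \<in> carrier H; y \<in> carrier H\<rbrakk> \<Longrightarrow> counit H (x \<oplus>\<^bsub>H\<^esub> y) = counit H x \<oplus>\<^bsub>K\<^esub> counit H y"
    and counit_smult: "\<lbrakk>r \<in> carrier K; x \<in> carrier H\<rbrakk> \<Longrightarrow> counit H (r \<odot>\<^bsub>H\<^esub> x) = r \<otimes>\<^bsub>K\<^esub> counit H x"
    and structure_one: "\<theta> \<in> {\<alpha> H, \<beta> H, \<omega> H, \<psi> H} \<Longrightarrow> \<theta> \<one>\<^bsub>H\<^esub> = \<one>\<^bsub>H\<^esub>"
    and structure_mult: "\<lbrakk>\<theta> \<in> {\<alpha> H, \<beta> H, \<omega> H, \<psi> H}; x \<in> carrier H; y \<in> carrier H\<rbrakk>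
      \<Longrightarrow> \<theta> (x \<otimes>\<^bsub>H\<^esub> y) = \<theta> x \<otimes>\<^bsub>H\<^esub> \<theta> y"
    and structure_counit: "\<lbrakk>\<theta> \<in> {\<alpha> H, \<beta> H, \<omega> H, \<psi> H}; x \<in> carrier H\<rbrakk>
      \<Longrightarrow> counit H (\<theta> x) = counit H x"
    and structure_comult: "\<lbrakk>\<theta> \<in> {\<alpha> H, \<beta> H, \<omega> H, \<psi> H}; x \<in> carrier H\<rbrakk>
      \<Longrightarrow> comult H (\<theta> x) =
        sweedler (tensor K H H) (comult H x) (\<lambda>x1 x2. pure K H H (\<theta> x1) (\<theta> x2))"
    and right_one: "x \<in> carrier H \<Longrightarrow> x \<otimes>\<^bsub>H\<^esub> \<one>\<^bsub>H\<^esub> = \<alpha> H x"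
    and left_one: "x \<in> carrier H \<Longrightarrow> \<one>\<^bsub>H\<^esub> \<otimes>\<^bsub>H\<^esub> x = \<beta> H x"
    and bihom_assoc: "\<lbrakk>x \<in> carrier H; y \<in> carrier H; z \<in> carrier H\<rbrakk>
      \<Longrightarrow> \<alpha> H x \<otimes>\<^bsub>H\<^esub> (y \<otimes>\<^bsub>H\<^esub> z) = (x \<otimes>\<^bsub>H\<^esub> y) \<otimes>\<^bsub>H\<^esub> \<beta> H z"
    and right_counit: "x \<in> carrier H
      \<Longrightarrow> sweedler H (comult H x) (\<lambda>x1 x2. counit H x2 \<odot>\<^bsub>H\<^esub> x1) = \<omega> H x"
    and left_counit: "x \<in> carrier H
      \<Longrightarrow> sweedler H (comult H x) (\<lambda>x1 x2. counit H x1 \<odot>\<^bsub>H\<^esub> x2) = \<psi> H x"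
    and bihom_coassoc: "x \<in> carrier H
      \<Longrightarrow> sweedler (tensor K H (tensor K H H)) (comult H x)
            (\<lambda>x1 x2. pure K H (tensor K H H) (\<omega> H x1) (comult H x2))
        = sweedler (tensor K H (tensor K H H)) (comult H x)
            (\<lambda>x1 x2. sweedler (tensor K H (tensor K H H)) (comult H x1)
              (\<lambda>x11 x12. pure K H (tensor K H H) x11 (pure K H H x12 (\<psi> H x2))))"
    and comult_mult: "\<lbrakk>x \<in> carrier H; y \<in> carrier H\<rbrakk>
      \<Longrightarrow> comult H (x \<otimes>\<^bsub>H\<^esub> y) =
        sweedler (tensor K H H) (comult H x) (\<lambda>x1 x2.
          sweedler (tensor K H H) (comult H y) (\<lambda>y1 y2.
            pure K H H (x1 \<otimes>\<^bsub>H\<^esub> y1) (x2 \<otimes>\<^bsub>H\<^esub> y2)))"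
    and counit_mult: "\<lbrakk>x \<in> carrier H; y \<in> carrier H\<rbrakk>
      \<Longrightarrow> counit H (x \<otimes>\<^bsub>H\<^esub> y) = counit H x \<otimes>\<^bsub>K\<^esub> counit H y"
    and comult_one: "comult H \<one>\<^bsub>H\<^esub> = pure K H H \<one>\<^bsub>H\<^esub> \<one>\<^bsub>H\<^esub>"
    and counit_one: "counit H \<one>\<^bsub>H\<^esub> = \<one>\<^bsub>K\<^esub>"

locale bihom_hopf_algebra = bihom_bialgebra K H
  for K :: "('k, 'z) ring_scheme" and H :: "('k, 'a universe, 'x) bihom_bialgebra_scheme" +
  fixes S :: "'a universe \<Rightarrow> 'a universe"
  assumes antipode_linear: "S \<in> linear_maps K H H"
    and antipode_commute: "\<lbrakk>\<theta> \<in> {\<alpha> H, \<beta> H, \<omega> H, \<psi> H}; x \<in> carrier H\<rbrakk> \<Longrightarrow> S (\<theta> x) = \<theta> (S x)"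
    and antipode_right: "x \<in> carrier H
      \<Longrightarrow> sweedler H (comult H x) (\<lambda>x1 x2. x1 \<otimes>\<^bsub>H\<^esub> S x2) = counit H x \<odot>\<^bsub>H\<^esub> \<one>\<^bsub>H\<^esub>"
    and antipode_left: "x \<in> carrier H
      \<Longrightarrow> sweedler H (comult H x) (\<lambda>x1 x2. S x1 \<otimes>\<^bsub>H\<^esub> x2) = counit H x \<odot>\<^bsub>H\<^esub> \<one>\<^bsub>H\<^esub>"


section \<open>BiHom-four-angle Hopf modules\<close>

record ('k, 'u) four_angle = "('k, 'u) bihom_space" +
  lact :: "'u \<Rightarrow> 'u \<Rightarrow> 'u"
  ract :: "'u \<Rightarrow> 'u \<Rightarrow> 'u"
  lcoact :: "'u \<Rightarrow> 'u"
  rcoact :: "'u \<Rightarrow> 'u"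

text \<open>\<open>lact M h m\<close> is \<open>h \<cdot> m\<close> and \<open>ract M m h\<close> is \<open>m \<cdot> h\<close>.\<close>

locale four_angle_hopf_module = bihom_bialgebra K H + M: bihom_space K M
  for K :: "('k, 'z) ring_scheme" and H :: "('k, 'a universe, 'x) bihom_bialgebra_scheme"
    and M :: "('k, 'a universe, 'y) four_angle_scheme" +
  assumes lact_bilinear: "lact M \<in> bilinear_maps K H M M"
    and ract_bilinear: "ract M \<in> bilinear_maps K M H M"
    and lcoact_linear: "lcoact M \<in> linear_maps K M (tensor K H M)"
    and rcoact_linear: "rcoact M \<in> linear_maps K M (tensor K M H)"
    and structure_lact:
      "\<lbrakk>(\<theta>, \<theta>') \<in> {(\<alpha> H, \<alpha> M), (\<beta> H, \<beta> M), (\<omega> H, \<omega> M), (\<psi> H, \<psi> M)}; h \<in> carrier H; m \<in> carrier M\<rbrakk>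
      \<Longrightarrow> lact M (\<theta> h) (\<theta>' m) = \<theta>' (lact M h m)"
    and structure_ract:
      "\<lbrakk>(\<theta>, \<theta>') \<in> {(\<alpha> H, \<alpha> M), (\<beta> H, \<beta> M), (\<omega> H, \<omega> M), (\<psi> H, \<psi> M)}; h \<in> carrier H; m \<in> carrier M\<rbrakk>
      \<Longrightarrow> ract M (\<theta>' m) (\<theta> h) = \<theta>' (ract M m h)"
    and structure_lcoact:
      "\<lbrakk>(\<theta>, \<theta>') \<in> {(\<alpha> H, \<alpha> M), (\<beta> H, \<beta> M), (\<omega> H, \<omega> M), (\<psi> H, \<psi> M)}; m \<in> carrier M\<rbrakk>
      \<Longrightarrow> lcoact M (\<theta>' m) = sweedler (tensor K H M) (lcoact M m) (\<lambda>h m0. pure K H M (\<theta> h) (\<theta>' m0))"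
    and structure_rcoact:
      "\<lbrakk>(\<theta>, \<theta>') \<in> {(\<alpha> H, \<alpha> M), (\<beta> H, \<beta> M), (\<omega> H, \<omega> M), (\<psi> H, \<psi> M)}; m \<in> carrier M\<rbrakk>
      \<Longrightarrow> rcoact M (\<theta>' m) = sweedler (tensor K M H) (rcoact M m) (\<lambda>m0 h. pure K M H (\<theta>' m0) (\<theta> h))"
    and lact_assoc: "\<lbrakk>h \<in> carrier H; g \<in> carrier H; m \<in> carrier M\<rbrakk>
      \<Longrightarrow> lact M (\<alpha> H h) (lact M g m) = lact M (h \<otimes>\<^bsub>H\<^esub> g) (\<beta> M m)"
    and lact_one: "m \<in> carrier M \<Longrightarrow> lact M \<one>\<^bsub>H\<^esub> m = \<beta> M m"
    and ract_assoc: "\<lbrakk>h \<in> carrier H; g \<in> carrier H; m \<in> carrier M\<rbrakk>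
      \<Longrightarrow> ract M (ract M m h) (\<beta> H g) = ract M (\<alpha> M m) (h \<otimes>\<^bsub>H\<^esub> g)"
    and ract_one: "m \<in> carrier M \<Longrightarrow> ract M m \<one>\<^bsub>H\<^esub> = \<alpha> M m"
    and bimodule: "\<lbrakk>x \<in> carrier H; y \<in> carrier H; m \<in> carrier M\<rbrakk>
      \<Longrightarrow> lact M (\<alpha> H x) (ract M m y) = ract M (lact M x m) (\<beta> H y)"
    and rcoact_coassoc: "m \<in> carrier M
      \<Longrightarrow> sweedler (tensor K M (tensor K H H)) (rcoact M m)
            (\<lambda>m0 m1. pure K M (tensor K H H) (\<omega> M m0) (comult H m1))
        = sweedler (tensor K M (tensor K H H)) (rcoact M m)
            (\<lambda>m0 m1. sweedler (tensor K M (tensor K H H)) (rcoact M m0)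
              (\<lambda>m00 m01. pure K M (tensor K H H) m00 (pure K H H m01 (\<psi> H m1))))"
    and rcoact_counit: "m \<in> carrier M
      \<Longrightarrow> sweedler M (rcoact M m) (\<lambda>m0 m1. counit H m1 \<odot>\<^bsub>M\<^esub> m0) = \<omega> M m"
    and lcoact_coassoc: "m \<in> carrier M
      \<Longrightarrow> sweedler (tensor K H (tensor K H M)) (lcoact M m)
            (\<lambda>h m0. pure K H (tensor K H M) (\<omega> H h) (lcoact M m0))
        = sweedler (tensor K H (tensor K H M)) (lcoact M m)
            (\<lambda>h m0. sweedler (tensor K H (tensor K H M)) (comult H h)
              (\<lambda>h1 h2. pure K H (tensor K H M) h1 (pure K H M h2 (\<psi> M m0))))"
    and lcoact_counit: "m \<in> carrier M
      \<Longrightarrow> sweedler M (lcoact M m) (\<lambda>h m0. counit H h \<odot>\<^bsub>M\<^esub> m0) = \<psi> M m"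
    and bicomodule: "m \<in> carrier M
      \<Longrightarrow> sweedler (tensor K H (tensor K M H)) (lcoact M m)
            (\<lambda>h m0. pure K H (tensor K M H) (\<omega> H h) (rcoact M m0))
        = sweedler (tensor K H (tensor K M H)) (rcoact M m)
            (\<lambda>m0 m1. sweedler (tensor K H (tensor K M H)) (lcoact M m0)
              (\<lambda>h m00. pure K H (tensor K M H) h (pure K M H m00 (\<psi> H m1))))"
    and lcoact_lact: "\<lbrakk>h \<in> carrier H; m \<in> carrier M\<rbrakk>
      \<Longrightarrow> lcoact M (lact M h m) =
        sweedler (tensor K H M) (comult H h) (\<lambda>h1 h2.
          sweedler (tensor K H M) (lcoact M m) (\<lambda>g m0. pure K H M (h1 \<otimes>\<^bsub>H\<^esub> g) (lact M h2 m0)))"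
    and rcoact_lact: "\<lbrakk>h \<in> carrier H; m \<in> carrier M\<rbrakk>
      \<Longrightarrow> rcoact M (lact M h m) =
        sweedler (tensor K M H) (comult H h) (\<lambda>h1 h2.
          sweedler (tensor K M H) (rcoact M m) (\<lambda>m0 g. pure K M H (lact M h1 m0) (h2 \<otimes>\<^bsub>H\<^esub> g)))"
    and lcoact_ract: "\<lbrakk>h \<in> carrier H; m \<in> carrier M\<rbrakk>
      \<Longrightarrow> lcoact M (ract M m h) =
        sweedler (tensor K H M) (lcoact M m) (\<lambda>g m0.
          sweedler (tensor K H M) (comult H h) (\<lambda>h1 h2. pure K H M (g \<otimes>\<^bsub>H\<^esub> h1) (ract M m0 h2)))"
    and rcoact_ract: "\<lbrakk>h \<in> carrier H; m \<in> carrier M\<rbrakk>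
      \<Longrightarrow> rcoact M (ract M m h) =
        sweedler (tensor K M H) (rcoact M m) (\<lambda>m0 g.
          sweedler (tensor K M H) (comult H h) (\<lambda>h1 h2. pure K M H (ract M m0 h1) (g \<otimes>\<^bsub>H\<^esub> h2)))"


section \<open>The category of BiHom-four-angle Hopf modules\<close>

type_synonym ('k, 'a) fa_object = "('k, 'a universe) four_angle"

record ('o, 'u) arrow =
  source :: 'o
  target :: 'o
  map_of_arrow :: "'u \<Rightarrow> 'u"

definition fa_obj ::
  "('k, 'z) ring_scheme \<Rightarrow> ('k, 'a universe, 'x) bihom_bialgebra_scheme \<Rightarrow> ('k, 'a) fa_object set"
where "fa_obj K H = {M. four_angle_hopf_module K H M}"

text \<open>Underlying maps are \<open>extensional\<close>, so equality of morphisms is equality on the carrier.\<close>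

definition fa_hom ::
  "('k, 'z) ring_scheme \<Rightarrow> ('k, 'a universe, 'x) bihom_bialgebra_scheme
   \<Rightarrow> ('k, 'a) fa_object \<Rightarrow> ('k, 'a) fa_object \<Rightarrow> (('k, 'a) fa_object, 'a universe) arrow set"
where
  "fa_hom K H M N = {\<lparr>source = M, target = N, map_of_arrow = f\<rparr> | f.
     f \<in> extensional (carrier M) \<and> f \<in> linear_maps K M N \<and>
     (\<forall>m\<in>carrier M. f (\<alpha> M m) = \<alpha> N (f m) \<and> f (\<beta> M m) = \<beta> N (f m) \<and>
        f (\<omega> M m) = \<omega> N (f m) \<and> f (\<psi> M m) = \<psi> N (f m)) \<and>
     (\<forall>h\<in>carrier H. \<forall>m\<in>carrier M. f (lact M h m) = lact N h (f m) \<and> f (ract M m h) = ract N (f m) h) \<and>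
     (\<forall>m\<in>carrier M.
        lcoact N (f m) = sweedler (tensor K H N) (lcoact M m) (\<lambda>h m0. pure K H N h (f m0)) \<and>
        rcoact N (f m) = sweedler (tensor K N H) (rcoact M m) (\<lambda>m0 h. pure K N H (f m0) h))}"

definition fa_id :: "('k, 'a) fa_object \<Rightarrow> (('k, 'a) fa_object, 'a universe) arrow" where
  "fa_id M = \<lparr>source = M, target = M, map_of_arrow = (\<lambda>m\<in>carrier M. m)\<rparr>"

definition fa_comp ::
  "(('k, 'a) fa_object, 'a universe) arrow \<Rightarrow> (('k, 'a) fa_object, 'a universe) arrow
   \<Rightarrow> (('k, 'a) fa_object, 'a universe) arrow"
where
  "fa_comp g f = \<lparr>source = source f, target = target g,
     map_of_arrow = compose (carrier (source f)) (map_of_arrow g) (map_of_arrow f)\<rparr>"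

definition balancing ::
  "('k, 'a universe, 'x) bihom_bialgebra_scheme \<Rightarrow> ('k, 'a) fa_object \<Rightarrow> ('k, 'a) fa_object
   \<Rightarrow> (('a universe \<times> 'a universe) \<times> ('a universe \<times> 'a universe)) set"
where
  "balancing H M N = {((ract M m h, \<beta> N n), (\<alpha> M m, lact N h n)) | m h n.
     m \<in> carrier M \<and> h \<in> carrier H \<and> n \<in> carrier N}"

definition htensor_space ::
  "('k, 'z) ring_scheme \<Rightarrow> ('k, 'a universe, 'x) bihom_bialgebra_scheme
   \<Rightarrow> ('k, 'a) fa_object \<Rightarrow> ('k, 'a) fa_object \<Rightarrow> ('k, 'a universe) module"
where "htensor_space K H M N = quotient_tensor K M N (balancing H M N)"

definition hpure ::
  "('k, 'z) ring_scheme \<Rightarrow> ('k, 'a universe, 'x) bihom_bialgebra_scheme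
   \<Rightarrow> ('k, 'a) fa_object \<Rightarrow> ('k, 'a) fa_object \<Rightarrow> 'a universe \<Rightarrow> 'a universe \<Rightarrow> 'a universe"
where "hpure K H M N m n = tensor_class K M N (balancing H M N) [(m, n)]"

text \<open>\<open>T = (a, b, c, d)\<close> encodes the automorphism \<open>T = \<alpha>\<^sup>a \<beta>\<^sup>b \<omega>\<^sup>c \<psi>\<^sup>d\<close>.\<close>

fun twist_inv :: "int \<times> int \<times> int \<times> int \<Rightarrow> int \<times> int \<times> int \<times> int" where
  "twist_inv (a, b, c, d) = (- a, - b, - c, - d)"

definition htensor ::
  "('k, 'z) ring_scheme \<Rightarrow> ('k, 'a universe, 'x) bihom_bialgebra_scheme \<Rightarrow> int \<times> int \<times> int \<times> int
   \<Rightarrow> ('k, 'a) fa_object \<Rightarrow> ('k, 'a) fa_object \<Rightarrow> ('k, 'a) fa_object"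
where
  "htensor K H T M N =
    (let V = htensor_space K H M N;
         HV = tensor K H V;
         VH = tensor K V H
     in \<lparr>carrier = carrier V, mult = undefined, one = undefined, zero = zero V, add = add V,
         smult = smult V,
         \<alpha> = (\<lambda>x. sweedler V x (\<lambda>m n. hpure K H M N (\<alpha> M m) (\<alpha> N n))),
         \<beta> = (\<lambda>x. sweedler V x (\<lambda>m n. hpure K H M N (\<beta> M m) (\<beta> N n))),
         \<omega> = (\<lambda>x. sweedler V x (\<lambda>m n. hpure K H M N (\<omega> M m) (\<omega> N n))),
         \<psi> = (\<lambda>x. sweedler V x (\<lambda>m n. hpure K H M N (\<psi> M m) (\<psi> N n))),
         lact = (\<lambda>h x. sweedler V x (\<lambda>m n.
           hpure K H M N (lact M (twist H (twist_inv T) (twist H (-1, 0, 0, 0) h)) m) (\<beta> N n))),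
         ract = (\<lambda>x h. sweedler V x (\<lambda>m n.
           hpure K H M N (\<alpha> M m) (ract N n (twist H (twist_inv T) (twist H (0, -1, 0, 0) h))))),
         lcoact = (\<lambda>x. sweedler HV x (\<lambda>m n.
           sweedler HV (lcoact M m) (\<lambda>g m0.
             sweedler HV (lcoact N n) (\<lambda>h n0.
               pure K H V (twist H T (g \<otimes>\<^bsub>H\<^esub> h)) (hpure K H M N m0 n0))))),
         rcoact = (\<lambda>x. sweedler VH x (\<lambda>m n.
           sweedler VH (rcoact M m) (\<lambda>m0 g.
             sweedler VH (rcoact N n) (\<lambda>n0 h.
               pure K V H (hpure K H M N m0 n0) (twist H T (g \<otimes>\<^bsub>H\<^esub> h))))))\<rparr>)"

definition hmap ::
  "('k, 'z) ring_scheme \<Rightarrow> ('k, 'a universe, 'x) bihom_bialgebra_scheme \<Rightarrow> int \<times> int \<times> int \<times> int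
   \<Rightarrow> (('k, 'a) fa_object, 'a universe) arrow \<Rightarrow> (('k, 'a) fa_object, 'a universe) arrow
   \<Rightarrow> (('k, 'a) fa_object, 'a universe) arrow"
where
  "hmap K H T f g =
    (let V = htensor K H T (source f) (source g);
         W = htensor K H T (target f) (target g)
     in \<lparr>source = V, target = W,
         map_of_arrow = (\<lambda>x\<in>carrier V. sweedler W x (\<lambda>m n.
           hpure K H (target f) (target g) (map_of_arrow f m) (map_of_arrow g n)))\<rparr>)"

definition hunit :: "('k, 'a universe, 'x) bihom_bialgebra_scheme \<Rightarrow> ('k, 'a) fa_object" where
  "hunit H = \<lparr>carrier = carrier H, mult = mult H, one = one H, zero = zero H, add = add H,
     smult = smult H, \<alpha> = \<alpha> H, \<beta> = \<beta> H, \<omega> = \<omega> H, \<psi> = \<psi> H,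
     lact = mult H, ract = mult H, lcoact = comult H, rcoact = comult H\<rparr>"

text \<open>
  The identifications of \<open>(M \<otimes> N) \<otimes> P\<close> with \<open>M \<otimes> (N \<otimes> P)\<close>, and of \<open>H \<otimes> M\<close> and \<open>M \<otimes> H\<close> with \<open>M\<close>:
  \<open>(m \<otimes> n) \<otimes> p = T \<alpha>(m) \<otimes> (n \<otimes> T\<^sup>-\<^sup>1 \<beta>\<^sup>-\<^sup>1(p))\<close>, \<open>h \<otimes> m = T(h \<cdot> m)\<close> and \<open>m \<otimes> h = T(m \<cdot> h)\<close>.
  The powers of the structure maps come from those in the actions on the quotients; the map
  \<open>(m \<otimes> n) \<otimes> p \<mapsto> m \<otimes> (n \<otimes> p)\<close> does not respect the relations of the quotients in general.
\<close>

definition hassoc ::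
  "('k, 'z) ring_scheme \<Rightarrow> ('k, 'a universe, 'x) bihom_bialgebra_scheme \<Rightarrow> int \<times> int \<times> int \<times> int
   \<Rightarrow> ('k, 'a) fa_object \<Rightarrow> ('k, 'a) fa_object \<Rightarrow> ('k, 'a) fa_object
   \<Rightarrow> (('k, 'a) fa_object, 'a universe) arrow"
where
  "hassoc K H T M N P =
    (let V = htensor K H T (htensor K H T M N) P;
         W = htensor K H T M (htensor K H T N P)
     in \<lparr>source = V, target = W,
         map_of_arrow = (\<lambda>x\<in>carrier V. sweedler W x (\<lambda>y p. sweedler W y (\<lambda>m n.
           hpure K H M (htensor K H T N P) (twist M T (\<alpha> M m))
             (hpure K H N P n (twist P (twist_inv T) (twist P (0, -1, 0, 0) p))))))\<rparr>)"

definition hlunit ::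
  "('k, 'z) ring_scheme \<Rightarrow> ('k, 'a universe, 'x) bihom_bialgebra_scheme \<Rightarrow> int \<times> int \<times> int \<times> int
   \<Rightarrow> ('k, 'a) fa_object \<Rightarrow> (('k, 'a) fa_object, 'a universe) arrow"
where
  "hlunit K H T M =
    (let V = htensor K H T (hunit H) M
     in \<lparr>source = V, target = M,
         map_of_arrow = (\<lambda>x\<in>carrier V. sweedler M x (\<lambda>h m. twist M T (lact M h m)))\<rparr>)"

definition hrunit ::
  "('k, 'z) ring_scheme \<Rightarrow> ('k, 'a universe, 'x) bihom_bialgebra_scheme \<Rightarrow> int \<times> int \<times> int \<times> int
   \<Rightarrow> ('k, 'a) fa_object \<Rightarrow> (('k, 'a) fa_object, 'a universe) arrow"
where
  "hrunit K H T M =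
    (let V = htensor K H T M (hunit H)
     in \<lparr>source = V, target = M,
         map_of_arrow = (\<lambda>x\<in>carrier V. sweedler M x (\<lambda>m h. twist M T (ract M m h)))\<rparr>)"

text \<open>
  The right-hand sides of the formulas for the braiding and its inverse. Below \<open>g\<close> is
  \<open>m\<^sub>[\<^sub>-\<^sub>1\<^sub>]\<close>, \<open>m0\<close> is \<open>m\<^sub>[\<^sub>0\<^sub>]\<close>, \<open>n0\<close> is \<open>n\<^sub>(\<^sub>0\<^sub>)\<close> and \<open>h\<close> is \<open>n\<^sub>(\<^sub>1\<^sub>)\<close>.
\<close>

definition braid_formula ::
  "('k, 'z) ring_scheme \<Rightarrow> ('k, 'a universe, 'x) bihom_bialgebra_scheme \<Rightarrow> ('a universe \<Rightarrow> 'a universe)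
   \<Rightarrow> ('k, 'a) fa_object \<Rightarrow> ('k, 'a) fa_object \<Rightarrow> 'a universe \<Rightarrow> 'a universe \<Rightarrow> 'a universe"
where
  "braid_formula K H S M N m n =
    (let W = htensor_space K H N M
     in sweedler W (lcoact M m) (\<lambda>g m0. sweedler W (comult H g) (\<lambda>g1 g2.
        sweedler W (rcoact N n) (\<lambda>n0 h. sweedler W (comult H h) (\<lambda>h1 h2.
          hpure K H N M
            (ract N (lact N (twist H (-2, 0, -2, 0) g1) (twist N (-2, 0, -1, 0) n0))
                    (S (twist H (0, -1, 0, -2) h1)))
            (lact M (S (twist H (-1, 0, -2, 0) g2))
                    (ract M (twist M (0, -2, 0, -1) m0) (twist H (0, -2, 0, -2) h2))))))))"

definition braid_inv_formula ::
  "('k, 'z) ring_scheme \<Rightarrow> ('k, 'a universe, 'x) bihom_bialgebra_scheme \<Rightarrow> ('a universe \<Rightarrow> 'a universe)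
   \<Rightarrow> ('k, 'a) fa_object \<Rightarrow> ('k, 'a) fa_object \<Rightarrow> 'a universe \<Rightarrow> 'a universe \<Rightarrow> 'a universe"
where
  "braid_inv_formula K H S M N n m =
    (let W = htensor_space K H M N; S' = inv_into (carrier H) S
     in sweedler W (lcoact M m) (\<lambda>g m0. sweedler W (comult H g) (\<lambda>g1 g2.
        sweedler W (rcoact N n) (\<lambda>n0 h. sweedler W (comult H h) (\<lambda>h1 h2.
          hpure K H M N
            (ract M (lact M (twist H (-2, 0, 0, -2) h2) (twist M (-2, 0, 0, -1) m0))
                    (S' (twist H (0, -1, 0, -2) g2)))
            (lact N (S' (twist H (-1, 0, -2, 0) h1))
                    (ract N (twist N (0, -2, -1, 0) n0) (twist H (0, -2, -2, 0) g1))))))))"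

end

theory Submission
  imports Defs "HOL-Library.Product_Plus"
begin

text \<open>
  A BiHom structure is an ordinary one twisted by powers of its automorphisms. With the product
  \<open>\<alpha>\<^sup>-\<^sup>1(a) \<beta>\<^sup>-\<^sup>1(b)\<close>, the coproduct \<open>(\<omega>\<^sup>-\<^sup>1 \<otimes> \<psi>\<^sup>-\<^sup>1)\<Delta>\<close> and the antipode \<open>\<alpha> \<beta>\<^sup>-\<^sup>1 \<omega> \<psi>\<^sup>-\<^sup>1 S\<close>, \<open>H\<close> is an ordinary
  Hopf algebra, and a BiHom-four-angle Hopf module is the same as an ordinary Hopf bimodule with a
  compatible action of the group of powers of the automorphisms. In terms of the generators
  \<open>p m n = T\<^sup>-\<^sup>1\<alpha>\<^sup>-\<^sup>1(m) \<otimes> T\<^sup>-\<^sup>1\<beta>\<^sup>-\<^sup>1(n)\<close> the tensor product, the associativity and the unit constraints are the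
  ordinary ones, independently of \<open>T\<close>, and the braiding becomes
  \<open>p m n \<mapsto> p (m\<^sub>[\<^sub>-\<^sub>1\<^sub>] \<cdot> Q(n\<^sub>(\<^sub>0\<^sub>))) (P(m\<^sub>[\<^sub>0\<^sub>]) \<cdot> n\<^sub>(\<^sub>1\<^sub>))\<close>, where \<open>P(m) = S(m\<^sub>[\<^sub>-\<^sub>1\<^sub>]) \<cdot> m\<^sub>[\<^sub>0\<^sub>]\<close> and \<open>Q(n) = n\<^sub>(\<^sub>0\<^sub>) \<cdot> S(n\<^sub>(\<^sub>1\<^sub>))\<close> project
  onto the left and the right coinvariants. Its inverse is the braiding over the co-opposite Hopf algebra,
  whose antipode is \<open>S\<^sup>-\<^sup>1\<close>. Identities between iterated tensors are stated as equalities of Sweedler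
  sums for all multilinear maps.
\<close>

text \<open>In a Hopf bimodule m = m_[-1] . P(m_[0]) and n = Q(n_(0)) . n_(1), so p m n is the sum
  of m_[-1] . p (P m_[0]) (Q n_(0)) . n_(1). A bimodule map on the tensor product is therefore
  determined by its values on p (P m) (Q n). The braiding is the bimodule map that exchanges the two
  coinvariant factors there, and its inverse exchanges them back. The powers in p are forced. After
  untwisting, h acts on the pure tensor of m and n through the ordinary action of T^-1
  \<alpha>^-1(h) on m. Applying T^-1 \<alpha>^-1 to m as well makes this the image of h acting on m.
  On the right the same happens with T^-1 \<beta>^-1. The passage to ordinary Hopf bimodules is
  needed in both directions: forwards to reach the ordinary theory, backwards because the tensor
  product is first seen to be an ordinary Hopf bimodule and only then a BiHom-module.\<close>

declare twist.simps [simp del]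

section \<open>Linear maps and sums over lists of pairs\<close>

text \<open>Transfers the vector space structure between records that agree in their linear fields;
  \<open>hunit\<close>, \<open>emb\<close> and \<open>htensor\<close> wrap known spaces in this
  way.\<close>

lemma module_cong:
  assumes "module K W" and f: "carrier V = carrier W" "zero V = zero W" "add V = add W" "smult V = smult W"
  shows "module K V"
proof -
  interpret module K W by fact
  show ?thesis
  proof (intro moduleI abelian_groupI R.is_cring)
    fix x assume "x \<in> carrier V"
    then show "\<exists>y\<in>carrier V. y \<oplus>\<^bsub>V\<^esub> x = \<zero>\<^bsub>V\<^esub>"
      using l_neg[of x] by (auto simp: f)
  qed (simp_all add: f a_ac smult_l_distr smult_r_distr smult_assoc1)
qed

lemma linear_mapsI:
  assumes "\<And>x. x \<in> carrier V \<Longrightarrow> f x \<in> carrier W"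
    and "\<And>x y. x \<in> carrier V \<Longrightarrow> y \<in> carrier V \<Longrightarrow> f (x \<oplus>\<^bsub>V\<^esub> y) = f x \<oplus>\<^bsub>W\<^esub> f y"
    and "\<And>c x. c \<in> carrier K \<Longrightarrow> x \<in> carrier V \<Longrightarrow> f (c \<odot>\<^bsub>V\<^esub> x) = c \<odot>\<^bsub>W\<^esub> f x"
  shows "f \<in> linear_maps K V W"
  using assms by (auto simp: linear_maps_def)

lemma linear_mapsD:
  assumes "f \<in> linear_maps K V W"
  shows "x \<in> carrier V \<Longrightarrow> f x \<in> carrier W"
    and "x \<in> carrier V \<Longrightarrow> y \<in> carrier V \<Longrightarrow> f (x \<oplus>\<^bsub>V\<^esub> y) = f x \<oplus>\<^bsub>W\<^esub> f y"
    and "c \<in> carrier K \<Longrightarrow> x \<in> carrier V \<Longrightarrow> f (c \<odot>\<^bsub>V\<^esub> x) = c \<odot>\<^bsub>W\<^esub> f x"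
  using assms by (auto simp: linear_maps_def)

lemma bilinear_mapsI:
  assumes "\<And>u. u \<in> carrier U \<Longrightarrow> F u \<in> linear_maps K V W"
    and "\<And>v. v \<in> carrier V \<Longrightarrow> (\<lambda>u. F u v) \<in> linear_maps K U W"
  shows "F \<in> bilinear_maps K U V W"
  using assms by (auto simp: bilinear_maps_def)

lemma bilinear_mapsD:
  assumes "F \<in> bilinear_maps K U V W"
  shows "u \<in> carrier U \<Longrightarrow> F u \<in> linear_maps K V W"
    and "v \<in> carrier V \<Longrightarrow> (\<lambda>u. F u v) \<in> linear_maps K U W"
    and "u \<in> carrier U \<Longrightarrow> v \<in> carrier V \<Longrightarrow> F u v \<in> carrier W"
  using assms by (auto simp: bilinear_maps_def linear_maps_def)

lemma linear_zero:
  assumes "module K V" "module K W" "f \<in> linear_maps K V W"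
  shows "f \<zero>\<^bsub>V\<^esub> = \<zero>\<^bsub>W\<^esub>"
proof -
  interpret V: module K V by fact
  interpret W: module K W by fact
  have "f \<zero>\<^bsub>V\<^esub> \<oplus>\<^bsub>W\<^esub> f \<zero>\<^bsub>V\<^esub> = f \<zero>\<^bsub>V\<^esub>"
    using linear_mapsD(2)[OF assms(3), of "\<zero>\<^bsub>V\<^esub>" "\<zero>\<^bsub>V\<^esub>"] by simp
  then show ?thesis
    using linear_mapsD(1)[OF assms(3), of "\<zero>\<^bsub>V\<^esub>"] by simp
qed

lemma linear_id: "(\<lambda>x. x) \<in> linear_maps K V V"
  by (auto simp: linear_maps_def)

lemma linear_comp:
  assumes "f \<in> linear_maps K V W" "g \<in> linear_maps K U V"
  shows "(\<lambda>x. f (g x)) \<in> linear_maps K U W"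
  by (rule linear_mapsI) (simp_all add: linear_mapsD[OF assms(1)] linear_mapsD[OF assms(2)])

lemma linear_cong:
  assumes "module K V" "\<And>x. x \<in> carrier V \<Longrightarrow> f x = g x"
  shows "f \<in> linear_maps K V W \<longleftrightarrow> g \<in> linear_maps K V W"
proof -
  interpret V: module K V by fact
  have "g \<in> linear_maps K V W"
    if f: "f \<in> linear_maps K V W" and fg: "\<And>x. x \<in> carrier V \<Longrightarrow> g x = f x" for f g
    by (rule linear_mapsI) (simp_all add: fg linear_mapsD[OF f])
  from this[of f g] this[of g f] show ?thesis using assms(2) by auto
qed

lemma bilinear_comp:
  assumes F: "F \<in> bilinear_maps K U V W"
    and f: "f \<in> linear_maps K U' U" and g: "g \<in> linear_maps K V' V"
  shows "(\<lambda>a b. F (f a) (g b)) \<in> bilinear_maps K U' V' W"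
  by (intro bilinear_mapsI linear_comp[OF bilinear_mapsD(1)[OF F] g]
      linear_comp[OF bilinear_mapsD(2)[OF F] f] linear_mapsD[OF f] linear_mapsD[OF g])

lemma linear_inverse:
  assumes "module K V" "module K W" "f \<in> linear_maps K V W"
    and "\<And>y. y \<in> carrier W \<Longrightarrow> g y \<in> carrier V"
    and gf: "\<And>x. x \<in> carrier V \<Longrightarrow> g (f x) = x" and fg: "\<And>y. y \<in> carrier W \<Longrightarrow> f (g y) = y"
  shows "g \<in> linear_maps K W V"
proof -
  interpret V: module K V by fact
  interpret W: module K W by fact
  note f = linear_mapsD[OF assms(3)]
  show ?thesis
  proof (rule linear_mapsI)
    fix x y assume xy: "x \<in> carrier W" "y \<in> carrier W"
    have "g (x \<oplus>\<^bsub>W\<^esub> y) = g (f (g x \<oplus>\<^bsub>V\<^esub> g y))"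
      using xy by (simp add: f fg assms(4))
    also have "\<dots> = g x \<oplus>\<^bsub>V\<^esub> g y"
      using xy assms(4) by (intro gf) simp
    finally show "g (x \<oplus>\<^bsub>W\<^esub> y) = g x \<oplus>\<^bsub>V\<^esub> g y" .
  next
    fix c x assume cx: "c \<in> carrier K" "x \<in> carrier W"
    have "g (c \<odot>\<^bsub>W\<^esub> x) = g (f (c \<odot>\<^bsub>V\<^esub> g x))"
      using cx by (simp add: f fg assms(4))
    also have "\<dots> = c \<odot>\<^bsub>V\<^esub> g x"
      using cx assms(4) by (intro gf) simp
    finally show "g (c \<odot>\<^bsub>W\<^esub> x) = c \<odot>\<^bsub>V\<^esub> g x" .
  qed (fact assms(4))
qed

lemma sum_pairs_Nil [simp]: "sum_pairs W F [] = \<zero>\<^bsub>W\<^esub>"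
  by (simp add: sum_pairs_def)

lemma sum_pairs_Cons [simp]: "sum_pairs W F ((a, b) # xs) = F a b \<oplus>\<^bsub>W\<^esub> sum_pairs W F xs"
  by (simp add: sum_pairs_def)

lemma sum_pairs_fun_cong:
  assumes "\<And>a b. (a, b) \<in> set xs \<Longrightarrow> F a b = G a b"
  shows "sum_pairs W F xs = sum_pairs W G xs"
  using assms by (induction xs) auto

lemma sum_pairs_map:
  "sum_pairs W F (map (\<lambda>(a, b). (f a, g b)) xs) = sum_pairs W (\<lambda>a b. F (f a) (g b)) xs"
  by (induction xs) auto

lemma sum_pairs_swap_map:
  "sum_pairs W F (map prod.swap xs) = sum_pairs W (\<lambda>a b. F b a) xs"
  by (induction xs) auto

lemma sum_pairs_in_carrier:
  assumes "module K W" "\<And>a b. (a, b) \<in> set xs \<Longrightarrow> F a b \<in> carrier W"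
  shows "sum_pairs W F xs \<in> carrier W"
proof -
  interpret W: module K W by fact
  show ?thesis using assms(2) by (induction xs) auto
qed

context
  fixes K :: "('k, 'z) ring_scheme" and W :: "('k, 'u, 'x) module_scheme"
  assumes W: "module K W"
begin

interpretation W: module K W by (fact W)

lemma sum_pairs_append':
  assumes "\<And>a b. (a, b) \<in> set (xs @ ys) \<Longrightarrow> F a b \<in> carrier W"
  shows "sum_pairs W F (xs @ ys) = sum_pairs W F xs \<oplus>\<^bsub>W\<^esub> sum_pairs W F ys"
  using assms
proof (induction xs)
  case Nil
  then show ?case by (simp add: sum_pairs_in_carrier[OF W])
next
  case (Cons p xs)
  obtain a b where p: "p = (a, b)" by (cases p)
  have "F a b \<in> carrier W" "sum_pairs W F xs \<in> carrier W" "sum_pairs W F ys \<in> carrier W"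
    using Cons.prems by (auto simp: p intro!: sum_pairs_in_carrier[OF W])
  then show ?case
    using Cons by (simp add: p W.a_assoc)
qed

lemma sum_pairs_add:
  assumes "\<And>a b. (a, b) \<in> set xs \<Longrightarrow> F a b \<in> carrier W"
    and "\<And>a b. (a, b) \<in> set xs \<Longrightarrow> G a b \<in> carrier W"
  shows "sum_pairs W (\<lambda>a b. F a b \<oplus>\<^bsub>W\<^esub> G a b) xs = sum_pairs W F xs \<oplus>\<^bsub>W\<^esub> sum_pairs W G xs"
  using assms
proof (induction xs)
  case (Cons p xs)
  obtain a b where p: "p = (a, b)" by (cases p)
  have "F a b \<in> carrier W" "sum_pairs W F xs \<in> carrier W" "G a b \<in> carrier W" "sum_pairs W G xs \<in> carrier W"
    using Cons.prems by (auto simp: p intro!: sum_pairs_in_carrier[OF W])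
  then show ?case
    using Cons by (simp add: p W.a_ac)
qed simp

lemma sum_pairs_smult:
  assumes "c \<in> carrier K" "\<And>a b. (a, b) \<in> set xs \<Longrightarrow> F a b \<in> carrier W"
  shows "sum_pairs W (\<lambda>a b. c \<odot>\<^bsub>W\<^esub> F a b) xs = c \<odot>\<^bsub>W\<^esub> sum_pairs W F xs"
  using assms
proof (induction xs)
  case (Cons p xs)
  obtain a b where p: "p = (a, b)" by (cases p)
  have "F a b \<in> carrier W" "sum_pairs W F xs \<in> carrier W"
    using Cons.prems by (auto simp: p intro!: sum_pairs_in_carrier[OF W])
  then show ?case
    using Cons by (simp add: p W.smult_r_distr)
qed simp

lemma sum_pairs_zero: "sum_pairs W (\<lambda>a b. \<zero>\<^bsub>W\<^esub>) xs = \<zero>\<^bsub>W\<^esub>"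
  by (induction xs) auto

lemma sum_pairs_commute:
  assumes "\<And>a b c d. (a, b) \<in> set xs \<Longrightarrow> (c, d) \<in> set ys \<Longrightarrow> F a b c d \<in> carrier W"
  shows "sum_pairs W (\<lambda>a b. sum_pairs W (\<lambda>c d. F a b c d) ys) xs
    = sum_pairs W (\<lambda>c d. sum_pairs W (\<lambda>a b. F a b c d) xs) ys"
  using assms
proof (induction xs)
  case Nil
  then show ?case by (simp add: sum_pairs_zero)
next
  case (Cons p xs)
  obtain a b where p: "p = (a, b)" by (cases p)
  have "sum_pairs W (\<lambda>c d. F a b c d \<oplus>\<^bsub>W\<^esub> sum_pairs W (\<lambda>a b. F a b c d) xs) ys
    = sum_pairs W (\<lambda>c d. F a b c d) ys \<oplus>\<^bsub>W\<^esub> sum_pairs W (\<lambda>c d. sum_pairs W (\<lambda>a b. F a b c d) xs) ys"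
    using Cons.prems by (intro sum_pairs_add) (auto simp: p intro!: sum_pairs_in_carrier[OF W])
  then show ?case
    using Cons by (simp add: p)
qed

lemma linear_sum_pairs:
  assumes "module K V" "\<And>a b. (a, b) \<in> set xs \<Longrightarrow> (\<lambda>x. F x a b) \<in> linear_maps K V W"
  shows "(\<lambda>x. sum_pairs W (F x) xs) \<in> linear_maps K V W"
proof -
  interpret V: module K V by fact
  note F = linear_mapsD[OF assms(2)]
  show ?thesis
  proof (rule linear_mapsI)
    fix x y assume "x \<in> carrier V" "y \<in> carrier V"
    then show "sum_pairs W (F (x \<oplus>\<^bsub>V\<^esub> y)) xs = sum_pairs W (F x) xs \<oplus>\<^bsub>W\<^esub> sum_pairs W (F y) xs"
      by (subst sum_pairs_add[symmetric]) (auto simp: F intro!: sum_pairs_fun_cong)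
  next
    fix c x assume "c \<in> carrier K" "x \<in> carrier V"
    then show "sum_pairs W (F (c \<odot>\<^bsub>V\<^esub> x)) xs = c \<odot>\<^bsub>W\<^esub> sum_pairs W (F x) xs"
      by (subst sum_pairs_smult[symmetric]) (auto simp: F intro!: sum_pairs_fun_cong)
  qed (auto simp: F intro!: sum_pairs_in_carrier[OF W])
qed

lemma linear_of_sum_pairs:
  assumes "module K V" "f \<in> linear_maps K V W"
    and "\<And>a b. (a, b) \<in> set xs \<Longrightarrow> F a b \<in> carrier V"
  shows "f (sum_pairs V F xs) = sum_pairs W (\<lambda>a b. f (F a b)) xs"
  using assms(3)
proof (induction xs)
  case Nil
  then show ?case using linear_zero[OF assms(1) W assms(2)] by simp
next
  case (Cons p xs)
  obtain a b where p: "p = (a, b)" by (cases p)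
  interpret V: module K V by fact
  have "F a b \<in> carrier V" "sum_pairs V F xs \<in> carrier V"
    using Cons.prems by (auto simp: p intro!: sum_pairs_in_carrier[OF assms(1)])
  then show ?case
    using Cons by (simp add: p linear_mapsD[OF assms(2)])
qed

end

section \<open>Quotients of tensor products\<close>

text \<open>\<open>tensor_eq\<close> has no closure rule for scalars. Stability of R under scaling
  of the left factors is what lets scalar multiplication descend to the quotient, see
  \<open>teq_smult\<close>.\<close>

locale balanced_tensor = V: module K V + W: module K W
  for K :: "('k, 'z) ring_scheme" and V :: "('k, 'a universe, 'x) module_scheme"
    and W :: "('k, 'a universe, 'y) module_scheme" +
  fixes R :: "(('a universe \<times> 'a universe) \<times> ('a universe \<times> 'a universe)) set"
  assumes relation_smult: "\<lbrakk>((v, w), (v', w')) \<in> R; c \<in> carrier K\<rbrakk>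
      \<Longrightarrow> ((c \<odot>\<^bsub>V\<^esub> v, w), (c \<odot>\<^bsub>V\<^esub> v', w')) \<in> R"
begin

abbreviation "teq \<equiv> tensor_eq K V W R"
abbreviation "cls \<equiv> tensor_class K V W R"
abbreviation "Q \<equiv> quotient_tensor K V W R"
abbreviation "good xs \<equiv> set xs \<subseteq> carrier V \<times> carrier W"

lemma teq_good: "teq xs ys \<Longrightarrow> good xs \<and> good ys"
  by (rule tensor_eq_carrier) unfold_locales

lemma teq_summands: "good xs \<Longrightarrow> teq xs (summands (cls xs))"
  unfolding tensor_class_def using someI[of "teq xs", OF tensor_eq.refl] by simp

text \<open>\<open>teq xs\<close> and \<open>teq ys\<close> are equal as predicates, so the choice
  operator returns the same list for both. This is what allows a chosen representative to stand for
  a class.\<close>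

lemma cls_eq: "teq xs ys \<Longrightarrow> cls xs = cls ys"
proof -
  assume e: "teq xs ys"
  have "teq xs zs \<longleftrightarrow> teq ys zs" for zs
    using tensor_eq.trans[OF e] tensor_eq.trans[OF tensor_eq.sym[OF e]] by blast
  then have "teq xs = teq ys" by (intro ext)
  then show ?thesis by (simp add: tensor_class_def)
qed

lemma cls_summands:
  assumes "x \<in> carrier Q"
  shows "good (summands x)" "cls (summands x) = x"
proof -
  obtain xs where x: "x = cls xs" and xs: "good xs"
    using assms by (auto simp: quotient_tensor_def lists_eq_set)
  show "good (summands x)"
    using teq_good[OF teq_summands[OF xs]] x by simp
  show "cls (summands x) = x"
    using cls_eq[OF teq_summands[OF xs]] x by simp
qed

lemma cls_carrier: "good xs \<Longrightarrow> cls xs \<in> carrier Q"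
  by (auto simp: quotient_tensor_def lists_eq_set)

lemma cls_add: "good xs \<Longrightarrow> good ys \<Longrightarrow> cls xs \<oplus>\<^bsub>Q\<^esub> cls ys = cls (xs @ ys)"
  unfolding quotient_tensor_def
  by simp (intro cls_eq tensor_eq.append; rule tensor_eq.sym; rule teq_summands; assumption)

lemma teq_smult:
  assumes c: "c \<in> carrier K" and "teq xs ys"
  shows "teq (map (\<lambda>(v, w). (c \<odot>\<^bsub>V\<^esub> v, w)) xs) (map (\<lambda>(v, w). (c \<odot>\<^bsub>V\<^esub> v, w)) ys)"
  using assms(2)
proof induction
  case (refl xs)
  then show ?case using c by (intro tensor_eq.refl) auto
next
  case (sym xs ys)
  show ?case by (rule tensor_eq.sym[OF sym.IH])
next
  case (trans xs ys zs)
  show ?case by (rule tensor_eq.trans[OF trans.IH])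
next
  case (append xs xs' ys ys')
  then show ?case by (simp add: tensor_eq.append)
next
  case (commute xs ys)
  then show ?case using c by (simp, intro tensor_eq.commute) auto
next
  case (zero w)
  then show ?case using c by (simp add: tensor_eq.zero)
next
  case (add_left v v' w)
  then show ?case using c by (simp add: V.smult_r_distr tensor_eq.add_left)
next
  case (add_right v w w')
  then show ?case using c by (simp add: tensor_eq.add_right)
next
  case (scalar d v w)
  then have "c \<odot>\<^bsub>V\<^esub> (d \<odot>\<^bsub>V\<^esub> v) = d \<odot>\<^bsub>V\<^esub> (c \<odot>\<^bsub>V\<^esub> v)"
    using c by (simp add: V.smult_assoc1[symmetric] V.m_comm)
  then show ?case using scalar c by (simp add: tensor_eq.scalar)
next
  case (relation v w v' w')
  then show ?case using c relation_smult by (simp add: tensor_eq.relation)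
qed

lemma cls_smult:
  assumes "c \<in> carrier K" "good xs"
  shows "c \<odot>\<^bsub>Q\<^esub> cls xs = cls (map (\<lambda>(v, w). (c \<odot>\<^bsub>V\<^esub> v, w)) xs)"
  unfolding quotient_tensor_def
  using cls_eq[OF tensor_eq.sym[OF teq_smult[OF assms(1) teq_summands[OF assms(2)]]]] by simp

lemma cls_zero: "\<zero>\<^bsub>Q\<^esub> = cls []"
  by (simp add: quotient_tensor_def)

lemma Q_cases:
  assumes "x \<in> carrier Q" obtains xs where "x = cls xs" "good xs"
  using cls_summands[OF assms] by metis

text \<open>The rules of \<open>tensor_eq\<close> contain no subtraction; additive inverses in the
  quotient come from negating the left factors, and \<open>zero\<close> removes each cancelled
  pair.\<close>

lemma neg_teq:
  assumes "good xs"
  shows "teq (xs @ map (\<lambda>(v, w). (\<ominus>\<^bsub>V\<^esub> v, w)) xs) []"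
  using assms
proof (induction xs)
  case Nil
  show ?case by (simp add: tensor_eq.refl)
next
  case (Cons p xs)
  obtain v w where p: "p = (v, w)" "v \<in> carrier V" "w \<in> carrier W" using Cons.prems by (cases p) auto
  let ?n = "map (\<lambda>(v, w). (\<ominus>\<^bsub>V\<^esub> v, w))"
  have g: "good xs" "good (?n xs)" using Cons.prems by auto
  have "teq [(v, w), (\<ominus>\<^bsub>V\<^esub> v, w)] [(v \<oplus>\<^bsub>V\<^esub> \<ominus>\<^bsub>V\<^esub> v, w)]"
    using p by (intro tensor_eq.sym[OF tensor_eq.add_left]) auto
  also have "v \<oplus>\<^bsub>V\<^esub> \<ominus>\<^bsub>V\<^esub> v = \<zero>\<^bsub>V\<^esub>" using p by (simp add: V.r_neg)
  finally have *: "teq [(v, w), (\<ominus>\<^bsub>V\<^esub> v, w)] []"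
    by (rule tensor_eq.trans[OF _ tensor_eq.zero[OF p(3)]])
  \<comment> \<open>The negated head stands behind \<open>xs\<close>; commuting it with
    \<open>xs\<close> places it next to (v, w).\<close>
  have "teq ([(v, w)] @ (xs @ [(\<ominus>\<^bsub>V\<^esub> v, w)]) @ ?n xs) ([(v, w)] @ ([(\<ominus>\<^bsub>V\<^esub> v, w)] @ xs) @ ?n xs)"
    using g p by (intro tensor_eq.append tensor_eq.refl tensor_eq.commute) auto
  then have "teq (p # xs @ ?n (p # xs)) ([(v, w), (\<ominus>\<^bsub>V\<^esub> v, w)] @ (xs @ ?n xs))"
    by (simp add: p)
  moreover have "teq ([(v, w), (\<ominus>\<^bsub>V\<^esub> v, w)] @ (xs @ ?n xs)) ([] @ [])"
    using * Cons.IH g(1) by (rule_tac tensor_eq.append) auto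
  ultimately have "teq (p # xs @ ?n (p # xs)) ([] @ [])"
    by (rule tensor_eq.trans)
  then show ?case by simp
qed

lemma module_quotient: "module K Q"
proof -
  have nl: "cls xs = cls ys" if "teq xs ys" for xs ys using that by (rule cls_eq)
  have ag: "abelian_group Q"
  proof (rule abelian_groupI)
    fix x y assume "x \<in> carrier Q" "y \<in> carrier Q"
    then obtain xs ys where xy: "x = cls xs" "good xs" "y = cls ys" "good ys"
      by (elim Q_cases) blast
    show "x \<oplus>\<^bsub>Q\<^esub> y \<in> carrier Q" using xy by (simp add: cls_add cls_carrier)
    show "x \<oplus>\<^bsub>Q\<^esub> y = y \<oplus>\<^bsub>Q\<^esub> x"
      using xy by (simp add: cls_add) (blast intro: nl tensor_eq.commute)
    fix z assume "z \<in> carrier Q"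
    then obtain zs where z: "z = cls zs" "good zs" by (rule Q_cases)
    show "x \<oplus>\<^bsub>Q\<^esub> y \<oplus>\<^bsub>Q\<^esub> z = x \<oplus>\<^bsub>Q\<^esub> (y \<oplus>\<^bsub>Q\<^esub> z)"
      using xy z by (simp add: cls_add)
  next
    show "\<zero>\<^bsub>Q\<^esub> \<in> carrier Q" by (simp add: cls_zero cls_carrier)
  next
    fix x assume "x \<in> carrier Q"
    then obtain xs where x: "x = cls xs" "good xs" by (rule Q_cases)
    show "\<zero>\<^bsub>Q\<^esub> \<oplus>\<^bsub>Q\<^esub> x = x" using x by (simp add: cls_zero cls_add)
    have g: "good (map (\<lambda>(v, w). (\<ominus>\<^bsub>V\<^esub> v, w)) xs)" using x(2) by auto
    have "cls (map (\<lambda>(v, w). (\<ominus>\<^bsub>V\<^esub> v, w)) xs) \<oplus>\<^bsub>Q\<^esub> x = \<zero>\<^bsub>Q\<^esub>"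
      using x(2) g nl[OF tensor_eq.trans[OF tensor_eq.commute[OF g x(2)] neg_teq[OF x(2)]]]
      by (simp add: cls_zero cls_add x(1))
    then show "\<exists>y\<in>carrier Q. y \<oplus>\<^bsub>Q\<^esub> x = \<zero>\<^bsub>Q\<^esub>" using cls_carrier[OF g] by blast
  qed
  show ?thesis
  proof (intro moduleI ag V.R.is_cring)
    fix x assume "x \<in> carrier Q"
    then obtain xs where x: "x = cls xs" "good xs" by (elim Q_cases)
    have "map (\<lambda>(v, w). (\<one>\<^bsub>K\<^esub> \<odot>\<^bsub>V\<^esub> v, w)) xs = xs" using x(2) by (intro map_idI) auto
    then show "\<one>\<^bsub>K\<^esub> \<odot>\<^bsub>Q\<^esub> x = x" using x by (simp add: cls_smult)
  next
    fix a x assume a: "a \<in> carrier K" and "x \<in> carrier Q"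
    then obtain xs where x: "x = cls xs" "good xs" by (elim Q_cases)
    let ?m = "\<lambda>a. map (\<lambda>(v, w). (a \<odot>\<^bsub>V\<^esub> v, w)) xs"
    have g: "good (?m a)" if "a \<in> carrier K" for a using x(2) that by auto
    show "a \<odot>\<^bsub>Q\<^esub> x \<in> carrier Q" using a x g by (simp add: cls_smult cls_carrier)
    {
      fix y assume "y \<in> carrier Q"
      then obtain ys where y: "y = cls ys" "good ys" by (elim Q_cases)
      have "good (map (\<lambda>(v, w). (a \<odot>\<^bsub>V\<^esub> v, w)) ys)" using y(2) a by auto
      then show "a \<odot>\<^bsub>Q\<^esub> (x \<oplus>\<^bsub>Q\<^esub> y) = a \<odot>\<^bsub>Q\<^esub> x \<oplus>\<^bsub>Q\<^esub> a \<odot>\<^bsub>Q\<^esub> y"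
        using a x y g[OF a] by (simp add: cls_smult cls_add)
    }
    fix b assume b: "b \<in> carrier K"
    show "(a \<otimes>\<^bsub>K\<^esub> b) \<odot>\<^bsub>Q\<^esub> x = a \<odot>\<^bsub>Q\<^esub> (b \<odot>\<^bsub>Q\<^esub> x)"
    proof -
      have "?m (a \<otimes>\<^bsub>K\<^esub> b) = map (\<lambda>(v, w). (a \<odot>\<^bsub>V\<^esub> v, w)) (?m b)"
        using x(2) a b by (auto simp: V.smult_assoc1)
      then show ?thesis using a b x g[OF b] by (simp add: cls_smult del: map_map)
    qed
    show "(a \<oplus>\<^bsub>K\<^esub> b) \<odot>\<^bsub>Q\<^esub> x = a \<odot>\<^bsub>Q\<^esub> x \<oplus>\<^bsub>Q\<^esub> b \<odot>\<^bsub>Q\<^esub> x"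
    proof -
      \<comment> \<open>Splitting every entry with \<open>add_left\<close> interleaves the two
        scaled lists; the inductive step moves the new entry of the second list behind the first
        list.\<close>
      have "teq (?m (a \<oplus>\<^bsub>K\<^esub> b)) (?m a @ ?m b)"
        using x(2)
      proof (induction xs)
        case (Cons p xs)
        obtain v w where p: "p = (v, w)" "v \<in> carrier V" "w \<in> carrier W" using Cons.prems by (cases p) auto
        let ?m = "\<lambda>a. map (\<lambda>(v, w). (a \<odot>\<^bsub>V\<^esub> v, w)) xs"
        have gg: "good (?m a)" "good (?m b)" using Cons.prems a b by auto
        have 1: "teq [((a \<oplus>\<^bsub>K\<^esub> b) \<odot>\<^bsub>V\<^esub> v, w)] [(a \<odot>\<^bsub>V\<^esub> v, w), (b \<odot>\<^bsub>V\<^esub> v, w)]"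
          using p a b by (simp add: V.smult_l_distr tensor_eq.add_left)
        have 2: "teq (?m (a \<oplus>\<^bsub>K\<^esub> b)) (?m a @ ?m b)" using Cons by simp
        have "teq ([((a \<oplus>\<^bsub>K\<^esub> b) \<odot>\<^bsub>V\<^esub> v, w)] @ ?m (a \<oplus>\<^bsub>K\<^esub> b))
            ([(a \<odot>\<^bsub>V\<^esub> v, w), (b \<odot>\<^bsub>V\<^esub> v, w)] @ (?m a @ ?m b))"
          by (rule tensor_eq.append[OF 1 2])
        moreover have "teq ([(a \<odot>\<^bsub>V\<^esub> v, w)] @ ([(b \<odot>\<^bsub>V\<^esub> v, w)] @ ?m a) @ ?m b)
            ([(a \<odot>\<^bsub>V\<^esub> v, w)] @ (?m a @ [(b \<odot>\<^bsub>V\<^esub> v, w)]) @ ?m b)"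
          using gg p a b by (intro tensor_eq.append tensor_eq.refl tensor_eq.commute) auto
        ultimately show ?case using tensor_eq.trans by (simp add: p) blast
      qed (simp add: tensor_eq.refl)
      then show ?thesis using a b x g[OF a] g[OF b] by (simp add: cls_smult cls_add nl)
    qed
  qed
qed

lemma cls_bilinear: "(\<lambda>v w. cls [(v, w)]) \<in> bilinear_maps K V W Q"
proof (intro bilinear_mapsI linear_mapsI)
  fix v w c assume vwc: "v \<in> carrier V" "w \<in> carrier W" "c \<in> carrier K"
  show "cls [(c \<odot>\<^bsub>V\<^esub> v, w)] = c \<odot>\<^bsub>Q\<^esub> cls [(v, w)]"
    using vwc by (simp add: cls_smult)
  show "cls [(v, c \<odot>\<^bsub>W\<^esub> w)] = c \<odot>\<^bsub>Q\<^esub> cls [(v, w)]"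
    using vwc by (simp add: cls_smult cls_eq[OF tensor_eq.scalar])
qed (auto intro: cls_carrier simp: cls_add cls_eq[OF tensor_eq.add_left] cls_eq[OF tensor_eq.add_right])

lemma cls_relation:
  assumes "((v, w), (v', w')) \<in> R" "v \<in> carrier V" "w \<in> carrier W" "v' \<in> carrier V" "w' \<in> carrier W"
  shows "cls [(v, w)] = cls [(v', w')]"
  by (intro cls_eq tensor_eq.relation assms)

lemma cls_sum: "good xs \<Longrightarrow> cls xs = sum_pairs Q (\<lambda>v w. cls [(v, w)]) xs"
proof (induction xs)
  case (Cons p xs)
  obtain v w where p: "p = (v, w)" "v \<in> carrier V" "w \<in> carrier W" using Cons.prems by (cases p) auto
  have "cls (p # xs) = cls [(v, w)] \<oplus>\<^bsub>Q\<^esub> cls xs"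
    using Cons.prems p by (simp add: cls_add)
  then show ?case using Cons p by simp
qed (simp add: cls_zero)

lemma sweedler_cls: "x \<in> carrier Q \<Longrightarrow> sweedler Q x (\<lambda>v w. cls [(v, w)]) = x"
  using cls_sum[of "summands x"] cls_summands[of x] by (simp add: sweedler_def)

text \<open>Pure tensors span: by \<open>sweedler_cls\<close> each element is the sum of the classes
  of its own \<open>summands\<close>, and both maps commute with this sum.\<close>

lemma linear_ext:
  assumes U: "module K U" and f: "f \<in> linear_maps K Q U" and g: "g \<in> linear_maps K Q U"
    and fg: "\<And>v w. v \<in> carrier V \<Longrightarrow> w \<in> carrier W \<Longrightarrow> f (cls [(v, w)]) = g (cls [(v, w)])"
    and x: "x \<in> carrier Q"
  shows "f x = g x"
proof -
  have c: "cls [(v, w)] \<in> carrier Q" "f (cls [(v, w)]) = g (cls [(v, w)])" if "(v, w) \<in> set (summands x)" for v w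
    using cls_summands(1)[OF x] that fg by (auto intro!: cls_carrier)
  have "f x = sum_pairs U (\<lambda>v w. f (cls [(v, w)])) (summands x)"
    using linear_of_sum_pairs[OF U module_quotient f, of "summands x" "\<lambda>v w. cls [(v, w)]"] c sweedler_cls[OF x] by (simp add: sweedler_def)
  also have "\<dots> = sum_pairs U (\<lambda>v w. g (cls [(v, w)])) (summands x)"
    by (intro sum_pairs_fun_cong c)
  also have "\<dots> = g x"
    using linear_of_sum_pairs[OF U module_quotient g, of "summands x" "\<lambda>v w. cls [(v, w)]"] c sweedler_cls[OF x] by (simp add: sweedler_def)
  finally show ?thesis .
qed

context
  fixes U :: "('k, 'u, 't) module_scheme" and F
  assumes U: "module K U" and F: "F \<in> bilinear_maps K V W U"
    and bal: "\<And>v w v' w'. ((v, w), (v', w')) \<in> R \<Longrightarrow> v \<in> carrier V \<Longrightarrow> w \<in> carrier W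
      \<Longrightarrow> v' \<in> carrier V \<Longrightarrow> w' \<in> carrier W \<Longrightarrow> F v w = F v' w'"
begin

lemma sweedler_cls_good: "good xs \<Longrightarrow> sweedler U (cls xs) F = sum_pairs U F xs"
  using sweedler_class[OF V.module_axioms W.module_axioms U F bal] by blast

interpretation U: module K U by (fact U)

lemma sweedler_pure: "v \<in> carrier V \<Longrightarrow> w \<in> carrier W \<Longrightarrow> sweedler U (cls [(v, w)]) F = F v w"
  using bilinear_mapsD(3)[OF F] by (simp add: sweedler_cls_good)

text \<open>Together with \<open>sweedler_pure\<close> this is the universal property of the
  quotient: a balanced bilinear F induces the linear map sending x to
  \<open>sweedler U x F\<close>.\<close>

lemma sweedler_linear: "(\<lambda>x. sweedler U x F) \<in> linear_maps K Q U"
proof (rule linear_mapsI)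
  fix x assume "x \<in> carrier Q"
  then obtain xs where x: "x = cls xs" "good xs" by (rule Q_cases)
  have c: "F a b \<in> carrier U" if "(a, b) \<in> set xs" for a b
    using x(2) that bilinear_mapsD(3)[OF F] by auto
  show "sweedler U x F \<in> carrier U"
    using x c by (simp add: sweedler_cls_good sum_pairs_in_carrier[OF U])
  {
    fix r assume r: "r \<in> carrier K"
    have "good (map (\<lambda>(v, w). (r \<odot>\<^bsub>V\<^esub> v, w)) xs)" using x(2) r by auto
    then have "sweedler U (r \<odot>\<^bsub>Q\<^esub> x) F = sum_pairs U (\<lambda>a b. F (r \<odot>\<^bsub>V\<^esub> a) b) xs"
      using x r sum_pairs_map[of U F "\<lambda>v. r \<odot>\<^bsub>V\<^esub> v" "\<lambda>w. w"] by (simp add: cls_smult sweedler_cls_good)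
    also have "\<dots> = sum_pairs U (\<lambda>a b. r \<odot>\<^bsub>U\<^esub> F a b) xs"
      using x(2) r linear_mapsD(3)[OF bilinear_mapsD(2)[OF F]]
      by (intro sum_pairs_fun_cong) auto
    also have "\<dots> = r \<odot>\<^bsub>U\<^esub> sweedler U x F"
      using x c r by (simp add: sweedler_cls_good sum_pairs_smult[OF U])
    finally show "sweedler U (r \<odot>\<^bsub>Q\<^esub> x) F = r \<odot>\<^bsub>U\<^esub> sweedler U x F" .
  }
  fix y assume "y \<in> carrier Q"
  then obtain ys where y: "y = cls ys" "good ys" by (rule Q_cases)
  have "F a b \<in> carrier U" if "(a, b) \<in> set (xs @ ys)" for a b
    using x(2) y(2) that bilinear_mapsD(3)[OF F] by auto
  from sum_pairs_append'[OF U this]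
  show "sweedler U (x \<oplus>\<^bsub>Q\<^esub> y) F = sweedler U x F \<oplus>\<^bsub>U\<^esub> sweedler U y F"
    using x y by (simp add: cls_add sweedler_cls_good)
qed

end

end

section \<open>Hopf bimodules over an ordinary Hopf algebra\<close>

definition trilinear ::
  "('k, 'z) ring_scheme \<Rightarrow> ('k, 'u, 'x) module_scheme \<Rightarrow> ('k, 'v, 'y) module_scheme
   \<Rightarrow> ('k, 'w, 't) module_scheme \<Rightarrow> ('k, 's, 'r) module_scheme \<Rightarrow> ('u \<Rightarrow> 'v \<Rightarrow> 'w \<Rightarrow> 's) \<Rightarrow> bool"
where
  "trilinear K U V X W F \<longleftrightarrow>
     (\<forall>u\<in>carrier U. \<forall>v\<in>carrier V. F u v \<in> linear_maps K X W) \<and>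
     (\<forall>u\<in>carrier U. \<forall>x\<in>carrier X. (\<lambda>v. F u v x) \<in> linear_maps K V W) \<and>
     (\<forall>v\<in>carrier V. \<forall>x\<in>carrier X. (\<lambda>u. F u v x) \<in> linear_maps K U W)"

lemma trilinearI:
  assumes "\<And>u v. u \<in> carrier U \<Longrightarrow> v \<in> carrier V \<Longrightarrow> F u v \<in> linear_maps K X W"
    and "\<And>u x. u \<in> carrier U \<Longrightarrow> x \<in> carrier X \<Longrightarrow> (\<lambda>v. F u v x) \<in> linear_maps K V W"
    and "\<And>v x. v \<in> carrier V \<Longrightarrow> x \<in> carrier X \<Longrightarrow> (\<lambda>u. F u v x) \<in> linear_maps K U W"
  shows "trilinear K U V X W F"
  using assms by (auto simp: trilinear_def)

lemma trilinearD:
  assumes "trilinear K U V X W F"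
  shows "u \<in> carrier U \<Longrightarrow> v \<in> carrier V \<Longrightarrow> F u v \<in> linear_maps K X W"
    and "u \<in> carrier U \<Longrightarrow> x \<in> carrier X \<Longrightarrow> (\<lambda>v. F u v x) \<in> linear_maps K V W"
    and "v \<in> carrier V \<Longrightarrow> x \<in> carrier X \<Longrightarrow> (\<lambda>u. F u v x) \<in> linear_maps K U W"
    and "u \<in> carrier U \<Longrightarrow> v \<in> carrier V \<Longrightarrow> x \<in> carrier X \<Longrightarrow> F u v x \<in> carrier W"
proof -
  show 1: "u \<in> carrier U \<Longrightarrow> v \<in> carrier V \<Longrightarrow> F u v \<in> linear_maps K X W"
    and "u \<in> carrier U \<Longrightarrow> x \<in> carrier X \<Longrightarrow> (\<lambda>v. F u v x) \<in> linear_maps K V W"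
    and "v \<in> carrier V \<Longrightarrow> x \<in> carrier X \<Longrightarrow> (\<lambda>u. F u v x) \<in> linear_maps K U W"
    using assms by (simp_all add: trilinear_def)
  show "u \<in> carrier U \<Longrightarrow> v \<in> carrier V \<Longrightarrow> x \<in> carrier X \<Longrightarrow> F u v x \<in> carrier W"
    by (rule 1[THEN linear_mapsD(1)])
qed

lemma trilinear_comp:
  assumes F: "trilinear K U V X W F"
  shows "g \<in> linear_maps K Y U \<Longrightarrow> v \<in> carrier V \<Longrightarrow> x \<in> carrier X \<Longrightarrow> (\<lambda>y. F (g y) v x) \<in> linear_maps K Y W"
    and "g \<in> linear_maps K Y V \<Longrightarrow> u \<in> carrier U \<Longrightarrow> x \<in> carrier X \<Longrightarrow> (\<lambda>y. F u (g y) x) \<in> linear_maps K Y W"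
    and "g \<in> linear_maps K Y X \<Longrightarrow> u \<in> carrier U \<Longrightarrow> v \<in> carrier V \<Longrightarrow> (\<lambda>y. F u v (g y)) \<in> linear_maps K Y W"
  by (rule linear_comp[OF trilinearD(3)[OF F]] linear_comp[OF trilinearD(2)[OF F]]
      linear_comp[OF trilinearD(1)[OF F]]; assumption)+

lemma bilinear_comps:
  assumes F: "F \<in> bilinear_maps K U V W"
  shows "g \<in> linear_maps K Y U \<Longrightarrow> v \<in> carrier V \<Longrightarrow> (\<lambda>y. F (g y) v) \<in> linear_maps K Y W"
    and "g \<in> linear_maps K Y V \<Longrightarrow> u \<in> carrier U \<Longrightarrow> (\<lambda>y. F u (g y)) \<in> linear_maps K Y W"
  by (rule linear_comp[OF bilinear_mapsD(2)[OF F]] linear_comp[OF bilinear_mapsD(1)[OF F]]; assumption)+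

lemma bilinear_smult:
  assumes F: "F \<in> bilinear_maps K U V W"
  shows "\<lbrakk>c \<in> carrier K; u \<in> carrier U; v \<in> carrier V\<rbrakk> \<Longrightarrow> F u (c \<odot>\<^bsub>V\<^esub> v) = c \<odot>\<^bsub>W\<^esub> F u v"
    and "\<lbrakk>c \<in> carrier K; u \<in> carrier U; v \<in> carrier V\<rbrakk> \<Longrightarrow> F (c \<odot>\<^bsub>U\<^esub> u) v = c \<odot>\<^bsub>W\<^esub> F u v"
  using linear_mapsD(3)[OF bilinear_mapsD(1)[OF F]] linear_mapsD(3)[OF bilinear_mapsD(2)[OF F]]
  by simp_all

text \<open>
  Coactions and the comultiplication are functions into lists of pairs. The lists have entries in
  the right carriers even outside the domain of the coaction, which gives congruence rules
  without side conditions. \<open>tw\<close> is the action of the powers of the structure automorphisms, and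
  \<open>adm\<close> carries the typing conditions of a BiHom-module that its ordinary structure does not
  determine.
\<close>

locale bimodule_data =
  fixes K :: "('k, 'z) ring_scheme" and I :: "('k, 'u, 'x) module_scheme"
    and la :: "('k, 'u, 'x) module_scheme \<Rightarrow> 'u \<Rightarrow> 'u \<Rightarrow> 'u"
    and ra :: "('k, 'u, 'x) module_scheme \<Rightarrow> 'u \<Rightarrow> 'u \<Rightarrow> 'u"
    and lc :: "('k, 'u, 'x) module_scheme \<Rightarrow> 'u \<Rightarrow> ('u \<times> 'u) list"
    and rc :: "('k, 'u, 'x) module_scheme \<Rightarrow> 'u \<Rightarrow> ('u \<times> 'u) list"
    and tw :: "('k, 'u, 'x) module_scheme \<Rightarrow> 't \<Rightarrow> 'u \<Rightarrow> 'u"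
    and e :: 'u and eps :: "'u \<Rightarrow> 'k"
    and adm :: "('k, 'u, 'x) module_scheme \<Rightarrow> bool"
  assumes lc_carrier: "set (lc M m) \<subseteq> carrier I \<times> carrier M"
    and rc_carrier: "set (rc M m) \<subseteq> carrier M \<times> carrier I"
begin

abbreviation lin where "lin V W f \<equiv> f \<in> linear_maps K V W"
abbreviation bil where "bil U V W F \<equiv> F \<in> bilinear_maps K U V W"
abbreviation tri where "tri U V X W F \<equiv> trilinear K U V X W F"

definition SL where "SL W M m F = sum_pairs W F (lc M m)"
definition SR where "SR W M m F = sum_pairs W F (rc M m)"
definition mul where "mul a b = la I a b"

lemma SL_cong [cong]:
  assumes "m = m'" "\<And>a b. a \<in> carrier I \<Longrightarrow> b \<in> carrier M \<Longrightarrow> F a b = G a b"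
  shows "SL W M m F = SL W M m' G"
  unfolding SL_def assms(1) using lc_carrier assms(2) by (intro sum_pairs_fun_cong) blast

lemma SR_cong [cong]:
  assumes "m = m'" "\<And>a b. a \<in> carrier M \<Longrightarrow> b \<in> carrier I \<Longrightarrow> F a b = G a b"
  shows "SR W M m F = SR W M m' G"
  unfolding SR_def assms(1) using rc_carrier assms(2) by (intro sum_pairs_fun_cong) blast

lemma SL_closed [simp]:
  assumes "module K W" "\<And>a b. a \<in> carrier I \<Longrightarrow> b \<in> carrier M \<Longrightarrow> F a b \<in> carrier W"
  shows "SL W M m F \<in> carrier W"
  unfolding SL_def using lc_carrier assms by (intro sum_pairs_in_carrier[of K]) blast+

lemma SR_closed [simp]:
  assumes "module K W" "\<And>a b. a \<in> carrier M \<Longrightarrow> b \<in> carrier I \<Longrightarrow> F a b \<in> carrier W"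
  shows "SR W M m F \<in> carrier W"
  unfolding SR_def using rc_carrier assms by (intro sum_pairs_in_carrier[of K]) blast+

lemma lin_SL [simp]:
  assumes "module K V" "module K W"
    and "\<And>a b. a \<in> carrier I \<Longrightarrow> b \<in> carrier M \<Longrightarrow> lin V W (\<lambda>x. F x a b)"
  shows "lin V W (\<lambda>x. SL W M m (F x))"
  unfolding SL_def using lc_carrier assms by (intro linear_sum_pairs) blast+

lemma lin_SR [simp]:
  assumes "module K V" "module K W"
    and "\<And>a b. a \<in> carrier M \<Longrightarrow> b \<in> carrier I \<Longrightarrow> lin V W (\<lambda>x. F x a b)"
  shows "lin V W (\<lambda>x. SR W M m (F x))"
  unfolding SR_def using rc_carrier assms by (intro linear_sum_pairs) blast+

lemma map_SL:
  assumes "lin V W f" "module K V" "module K W"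
    and "\<And>a b. a \<in> carrier I \<Longrightarrow> b \<in> carrier M \<Longrightarrow> F a b \<in> carrier V"
  shows "f (SL V M m F) = SL W M m (\<lambda>a b. f (F a b))"
  unfolding SL_def using lc_carrier assms by (intro linear_of_sum_pairs) blast+

lemma map_SR:
  assumes "lin V W f" "module K V" "module K W"
    and "\<And>a b. a \<in> carrier M \<Longrightarrow> b \<in> carrier I \<Longrightarrow> F a b \<in> carrier V"
  shows "f (SR V M m F) = SR W M m (\<lambda>a b. f (F a b))"
  unfolding SR_def using rc_carrier assms by (intro linear_of_sum_pairs) blast+

lemma SL_smult:
  assumes "module K W" "c \<in> carrier K" "\<And>a b. a \<in> carrier I \<Longrightarrow> b \<in> carrier M \<Longrightarrow> F a b \<in> carrier W"
  shows "SL W M m (\<lambda>a b. c \<odot>\<^bsub>W\<^esub> F a b) = c \<odot>\<^bsub>W\<^esub> SL W M m F"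
  unfolding SL_def using lc_carrier assms by (intro sum_pairs_smult) blast+

lemma SR_smult:
  assumes "module K W" "c \<in> carrier K" "\<And>a b. a \<in> carrier M \<Longrightarrow> b \<in> carrier I \<Longrightarrow> F a b \<in> carrier W"
  shows "SR W M m (\<lambda>a b. c \<odot>\<^bsub>W\<^esub> F a b) = c \<odot>\<^bsub>W\<^esub> SR W M m F"
  unfolding SR_def using rc_carrier assms by (intro sum_pairs_smult) blast+

lemma SL_SL_commute:
  assumes "module K W" "\<And>a b c d. \<lbrakk>a \<in> carrier I; b \<in> carrier M; c \<in> carrier I; d \<in> carrier N\<rbrakk> \<Longrightarrow> F a b c d \<in> carrier W"
  shows "SL W M m (\<lambda>a b. SL W N n (\<lambda>c d. F a b c d)) = SL W N n (\<lambda>c d. SL W M m (\<lambda>a b. F a b c d))"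
  unfolding SL_def using lc_carrier assms by (intro sum_pairs_commute) blast+

lemma SL_SR_commute:
  assumes "module K W" "\<And>a b c d. \<lbrakk>a \<in> carrier I; b \<in> carrier M; c \<in> carrier N; d \<in> carrier I\<rbrakk> \<Longrightarrow> F a b c d \<in> carrier W"
  shows "SL W M m (\<lambda>a b. SR W N n (\<lambda>c d. F a b c d)) = SR W N n (\<lambda>c d. SL W M m (\<lambda>a b. F a b c d))"
  unfolding SL_def SR_def using lc_carrier rc_carrier assms by (intro sum_pairs_commute) blast+

lemma SR_SR_commute:
  assumes "module K W" "\<And>a b c d. \<lbrakk>a \<in> carrier M; b \<in> carrier I; c \<in> carrier N; d \<in> carrier I\<rbrakk> \<Longrightarrow> F a b c d \<in> carrier W"
  shows "SR W M m (\<lambda>a b. SR W N n (\<lambda>c d. F a b c d)) = SR W N n (\<lambda>c d. SR W M m (\<lambda>a b. F a b c d))"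
  unfolding SR_def using rc_carrier assms by (intro sum_pairs_commute) blast+

end

text \<open>The Hopf algebra enters as the module I: \<open>SL W I\<close> is Sweedler notation for
  its comultiplication and \<open>mul\<close> is its action on itself. In the four compatibilities
  of actions with coactions the sum over h always stands outermost; other orders are obtained from
  the commutation lemmas of \<open>bimodule_data\<close>.\<close>

locale hopf_bimodule = bimodule_data K I la ra lc rc tw e eps adm
  for K :: "('k, 'z) ring_scheme" and I :: "('k, 'u, 'x) module_scheme"
    and la ra lc rc and tw :: "('k, 'u, 'x) module_scheme \<Rightarrow> 't \<Rightarrow> 'u \<Rightarrow> 'u" and e eps adm +
  fixes M :: "('k, 'u, 'x) module_scheme"
  assumes admissible: "adm M"
    and modM: "module K M"
    and la_bil: "bil I M M (la M)"
    and ra_bil: "bil M I M (ra M)"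
    and SL_lin: "\<lbrakk>module K (W :: ('k, 'u, 'x) module_scheme); bil I M W F\<rbrakk> \<Longrightarrow> lin M W (\<lambda>m. SL W M m F)"
    and SR_lin: "\<lbrakk>module K (W :: ('k, 'u, 'x) module_scheme); bil M I W F\<rbrakk> \<Longrightarrow> lin M W (\<lambda>m. SR W M m F)"
    and tw_lin: "lin M M (tw M t)"
    and tw_la: "\<lbrakk>h \<in> carrier I; m \<in> carrier M\<rbrakk> \<Longrightarrow> tw M t (la M h m) = la M (tw I t h) (tw M t m)"
    and tw_ra: "\<lbrakk>h \<in> carrier I; m \<in> carrier M\<rbrakk> \<Longrightarrow> tw M t (ra M m h) = ra M (tw M t m) (tw I t h)"
    and SL_tw: "\<lbrakk>module K (W :: ('k, 'u, 'x) module_scheme); bil I M W F; m \<in> carrier M\<rbrakk>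
      \<Longrightarrow> SL W M (tw M t m) F = SL W M m (\<lambda>a b. F (tw I t a) (tw M t b))"
    and SR_tw: "\<lbrakk>module K (W :: ('k, 'u, 'x) module_scheme); bil M I W F; m \<in> carrier M\<rbrakk>
      \<Longrightarrow> SR W M (tw M t m) F = SR W M m (\<lambda>a b. F (tw M t a) (tw I t b))"
    and la_la: "\<lbrakk>a \<in> carrier I; b \<in> carrier I; m \<in> carrier M\<rbrakk> \<Longrightarrow> la M a (la M b m) = la M (mul a b) m"
    and la_one: "m \<in> carrier M \<Longrightarrow> la M e m = m"
    and ra_ra: "\<lbrakk>a \<in> carrier I; b \<in> carrier I; m \<in> carrier M\<rbrakk> \<Longrightarrow> ra M (ra M m a) b = ra M m (mul a b)"
    and ra_one: "m \<in> carrier M \<Longrightarrow> ra M m e = m"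
    and la_ra: "\<lbrakk>a \<in> carrier I; b \<in> carrier I; m \<in> carrier M\<rbrakk> \<Longrightarrow> la M a (ra M m b) = ra M (la M a m) b"
    and SL_coassoc: "\<lbrakk>module K (W :: ('k, 'u, 'x) module_scheme); tri I I M W J; m \<in> carrier M\<rbrakk>
      \<Longrightarrow> SL W M m (\<lambda>a x. SL W M x (\<lambda>b y. J a b y)) = SL W M m (\<lambda>h y. SL W I h (\<lambda>a b. J a b y))"
    and SL_counit: "m \<in> carrier M \<Longrightarrow> SL M M m (\<lambda>h x. eps h \<odot>\<^bsub>M\<^esub> x) = m"
    and SR_coassoc: "\<lbrakk>module K (W :: ('k, 'u, 'x) module_scheme); tri M I I W J; m \<in> carrier M\<rbrakk>
      \<Longrightarrow> SR W M m (\<lambda>x b. SR W M x (\<lambda>y a. J y a b)) = SR W M m (\<lambda>y h. SL W I h (\<lambda>a b. J y a b))"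
    and SR_counit: "m \<in> carrier M \<Longrightarrow> SR M M m (\<lambda>x h. eps h \<odot>\<^bsub>M\<^esub> x) = m"
    and SL_SR: "\<lbrakk>module K (W :: ('k, 'u, 'x) module_scheme); tri I M I W J; m \<in> carrier M\<rbrakk>
      \<Longrightarrow> SL W M m (\<lambda>a x. SR W M x (\<lambda>y b. J a y b)) = SR W M m (\<lambda>x b. SL W M x (\<lambda>a y. J a y b))"
    and SL_la: "\<lbrakk>module K (W :: ('k, 'u, 'x) module_scheme); bil I M W F; h \<in> carrier I; m \<in> carrier M\<rbrakk>
      \<Longrightarrow> SL W M (la M h m) F = SL W I h (\<lambda>a b. SL W M m (\<lambda>g x. F (mul a g) (la M b x)))"
    and SR_la: "\<lbrakk>module K (W :: ('k, 'u, 'x) module_scheme); bil M I W F; h \<in> carrier I; m \<in> carrier M\<rbrakk>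
      \<Longrightarrow> SR W M (la M h m) F = SL W I h (\<lambda>a b. SR W M m (\<lambda>x g. F (la M a x) (mul b g)))"
    and SL_ra: "\<lbrakk>module K (W :: ('k, 'u, 'x) module_scheme); bil I M W F; h \<in> carrier I; m \<in> carrier M\<rbrakk>
      \<Longrightarrow> SL W M (ra M m h) F = SL W I h (\<lambda>a b. SL W M m (\<lambda>g x. F (mul g a) (ra M x b)))"
    and SR_ra: "\<lbrakk>module K (W :: ('k, 'u, 'x) module_scheme); bil M I W F; h \<in> carrier I; m \<in> carrier M\<rbrakk>
      \<Longrightarrow> SR W M (ra M m h) F = SL W I h (\<lambda>a b. SR W M m (\<lambda>x g. F (ra M x a) (mul g b)))"

text \<open>Most bialgebra axioms are not listed, because \<open>objI\<close> makes I a Hopf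
  bimodule over itself and \<open>raI\<close>, \<open>rcI\<close> identify its two actions and its
  two coactions. Associativity, coassociativity and multiplicativity of the comultiplication become
  instances of the module axioms.\<close>

locale hopf_base = bimodule_data K I la ra lc rc tw e eps adm
  for K :: "('k, 'z) ring_scheme" and I :: "('k, 'u, 'x) module_scheme"
    and la ra lc rc and tw :: "('k, 'u, 'x) module_scheme \<Rightarrow> 't \<Rightarrow> 'u \<Rightarrow> 'u" and e eps adm +
  assumes objI: "hopf_bimodule K I la ra lc rc tw e eps adm I"
    and raI: "ra I = la I" and rcI: "rc I = lc I"
    and e_closed [simp]: "e \<in> carrier I"
    and SL_e: "\<lbrakk>module K (W :: ('k, 'u, 'x) module_scheme); bil I I W F\<rbrakk> \<Longrightarrow> SL W I e F = F e e"
    and eps_closed [simp]: "a \<in> carrier I \<Longrightarrow> eps a \<in> carrier K"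
    and eps_add: "\<lbrakk>a \<in> carrier I; b \<in> carrier I\<rbrakk> \<Longrightarrow> eps (a \<oplus>\<^bsub>I\<^esub> b) = eps a \<oplus>\<^bsub>K\<^esub> eps b"
    and eps_smult: "\<lbrakk>c \<in> carrier K; a \<in> carrier I\<rbrakk> \<Longrightarrow> eps (c \<odot>\<^bsub>I\<^esub> a) = c \<otimes>\<^bsub>K\<^esub> eps a"
    and eps_e [simp]: "eps e = \<one>\<^bsub>K\<^esub>"
    and eps_mul: "\<lbrakk>a \<in> carrier I; b \<in> carrier I\<rbrakk> \<Longrightarrow> eps (mul a b) = eps a \<otimes>\<^bsub>K\<^esub> eps b"
    and tw_e: "tw I t e = e"
begin

abbreviation obj where "obj M \<equiv> hopf_bimodule K I la ra lc rc tw e eps adm M"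

lemma la_I: "la I a b = mul a b" and ra_I: "ra I a b = mul a b"
  by (simp_all add: mul_def raI)

lemma SR_I: "SR W I m F = SL W I m F"
  by (simp add: SL_def SR_def rcI)

lemmas [simp] = objI
lemmas admissible = hopf_bimodule.admissible [of K I la ra lc rc tw e eps adm]
lemmas modM [simp] = hopf_bimodule.modM [of K I la ra lc rc tw e eps adm]
lemmas la_bil = hopf_bimodule.la_bil [of K I la ra lc rc tw e eps adm]
lemmas ra_bil = hopf_bimodule.ra_bil [of K I la ra lc rc tw e eps adm]
lemmas SL_lin' = hopf_bimodule.SL_lin [of K I la ra lc rc tw e eps adm]
lemmas SR_lin' = hopf_bimodule.SR_lin [of K I la ra lc rc tw e eps adm]
lemmas tw_lin [simp] = hopf_bimodule.tw_lin [of K I la ra lc rc tw e eps adm]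
lemmas tw_la = hopf_bimodule.tw_la [of K I la ra lc rc tw e eps adm]
lemmas tw_ra = hopf_bimodule.tw_ra [of K I la ra lc rc tw e eps adm]
lemmas SL_tw = hopf_bimodule.SL_tw [of K I la ra lc rc tw e eps adm]
lemmas SR_tw = hopf_bimodule.SR_tw [of K I la ra lc rc tw e eps adm]
lemmas la_la = hopf_bimodule.la_la [of K I la ra lc rc tw e eps adm]
lemmas la_one = hopf_bimodule.la_one [of K I la ra lc rc tw e eps adm]
lemmas ra_ra = hopf_bimodule.ra_ra [of K I la ra lc rc tw e eps adm]
lemmas ra_one = hopf_bimodule.ra_one [of K I la ra lc rc tw e eps adm]
lemmas la_ra = hopf_bimodule.la_ra [of K I la ra lc rc tw e eps adm]
lemmas SL_coassoc = hopf_bimodule.SL_coassoc [of K I la ra lc rc tw e eps adm]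
lemmas SL_counit = hopf_bimodule.SL_counit [of K I la ra lc rc tw e eps adm]
lemmas SR_coassoc = hopf_bimodule.SR_coassoc [of K I la ra lc rc tw e eps adm]
lemmas SR_counit = hopf_bimodule.SR_counit [of K I la ra lc rc tw e eps adm]
lemmas SL_SR = hopf_bimodule.SL_SR [of K I la ra lc rc tw e eps adm]
lemmas SL_la = hopf_bimodule.SL_la [of K I la ra lc rc tw e eps adm]
lemmas SR_la = hopf_bimodule.SR_la [of K I la ra lc rc tw e eps adm]
lemmas SL_ra = hopf_bimodule.SL_ra [of K I la ra lc rc tw e eps adm]
lemmas SR_ra = hopf_bimodule.SR_ra [of K I la ra lc rc tw e eps adm]

lemma mul_bil: "bil I I I mul"
  using la_bil[OF objI] by (simp add: mul_def[abs_def])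

lemma act_closed [simp]:
  "\<lbrakk>obj M; h \<in> carrier I; m \<in> carrier M\<rbrakk> \<Longrightarrow> la M h m \<in> carrier M"
  "\<lbrakk>obj M; h \<in> carrier I; m \<in> carrier M\<rbrakk> \<Longrightarrow> ra M m h \<in> carrier M"
  "\<lbrakk>a \<in> carrier I; b \<in> carrier I\<rbrakk> \<Longrightarrow> mul a b \<in> carrier I"
  "\<lbrakk>obj M; m \<in> carrier M\<rbrakk> \<Longrightarrow> tw M t m \<in> carrier M"
  using bilinear_mapsD(3)[OF la_bil] bilinear_mapsD(3)[OF ra_bil] bilinear_mapsD(3)[OF mul_bil]
    linear_mapsD(1)[OF tw_lin] by blast+

lemma smult_closed [simp]: "\<lbrakk>obj M; c \<in> carrier K; x \<in> carrier M\<rbrakk> \<Longrightarrow> c \<odot>\<^bsub>M\<^esub> x \<in> carrier M"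
  by (rule module.smult_closed[OF modM])

lemma linear_id' [simp]: "lin V V (\<lambda>x. x)"
  by (rule linear_id)

text \<open>With these rules, \<open>bilI\<close> and \<open>triI\<close>, the simplifier settles
  multilinearity of any expression built from the structure maps by descending through it, which
  discharges the side conditions of the Sweedler calculus.\<close>

lemma act_lin [simp]:
  "\<lbrakk>obj M; h \<in> carrier I; lin V M g\<rbrakk> \<Longrightarrow> lin V M (\<lambda>x. la M h (g x))"
  "\<lbrakk>obj M; m \<in> carrier M; lin V I g\<rbrakk> \<Longrightarrow> lin V M (\<lambda>x. la M (g x) m)"
  "\<lbrakk>obj M; h \<in> carrier I; lin V M g\<rbrakk> \<Longrightarrow> lin V M (\<lambda>x. ra M (g x) h)"
  "\<lbrakk>obj M; m \<in> carrier M; lin V I g\<rbrakk> \<Longrightarrow> lin V M (\<lambda>x. ra M m (g x))"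
  "\<lbrakk>a \<in> carrier I; lin V I g\<rbrakk> \<Longrightarrow> lin V I (\<lambda>x. mul a (g x))"
  "\<lbrakk>a \<in> carrier I; lin V I g\<rbrakk> \<Longrightarrow> lin V I (\<lambda>x. mul (g x) a)"
  "\<lbrakk>obj M; lin V M g\<rbrakk> \<Longrightarrow> lin V M (\<lambda>x. tw M t (g x))"
  by (rule bilinear_comps[OF la_bil] bilinear_comps[OF ra_bil] bilinear_comps[OF mul_bil]
      linear_comp[OF tw_lin]; assumption)+

lemma bilI [simp]:
  assumes "\<And>u. u \<in> carrier U \<Longrightarrow> lin V W (F u)" "\<And>v. v \<in> carrier V \<Longrightarrow> lin U W (\<lambda>u. F u v)"
  shows "bil U V W F"
  using assms by (rule bilinear_mapsI)

lemmas triI [simp] = trilinearI[of _ _ _ K]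

lemma lin_SL_arg [simp]:
  "\<lbrakk>obj M; module K (W :: ('k, 'u, 'x) module_scheme); lin V M g; bil I M W F\<rbrakk>
    \<Longrightarrow> lin V W (\<lambda>x. SL W M (g x) F)"
  by (rule linear_comp[OF SL_lin'])

lemma lin_SR_arg [simp]:
  "\<lbrakk>obj M; module K (W :: ('k, 'u, 'x) module_scheme); lin V M g; bil M I W F\<rbrakk>
    \<Longrightarrow> lin V W (\<lambda>x. SR W M (g x) F)"
  by (rule linear_comp[OF SR_lin'])

lemma lin_eps [simp]:
  assumes W: "module K W" and V: "module K V"
  shows "\<lbrakk>w \<in> carrier W; lin V I g\<rbrakk> \<Longrightarrow> lin V W (\<lambda>x. eps (g x) \<odot>\<^bsub>W\<^esub> w)"
    and "\<lbrakk>c \<in> carrier K; lin V W f\<rbrakk> \<Longrightarrow> lin V W (\<lambda>x. c \<odot>\<^bsub>W\<^esub> f x)"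
proof -
  interpret W: module K W by fact
  interpret V: module K V by fact
  show "lin V W (\<lambda>x. eps (g x) \<odot>\<^bsub>W\<^esub> w)" if w: "w \<in> carrier W" and g: "lin V I g"
    using w by (intro linear_mapsI)
      (simp_all add: linear_mapsD[OF g] eps_add eps_smult W.smult_l_distr W.smult_assoc1)
  show "lin V W (\<lambda>x. c \<odot>\<^bsub>W\<^esub> f x)" if c: "c \<in> carrier K" and f: "lin V W f"
    using c by (intro linear_mapsI)
      (simp_all add: linear_mapsD[OF f] W.smult_r_distr W.smult_assoc1[symmetric] W.R.m_comm)
qed

lemma mul_assoc: "\<lbrakk>a \<in> carrier I; b \<in> carrier I; c \<in> carrier I\<rbrakk> \<Longrightarrow> mul (mul a b) c = mul a (mul b c)"
  using la_la[OF objI, of a b c] by (simp add: la_I)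

lemma mul_e [simp]: "a \<in> carrier I \<Longrightarrow> mul e a = a" "a \<in> carrier I \<Longrightarrow> mul a e = a"
  using la_one[OF objI] ra_one[OF objI] by (simp_all add: la_I ra_I)

lemma tw_mul: "\<lbrakk>a \<in> carrier I; b \<in> carrier I\<rbrakk> \<Longrightarrow> tw I t (mul a b) = mul (tw I t a) (tw I t b)"
  using tw_la[OF objI, of a b t] by (simp add: la_I)

lemma act_smult:
  "\<lbrakk>obj M; c \<in> carrier K; h \<in> carrier I; m \<in> carrier M\<rbrakk> \<Longrightarrow> la M h (c \<odot>\<^bsub>M\<^esub> m) = c \<odot>\<^bsub>M\<^esub> la M h m"
  "\<lbrakk>obj M; c \<in> carrier K; h \<in> carrier I; m \<in> carrier M\<rbrakk> \<Longrightarrow> la M (c \<odot>\<^bsub>I\<^esub> h) m = c \<odot>\<^bsub>M\<^esub> la M h m"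
  "\<lbrakk>obj M; c \<in> carrier K; h \<in> carrier I; m \<in> carrier M\<rbrakk> \<Longrightarrow> ra M (c \<odot>\<^bsub>M\<^esub> m) h = c \<odot>\<^bsub>M\<^esub> ra M m h"
  "\<lbrakk>obj M; c \<in> carrier K; h \<in> carrier I; m \<in> carrier M\<rbrakk> \<Longrightarrow> ra M m (c \<odot>\<^bsub>I\<^esub> h) = c \<odot>\<^bsub>M\<^esub> ra M m h"
  "\<lbrakk>c \<in> carrier K; a \<in> carrier I; b \<in> carrier I\<rbrakk> \<Longrightarrow> mul (c \<odot>\<^bsub>I\<^esub> a) b = c \<odot>\<^bsub>I\<^esub> mul a b"
  "\<lbrakk>c \<in> carrier K; a \<in> carrier I; b \<in> carrier I\<rbrakk> \<Longrightarrow> mul a (c \<odot>\<^bsub>I\<^esub> b) = c \<odot>\<^bsub>I\<^esub> mul a b"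
  by (rule bilinear_smult[OF la_bil] bilinear_smult[OF ra_bil] bilinear_smult[OF mul_bil]; assumption)+

lemma SL_counit':
  fixes W :: "('k, 'u, 'x) module_scheme"
  assumes "obj M" "module K W" "lin M W f" "m \<in> carrier M"
  shows "SL W M m (\<lambda>h x. eps h \<odot>\<^bsub>W\<^esub> f x) = f m"
proof -
  have "f m = f (SL M M m (\<lambda>h x. eps h \<odot>\<^bsub>M\<^esub> x))" using assms by (simp add: SL_counit)
  also have "\<dots> = SL W M m (\<lambda>h x. f (eps h \<odot>\<^bsub>M\<^esub> x))" using assms by (intro map_SL) auto
  also have "\<dots> = SL W M m (\<lambda>h x. eps h \<odot>\<^bsub>W\<^esub> f x)" by (simp add: linear_mapsD[OF assms(3)])
  finally show ?thesis ..
qed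

lemma SR_counit':
  fixes W :: "('k, 'u, 'x) module_scheme"
  assumes "obj M" "module K W" "lin M W f" "m \<in> carrier M"
  shows "SR W M m (\<lambda>x h. eps h \<odot>\<^bsub>W\<^esub> f x) = f m"
proof -
  have "f m = f (SR M M m (\<lambda>x h. eps h \<odot>\<^bsub>M\<^esub> x))" using assms by (simp add: SR_counit)
  also have "\<dots> = SR W M m (\<lambda>x h. f (eps h \<odot>\<^bsub>M\<^esub> x))" using assms by (intro map_SR) auto
  also have "\<dots> = SR W M m (\<lambda>x h. eps h \<odot>\<^bsub>W\<^esub> f x)" by (simp add: linear_mapsD[OF assms(3)])
  finally show ?thesis ..
qed

text \<open>In the convolution algebra f is a left and g a right inverse of the identity map, so f =
  f * (id * g) = (f * id) * g = g.\<close>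

lemma convolution_inverse_unique:
  assumes f: "lin I I f" and g: "lin I I g"
    and fl: "\<And>h. h \<in> carrier I \<Longrightarrow> SL I I h (\<lambda>a b. mul (f a) b) = eps h \<odot>\<^bsub>I\<^esub> e"
    and gr: "\<And>h. h \<in> carrier I \<Longrightarrow> SL I I h (\<lambda>a b. mul a (g b)) = eps h \<odot>\<^bsub>I\<^esub> e"
    and h: "h \<in> carrier I"
  shows "f h = g h"
proof -
  note [simp] = linear_mapsD(1)[OF f] linear_mapsD(1)[OF g] linear_comp[OF f] linear_comp[OF g] f g
  have "f h = SL I I h (\<lambda>a b. eps b \<odot>\<^bsub>I\<^esub> f a)"
    using SR_counit'[of I I f h] h by (simp add: SR_I)
  also have "\<dots> = SL I I h (\<lambda>a b. mul (f a) (SL I I b (\<lambda>c d. mul c (g d))))"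
    by (simp add: gr act_smult)
  also have "\<dots> = SL I I h (\<lambda>a b. SL I I b (\<lambda>c d. mul (mul (f a) c) (g d)))"
    by (simp add: map_SL[where V=I and W=I] mul_assoc)
  also have "\<dots> = SL I I h (\<lambda>a b. SL I I a (\<lambda>c d. mul (mul (f c) d) (g b)))"
    using h by (subst SL_coassoc) simp_all
  also have "\<dots> = SL I I h (\<lambda>a b. mul (SL I I a (\<lambda>c d. mul (f c) d)) (g b))"
    by (simp add: map_SL[where V=I and W=I and f="\<lambda>x. mul x _"])
  also have "\<dots> = SL I I h (\<lambda>a b. eps a \<odot>\<^bsub>I\<^esub> g b)"
    by (simp add: fl act_smult)
  also have "\<dots> = g h"
    using h by (simp add: SL_counit')
  finally show ?thesis .
qed

end

section \<open>The antipode and the coinvariant projections\<close>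

locale hopf = hopf_base K I la ra lc rc tw e eps adm
  for K :: "('k, 'z) ring_scheme" and I :: "('k, 'u, 'x) module_scheme"
    and la ra lc rc and tw :: "('k, 'u, 'x) module_scheme \<Rightarrow> 't \<Rightarrow> 'u \<Rightarrow> 'u" and e eps adm +
  fixes S :: "'u \<Rightarrow> 'u"
  assumes S_lin [simp]: "lin I I S"
    and S_left: "a \<in> carrier I \<Longrightarrow> SL I I a (\<lambda>x y. mul (S x) y) = eps a \<odot>\<^bsub>I\<^esub> e"
    and S_right: "a \<in> carrier I \<Longrightarrow> SL I I a (\<lambda>x y. mul x (S y)) = eps a \<odot>\<^bsub>I\<^esub> e"
    and S_tw: "a \<in> carrier I \<Longrightarrow> S (tw I t a) = tw I t (S a)"
begin

lemma S_closed [simp]: "a \<in> carrier I \<Longrightarrow> S a \<in> carrier I"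
  by (rule linear_mapsD(1)[OF S_lin])

lemma S_lin' [simp]: "lin V I g \<Longrightarrow> lin V I (\<lambda>x. S (g x))"
  by (rule linear_comp[OF S_lin])

lemma S_smult: "c \<in> carrier K \<Longrightarrow> a \<in> carrier I \<Longrightarrow> S (c \<odot>\<^bsub>I\<^esub> a) = c \<odot>\<^bsub>I\<^esub> S a"
  by (rule linear_mapsD(3)[OF S_lin])

lemma K_one_smult [simp]: "module K W \<Longrightarrow> x \<in> carrier W \<Longrightarrow> \<one>\<^bsub>K\<^esub> \<odot>\<^bsub>W\<^esub> x = x"
  by (rule module.smult_one)

lemma S_e [simp]: "S e = e"
  using S_left[of e] by (simp add: SL_e)

context
  fixes W :: "('k, 'u, 'x) module_scheme"
  assumes W [simp]: "module K W"
begin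

lemma mul_S_cancel:
  assumes f: "lin I W f" and a: "a \<in> carrier I"
  shows "SL W I a (\<lambda>x y. f (mul (S x) y)) = eps a \<odot>\<^bsub>W\<^esub> f e"
    and "SL W I a (\<lambda>x y. f (mul x (S y))) = eps a \<odot>\<^bsub>W\<^esub> f e"
  using a map_SL[OF f, where M=I and m=a and F="\<lambda>x y. mul (S x) y"]
    map_SL[OF f, where M=I and m=a and F="\<lambda>x y. mul x (S y)"]
  by (simp_all add: S_left S_right linear_mapsD(3)[OF f])

text \<open>Coassociativity turns two adjacent legs of an iterated coaction into a coproduct, the
  antipode axiom makes this a scalar, and the counit absorbs it. Nearly every later cancellation is
  brought into one of these four shapes.\<close>

lemma coact_S_cancel:
  assumes M [simp]: "obj M" and m: "m \<in> carrier M"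
  shows "bil I M W F \<Longrightarrow> SL W M m (\<lambda>a x. SL W M x (\<lambda>b y. F (mul (S a) b) y)) = F e m"
    and "bil I M W F \<Longrightarrow> SL W M m (\<lambda>a x. SL W M x (\<lambda>b y. F (mul a (S b)) y)) = F e m"
    and "bil M I W G \<Longrightarrow> SR W M m (\<lambda>x b. SR W M x (\<lambda>y a. G y (mul (S a) b))) = G m e"
    and "bil M I W G \<Longrightarrow> SR W M m (\<lambda>x b. SR W M x (\<lambda>y a. G y (mul a (S b)))) = G m e"
proof -
  {
    assume F: "bil I M W F"
    note [simp] = F bilinear_comps[OF F] bilinear_mapsD[OF F]
    show "SL W M m (\<lambda>a x. SL W M x (\<lambda>b y. F (mul (S a) b) y)) = F e m"
      using m by (simp add: SL_coassoc mul_S_cancel[where f="\<lambda>z. F z _"] SL_counit')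
    show "SL W M m (\<lambda>a x. SL W M x (\<lambda>b y. F (mul a (S b)) y)) = F e m"
      using m by (simp add: SL_coassoc mul_S_cancel[where f="\<lambda>z. F z _"] SL_counit')
  }
  {
    assume G: "bil M I W G"
    note [simp] = G bilinear_comps[OF G] bilinear_mapsD[OF G]
    show "SR W M m (\<lambda>x b. SR W M x (\<lambda>y a. G y (mul (S a) b))) = G m e"
      using m by (simp add: SR_coassoc mul_S_cancel[where f="\<lambda>z. G _ z"] SR_counit')
    show "SR W M m (\<lambda>x b. SR W M x (\<lambda>y a. G y (mul a (S b)))) = G m e"
      using m by (simp add: SR_coassoc mul_S_cancel[where f="\<lambda>z. G _ z"] SR_counit')
  }
qed

lemma comult_mul:
  assumes F: "bil I I W F" and "a \<in> carrier I" "b \<in> carrier I"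
  shows "SL W I (mul a b) F = SL W I a (\<lambda>x y. SL W I b (\<lambda>c d. F (mul x c) (mul y d)))"
  using assms SL_la[of I W F a b] by (simp add: la_I)

text \<open>Both sides are convolution inverses of the comultiplication. The proof evaluates one sum
  twice, cancelling either S(h_1) h_2 inside the comultiplication or the coproduct of h_2 against
  the reversed antipodes of the legs of h_3.\<close>

lemma comult_S:
  assumes F: "bil I I W F" and h: "h \<in> carrier I"
  shows "SL W I (S h) F = SL W I h (\<lambda>a b. F (S b) (S a))"
proof -
  note [simp] = F bilinear_comps[OF F] bilinear_mapsD[OF F]
  \<comment> \<open>G k z is F applied to the coproduct of k times S(z_2) \<otimes> S(z_1).\<close>
  define G where "G k z = SL W I k (\<lambda>s t. SL W I z (\<lambda>c d. F (mul s (S d)) (mul t (S c))))" for k z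
  have G: "bil I I W G" by (simp add: G_def[abs_def])
  note [simp] = G bilinear_comps[OF G] bilinear_mapsD[OF G]
  have "SL W I h (\<lambda>a y. SL W I y (\<lambda>b z. G (mul (S a) b) z)) = G e h"
    using h by (simp add: coact_S_cancel)
  also have "\<dots> = SL W I h (\<lambda>a b. F (S b) (S a))"
    by (simp add: G_def SL_e)
  finally have 1: "SL W I h (\<lambda>a y. SL W I y (\<lambda>b z. G (mul (S a) b) z)) = SL W I h (\<lambda>a b. F (S b) (S a))" .
  \<comment> \<open>The legs of y are p, q, c, d in this order. The inner pair q S(c) cancels first,
    which makes p and S(d) adjacent.\<close>
  have 2: "SL W I y (\<lambda>b z. SL W I b (\<lambda>p q. SL W I z (\<lambda>c d. F (mul s (mul p (S d))) (mul t (mul q (S c))))))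
      = eps y \<odot>\<^bsub>W\<^esub> F s t" if [simp]: "s \<in> carrier I" "t \<in> carrier I" "y \<in> carrier I" for s t y
  proof -
    have "SL W I y (\<lambda>b z. SL W I b (\<lambda>p q. SL W I z (\<lambda>c d. F (mul s (mul p (S d))) (mul t (mul q (S c))))))
      = SL W I y (\<lambda>p r. SL W I r (\<lambda>q z. SL W I z (\<lambda>c d. F (mul s (mul p (S d))) (mul t (mul q (S c))))))"
      by (rule SL_coassoc[symmetric]; simp)
    also have "\<dots> = SL W I y (\<lambda>p r. F (mul s (mul p (S r))) t)"
      using coact_S_cancel(2)[OF objI, where F="\<lambda>x d. F (mul s (mul _ (S d))) (mul t x)"] by simp
    also have "\<dots> = eps y \<odot>\<^bsub>W\<^esub> F s t"
      using mul_S_cancel(2)[where f="\<lambda>x. F (mul s x) t"] by simp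
    finally show ?thesis .
  qed
  have "SL W I h (\<lambda>a y. SL W I y (\<lambda>b z. G (mul (S a) b) z))
    = SL W I h (\<lambda>a y. SL W I y (\<lambda>b z. SL W I (S a) (\<lambda>s t. SL W I b (\<lambda>p q.
         SL W I z (\<lambda>c d. F (mul s (mul p (S d))) (mul t (mul q (S c))))))))"
    by (simp add: G_def comult_mul mul_assoc)
  also have "\<dots> = SL W I h (\<lambda>a y. SL W I (S a) (\<lambda>s t. SL W I y (\<lambda>b z. SL W I b (\<lambda>p q.
         SL W I z (\<lambda>c d. F (mul s (mul p (S d))) (mul t (mul q (S c))))))))"
    by (intro SL_cong HOL.refl SL_SL_commute) simp_all
  also have "\<dots> = SL W I h (\<lambda>a y. eps y \<odot>\<^bsub>W\<^esub> SL W I (S a) F)"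
    by (simp add: 2 SL_smult)
  also have "\<dots> = SL W I (S h) F"
    using SR_counit'[of I W "\<lambda>a. SL W I (S a) F" h] h by (simp add: SR_I)
  finally show ?thesis using 1 by simp
qed

end

text \<open>X is the sum of S(b_1) S(a_1) a_2 b_2 S(a_3 b_3). Cancelling the last two factors
  against each other leaves S(b) S(a); cancelling S(a_1) a_2 and then S(b_1) b_2 leaves S(a
  b).\<close>

lemma S_mul:
  assumes a [simp]: "a \<in> carrier I" and b [simp]: "b \<in> carrier I"
  shows "S (mul a b) = mul (S b) (S a)"
proof -
  define X where "X = SL I I b (\<lambda>b1 b2. SL I I a (\<lambda>a1 a2.
      mul (mul (S b1) (S a1)) (SL I I (mul a2 b2) (\<lambda>c d. mul c (S d)))))"
  have "X = SL I I b (\<lambda>b1 b2. SL I I a (\<lambda>a1 a2. eps b2 \<odot>\<^bsub>I\<^esub> (eps a2 \<odot>\<^bsub>I\<^esub> (mul (S b1) (S a1)))))"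
    unfolding X_def using module.smult_assoc1[OF modM[OF objI]]
    by (simp add: S_right act_smult eps_mul cring.cring_simprules module.axioms(1)[OF modM[OF objI]] mul_assoc)
  also have "\<dots> = mul (S b) (S a)"
    using SR_counit'[of I I "\<lambda>z. mul _ (S z)" a] SR_counit'[of I I "\<lambda>z. mul (S z) (S a)" b]
    by (simp add: SL_smult SR_I)
  finally have 1: "X = mul (S b) (S a)" .
  have "X = SL I I b (\<lambda>b1 b2. SL I I a (\<lambda>a1 a2. SL I I a2 (\<lambda>c1 c2. SL I I b2 (\<lambda>d1 d2.
      mul (mul (S b1) (S a1)) (mul (mul c1 d1) (S (mul c2 d2)))))))"
    unfolding X_def by (simp add: comult_mul map_SL[where V=I and W=I and f="\<lambda>x. mul _ x"])
  also have "\<dots> = SL I I b (\<lambda>b1 b2. SL I I a (\<lambda>a1 a2. SL I I a2 (\<lambda>c1 c2. SL I I b2 (\<lambda>d1 d2.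
      mul (S b1) (mul (mul (S a1) c1) (mul d1 (S (mul c2 d2))))))))"
    by (simp add: mul_assoc)
  also have "\<dots> = SL I I b (\<lambda>b1 b2. SL I I b2 (\<lambda>d1 d2. mul (S b1) (mul d1 (S (mul a d2)))))"
    using coact_S_cancel(1)[OF modM[OF objI] objI, where F="\<lambda>x y. SL I I _ (\<lambda>d1 d2. mul (S _) (mul x (mul d1 (S (mul y d2)))))"]
    by simp
  also have "\<dots> = SL I I b (\<lambda>b1 b2. SL I I b2 (\<lambda>d1 d2. mul (mul (S b1) d1) (S (mul a d2))))"
    by (simp add: mul_assoc)
  also have "\<dots> = S (mul a b)"
    using coact_S_cancel(1)[OF modM[OF objI] objI, where F="\<lambda>x y. mul x (S (mul a y))"] by simp
  finally show ?thesis using 1 by simp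
qed

definition P where "P M m = SL M M m (\<lambda>h x. la M (S h) x)"
definition Q where "Q N n = SR N N n (\<lambda>x h. ra N x (S h))"

section \<open>Actions and coactions on the coinvariant projections\<close>

context
  fixes M :: "('k, 'u, 'x) module_scheme"
  assumes M [simp]: "obj M"
begin

lemma P_closed [simp]: "P M m \<in> carrier M" and Q_closed [simp]: "Q M m \<in> carrier M"
  by (simp_all add: P_def Q_def)

lemma PQ_lin [simp]: "lin M M (P M)" "lin M M (Q M)"
  by (simp_all add: P_def[abs_def] Q_def[abs_def])

lemma PQ_lin' [simp]: "lin V M g \<Longrightarrow> lin V M (\<lambda>x. P M (g x))" "lin V M g \<Longrightarrow> lin V M (\<lambda>x. Q M (g x))"
  by (rule linear_comp[OF PQ_lin(1)] linear_comp[OF PQ_lin(2)]; assumption)+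

text \<open>The antipode reverses products, so S(h_1) comes to stand next to h_2 and the pair
  collapses to the counit.\<close>

lemma P_la:
  assumes [simp]: "h \<in> carrier I" "m \<in> carrier M"
  shows "P M (la M h m) = eps h \<odot>\<^bsub>M\<^esub> P M m"
proof -
  have "P M (la M h m) = SL M I h (\<lambda>a b. SL M M m (\<lambda>g x. la M (mul (S g) (mul (S a) b)) x))"
    by (simp add: P_def SL_la la_la S_mul mul_assoc)
  also have "\<dots> = SL M M m (\<lambda>g x. SL M I h (\<lambda>a b. la M (mul (S g) (mul (S a) b)) x))"
    by (intro SL_SL_commute) simp_all
  also have "\<dots> = SL M M m (\<lambda>g x. eps h \<odot>\<^bsub>M\<^esub> la M (S g) x)"
    using mul_S_cancel(1)[where W=M and f="\<lambda>z. la M (mul (S _) z) _"] by simp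
  also have "\<dots> = eps h \<odot>\<^bsub>M\<^esub> P M m"
    by (simp add: P_def SL_smult)
  finally show ?thesis .
qed

lemma Q_ra:
  assumes [simp]: "h \<in> carrier I" "m \<in> carrier M"
  shows "Q M (ra M m h) = eps h \<odot>\<^bsub>M\<^esub> Q M m"
proof -
  have "Q M (ra M m h) = SL M I h (\<lambda>a b. SR M M m (\<lambda>x g. ra M x (mul (mul a (S b)) (S g))))"
    by (simp add: Q_def SR_ra ra_ra S_mul mul_assoc)
  also have "\<dots> = SR M M m (\<lambda>x g. SL M I h (\<lambda>a b. ra M x (mul (mul a (S b)) (S g))))"
    by (intro SL_SR_commute) simp_all
  also have "\<dots> = SR M M m (\<lambda>x g. eps h \<odot>\<^bsub>M\<^esub> ra M x (S g))"
    using mul_S_cancel(2)[where W=M and f="\<lambda>z. ra M _ (mul z (S _))"] by simp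
  also have "\<dots> = eps h \<odot>\<^bsub>M\<^esub> Q M m"
    by (simp add: Q_def SR_smult)
  finally show ?thesis .
qed

text \<open>On left coinvariants the right action becomes the right adjoint action.
  \<open>Q_la\<close> is the mirror image.\<close>

lemma P_ra:
  assumes [simp]: "h \<in> carrier I" "m \<in> carrier M"
  shows "P M (ra M m h) = SL M I h (\<lambda>a b. ra M (la M (S a) (P M m)) b)"
  by (simp add: P_def SL_ra S_mul la_ra la_la map_SL[where V=M and W=M and f="\<lambda>z. ra M (la M _ z) _"])

lemma Q_la:
  assumes [simp]: "h \<in> carrier I" "m \<in> carrier M"
  shows "Q M (la M h m) = SL M I h (\<lambda>a b. ra M (la M a (Q M m)) (S b))"
  by (simp add: Q_def SR_la S_mul la_ra ra_ra[symmetric] map_SR[where V=M and W=M and f="\<lambda>z. ra M (la M _ z) _"])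

text \<open>The reconstruction half of the fundamental theorem of Hopf modules: m_[-1] S(m_[-1]')
  cancels between two adjacent legs. \<open>ra_Q\<close> is the version for the right
  coaction.\<close>

lemma la_P: "m \<in> carrier M \<Longrightarrow> SL M M m (\<lambda>h x. la M h (P M x)) = m"
  using coact_S_cancel(2)[OF modM[OF M] M, where F="\<lambda>a x. la M a x"]
  by (simp add: P_def map_SL[where V=M and W=M and f="\<lambda>z. la M _ z"] la_la la_one)

lemma ra_Q: "m \<in> carrier M \<Longrightarrow> SR M M m (\<lambda>x h. ra M (Q M x) h) = m"
  using coact_S_cancel(3)[OF modM[OF M] M, where G="\<lambda>x a. ra M x a"]
  by (simp add: Q_def map_SR[where V=M and W=M and f="\<lambda>z. ra M z _"] ra_ra ra_one)

lemma P_tw: "m \<in> carrier M \<Longrightarrow> P M (tw M t m) = tw M t (P M m)"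
  and Q_tw: "m \<in> carrier M \<Longrightarrow> Q M (tw M t m) = tw M t (Q M m)"
  by (simp_all add: P_def Q_def SL_tw SR_tw S_tw tw_la tw_ra
      map_SL[where V=M and W=M and f="\<lambda>z. tw M t z"] map_SR[where V=M and W=M and f="\<lambda>z. tw M t z"])

context
  fixes W :: "('k, 'u, 'x) module_scheme"
  assumes W [simp]: "module K W"
begin

text \<open>Left coinvariance of P(m). Since S reverses the coproduct, the antipode that lands in
  the coaction leg meets the leg of the remaining module element directly after it and
  cancels.\<close>

lemma SL_P:
  assumes F: "bil I M W F" and m [simp]: "m \<in> carrier M"
  shows "SL W M (P M m) F = F e (P M m)"
proof -
  note [simp] = F bilinear_comps[OF F] bilinear_mapsD[OF F]
  have "SL W M (P M m) F = SL W M m (\<lambda>g x. SL W I g (\<lambda>c d. SL W M x (\<lambda>b y. F (mul (S d) b) (la M (S c) y))))"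
    by (simp add: P_def map_SL[where V=M and W=W and f="\<lambda>z. SL W M z F"] SL_la comult_S)
  also have "\<dots> = SL W M m (\<lambda>c r. SL W M r (\<lambda>d x. SL W M x (\<lambda>b y. F (mul (S d) b) (la M (S c) y))))"
    by (rule SL_coassoc[symmetric]; simp)
  also have "\<dots> = SL W M m (\<lambda>c r. F e (la M (S c) r))"
    using coact_S_cancel(1)[OF W M, where F="\<lambda>z y. F z (la M (S _) y)"] by simp
  also have "\<dots> = F e (P M m)"
    by (simp add: P_def map_SL[where V=M and W=W and f="\<lambda>z. F e z"])
  finally show ?thesis .
qed

lemma SR_Q:
  assumes F: "bil M I W F" and m [simp]: "m \<in> carrier M"
  shows "SR W M (Q M m) F = F (Q M m) e"
proof -
  note [simp] = F bilinear_comps[OF F] bilinear_mapsD[OF F]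
  have "SR W M (Q M m) F = SR W M m (\<lambda>x g. SL W I g (\<lambda>c d. SR W M x (\<lambda>y b. F (ra M y (S d)) (mul b (S c)))))"
    by (simp add: Q_def map_SR[where V=M and W=W and f="\<lambda>z. SR W M z F"] SR_ra comult_S)
  also have "\<dots> = SR W M m (\<lambda>r d. SR W M r (\<lambda>x c. SR W M x (\<lambda>y b. F (ra M y (S d)) (mul b (S c)))))"
    by (rule SR_coassoc[symmetric]; simp)
  also have "\<dots> = SR W M m (\<lambda>r d. F (ra M r (S d)) e)"
    using coact_S_cancel(4)[OF W M, where G="\<lambda>y z. F (ra M y (S _)) z"] by simp
  also have "\<dots> = F (Q M m) e"
    by (simp add: Q_def map_SR[where V=M and W=W and f="\<lambda>z. F z e"])
  finally show ?thesis .
qed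

text \<open>The right coaction does not stay trivial on left coinvariants: it is the coadjoint one,
  with S(m_[-1]) multiplied to the coaction leg. This antipode is what cancels in
  \<open>SR_br\<close>; \<open>SL_Q\<close> plays the same part in \<open>SL_br\<close>.\<close>

lemma SR_P:
  assumes F: "bil M I W F" and m [simp]: "m \<in> carrier M"
  shows "SR W M (P M m) F = SL W M m (\<lambda>c r. SR W M r (\<lambda>z a. F (P M z) (mul (S c) a)))"
proof -
  note [simp] = F bilinear_comps[OF F] bilinear_mapsD[OF F]
  have "SR W M (P M m) F = SL W M m (\<lambda>g x. SL W I g (\<lambda>c d. SR W M x (\<lambda>y a. F (la M (S d) y) (mul (S c) a))))"
    by (simp add: P_def map_SL[where V=M and W=W and f="\<lambda>z. SR W M z F"] SR_la comult_S)
  also have "\<dots> = SL W M m (\<lambda>c r. SL W M r (\<lambda>d x. SR W M x (\<lambda>y a. F (la M (S d) y) (mul (S c) a))))"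
    by (simp add: SL_coassoc)
  also have "\<dots> = SL W M m (\<lambda>c r. SR W M r (\<lambda>z a. SL W M z (\<lambda>d y. F (la M (S d) y) (mul (S c) a))))"
    by (simp add: SL_SR)
  also have "\<dots> = SL W M m (\<lambda>c r. SR W M r (\<lambda>z a. F (P M z) (mul (S c) a)))"
    by (simp add: P_def map_SL[where V=M and W=W and f="\<lambda>z. F z _"])
  finally show ?thesis .
qed

lemma SL_Q:
  assumes F: "bil I M W F" and m [simp]: "m \<in> carrier M"
  shows "SL W M (Q M m) F = SR W M m (\<lambda>r d. SL W M r (\<lambda>a z. F (mul a (S d)) (Q M z)))"
proof -
  note [simp] = F bilinear_comps[OF F] bilinear_mapsD[OF F]
  have "SL W M (Q M m) F = SR W M m (\<lambda>x g. SL W I g (\<lambda>c d. SL W M x (\<lambda>a y. F (mul a (S d)) (ra M y (S c)))))"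
    by (simp add: Q_def map_SR[where V=M and W=W and f="\<lambda>z. SL W M z F"] SL_ra comult_S)
  also have "\<dots> = SR W M m (\<lambda>r d. SR W M r (\<lambda>x c. SL W M x (\<lambda>a y. F (mul a (S d)) (ra M y (S c)))))"
    by (simp add: SR_coassoc)
  also have "\<dots> = SR W M m (\<lambda>r d. SL W M r (\<lambda>a z. SR W M z (\<lambda>y c. F (mul a (S d)) (ra M y (S c)))))"
    by (simp add: SL_SR)
  also have "\<dots> = SR W M m (\<lambda>r d. SL W M r (\<lambda>a z. F (mul a (S d)) (Q M z)))"
    by (simp add: Q_def map_SR[where V=M and W=W and f="\<lambda>z. F _ z"])
  finally show ?thesis .
qed

end

end

end

section \<open>Tensor products over the Hopf algebra\<close>

text \<open>
  \<open>rep M N x\<close> is a representation of \<open>x\<close> as a sum of elements \<open>p M N m n\<close>, so \<open>ST\<close> below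
  is Sweedler notation for the universal property of the tensor product.
\<close>

locale hopf_tensor_data = hopf K I la ra lc rc tw e eps adm S
  for K :: "('k, 'z) ring_scheme" and I :: "('k, 'u, 'x) module_scheme"
    and la ra lc rc and tw :: "('k, 'u, 'x) module_scheme \<Rightarrow> 't \<Rightarrow> 'u \<Rightarrow> 'u" and e eps adm S +
  fixes tp :: "('k, 'u, 'x) module_scheme \<Rightarrow> ('k, 'u, 'x) module_scheme \<Rightarrow> ('k, 'u, 'x) module_scheme"
    and rep :: "('k, 'u, 'x) module_scheme \<Rightarrow> ('k, 'u, 'x) module_scheme \<Rightarrow> 'u \<Rightarrow> ('u \<times> 'u) list"
    and p :: "('k, 'u, 'x) module_scheme \<Rightarrow> ('k, 'u, 'x) module_scheme \<Rightarrow> 'u \<Rightarrow> 'u \<Rightarrow> 'u"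
  assumes rep_carrier: "set (rep M N x) \<subseteq> carrier M \<times> carrier N"
begin

definition ST where "ST W M N x F = sum_pairs W F (rep M N x)"

lemma ST_cong [cong]:
  assumes "x = x'" "\<And>a b. a \<in> carrier M \<Longrightarrow> b \<in> carrier N \<Longrightarrow> F a b = G a b"
  shows "ST W M N x F = ST W M N x' G"
  unfolding ST_def assms(1) using rep_carrier assms(2) by (intro sum_pairs_fun_cong) blast

lemma lin_ST [simp]:
  assumes "module K V" "module K W"
    and "\<And>a b. a \<in> carrier M \<Longrightarrow> b \<in> carrier N \<Longrightarrow> lin V W (\<lambda>x. F x a b)"
  shows "lin V W (\<lambda>x. ST W M N z (F x))"
  unfolding ST_def using rep_carrier assms by (intro linear_sum_pairs) blast+

lemma map_ST:
  assumes "lin V W f" "module K V" "module K W"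
    and "\<And>a b. a \<in> carrier M \<Longrightarrow> b \<in> carrier N \<Longrightarrow> F a b \<in> carrier V"
  shows "f (ST V M N x F) = ST W M N x (\<lambda>a b. f (F a b))"
  unfolding ST_def using rep_carrier assms by (intro linear_of_sum_pairs) blast+

definition balanced where
  "balanced M N F \<longleftrightarrow> (\<forall>m\<in>carrier M. \<forall>h\<in>carrier I. \<forall>n\<in>carrier N. F (ra M m h) n = F m (la N h n))"

lemma balancedI [simp]:
  "(\<And>m h n. \<lbrakk>m \<in> carrier M; h \<in> carrier I; n \<in> carrier N\<rbrakk> \<Longrightarrow> F (ra M m h) n = F m (la N h n)) \<Longrightarrow> balanced M N F"
  by (simp add: balanced_def)

end

text \<open>A presentation of the tensor product: \<open>ST_rep\<close>, \<open>ST_lin\<close> and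
  \<open>ST_p\<close> express its universal property, and the structure maps are described on
  generators. Their linearity is assumed separately, since only then do the values on generators
  determine them. The Hopf bimodule axioms are derived in \<open>obj_tp\<close>.\<close>

locale hopf_tensor = hopf_tensor_data K I la ra lc rc tw e eps adm S tp rep p
  for K :: "('k, 'z) ring_scheme" and I :: "('k, 'u, 'x) module_scheme"
    and la ra lc rc and tw :: "('k, 'u, 'x) module_scheme \<Rightarrow> 't \<Rightarrow> 'u \<Rightarrow> 'u" and e eps adm S
    and tp rep p +
  assumes tp_admissible: "\<lbrakk>obj M; obj N\<rbrakk> \<Longrightarrow> adm (tp M N)"
    and tp_mod [simp]: "\<lbrakk>obj M; obj N\<rbrakk> \<Longrightarrow> module K (tp M N)"
    and p_bil: "\<lbrakk>obj M; obj N\<rbrakk> \<Longrightarrow> bil M N (tp M N) (p M N)"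
    and p_bal: "\<lbrakk>obj M; obj N; m \<in> carrier M; h \<in> carrier I; n \<in> carrier N\<rbrakk>
      \<Longrightarrow> p M N (ra M m h) n = p M N m (la N h n)"
    and ST_rep: "\<lbrakk>obj M; obj N; x \<in> carrier (tp M N)\<rbrakk> \<Longrightarrow> ST (tp M N) M N x (p M N) = x"
    and ST_lin: "\<lbrakk>obj M; obj N; module K (W :: ('k, 'u, 'x) module_scheme); bil M N W F; balanced M N F\<rbrakk>
      \<Longrightarrow> lin (tp M N) W (\<lambda>x. ST W M N x F)"
    and ST_p: "\<lbrakk>obj M; obj N; module K (W :: ('k, 'u, 'x) module_scheme); bil M N W F; balanced M N F;
        m \<in> carrier M; n \<in> carrier N\<rbrakk> \<Longrightarrow> ST W M N (p M N m n) F = F m n"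
    and la_tp_bil: "\<lbrakk>obj M; obj N\<rbrakk> \<Longrightarrow> bil I (tp M N) (tp M N) (la (tp M N))"
    and ra_tp_bil: "\<lbrakk>obj M; obj N\<rbrakk> \<Longrightarrow> bil (tp M N) I (tp M N) (ra (tp M N))"
    and SL_tp_lin: "\<lbrakk>obj M; obj N; module K (W :: ('k, 'u, 'x) module_scheme); bil I (tp M N) W F\<rbrakk>
      \<Longrightarrow> lin (tp M N) W (\<lambda>x. SL W (tp M N) x F)"
    and SR_tp_lin: "\<lbrakk>obj M; obj N; module K (W :: ('k, 'u, 'x) module_scheme); bil (tp M N) I W F\<rbrakk>
      \<Longrightarrow> lin (tp M N) W (\<lambda>x. SR W (tp M N) x F)"
    and tw_tp_lin: "\<lbrakk>obj M; obj N\<rbrakk> \<Longrightarrow> lin (tp M N) (tp M N) (tw (tp M N) t)"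
    and la_p: "\<lbrakk>obj M; obj N; m \<in> carrier M; h \<in> carrier I; n \<in> carrier N\<rbrakk>
      \<Longrightarrow> la (tp M N) h (p M N m n) = p M N (la M h m) n"
    and ra_p: "\<lbrakk>obj M; obj N; m \<in> carrier M; h \<in> carrier I; n \<in> carrier N\<rbrakk>
      \<Longrightarrow> ra (tp M N) (p M N m n) h = p M N m (ra N n h)"
    and tw_p: "\<lbrakk>obj M; obj N; m \<in> carrier M; n \<in> carrier N\<rbrakk>
      \<Longrightarrow> tw (tp M N) t (p M N m n) = p M N (tw M t m) (tw N t n)"
    and SL_p: "\<lbrakk>obj M; obj N; module K (W :: ('k, 'u, 'x) module_scheme); bil I (tp M N) W F;
        m \<in> carrier M; n \<in> carrier N\<rbrakk>
      \<Longrightarrow> SL W (tp M N) (p M N m n) F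
        = SL W M m (\<lambda>g x. SL W N n (\<lambda>h y. F (mul g h) (p M N x y)))"
    and SR_p: "\<lbrakk>obj M; obj N; module K (W :: ('k, 'u, 'x) module_scheme); bil (tp M N) I W F;
        m \<in> carrier M; n \<in> carrier N\<rbrakk>
      \<Longrightarrow> SR W (tp M N) (p M N m n) F
        = SR W M m (\<lambda>x g. SR W N n (\<lambda>y h. F (p M N x y) (mul g h)))"
begin

lemma p_closed [simp]: "\<lbrakk>obj M; obj N; m \<in> carrier M; n \<in> carrier N\<rbrakk> \<Longrightarrow> p M N m n \<in> carrier (tp M N)"
  by (rule bilinear_mapsD(3)[OF p_bil])

lemma p_lin [simp]:
  "\<lbrakk>obj M; obj N; lin V M g; n \<in> carrier N\<rbrakk> \<Longrightarrow> lin V (tp M N) (\<lambda>x. p M N (g x) n)"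
  "\<lbrakk>obj M; obj N; lin V N g; m \<in> carrier M\<rbrakk> \<Longrightarrow> lin V (tp M N) (\<lambda>x. p M N m (g x))"
  by (rule bilinear_comps[OF p_bil]; assumption)+

lemma p_smult:
  "\<lbrakk>obj M; obj N; c \<in> carrier K; m \<in> carrier M; n \<in> carrier N\<rbrakk> \<Longrightarrow> p M N (c \<odot>\<^bsub>M\<^esub> m) n = c \<odot>\<^bsub>tp M N\<^esub> p M N m n"
  "\<lbrakk>obj M; obj N; c \<in> carrier K; m \<in> carrier M; n \<in> carrier N\<rbrakk> \<Longrightarrow> p M N m (c \<odot>\<^bsub>N\<^esub> n) = c \<odot>\<^bsub>tp M N\<^esub> p M N m n"
  by (rule bilinear_smult[OF p_bil]; assumption)+

lemma tp_ext:
  fixes W :: "('k, 'u, 'x) module_scheme"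
  assumes [simp]: "obj M" "obj N" "module K W" and f: "lin (tp M N) W f" and g: "lin (tp M N) W g"
    and fg: "\<And>m n. m \<in> carrier M \<Longrightarrow> n \<in> carrier N \<Longrightarrow> f (p M N m n) = g (p M N m n)"
    and x: "x \<in> carrier (tp M N)"
  shows "f x = g x"
proof -
  have "f x = ST W M N x (\<lambda>m n. f (p M N m n))"
    using map_ST[OF f, where F="p M N" and M=M and N=N and x=x] x by (simp add: ST_rep)
  also have "\<dots> = ST W M N x (\<lambda>m n. g (p M N m n))"
    by (simp add: fg)
  also have "\<dots> = g x"
    using map_ST[OF g, where F="p M N" and M=M and N=N and x=x] x by (simp add: ST_rep)
  finally show ?thesis .
qed

text \<open>Each axiom is an equation between linear maps in the module element, so
  \<open>tp_ext\<close> reduces it to generators. There the left action concerns the first factor,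
  the right action the second, and the coactions multiply the legs of both.\<close>

lemma obj_tp [simp]:
  assumes [simp]: "obj M" "obj N"
  shows "obj (tp M N)"
proof -
  let ?V = "tp M N"
  have cl [simp]: "\<lbrakk>h \<in> carrier I; x \<in> carrier ?V\<rbrakk> \<Longrightarrow> la ?V h x \<in> carrier ?V"
    "\<lbrakk>h \<in> carrier I; x \<in> carrier ?V\<rbrakk> \<Longrightarrow> ra ?V x h \<in> carrier ?V"
    "x \<in> carrier ?V \<Longrightarrow> tw ?V t x \<in> carrier ?V" for h x t
    using bilinear_mapsD(3)[OF la_tp_bil] bilinear_mapsD(3)[OF ra_tp_bil] linear_mapsD(1)[OF tw_tp_lin]
    by simp_all
  have [simp]:
    "\<lbrakk>h \<in> carrier I; lin V ?V g\<rbrakk> \<Longrightarrow> lin V ?V (\<lambda>x. la ?V h (g x))"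
    "\<lbrakk>m \<in> carrier ?V; lin V I g\<rbrakk> \<Longrightarrow> lin V ?V (\<lambda>x. la ?V (g x) m)"
    "\<lbrakk>h \<in> carrier I; lin V ?V g\<rbrakk> \<Longrightarrow> lin V ?V (\<lambda>x. ra ?V (g x) h)"
    "\<lbrakk>m \<in> carrier ?V; lin V I g\<rbrakk> \<Longrightarrow> lin V ?V (\<lambda>x. ra ?V m (g x))"
    "lin V ?V g \<Longrightarrow> lin V ?V (\<lambda>x. tw ?V t (g x))" for V :: "('k, 'u, 'x) module_scheme" and h m t g
    by (rule bilinear_comps[OF la_tp_bil] bilinear_comps[OF ra_tp_bil] linear_comp[OF tw_tp_lin]; simp)+
  have [simp]: "\<lbrakk>module K W; lin V ?V g; bil I ?V W F\<rbrakk> \<Longrightarrow> lin V W (\<lambda>x. SL W ?V (g x) F)"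
    "\<lbrakk>module K W; lin V ?V g; bil ?V I W G\<rbrakk> \<Longrightarrow> lin V W (\<lambda>x. SR W ?V (g x) G)"
    for V W :: "('k, 'u, 'x) module_scheme" and g F G
    by (rule linear_comp[OF SL_tp_lin] linear_comp[OF SR_tp_lin]; simp)+
  have [simp]: "module K V \<Longrightarrow> c \<in> carrier K \<Longrightarrow> x \<in> carrier V \<Longrightarrow> c \<odot>\<^bsub>V\<^esub> x \<in> carrier V"
    for V :: "('k, 'u, 'x) module_scheme" and c x by (rule module.smult_closed)
  note ext = tp_ext[OF assms]
  show ?thesis
  proof (intro hopf_bimodule.intro hopf_bimodule_axioms.intro)
    show "bimodule_data I lc rc" by unfold_locales
    show "adm ?V" by (simp add: tp_admissible)
    show "module K ?V" by simp
    show "bil I ?V ?V (la ?V)" "bil ?V I ?V (ra ?V)" by (simp_all add: la_tp_bil ra_tp_bil)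
    fix t show "lin ?V ?V (tw ?V t)" by (simp add: tw_tp_lin)
  next
    fix W :: "('k, 'u, 'x) module_scheme" and F assume "module K W" "bil I ?V W F"
    then show "lin ?V W (\<lambda>m. SL W ?V m F)" by simp
  next
    fix W :: "('k, 'u, 'x) module_scheme" and F assume "module K W" "bil ?V I W F"
    then show "lin ?V W (\<lambda>m. SR W ?V m F)" by simp
  next
    fix h x t assume [simp]: "h \<in> carrier I" and x: "x \<in> carrier ?V"
    show "tw ?V t (la ?V h x) = la ?V (tw I t h) (tw ?V t x)"
      by (rule ext[where W="?V", OF _ _ _ _ x]) (simp_all add: la_p tw_p tw_la)
    show "tw ?V t (ra ?V x h) = ra ?V (tw ?V t x) (tw I t h)"
      by (rule ext[where W="?V", OF _ _ _ _ x]) (simp_all add: ra_p tw_p tw_ra)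
  next
    fix W :: "('k, 'u, 'x) module_scheme" and F x t
    assume W [simp]: "module K W" and F [simp]: "bil I ?V W F" and x: "x \<in> carrier ?V"
    note [simp] = bilinear_comps[OF F] bilinear_mapsD[OF F]
    show "SL W ?V (tw ?V t x) F = SL W ?V x (\<lambda>a b. F (tw I t a) (tw ?V t b))"
      by (rule ext[where W="W", OF _ _ _ _ x]) (simp_all add: tw_p SL_p SL_tw tw_mul)
    fix h assume [simp]: "h \<in> carrier I"
    show "SL W ?V (la ?V h x) F = SL W I h (\<lambda>a b. SL W ?V x (\<lambda>g x. F (mul a g) (la ?V b x)))"
      by (rule ext[where W="W", OF _ _ _ _ x]) (simp_all add: la_p SL_p SL_la mul_assoc)
    \<comment> \<open>The right action sits on the second factor, so the sum over h first appears
      inside the sum over m and has to be moved out.\<close>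
    show "SL W ?V (ra ?V x h) F = SL W I h (\<lambda>a b. SL W ?V x (\<lambda>g x. F (mul g a) (ra ?V x b)))"
    proof (rule ext[where W="W", OF _ _ _ _ x])
      fix m n assume [simp]: "m \<in> carrier M" "n \<in> carrier N"
      have "SL W ?V (ra ?V (p M N m n) h) F = SL W M m (\<lambda>g x. SL W I h (\<lambda>a b. SL W N n (\<lambda>k y. F (mul g (mul k a)) (p M N x (ra N y b)))))"
        by (simp add: ra_p SL_p SL_ra)
      also have "\<dots> = SL W I h (\<lambda>a b. SL W M m (\<lambda>g x. SL W N n (\<lambda>k y. F (mul g (mul k a)) (p M N x (ra N y b)))))"
        by (rule SL_SL_commute; simp)
      also have "\<dots> = SL W I h (\<lambda>a b. SL W ?V (p M N m n) (\<lambda>g x. F (mul g a) (ra ?V x b)))"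
        by (simp add: ra_p SL_p mul_assoc)
      finally show "SL W ?V (ra ?V (p M N m n) h) F = SL W I h (\<lambda>a b. SL W ?V (p M N m n) (\<lambda>g x. F (mul g a) (ra ?V x b)))" .
    qed simp_all
  next
    fix W :: "('k, 'u, 'x) module_scheme" and F x t
    assume W [simp]: "module K W" and F [simp]: "bil ?V I W F" and x: "x \<in> carrier ?V"
    note [simp] = bilinear_comps[OF F] bilinear_mapsD[OF F]
    show "SR W ?V (tw ?V t x) F = SR W ?V x (\<lambda>a b. F (tw ?V t a) (tw I t b))"
      by (rule ext[where W="W", OF _ _ _ _ x]) (simp_all add: tw_p SR_p SR_tw tw_mul)
    fix h assume [simp]: "h \<in> carrier I"
    show "SR W ?V (la ?V h x) F = SL W I h (\<lambda>a b. SR W ?V x (\<lambda>x g. F (la ?V a x) (mul b g)))"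
      by (rule ext[where W="W", OF _ _ _ _ x]) (simp_all add: la_p SR_p SR_la mul_assoc)
    show "SR W ?V (ra ?V x h) F = SL W I h (\<lambda>a b. SR W ?V x (\<lambda>x g. F (ra ?V x a) (mul g b)))"
    proof (rule ext[where W="W", OF _ _ _ _ x])
      fix m n assume [simp]: "m \<in> carrier M" "n \<in> carrier N"
      have "SR W ?V (ra ?V (p M N m n) h) F = SR W M m (\<lambda>x g. SL W I h (\<lambda>a b. SR W N n (\<lambda>y k. F (p M N x (ra N y a)) (mul g (mul k b)))))"
        by (simp add: ra_p SR_p SR_ra)
      also have "\<dots> = SL W I h (\<lambda>a b. SR W M m (\<lambda>x g. SR W N n (\<lambda>y k. F (p M N x (ra N y a)) (mul g (mul k b)))))"
        by (rule SL_SR_commute[symmetric]; simp)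
      also have "\<dots> = SL W I h (\<lambda>a b. SR W ?V (p M N m n) (\<lambda>x g. F (ra ?V x a) (mul g b)))"
        by (simp add: ra_p SR_p mul_assoc)
      finally show "SR W ?V (ra ?V (p M N m n) h) F = SL W I h (\<lambda>a b. SR W ?V (p M N m n) (\<lambda>x g. F (ra ?V x a) (mul g b)))" .
    qed simp_all
  next
    fix a b x assume [simp]: "a \<in> carrier I" "b \<in> carrier I" and x: "x \<in> carrier ?V"
    show "la ?V a (la ?V b x) = la ?V (mul a b) x"
      by (rule ext[where W="?V", OF _ _ _ _ x]) (simp_all add: la_p la_la)
    show "ra ?V (ra ?V x a) b = ra ?V x (mul a b)"
      by (rule ext[where W="?V", OF _ _ _ _ x]) (simp_all add: ra_p ra_ra)
    show "la ?V a (ra ?V x b) = ra ?V (la ?V a x) b"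
      by (rule ext[where W="?V", OF _ _ _ _ x]) (simp_all add: ra_p la_p)
  next
    fix x assume x: "x \<in> carrier ?V"
    show "la ?V e x = x"
      by (rule ext[where W="?V", OF _ _ _ _ x]) (simp_all add: la_p la_one)
    show "ra ?V x e = x"
      by (rule ext[where W="?V", OF _ _ _ _ x]) (simp_all add: ra_p ra_one)
    have eps2: "eps (mul g h) \<odot>\<^bsub>?V\<^esub> z = eps g \<odot>\<^bsub>?V\<^esub> (eps h \<odot>\<^bsub>?V\<^esub> z)"
      if "g \<in> carrier I" "h \<in> carrier I" "z \<in> carrier ?V" for g h z
      using that module.smult_assoc1[of K ?V] by (simp add: eps_mul)
    show "SL ?V ?V x (\<lambda>h y. eps h \<odot>\<^bsub>?V\<^esub> y) = x"
      by (rule ext[where W="?V", OF _ _ _ _ x]) (simp_all add: SL_p eps2 SL_smult SL_counit')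
    show "SR ?V ?V x (\<lambda>y h. eps h \<odot>\<^bsub>?V\<^esub> y) = x"
      by (rule ext[where W="?V", OF _ _ _ _ x]) (simp_all add: SR_p eps2 SR_smult SR_counit')
  next
    fix W :: "('k, 'u, 'x) module_scheme" and F x
    assume W [simp]: "module K W" and F: "tri I I ?V W F" and x: "x \<in> carrier ?V"
    note [simp] = F trilinear_comp[OF F] trilinearD[OF F]
    show "SL W ?V x (\<lambda>a x. SL W ?V x (\<lambda>b y. F a b y)) = SL W ?V x (\<lambda>h y. SL W I h (\<lambda>a b. F a b y))"
    proof (rule ext[where W="W", OF _ _ _ _ x])
      fix m n assume [simp]: "m \<in> carrier M" "n \<in> carrier N"
      \<comment> \<open>g, k, x are the legs of m and h, l, y those of n. Separating the two
        families lets coassociativity be applied in N and in M independently.\<close>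
      let ?G = "\<lambda>g k x h l y. F (mul g h) (mul k l) (p M N x y)"
      have "SL W ?V (p M N m n) (\<lambda>a x. SL W ?V x (\<lambda>b y. F a b y))
        = SL W M m (\<lambda>g r. SL W N n (\<lambda>h s. SL W M r (\<lambda>k x. SL W N s (\<lambda>l y. ?G g k x h l y))))"
        by (simp add: SL_p)
      also have "\<dots> = SL W M m (\<lambda>g r. SL W M r (\<lambda>k x. SL W N n (\<lambda>h s. SL W N s (\<lambda>l y. ?G g k x h l y))))"
        by (rule SL_cong[OF HOL.refl], rule SL_SL_commute; simp)
      also have "\<dots> = SL W M m (\<lambda>g r. SL W M r (\<lambda>k x. SL W N n (\<lambda>h y. SL W I h (\<lambda>h l. ?G g k x h l y))))"
        by (rule SL_cong[OF HOL.refl], rule SL_cong[OF HOL.refl], rule SL_coassoc; simp)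
      also have "\<dots> = SL W M m (\<lambda>g x. SL W I g (\<lambda>g k. SL W N n (\<lambda>h y. SL W I h (\<lambda>h l. ?G g k x h l y))))"
        by (rule SL_coassoc; simp)
      also have "\<dots> = SL W M m (\<lambda>g x. SL W N n (\<lambda>h y. SL W I g (\<lambda>g k. SL W I h (\<lambda>h l. ?G g k x h l y))))"
        by (rule SL_cong[OF HOL.refl], rule SL_SL_commute; simp)
      also have "\<dots> = SL W ?V (p M N m n) (\<lambda>h y. SL W I h (\<lambda>a b. F a b y))"
        by (simp add: SL_p comult_mul)
      finally show "SL W ?V (p M N m n) (\<lambda>a x. SL W ?V x (\<lambda>b y. F a b y))
        = SL W ?V (p M N m n) (\<lambda>h y. SL W I h (\<lambda>a b. F a b y))" .
    qed simp_all
  next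
    fix W :: "('k, 'u, 'x) module_scheme" and F x
    assume W [simp]: "module K W" and F: "tri ?V I I W F" and x: "x \<in> carrier ?V"
    note [simp] = F trilinear_comp[OF F] trilinearD[OF F]
    show "SR W ?V x (\<lambda>x b. SR W ?V x (\<lambda>y a. F y a b)) = SR W ?V x (\<lambda>y h. SL W I h (\<lambda>a b. F y a b))"
    proof (rule ext[where W="W", OF _ _ _ _ x])
      fix m n assume [simp]: "m \<in> carrier M" "n \<in> carrier N"
      let ?G = "\<lambda>g k x h l y. F (p M N x y) (mul g h) (mul k l)"
      have "SR W ?V (p M N m n) (\<lambda>x b. SR W ?V x (\<lambda>y a. F y a b))
        = SR W M m (\<lambda>r k. SR W N n (\<lambda>s l. SR W M r (\<lambda>x g. SR W N s (\<lambda>y h. ?G g k x h l y))))"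
        by (simp add: SR_p)
      also have "\<dots> = SR W M m (\<lambda>r k. SR W M r (\<lambda>x g. SR W N n (\<lambda>s l. SR W N s (\<lambda>y h. ?G g k x h l y))))"
        by (rule SR_cong[OF HOL.refl], rule SR_SR_commute; simp)
      also have "\<dots> = SR W M m (\<lambda>r k. SR W M r (\<lambda>x g. SR W N n (\<lambda>y h. SL W I h (\<lambda>h l. ?G g k x h l y))))"
        by (rule SR_cong[OF HOL.refl], rule SR_cong[OF HOL.refl], rule SR_coassoc; simp)
      also have "\<dots> = SR W M m (\<lambda>x g. SL W I g (\<lambda>g k. SR W N n (\<lambda>y h. SL W I h (\<lambda>h l. ?G g k x h l y))))"
        by (rule SR_coassoc; simp)
      also have "\<dots> = SR W M m (\<lambda>x g. SR W N n (\<lambda>y h. SL W I g (\<lambda>g k. SL W I h (\<lambda>h l. ?G g k x h l y))))"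
        by (rule SR_cong[OF HOL.refl], rule SL_SR_commute; simp)
      also have "\<dots> = SR W ?V (p M N m n) (\<lambda>y h. SL W I h (\<lambda>a b. F y a b))"
        by (simp add: SR_p comult_mul)
      finally show "SR W ?V (p M N m n) (\<lambda>x b. SR W ?V x (\<lambda>y a. F y a b))
        = SR W ?V (p M N m n) (\<lambda>y h. SL W I h (\<lambda>a b. F y a b))" .
    qed simp_all
  next
    fix W :: "('k, 'u, 'x) module_scheme" and F x
    assume W [simp]: "module K W" and F: "tri I ?V I W F" and x: "x \<in> carrier ?V"
    note [simp] = F trilinear_comp[OF F] trilinearD[OF F]
    show "SL W ?V x (\<lambda>a x. SR W ?V x (\<lambda>y b. F a y b)) = SR W ?V x (\<lambda>x b. SL W ?V x (\<lambda>a y. F a y b))"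
    proof (rule ext[where W="W", OF _ _ _ _ x])
      fix m n assume [simp]: "m \<in> carrier M" "n \<in> carrier N"
      let ?G = "\<lambda>g k x h l y. F (mul g h) (p M N x y) (mul k l)"
      have "SL W ?V (p M N m n) (\<lambda>a x. SR W ?V x (\<lambda>y b. F a y b))
        = SL W M m (\<lambda>g r. SL W N n (\<lambda>h s. SR W M r (\<lambda>x k. SR W N s (\<lambda>y l. ?G g k x h l y))))"
        by (simp add: SL_p SR_p)
      also have "\<dots> = SL W M m (\<lambda>g r. SR W M r (\<lambda>x k. SL W N n (\<lambda>h s. SR W N s (\<lambda>y l. ?G g k x h l y))))"
        by (rule SL_cong[OF HOL.refl], rule SL_SR_commute; simp)
      also have "\<dots> = SL W M m (\<lambda>g r. SR W M r (\<lambda>x k. SR W N n (\<lambda>s l. SL W N s (\<lambda>h y. ?G g k x h l y))))"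
        by (rule SL_cong[OF HOL.refl], rule SR_cong[OF HOL.refl], rule SL_SR; simp)
      also have "\<dots> = SR W M m (\<lambda>r k. SL W M r (\<lambda>g x. SR W N n (\<lambda>s l. SL W N s (\<lambda>h y. ?G g k x h l y))))"
        by (rule SL_SR; simp)
      also have "\<dots> = SR W M m (\<lambda>r k. SR W N n (\<lambda>s l. SL W M r (\<lambda>g x. SL W N s (\<lambda>h y. ?G g k x h l y))))"
        by (rule SR_cong[OF HOL.refl], rule SL_SR_commute; simp)
      also have "\<dots> = SR W ?V (p M N m n) (\<lambda>x b. SL W ?V x (\<lambda>a y. F a y b))"
        by (simp add: SL_p SR_p)
      finally show "SL W ?V (p M N m n) (\<lambda>a x. SR W ?V x (\<lambda>y b. F a y b))
        = SR W ?V (p M N m n) (\<lambda>x b. SL W ?V x (\<lambda>a y. F a y b))" .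
    qed simp_all
  qed
qed

end

section \<open>The braided monoidal structure\<close>

context hopf_tensor
begin

lemma lin_ST_arg [simp]:
  "\<lbrakk>obj M; obj N; module K (W :: ('k, 'u, 'x) module_scheme); lin V (tp M N) g; bil M N W F; balanced M N F\<rbrakk>
    \<Longrightarrow> lin V W (\<lambda>x. ST W M N (g x) F)"
  by (rule linear_comp[OF ST_lin])

text \<open>Spanning, expressed through its effect on linear maps. This lets one criterion for
  morphisms serve tensor products of two and of three factors.\<close>

definition generates where
  "generates M E \<longleftrightarrow> E \<subseteq> carrier M \<and> (\<forall>(W :: ('k, 'u, 'x) module_scheme) f g x. module K W \<longrightarrow> lin M W f \<longrightarrow> lin M W g
     \<longrightarrow> (\<forall>y\<in>E. f y = g y) \<longrightarrow> x \<in> carrier M \<longrightarrow> f x = g x)"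

lemma generates_tp: "\<lbrakk>obj M; obj N\<rbrakk> \<Longrightarrow> generates (tp M N) {p M N m n | m n. m \<in> carrier M \<and> n \<in> carrier N}"
  unfolding generates_def using tp_ext[of M N] by auto blast

lemma generatesD:
  assumes "generates M E" "module K (W :: ('k, 'u, 'x) module_scheme)" "lin M W f" "lin M W g"
    "\<And>y. y \<in> E \<Longrightarrow> f y = g y" "x \<in> carrier M"
  shows "f x = g x"
  using assms unfolding generates_def by blast

lemma tp_ext_left:
  fixes W :: "('k, 'u, 'x) module_scheme"
  assumes [simp]: "obj M" "obj N" "obj R" "module K W"
    and f: "lin (tp (tp M N) R) W f" and g: "lin (tp (tp M N) R) W g"
    and fg: "\<And>m n q. \<lbrakk>m \<in> carrier M; n \<in> carrier N; q \<in> carrier R\<rbrakk>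
      \<Longrightarrow> f (p (tp M N) R (p M N m n) q) = g (p (tp M N) R (p M N m n) q)"
    and x: "x \<in> carrier (tp (tp M N) R)"
  shows "f x = g x"
proof (rule tp_ext[OF _ _ _ f g _ x])
  fix y q assume y: "y \<in> carrier (tp M N)" and [simp]: "q \<in> carrier R"
  show "f (p (tp M N) R y q) = g (p (tp M N) R y q)"
    by (rule tp_ext[OF _ _ _ _ _ _ y, where W=W]) (simp_all add: fg linear_comp[OF f] linear_comp[OF g])
qed simp_all

lemma tp_ext_right:
  fixes W :: "('k, 'u, 'x) module_scheme"
  assumes [simp]: "obj M" "obj N" "obj R" "module K W"
    and f: "lin (tp M (tp N R)) W f" and g: "lin (tp M (tp N R)) W g"
    and fg: "\<And>m n q. \<lbrakk>m \<in> carrier M; n \<in> carrier N; q \<in> carrier R\<rbrakk>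
      \<Longrightarrow> f (p M (tp N R) m (p N R n q)) = g (p M (tp N R) m (p N R n q))"
    and x: "x \<in> carrier (tp M (tp N R))"
  shows "f x = g x"
proof (rule tp_ext[OF _ _ _ f g _ x])
  fix m y assume [simp]: "m \<in> carrier M" and y: "y \<in> carrier (tp N R)"
  show "f (p M (tp N R) m y) = g (p M (tp N R) m y)"
    by (rule tp_ext[OF _ _ _ _ _ _ y, where W=W]) (simp_all add: fg linear_comp[OF f] linear_comp[OF g])
qed simp_all

lemma generates_tp_left:
  assumes [simp]: "obj M" "obj N" "obj R"
  shows "generates (tp (tp M N) R)
    {p (tp M N) R (p M N m n) q | m n q. m \<in> carrier M \<and> n \<in> carrier N \<and> q \<in> carrier R}"
  unfolding generates_def using tp_ext_left[OF assms] by auto blast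

definition hom where
  "hom M N f \<longleftrightarrow> lin M N f \<and>
     (\<forall>h\<in>carrier I. \<forall>m\<in>carrier M. f (la M h m) = la N h (f m) \<and> f (ra M m h) = ra N (f m) h) \<and>
     (\<forall>t. \<forall>m\<in>carrier M. f (tw M t m) = tw N t (f m)) \<and>
     (\<forall>(W :: ('k, 'u, 'x) module_scheme) F. module K W \<longrightarrow> bil I N W F \<longrightarrow>
        (\<forall>m\<in>carrier M. SL W N (f m) F = SL W M m (\<lambda>h x. F h (f x)))) \<and>
     (\<forall>(W :: ('k, 'u, 'x) module_scheme) F. module K W \<longrightarrow> bil N I W F \<longrightarrow>
        (\<forall>m\<in>carrier M. SR W N (f m) F = SR W M m (\<lambda>x h. F (f x) h)))"

lemma homD:
  assumes "hom M N f"
  shows "lin M N f"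
    and "\<lbrakk>h \<in> carrier I; m \<in> carrier M\<rbrakk> \<Longrightarrow> f (la M h m) = la N h (f m)"
    and "\<lbrakk>h \<in> carrier I; m \<in> carrier M\<rbrakk> \<Longrightarrow> f (ra M m h) = ra N (f m) h"
    and "m \<in> carrier M \<Longrightarrow> f (tw M t m) = tw N t (f m)"
    and "\<lbrakk>module K (W :: ('k, 'u, 'x) module_scheme); bil I N W F; m \<in> carrier M\<rbrakk>
      \<Longrightarrow> SL W N (f m) F = SL W M m (\<lambda>h x. F h (f x))"
    and "\<lbrakk>module K (W :: ('k, 'u, 'x) module_scheme); bil N I W F; m \<in> carrier M\<rbrakk>
      \<Longrightarrow> SR W N (f m) F = SR W M m (\<lambda>x h. F (f x) h)"
    and "m \<in> carrier M \<Longrightarrow> f m \<in> carrier N"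
    and "lin V M g \<Longrightarrow> lin V N (\<lambda>x. f (g x))"
  using assms unfolding hom_def by (auto intro: linear_mapsD(1) linear_comp)

text \<open>All conditions on a morphism are linear in the module element, the colinearity
  conditions after evaluation on a test map, so a generating set suffices.\<close>

lemma hom_genI:
  assumes [simp]: "obj M" "obj N" and gen: "generates M E" and f: "lin M N f"
    and la: "\<And>h m. \<lbrakk>h \<in> carrier I; m \<in> E\<rbrakk> \<Longrightarrow> f (la M h m) = la N h (f m)"
    and ra: "\<And>h m. \<lbrakk>h \<in> carrier I; m \<in> E\<rbrakk> \<Longrightarrow> f (ra M m h) = ra N (f m) h"
    and tw: "\<And>t m. m \<in> E \<Longrightarrow> f (tw M t m) = tw N t (f m)"
    and SL: "\<And>(W :: ('k, 'u, 'x) module_scheme) F m. \<lbrakk>module K W; bil I N W F; m \<in> E\<rbrakk>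
      \<Longrightarrow> SL W N (f m) F = SL W M m (\<lambda>h x. F h (f x))"
    and SR: "\<And>(W :: ('k, 'u, 'x) module_scheme) F m. \<lbrakk>module K W; bil N I W F; m \<in> E\<rbrakk>
      \<Longrightarrow> SR W N (f m) F = SR W M m (\<lambda>x h. F (f x) h)"
  shows "hom M N f"
  unfolding hom_def
proof (intro conjI ballI allI impI)
  note [simp] = linear_comp[OF f] linear_mapsD(1)[OF f] f
  show "lin M N f" by (fact f)
  fix m assume m: "m \<in> carrier M"
  fix t show "f (tw M t m) = tw N t (f m)"
    by (rule generatesD[where W=N, OF gen _ _ _ tw m]) simp_all
  fix h assume h [simp]: "h \<in> carrier I"
  show "f (la M h m) = la N h (f m)"
    by (rule generatesD[where W=N, OF gen _ _ _ la[OF h] m]) simp_all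
  show "f (ra M m h) = ra N (f m) h"
    by (rule generatesD[where W=N, OF gen _ _ _ ra[OF h] m]) simp_all
next
  note [simp] = linear_comp[OF f] linear_mapsD(1)[OF f] f
  fix W :: "('k, 'u, 'x) module_scheme" and F m
  assume W [simp]: "module K W" and m: "m \<in> carrier M"
  {
    assume F: "bil I N W F"
    note [simp] = F bilinear_comps[OF F]
    show "SL W N (f m) F = SL W M m (\<lambda>h x. F h (f x))"
      by (rule generatesD[where W=W, OF gen _ _ _ SL[OF W F] m]) simp_all
  }
  {
    assume F: "bil N I W F"
    note [simp] = F bilinear_comps[OF F]
    show "SR W N (f m) F = SR W M m (\<lambda>x h. F (f x) h)"
      by (rule generatesD[where W=W, OF gen _ _ _ SR[OF W F] m]) simp_all
  }
qed

lemmas hom_tpI = hom_genI[OF _ _ generates_tp]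
lemmas hom_tp_leftI = hom_genI[OF _ _ generates_tp_left]

lemma hom_id: "hom M M (\<lambda>x. x)"
  by (simp add: hom_def)

lemma hom_comp:
  assumes f: "hom M N f" and g: "hom N R g"
  shows "hom M R (\<lambda>x. g (f x))"
  unfolding hom_def
  by (auto simp: homD[OF f] homD[OF g] bilinear_comp[OF _ linear_id homD(1)[OF g]] bilinear_comp[OF _ homD(1)[OF g] linear_id])

lemma hom_cong:
  assumes "obj M" "hom M N f" and fg: "\<And>x. x \<in> carrier M \<Longrightarrow> g x = f x"
  shows "hom M N g"
proof -
  have "lin M N g"
    using linear_cong[OF modM[OF assms(1)], where f=g and g=f and W=N] fg homD(1)[OF assms(2)] by simp
  then show ?thesis
    using assms(1) unfolding hom_def by (simp add: fg homD[OF assms(2)])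
qed

lemma hom_inverse:
  assumes [simp]: "obj M" "obj N" and f: "hom M N f"
    and g: "\<And>y. y \<in> carrier N \<Longrightarrow> g y \<in> carrier M"
    and gf: "\<And>x. x \<in> carrier M \<Longrightarrow> g (f x) = x" and fg: "\<And>y. y \<in> carrier N \<Longrightarrow> f (g y) = y"
  shows "hom N M g"
proof -
  have lg: "lin N M g" by (rule linear_inverse[OF _ _ homD(1)[OF f] g gf fg]) simp_all
  show ?thesis
    unfolding hom_def
  proof (intro conjI ballI allI impI lg)
    fix y assume y: "y \<in> carrier N"
    fix h assume h: "h \<in> carrier I"
    show "g (la N h y) = la M h (g y)"
      using homD(2)[OF f h g[OF y]] gf[of "la M h (g y)"] h y g fg by simp
    show "g (ra N y h) = ra M (g y) h"
      using homD(3)[OF f h g[OF y]] gf[of "ra M (g y) h"] h y g fg by simp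
  next
    fix y t assume y: "y \<in> carrier N"
    show "g (tw N t y) = tw M t (g y)"
      using homD(4)[OF f g[OF y], of t] gf[of "tw M t (g y)"] y g fg by simp
  next
    fix W :: "('k, 'u, 'x) module_scheme" and F y assume "module K W" "bil I M W F" "y \<in> carrier N"
    then show "SL W M (g y) F = SL W N y (\<lambda>h x. F h (g x))"
      using homD(5)[OF f, of W "\<lambda>h x. F h (g x)" "g y"] by (simp add: g gf fg bilinear_comp[OF _ linear_id lg])
  next
    fix W :: "('k, 'u, 'x) module_scheme" and F y assume "module K W" "bil M I W F" "y \<in> carrier N"
    then show "SR W M (g y) F = SR W N y (\<lambda>x h. F (g x) h)"
      using homD(6)[OF f, of W "\<lambda>x h. F (g x) h" "g y"] by (simp add: g gf fg bilinear_comp[OF _ lg linear_id])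
  qed
qed

subsection \<open>Tensor products of morphisms and the coherence maps\<close>

definition tmap where "tmap M N M' N' f g x = ST (tp M' N') M N x (\<lambda>m n. p M' N' (f m) (g n))"

lemma tmap_hom:
  assumes [simp]: "obj M" "obj N" "obj M'" "obj N'" and f: "hom M M' f" and g: "hom N N' g"
  shows tmap_p: "\<lbrakk>m \<in> carrier M; n \<in> carrier N\<rbrakk> \<Longrightarrow> tmap M N M' N' f g (p M N m n) = p M' N' (f m) (g n)"
    and "hom (tp M N) (tp M' N') (tmap M N M' N' f g)"
proof -
  note [simp] = homD[OF f] homD[OF g]
  have bal: "balanced M N (\<lambda>m n. p M' N' (f m) (g n))" by (simp add: p_bal)
  show p: "\<lbrakk>m \<in> carrier M; n \<in> carrier N\<rbrakk> \<Longrightarrow> tmap M N M' N' f g (p M N m n) = p M' N' (f m) (g n)" for m n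
    unfolding tmap_def by (rule ST_p[OF _ _ _ _ bal]) simp_all
  show "hom (tp M N) (tp M' N') (tmap M N M' N' f g)"
  proof (rule hom_tpI)
    show "lin (tp M N) (tp M' N') (tmap M N M' N' f g)"
      unfolding tmap_def by (rule ST_lin[OF _ _ _ _ bal]) simp_all
  next
    fix W :: "('k, 'u, 'x) module_scheme" and F x assume [simp]: "module K W" and F: "bil I (tp M' N') W F"
      and x: "x \<in> {p M N m n | m n. m \<in> carrier M \<and> n \<in> carrier N}"
    note [simp] = F bilinear_comps[OF F] bilinear_mapsD[OF F]
    have "bil I (tp M N) W (\<lambda>h x. F h (tmap M N M' N' f g x))"
      by (rule bilinear_comp[OF F linear_id]) (unfold tmap_def, rule ST_lin[OF _ _ _ _ bal], simp_all)
    then show "SL W (tp M' N') (tmap M N M' N' f g x) F = SL W (tp M N) x (\<lambda>h x. F h (tmap M N M' N' f g x))"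
      using x by (auto simp: p SL_p)
  next
    fix W :: "('k, 'u, 'x) module_scheme" and F x assume [simp]: "module K W" and F: "bil (tp M' N') I W F"
      and x: "x \<in> {p M N m n | m n. m \<in> carrier M \<and> n \<in> carrier N}"
    note [simp] = F bilinear_comps[OF F] bilinear_mapsD[OF F]
    have "bil (tp M N) I W (\<lambda>x h. F (tmap M N M' N' f g x) h)"
      by (rule bilinear_comp[OF F _ linear_id]) (unfold tmap_def, rule ST_lin[OF _ _ _ _ bal], simp_all)
    then show "SR W (tp M' N') (tmap M N M' N' f g x) F = SR W (tp M N) x (\<lambda>x h. F (tmap M N M' N' f g x) h)"
      using x by (auto simp: p SR_p)
  qed (auto simp: p la_p ra_p tw_p)
qed

definition asc where "asc M N R x = ST (tp M (tp N R)) (tp M N) R x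
  (\<lambda>y q. ST (tp M (tp N R)) M N y (\<lambda>m n. p M (tp N R) m (p N R n q)))"

definition asc_inv where "asc_inv M N R x = ST (tp (tp M N) R) M (tp N R) x
  (\<lambda>m y. ST (tp (tp M N) R) N R y (\<lambda>n q. p (tp M N) R (p M N m n) q))"

context
  fixes M N R assumes objs [simp]: "obj M" "obj N" "obj R"
begin

text \<open>Well-definedness in two stages: with the outer factor fixed the inner map is balanced,
  and balance of the outer map is then checked on generators of the inner tensor product.\<close>

lemma asc_balanced:
  shows "q \<in> carrier R \<Longrightarrow> balanced M N (\<lambda>m n. p M (tp N R) m (p N R n q))"
    and "m \<in> carrier M \<Longrightarrow> balanced N R (\<lambda>n q. p (tp M N) R (p M N m n) q)"
    and "balanced (tp M N) R (\<lambda>y q. ST (tp M (tp N R)) M N y (\<lambda>m n. p M (tp N R) m (p N R n q)))"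
    and "balanced M (tp N R) (\<lambda>m y. ST (tp (tp M N) R) N R y (\<lambda>n q. p (tp M N) R (p M N m n) q))"
proof -
  show 1 [simp]: "balanced M N (\<lambda>m n. p M (tp N R) m (p N R n q))" if "q \<in> carrier R" for q
    using that by (simp add: p_bal la_p)
  show 2 [simp]: "balanced N R (\<lambda>n q. p (tp M N) R (p M N m n) q)" if "m \<in> carrier M" for m
    using that by (simp add: p_bal[symmetric] ra_p)
  show "balanced (tp M N) R (\<lambda>y q. ST (tp M (tp N R)) M N y (\<lambda>m n. p M (tp N R) m (p N R n q)))"
  proof (rule balancedI)
    fix y h q assume y: "y \<in> carrier (tp M N)" and [simp]: "h \<in> carrier I" "q \<in> carrier R"
    show "ST (tp M (tp N R)) M N (ra (tp M N) y h) (\<lambda>m n. p M (tp N R) m (p N R n q))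
      = ST (tp M (tp N R)) M N y (\<lambda>m n. p M (tp N R) m (p N R n (la R h q)))"
      by (rule tp_ext[OF _ _ _ _ _ _ y, where W="tp M (tp N R)"]) (simp_all add: ra_p ST_p p_bal)
  qed
  show "balanced M (tp N R) (\<lambda>m y. ST (tp (tp M N) R) N R y (\<lambda>n q. p (tp M N) R (p M N m n) q))"
  proof (rule balancedI)
    fix m h y assume y: "y \<in> carrier (tp N R)" and [simp]: "h \<in> carrier I" "m \<in> carrier M"
    show "ST (tp (tp M N) R) N R y (\<lambda>n q. p (tp M N) R (p M N (ra M m h) n) q)
      = ST (tp (tp M N) R) N R (la (tp N R) h y) (\<lambda>n q. p (tp M N) R (p M N m n) q)"
      by (rule tp_ext[OF _ _ _ _ _ _ y, where W="tp (tp M N) R"]) (simp_all add: la_p ST_p, simp add: p_bal)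
  qed
qed

lemma asc_lin: "lin (tp (tp M N) R) (tp M (tp N R)) (asc M N R)"
  unfolding asc_def by (rule ST_lin) (simp_all add: asc_balanced del: balancedI)

lemma asc_inv_lin: "lin (tp M (tp N R)) (tp (tp M N) R) (asc_inv M N R)"
  unfolding asc_inv_def by (rule ST_lin) (simp_all add: asc_balanced del: balancedI)

lemma asc_p: "\<lbrakk>m \<in> carrier M; n \<in> carrier N; q \<in> carrier R\<rbrakk>
    \<Longrightarrow> asc M N R (p (tp M N) R (p M N m n) q) = p M (tp N R) m (p N R n q)"
  unfolding asc_def by (simp add: ST_p asc_balanced del: balancedI)

lemma asc_inv_p: "\<lbrakk>m \<in> carrier M; n \<in> carrier N; q \<in> carrier R\<rbrakk>
    \<Longrightarrow> asc_inv M N R (p M (tp N R) m (p N R n q)) = p (tp M N) R (p M N m n) q"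
  unfolding asc_inv_def by (simp add: ST_p asc_balanced del: balancedI)

lemma asc_hom: "hom (tp (tp M N) R) (tp M (tp N R)) (asc M N R)"
proof (rule hom_tp_leftI)
  note [simp] = asc_p linear_comp[OF asc_lin] linear_mapsD(1)[OF asc_lin] asc_lin
  fix W :: "('k, 'u, 'x) module_scheme" and F x assume [simp]: "module K W" and F: "bil I (tp M (tp N R)) W F"
    and x: "x \<in> {p (tp M N) R (p M N m n) q | m n q. m \<in> carrier M \<and> n \<in> carrier N \<and> q \<in> carrier R}"
  note [simp] = F bilinear_comps[OF F] bilinear_mapsD[OF F]
  show "SL W (tp M (tp N R)) (asc M N R x) F = SL W (tp (tp M N) R) x (\<lambda>h x. F h (asc M N R x))"
    using x by (auto simp: SL_p mul_assoc)
next
  note [simp] = asc_p linear_comp[OF asc_lin] linear_mapsD(1)[OF asc_lin] asc_lin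
  fix W :: "('k, 'u, 'x) module_scheme" and F x assume [simp]: "module K W" and F: "bil (tp M (tp N R)) I W F"
    and x: "x \<in> {p (tp M N) R (p M N m n) q | m n q. m \<in> carrier M \<and> n \<in> carrier N \<and> q \<in> carrier R}"
  note [simp] = F bilinear_comps[OF F] bilinear_mapsD[OF F]
  show "SR W (tp M (tp N R)) (asc M N R x) F = SR W (tp (tp M N) R) x (\<lambda>x h. F (asc M N R x) h)"
    using x by (auto simp: SR_p mul_assoc)
qed (auto simp: asc_p la_p ra_p tw_p asc_lin)

lemma asc_inverse:
  shows "x \<in> carrier (tp (tp M N) R) \<Longrightarrow> asc_inv M N R (asc M N R x) = x"
    and "y \<in> carrier (tp M (tp N R)) \<Longrightarrow> asc M N R (asc_inv M N R y) = y"
proof -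
  note [simp] = asc_p asc_inv_p linear_comp[OF asc_lin] linear_comp[OF asc_inv_lin] asc_lin asc_inv_lin
  show "x \<in> carrier (tp (tp M N) R) \<Longrightarrow> asc_inv M N R (asc M N R x) = x"
    by (rule tp_ext_left[OF objs, where W="tp (tp M N) R"]) simp_all
  show "y \<in> carrier (tp M (tp N R)) \<Longrightarrow> asc M N R (asc_inv M N R y) = y"
    by (rule tp_ext_right[OF objs, where W="tp M (tp N R)"]) simp_all
qed

lemma asc_inv_hom: "hom (tp M (tp N R)) (tp (tp M N) R) (asc_inv M N R)"
  by (rule hom_inverse[OF _ _ asc_hom]) (simp_all add: asc_inverse linear_mapsD(1)[OF asc_inv_lin])

end

definition lun where "lun M x = ST M I M x (\<lambda>h m. la M h m)"
definition run where "run M x = ST M M I x (\<lambda>m h. ra M m h)"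

context
  fixes M assumes M [simp]: "obj M"
begin

lemma unit_balanced: "balanced I M (\<lambda>h m. la M h m)" "balanced M I (\<lambda>m h. ra M m h)"
  by (simp_all add: la_la ra_ra la_I ra_I)

lemma lun_p: "\<lbrakk>h \<in> carrier I; m \<in> carrier M\<rbrakk> \<Longrightarrow> lun M (p I M h m) = la M h m"
  unfolding lun_def by (simp add: ST_p unit_balanced del: balancedI)

lemma run_p: "\<lbrakk>h \<in> carrier I; m \<in> carrier M\<rbrakk> \<Longrightarrow> run M (p M I m h) = ra M m h"
  unfolding run_def by (simp add: ST_p unit_balanced del: balancedI)

lemma unit_lin: "lin (tp I M) M (lun M)" "lin (tp M I) M (run M)"
  unfolding lun_def run_def by (simp_all add: ST_lin unit_balanced del: balancedI)

lemma lun_hom: "hom (tp I M) M (lun M)"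
proof (rule hom_tpI)
  note [simp] = lun_p linear_comp[OF unit_lin(1)] linear_mapsD(1)[OF unit_lin(1)] unit_lin
  fix W :: "('k, 'u, 'x) module_scheme" and F x assume [simp]: "module K W" and F: "bil I M W F"
    and x: "x \<in> {p I M h m | h m. h \<in> carrier I \<and> m \<in> carrier M}"
  note [simp] = F bilinear_comps[OF F] bilinear_mapsD[OF F]
  show "SL W M (lun M x) F = SL W (tp I M) x (\<lambda>h x. F h (lun M x))"
    using x by (auto simp: SL_p SL_la)
next
  note [simp] = lun_p linear_comp[OF unit_lin(1)] linear_mapsD(1)[OF unit_lin(1)] unit_lin
  fix W :: "('k, 'u, 'x) module_scheme" and F x assume [simp]: "module K W" and F: "bil M I W F"
    and x: "x \<in> {p I M h m | h m. h \<in> carrier I \<and> m \<in> carrier M}"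
  note [simp] = F bilinear_comps[OF F] bilinear_mapsD[OF F]
  show "SR W M (lun M x) F = SR W (tp I M) x (\<lambda>x h. F (lun M x) h)"
    using x by (auto simp: SR_p SR_la SR_I)
qed (auto simp: lun_p la_p ra_p tw_p unit_lin la_I la_la la_ra tw_la)

lemma run_hom: "hom (tp M I) M (run M)"
proof (rule hom_tpI)
  note [simp] = run_p linear_comp[OF unit_lin(2)] linear_mapsD(1)[OF unit_lin(2)] unit_lin
  fix W :: "('k, 'u, 'x) module_scheme" and F x assume [simp]: "module K W" and F: "bil I M W F"
    and x: "x \<in> {p M I m h | m h. m \<in> carrier M \<and> h \<in> carrier I}"
  note [simp] = F bilinear_comps[OF F] bilinear_mapsD[OF F]
  show "SL W M (run M x) F = SL W (tp M I) x (\<lambda>h x. F h (run M x))"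
    using x by (auto simp: SL_p SL_ra intro!: SL_SL_commute)
next
  note [simp] = run_p linear_comp[OF unit_lin(2)] linear_mapsD(1)[OF unit_lin(2)] unit_lin
  fix W :: "('k, 'u, 'x) module_scheme" and F x assume [simp]: "module K W" and F: "bil M I W F"
    and x: "x \<in> {p M I m h | m h. m \<in> carrier M \<and> h \<in> carrier I}"
  note [simp] = F bilinear_comps[OF F] bilinear_mapsD[OF F]
  show "SR W M (run M x) F = SR W (tp M I) x (\<lambda>x h. F (run M x) h)"
    using x by (auto simp: SR_p SR_ra SR_I intro!: SL_SR_commute)
qed (auto simp: run_p la_p ra_p tw_p unit_lin ra_I ra_ra la_ra tw_ra)

lemma lun_inverse:
  shows "x \<in> carrier (tp I M) \<Longrightarrow> p I M e (lun M x) = x" and "m \<in> carrier M \<Longrightarrow> lun M (p I M e m) = m"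
proof -
  show "m \<in> carrier M \<Longrightarrow> lun M (p I M e m) = m" by (simp add: lun_p la_one)
  note [simp] = lun_p linear_comp[OF unit_lin(1)] linear_mapsD(1)[OF unit_lin(1)] unit_lin
  \<comment> \<open>On generators h moves across the tensor sign: p e (h . m) = p (e h) m.\<close>
  show "x \<in> carrier (tp I M) \<Longrightarrow> p I M e (lun M x) = x"
    by (rule tp_ext[where W="tp I M" and M=I and N=M]) (simp_all add: p_bal[symmetric] ra_I)
qed

lemma run_inverse:
  shows "x \<in> carrier (tp M I) \<Longrightarrow> p M I (run M x) e = x" and "m \<in> carrier M \<Longrightarrow> run M (p M I m e) = m"
proof -
  show "m \<in> carrier M \<Longrightarrow> run M (p M I m e) = m" by (simp add: run_p ra_one)
  note [simp] = run_p linear_comp[OF unit_lin(2)] linear_mapsD(1)[OF unit_lin(2)] unit_lin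
  show "x \<in> carrier (tp M I) \<Longrightarrow> p M I (run M x) e = x"
    by (rule tp_ext[where W="tp M I" and M=M and N=I]) (simp_all add: p_bal la_I)
qed

end

section \<open>Functoriality, naturality and coherence of the ordinary constraints\<close>

lemma tmap_id: "\<lbrakk>obj M; obj N; x \<in> carrier (tp M N)\<rbrakk> \<Longrightarrow> tmap M N M N (\<lambda>x. x) (\<lambda>x. x) x = x"
  by (simp add: tmap_def ST_rep)

lemma tmap_comp:
  assumes objs [simp]: "obj M" "obj N" "obj M'" "obj N'" "obj M''" "obj N''"
    and h: "hom M M' f" "hom N N' g" "hom M' M'' f'" "hom N' N'' g'" and x: "x \<in> carrier (tp M N)"
  shows "tmap M N M'' N'' (\<lambda>x. f' (f x)) (\<lambda>x. g' (g x)) x = tmap M' N' M'' N'' f' g' (tmap M N M' N' f g x)"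
proof -
  note hc = hom_comp[OF h(1,3)] hom_comp[OF h(2,4)]
  note [simp] = homD(7,8)[OF h(1)] homD(7,8)[OF h(2)] homD(7,8)[OF h(3)] homD(7,8)[OF h(4)]
  show ?thesis
    by (rule tp_ext[where W="tp M'' N''", OF _ _ _ _ _ _ x])
      (simp_all add: tmap_p hc h homD(1)[OF tmap_hom(2)] homD(8)[OF tmap_hom(2)])
qed

lemma asc_natural:
  assumes objs [simp]: "obj M" "obj N" "obj R" "obj M'" "obj N'" "obj R'"
    and h: "hom M M' f" "hom N N' g" "hom R R' k" and x: "x \<in> carrier (tp (tp M N) R)"
  shows "asc M' N' R' (tmap (tp M N) R (tp M' N') R' (tmap M N M' N' f g) k x)
    = tmap M (tp N R) M' (tp N' R') f (tmap N R N' R' g k) (asc M N R x)"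
proof -
  note [simp] = homD(7)[OF h(1)] homD(7)[OF h(2)] homD(7)[OF h(3)]
  show ?thesis
    by (rule tp_ext_left[where W="tp M' (tp N' R')", OF _ _ _ _ _ _ _ x])
      (simp_all add: tmap_p tmap_hom h homD(1)[OF tmap_hom(2)] homD(8)[OF tmap_hom(2)]
        asc_p linear_comp[OF asc_lin] asc_lin)
qed

lemma lun_natural:
  assumes objs [simp]: "obj M" "obj M'" and f: "hom M M' f" and x: "x \<in> carrier (tp I M)"
  shows "lun M' (tmap I M I M' (\<lambda>x. x) f x) = f (lun M x)"
  by (rule tp_ext[where W=M', OF _ _ _ _ _ _ x])
    (simp_all add: tmap_p hom_id f homD[OF f] homD(1,8)[OF tmap_hom(2)] lun_p linear_comp[OF unit_lin(1)] unit_lin)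

lemma run_natural:
  assumes objs [simp]: "obj M" "obj M'" and f: "hom M M' f" and x: "x \<in> carrier (tp M I)"
  shows "run M' (tmap M I M' I f (\<lambda>x. x) x) = f (run M x)"
  by (rule tp_ext[where W=M', OF _ _ _ _ _ _ x])
    (simp_all add: tmap_p hom_id f homD[OF f] homD(1,8)[OF tmap_hom(2)] run_p linear_comp[OF unit_lin(2)] unit_lin)

lemma triangle_map:
  assumes objs [simp]: "obj M" "obj N" and x: "x \<in> carrier (tp (tp M I) N)"
  shows "tmap M (tp I N) M N (\<lambda>x. x) (lun N) (asc M I N x) = tmap (tp M I) N M N (run M) (\<lambda>x. x) x"
  by (rule tp_ext_left[where W="tp M N", OF _ _ _ _ _ _ _ x])
    (simp_all add: tmap_p hom_id lun_hom run_hom homD(1,8)[OF tmap_hom(2)] run_p lun_p asc_p asc_lin linear_comp[OF asc_lin] p_bal)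

lemma pentagon_map:
  assumes objs [simp]: "obj A" "obj B" "obj C" "obj D" and x: "x \<in> carrier (tp (tp (tp A B) C) D)"
  shows "tmap A (tp (tp B C) D) A (tp B (tp C D)) (\<lambda>x. x) (asc B C D)
      (asc A (tp B C) D (tmap (tp (tp A B) C) D (tp A (tp B C)) D (asc A B C) (\<lambda>x. x) x))
    = asc A B (tp C D) (asc (tp A B) C D x)" (is "?l x = ?r x")
proof (rule tp_ext_left[where W="tp A (tp B (tp C D))" and f="?l" and g="?r", OF _ _ _ _ _ _ _ x])
  have [simp]: "lin (tp (tp (tp A B) C) D) (tp A (tp B (tp C D))) ?l"
    by (simp add: hom_id asc_hom homD(1,8)[OF tmap_hom(2)] asc_lin linear_comp[OF asc_lin])
  have [simp]: "lin (tp (tp (tp A B) C) D) (tp A (tp B (tp C D))) ?r"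
    by (simp add: asc_lin linear_comp[OF asc_lin])
  show "lin (tp (tp (tp A B) C) D) (tp A (tp B (tp C D))) ?l" "lin (tp (tp (tp A B) C) D) (tp A (tp B (tp C D))) ?r"
    by simp_all
  \<comment> \<open>\<open>tp_ext_left\<close> splits only the two outer tensor products; the
    element y of \<open>tp A B\<close> still has to be resolved into generators.\<close>
  fix y c d assume y: "y \<in> carrier (tp A B)" and [simp]: "c \<in> carrier C" "d \<in> carrier D"
  show "?l (p (tp (tp A B) C) D (p (tp A B) C y c) d) = ?r (p (tp (tp A B) C) D (p (tp A B) C y c) d)"
    by (rule tp_ext[where W="tp A (tp B (tp C D))", OF _ _ _ _ _ _ y])
      (simp_all add: tmap_p hom_id asc_hom homD(1,8)[OF tmap_hom(2)] asc_p asc_lin linear_comp[OF asc_lin])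
qed simp_all

end

section \<open>The braiding\<close>

context hopf
begin

context
  fixes W M :: "('k, 'u, 'x) module_scheme" and m
  assumes W [simp]: "module K W" and M [simp]: "obj M" and m [simp]: "m \<in> carrier M"
begin

text \<open>The legs are r, d, a, b, with a and b bracketed as a coproduct. Coassociativity
  rebrackets them so that S(d) a belongs to an iterated coaction and \<open>coact_S_cancel\<close>
  applies. \<open>SL_S_cancel_left\<close> is the mirror image.\<close>

lemma SR_S_cancel_right:
  assumes F: "tri M I I W F"
  shows "SR W M m (\<lambda>y k. SR W M y (\<lambda>r d. SL W I k (\<lambda>a b. F r (mul (S d) a) b))) = SR W M m (\<lambda>r k. F r e k)"
proof -
  note [simp] = F trilinear_comp[OF F] trilinearD[OF F]
  have "SR W M m (\<lambda>y k. SR W M y (\<lambda>r d. SL W I k (\<lambda>a b. F r (mul (S d) a) b)))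
    = SR W M m (\<lambda>y k. SL W I k (\<lambda>a b. SR W M y (\<lambda>r d. F r (mul (S d) a) b)))"
    by (rule SR_cong[OF HOL.refl], rule SL_SR_commute[symmetric]; simp)
  also have "\<dots> = SR W M m (\<lambda>x b. SR W M x (\<lambda>y a. SR W M y (\<lambda>r d. F r (mul (S d) a) b)))"
    by (rule SR_coassoc[symmetric]; simp)
  also have "\<dots> = SR W M m (\<lambda>r k. F r e k)"
    using coact_S_cancel(3)[OF W M, where G="\<lambda>r s. F r s _"] by simp
  finally show ?thesis .
qed

lemma SL_S_cancel_left:
  assumes F: "tri I I M W F"
  shows "SL W M m (\<lambda>g x. SL W I g (\<lambda>a b. SL W M x (\<lambda>d w. F a (mul b (S d)) w))) = SL W M m (\<lambda>a w. F a e w)"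
proof -
  note [simp] = F trilinear_comp[OF F] trilinearD[OF F]
  have "SL W M m (\<lambda>g x. SL W I g (\<lambda>a b. SL W M x (\<lambda>d w. F a (mul b (S d)) w)))
    = SL W M m (\<lambda>a y. SL W M y (\<lambda>b x. SL W M x (\<lambda>d w. F a (mul b (S d)) w)))"
    by (rule SL_coassoc[symmetric]; simp)
  also have "\<dots> = SL W M m (\<lambda>a w. F a e w)"
    using coact_S_cancel(2)[OF W M, where F="\<lambda>s w. F _ s w"] by simp
  finally show ?thesis .
qed

end

lemma P_P: "obj M \<Longrightarrow> m \<in> carrier M \<Longrightarrow> P M (P M m) = P M m"
  by (subst P_def, subst SL_P) (simp_all add: la_one)

lemma Q_Q: "obj M \<Longrightarrow> m \<in> carrier M \<Longrightarrow> Q M (Q M m) = Q M m"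
  by (subst Q_def, subst SR_Q) (simp_all add: ra_one)

end

context hopf_tensor
begin

definition br where
  "br M N m n = SL (tp N M) M m (\<lambda>g x. SR (tp N M) N n (\<lambda>y k. p N M (la N g (Q N y)) (ra M (P M x) k)))"

definition sigma where "sigma M N x = ST (tp N M) M N x (br M N)"

context
  fixes M N assumes objs [simp]: "obj M" "obj N"
begin

lemma br_bil: "bil M N (tp N M) (br M N)"
  by (simp add: br_def[abs_def])

lemmas br_simps [simp] = br_bil bilinear_comps[OF br_bil] bilinear_mapsD[OF br_bil]

text \<open>Both sides equal the sum of m_[-1] h_1 . Q(n_(0)) \<otimes> S(h_2) . P(m_[0]) . h_3
  n_(1). The factor S(h_2) arises from the adjoint action in \<open>P_ra\<close> on one side; on the
  other it arises from \<open>Q_la\<close> and is moved across the tensor sign.\<close>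

lemma br_balanced: "balanced M N (br M N)"
proof (rule balancedI)
  fix m h n assume [simp]: "m \<in> carrier M" "h \<in> carrier I" "n \<in> carrier N"
  let ?V = "tp N M"
  let ?F = "\<lambda>g x a c d. SR ?V N n (\<lambda>y k. p N M (la N (mul g a) (Q N y)) (ra M (la M (S c) (P M x)) (mul d k)))"
  have "br M N (ra M m h) n = SL ?V I h (\<lambda>a b. SL ?V M m (\<lambda>g x. SR ?V N n (\<lambda>y k. SL ?V I b (\<lambda>c d.
      p N M (la N (mul g a) (Q N y)) (ra M (la M (S c) (P M x)) (mul d k))))))"
    by (simp add: br_def SL_ra P_ra map_SL[where V=M and W="?V" and f="\<lambda>z. p N M _ (ra M z _)"] ra_ra)
  also have "\<dots> = SL ?V I h (\<lambda>a b. SL ?V M m (\<lambda>g x. SL ?V I b (\<lambda>c d. ?F g x a c d)))"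
    by (rule SL_cong[OF HOL.refl], rule SL_cong[OF HOL.refl], rule SL_SR_commute[symmetric]; simp)
  finally have 1: "br M N (ra M m h) n = SL ?V I h (\<lambda>a b. SL ?V M m (\<lambda>g x. SL ?V I b (\<lambda>c d. ?F g x a c d)))" .
  have "br M N m (la N h n) = SL ?V M m (\<lambda>g x. SL ?V I h (\<lambda>u v. SR ?V N n (\<lambda>y k. SL ?V I u (\<lambda>a c.
      p N M (la N (mul g a) (Q N y)) (ra M (la M (S c) (P M x)) (mul v k))))))"
    by (simp add: br_def SR_la Q_la map_SL[where V=N and W="?V" and f="\<lambda>z. p N M (la N _ z) _"] la_ra la_la p_bal)
  also have "\<dots> = SL ?V M m (\<lambda>g x. SL ?V I h (\<lambda>u v. SL ?V I u (\<lambda>a c. ?F g x a c v)))"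
    by (rule SL_cong[OF HOL.refl], rule SL_cong[OF HOL.refl], rule SL_SR_commute[symmetric]; simp)
  also have "\<dots> = SL ?V M m (\<lambda>g x. SL ?V I h (\<lambda>a b. SL ?V I b (\<lambda>c d. ?F g x a c d)))"
    by (rule SL_cong[OF HOL.refl], rule SL_coassoc[symmetric]; simp)
  also have "\<dots> = br M N (ra M m h) n"
    unfolding 1 by (rule SL_SL_commute; simp)
  finally show "br M N (ra M m h) n = br M N m (la N h n)" ..
qed

lemma sigma_p: "\<lbrakk>m \<in> carrier M; n \<in> carrier N\<rbrakk> \<Longrightarrow> sigma M N (p M N m n) = br M N m n"
  unfolding sigma_def by (simp add: ST_p br_balanced del: balancedI)

lemma sigma_lin: "lin (tp M N) (tp N M) (sigma M N)"
  unfolding sigma_def by (simp add: ST_lin br_balanced del: balancedI)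

text \<open>P turns the second leg of h into a counit, so all of h remains on the first factor,
  where the left action of the tensor product takes place. \<open>br_ra\<close> uses Q in the same
  way.\<close>

lemma br_la:
  assumes [simp]: "m \<in> carrier M" "h \<in> carrier I" "n \<in> carrier N"
  shows "br M N (la M h m) n = la (tp N M) h (br M N m n)"
proof -
  let ?V = "tp N M"
  have "br M N (la M h m) n = SL ?V I h (\<lambda>a b. eps b \<odot>\<^bsub>?V\<^esub>
      SL ?V M m (\<lambda>g x. SR ?V N n (\<lambda>y k. p N M (la N (mul a g) (Q N y)) (ra M (P M x) k))))"
    by (simp add: br_def SL_la P_la act_smult p_smult SL_smult SR_smult)
  also have "\<dots> = SL ?V M m (\<lambda>g x. SR ?V N n (\<lambda>y k. p N M (la N (mul h g) (Q N y)) (ra M (P M x) k)))"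
    using SR_counit'[of I ?V "\<lambda>a. SL ?V M m (\<lambda>g x. SR ?V N n (\<lambda>y k. p N M (la N (mul a g) (Q N y)) (ra M (P M x) k)))" h]
    by (simp add: SR_I)
  also have "\<dots> = la ?V h (br M N m n)"
    by (simp add: br_def map_SL[where V="?V" and W="?V" and f="la ?V h"]
        map_SR[where V="?V" and W="?V" and f="la ?V h"] la_p la_la)
  finally show ?thesis .
qed

lemma br_ra:
  assumes [simp]: "m \<in> carrier M" "h \<in> carrier I" "n \<in> carrier N"
  shows "br M N m (ra N n h) = ra (tp N M) (br M N m n) h"
proof -
  let ?V = "tp N M"
  have "br M N m (ra N n h) = SL ?V M m (\<lambda>g x. SL ?V I h (\<lambda>a b. eps a \<odot>\<^bsub>?V\<^esub>
      SR ?V N n (\<lambda>y k. p N M (la N g (Q N y)) (ra M (P M x) (mul k b)))))"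
    by (simp add: br_def SR_ra Q_ra act_smult p_smult SL_smult SR_smult)
  also have "\<dots> = SL ?V M m (\<lambda>g x. SR ?V N n (\<lambda>y k. p N M (la N g (Q N y)) (ra M (P M x) (mul k h))))"
    using SL_counit'[of I ?V "\<lambda>b. SR ?V N n (\<lambda>y k. p N M (la N _ (Q N y)) (ra M (P M _) (mul k b)))" h] by simp
  also have "\<dots> = ra ?V (br M N m n) h"
    by (simp add: br_def map_SL[where V="?V" and W="?V" and f="\<lambda>z. ra ?V z h"]
        map_SR[where V="?V" and W="?V" and f="\<lambda>z. ra ?V z h"] ra_p ra_ra)
  finally show ?thesis .
qed

lemma br_tw:
  assumes [simp]: "m \<in> carrier M" "n \<in> carrier N"
  shows "br M N (tw M t m) (tw N t n) = tw (tp N M) t (br M N m n)"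
  by (simp add: br_def SL_tw SR_tw Q_tw P_tw tw_p tw_la tw_ra map_SL[where V="tp N M" and W="tp N M" and f="tw (tp N M) t"]
      map_SR[where V="tp N M" and W="tp N M" and f="tw (tp N M) t"])

text \<open>P(m_[0]) is left coinvariant and contributes no leg. The left coaction of Q(n_(0))
  leaves an antipode behind, which meets the first leg of the coproduct of n_(1) and
  cancels.\<close>

lemma SL_br:
  fixes W :: "('k, 'u, 'x) module_scheme"
  assumes m [simp]: "m \<in> carrier M" and n [simp]: "n \<in> carrier N" and W [simp]: "module K W" and F: "bil I (tp N M) W F"
  shows "SL W (tp N M) (br M N m n) F = SL W M m (\<lambda>g x. SL W N n (\<lambda>h y. F (mul g h) (br M N x y)))"
proof -
  let ?V = "tp N M"
  note [simp] = F bilinear_comps[OF F] bilinear_mapsD[OF F]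
  define G where "G g a x z k = F (mul g a) (p N M z (ra M (P M x) k))" for g a x z k
  have GF [simp]: "\<lbrakk>g \<in> carrier I; a \<in> carrier I; x \<in> carrier M; z \<in> carrier N; k \<in> carrier I\<rbrakk> \<Longrightarrow> G g a x z k \<in> carrier W"
    for g a x z k by (simp add: G_def)
  have 1: "SR W N n (\<lambda>y k. SR W N y (\<lambda>r d. SL W N r (\<lambda>a z. SL W I k (\<lambda>k1 k2.
        F (mul g (mul a (mul (S d) k1))) (p N M (la N g' (Q N z)) (ra M (P M x) k2))))))
    = SL W N n (\<lambda>a y. SR W N y (\<lambda>z k. F (mul g a) (p N M (la N g' (Q N z)) (ra M (P M x) k))))"
    if [simp]: "g \<in> carrier I" "g' \<in> carrier I" "x \<in> carrier M" for g g' x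
  proof -
    have "SR W N n (\<lambda>y k. SR W N y (\<lambda>r d. SL W N r (\<lambda>a z. SL W I k (\<lambda>k1 k2.
        F (mul g (mul a (mul (S d) k1))) (p N M (la N g' (Q N z)) (ra M (P M x) k2))))))
      = SR W N n (\<lambda>y k. SR W N y (\<lambda>r d. SL W I k (\<lambda>k1 k2. SL W N r (\<lambda>a z.
        F (mul g (mul a (mul (S d) k1))) (p N M (la N g' (Q N z)) (ra M (P M x) k2))))))"
      by (rule SR_cong[OF HOL.refl], rule SR_cong[OF HOL.refl], rule SL_SL_commute; simp)
    also have "\<dots> = SR W N n (\<lambda>r k. SL W N r (\<lambda>a z. F (mul g (mul a e)) (p N M (la N g' (Q N z)) (ra M (P M x) k))))"
      by (rule SR_S_cancel_right[where F="\<lambda>r s k. SL W N r (\<lambda>a z. F (mul g (mul a s)) (p N M (la N g' (Q N z)) (ra M (P M x) k)))"]; simp)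
    also have "\<dots> = SR W N n (\<lambda>r k. SL W N r (\<lambda>a z. F (mul g a) (p N M (la N g' (Q N z)) (ra M (P M x) k))))"
      by simp
    also have "\<dots> = SL W N n (\<lambda>a y. SR W N y (\<lambda>z k. F (mul g a) (p N M (la N g' (Q N z)) (ra M (P M x) k))))"
      by (rule SL_SR[symmetric]; simp)
    finally show ?thesis .
  qed
  have "SL W ?V (br M N m n) F = SL W M m (\<lambda>g x. SR W N n (\<lambda>y k. SL W ?V (p N M (la N g (Q N y)) (ra M (P M x) k)) F))"
    by (simp add: br_def map_SL[where V="?V" and W=W and f="\<lambda>z. SL W ?V z F"] map_SR[where V="?V" and W=W and f="\<lambda>z. SL W ?V z F"])
  also have "\<dots> = SL W M m (\<lambda>g x. SR W N n (\<lambda>y k. SL W I g (\<lambda>g g'. SR W N y (\<lambda>r d. SL W N r (\<lambda>a z. SL W I k (\<lambda>k1 k2.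
        F (mul g (mul a (mul (S d) k1))) (p N M (la N g' (Q N z)) (ra M (P M x) k2))))))))"
    by (simp add: SL_p SL_la SL_ra SL_P SL_Q mul_assoc)
  also have "\<dots> = SL W M m (\<lambda>g x. SL W I g (\<lambda>g g'. SR W N n (\<lambda>y k. SR W N y (\<lambda>r d. SL W N r (\<lambda>a z. SL W I k (\<lambda>k1 k2.
        F (mul g (mul a (mul (S d) k1))) (p N M (la N g' (Q N z)) (ra M (P M x) k2))))))))"
    by (rule SL_cong[OF HOL.refl], rule SL_SR_commute[symmetric]; simp)
  also have "\<dots> = SL W M m (\<lambda>g x. SL W I g (\<lambda>g g'. SL W N n (\<lambda>a y. SR W N y (\<lambda>z k.
      F (mul g a) (p N M (la N g' (Q N z)) (ra M (P M x) k))))))"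
    by (simp only: 1 cong: SL_cong SR_cong)
  also have "\<dots> = SL W M m (\<lambda>g r. SL W M r (\<lambda>g' x. SL W N n (\<lambda>a y. SR W N y (\<lambda>z k.
      F (mul g a) (p N M (la N g' (Q N z)) (ra M (P M x) k))))))"
    by (rule SL_coassoc[symmetric]; simp)
  also have "\<dots> = SL W M m (\<lambda>g r. SL W N n (\<lambda>a y. SL W M r (\<lambda>g' x. SR W N y (\<lambda>z k.
      F (mul g a) (p N M (la N g' (Q N z)) (ra M (P M x) k))))))"
    by (rule SL_cong[OF HOL.refl], rule SL_SL_commute; simp)
  also have "\<dots> = SL W M m (\<lambda>g x. SL W N n (\<lambda>h y. F (mul g h) (br M N x y)))"
    by (simp add: br_def map_SL[where V="?V" and W=W and f="\<lambda>z. F _ z"] map_SR[where V="?V" and W=W and f="\<lambda>z. F _ z"])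
  finally show ?thesis .
qed

text \<open>Here Q(n_(0)) is right coinvariant, while the right coaction of P(m_[0]) leaves an
  antipode that cancels against the second leg of the coproduct of m_[-1].\<close>

lemma SR_br:
  fixes W :: "('k, 'u, 'x) module_scheme"
  assumes m [simp]: "m \<in> carrier M" and n [simp]: "n \<in> carrier N" and W [simp]: "module K W" and F: "bil (tp N M) I W F"
  shows "SR W (tp N M) (br M N m n) F = SR W M m (\<lambda>x g. SR W N n (\<lambda>y h. F (br M N x y) (mul g h)))"
proof -
  let ?V = "tp N M"
  note [simp] = F bilinear_comps[OF F] bilinear_mapsD[OF F]
  have 1: "SL W M m (\<lambda>g x. SL W I g (\<lambda>a b. SL W M x (\<lambda>c r. SR W M r (\<lambda>z d.
        F (p N M (la N a (Q N y)) (ra M (P M z) k)) (mul b (mul (S c) (mul d l)))))))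
    = SR W M m (\<lambda>x d. SL W M x (\<lambda>a z. F (p N M (la N a (Q N y)) (ra M (P M z) k)) (mul d l)))"
    if [simp]: "k \<in> carrier I" "l \<in> carrier I" "y \<in> carrier N" for k l y
  proof -
    have "SL W M m (\<lambda>g x. SL W I g (\<lambda>a b. SL W M x (\<lambda>c r. SR W M r (\<lambda>z d.
        F (p N M (la N a (Q N y)) (ra M (P M z) k)) (mul b (mul (S c) (mul d l)))))))
      = SL W M m (\<lambda>g x. SL W I g (\<lambda>a b. SL W M x (\<lambda>c r. SR W M r (\<lambda>z d.
        F (p N M (la N a (Q N y)) (ra M (P M z) k)) (mul (mul b (S c)) (mul d l))))))"
      by (simp add: mul_assoc)
    also have "\<dots> = SL W M m (\<lambda>a r. SR W M r (\<lambda>z d. F (p N M (la N a (Q N y)) (ra M (P M z) k)) (mul e (mul d l))))"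
      by (rule SL_S_cancel_left[where F="\<lambda>a s r. SR W M r (\<lambda>z d. F (p N M (la N a (Q N y)) (ra M (P M z) k)) (mul s (mul d l)))"]; simp)
    also have "\<dots> = SL W M m (\<lambda>a r. SR W M r (\<lambda>z d. F (p N M (la N a (Q N y)) (ra M (P M z) k)) (mul d l)))"
      by simp
    also have "\<dots> = SR W M m (\<lambda>x d. SL W M x (\<lambda>a z. F (p N M (la N a (Q N y)) (ra M (P M z) k)) (mul d l)))"
      by (rule SL_SR; simp)
    finally show ?thesis .
  qed
  have "SR W ?V (br M N m n) F = SL W M m (\<lambda>g x. SR W N n (\<lambda>y k. SR W ?V (p N M (la N g (Q N y)) (ra M (P M x) k)) F))"
    by (simp add: br_def map_SL[where V="?V" and W=W and f="\<lambda>z. SR W ?V z F"] map_SR[where V="?V" and W=W and f="\<lambda>z. SR W ?V z F"])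
  also have "\<dots> = SR W N n (\<lambda>y k. SL W M m (\<lambda>g x. SR W ?V (p N M (la N g (Q N y)) (ra M (P M x) k)) F))"
    by (rule SL_SR_commute; simp)
  also have "\<dots> = SR W N n (\<lambda>y k. SL W M m (\<lambda>g x. SL W I g (\<lambda>a b. SL W I k (\<lambda>k l. SL W M x (\<lambda>c r. SR W M r (\<lambda>z d.
        F (p N M (la N a (Q N y)) (ra M (P M z) k)) (mul b (mul (S c) (mul d l)))))))))"
    by (simp add: SR_p SR_la SR_ra SR_P SR_Q mul_assoc)
  also have "\<dots> = SR W N n (\<lambda>y k. SL W M m (\<lambda>g x. SL W I k (\<lambda>k l. SL W I g (\<lambda>a b. SL W M x (\<lambda>c r. SR W M r (\<lambda>z d.
        F (p N M (la N a (Q N y)) (ra M (P M z) k)) (mul b (mul (S c) (mul d l)))))))))"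
    by (rule SR_cong[OF HOL.refl], rule SL_cong[OF HOL.refl], rule SL_SL_commute; simp)
  also have "\<dots> = SR W N n (\<lambda>y k. SL W I k (\<lambda>k l. SL W M m (\<lambda>g x. SL W I g (\<lambda>a b. SL W M x (\<lambda>c r. SR W M r (\<lambda>z d.
        F (p N M (la N a (Q N y)) (ra M (P M z) k)) (mul b (mul (S c) (mul d l)))))))))"
    by (rule SR_cong[OF HOL.refl], rule SL_SL_commute; simp)
  also have "\<dots> = SR W N n (\<lambda>y k. SL W I k (\<lambda>k l. SR W M m (\<lambda>x d. SL W M x (\<lambda>a z. F (p N M (la N a (Q N y)) (ra M (P M z) k)) (mul d l)))))"
    by (simp only: 1 cong: SL_cong SR_cong)
  also have "\<dots> = SR W N n (\<lambda>r l. SR W N r (\<lambda>y k. SR W M m (\<lambda>x d. SL W M x (\<lambda>a z. F (p N M (la N a (Q N y)) (ra M (P M z) k)) (mul d l)))))"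
    by (rule SR_coassoc[symmetric]; simp)
  also have "\<dots> = SR W N n (\<lambda>r l. SR W M m (\<lambda>x d. SR W N r (\<lambda>y k. SL W M x (\<lambda>a z. F (p N M (la N a (Q N y)) (ra M (P M z) k)) (mul d l)))))"
    by (rule SR_cong[OF HOL.refl], rule SR_SR_commute; simp)
  also have "\<dots> = SR W M m (\<lambda>x d. SR W N n (\<lambda>r l. SR W N r (\<lambda>y k. SL W M x (\<lambda>a z. F (p N M (la N a (Q N y)) (ra M (P M z) k)) (mul d l)))))"
    by (rule SR_SR_commute; simp)
  also have "\<dots> = SR W M m (\<lambda>x d. SR W N n (\<lambda>r l. SL W M x (\<lambda>a z. SR W N r (\<lambda>y k. F (p N M (la N a (Q N y)) (ra M (P M z) k)) (mul d l)))))"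
    by (rule SR_cong[OF HOL.refl], rule SR_cong[OF HOL.refl], rule SL_SR_commute[symmetric]; simp)
  also have "\<dots> = SR W M m (\<lambda>x g. SR W N n (\<lambda>y h. F (br M N x y) (mul g h)))"
    by (simp add: br_def map_SL[where V="?V" and W=W and f="\<lambda>z. F z _"] map_SR[where V="?V" and W=W and f="\<lambda>z. F z _"])
  finally show ?thesis .
qed

lemma sigma_hom: "hom (tp M N) (tp N M) (sigma M N)"
proof (rule hom_tpI)
  note [simp] = sigma_p linear_comp[OF sigma_lin] linear_mapsD(1)[OF sigma_lin] sigma_lin
  fix W :: "('k, 'u, 'x) module_scheme" and F x assume [simp]: "module K W" and F: "bil I (tp N M) W F"
    and x: "x \<in> {p M N m n | m n. m \<in> carrier M \<and> n \<in> carrier N}"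
  note [simp] = F bilinear_comps[OF F] bilinear_mapsD[OF F]
  show "SL W (tp N M) (sigma M N x) F = SL W (tp M N) x (\<lambda>h x. F h (sigma M N x))"
    using x by (auto simp: SL_p SL_br)
next
  note [simp] = sigma_p linear_comp[OF sigma_lin] linear_mapsD(1)[OF sigma_lin] sigma_lin
  fix W :: "('k, 'u, 'x) module_scheme" and F x assume [simp]: "module K W" and F: "bil (tp N M) I W F"
    and x: "x \<in> {p M N m n | m n. m \<in> carrier M \<and> n \<in> carrier N}"
  note [simp] = F bilinear_comps[OF F] bilinear_mapsD[OF F]
  show "SR W (tp N M) (sigma M N x) F = SR W (tp M N) x (\<lambda>x h. F (sigma M N x) h)"
    using x by (auto simp: SR_p SR_br)
qed (auto simp: sigma_p la_p ra_p tw_p sigma_lin br_la br_ra br_tw)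

end

section \<open>Naturality of the braiding\<close>

lemma hom_P: "\<lbrakk>obj M; obj N; hom M N f; x \<in> carrier M\<rbrakk> \<Longrightarrow> P N (f x) = f (P M x)"
  by (simp add: P_def homD map_SL[where V=M and W=N and f=f])

lemma hom_Q: "\<lbrakk>obj M; obj N; hom M N f; x \<in> carrier M\<rbrakk> \<Longrightarrow> Q N (f x) = f (Q M x)"
  by (simp add: Q_def homD map_SR[where V=M and W=N and f=f])

lemma sigma_natural:
  assumes objs [simp]: "obj M" "obj M'" "obj N" "obj N'" and f: "hom M M' f" and g: "hom N N' g"
    and x: "x \<in> carrier (tp M N)"
  shows "sigma M' N' (tmap M N M' N' f g x) = tmap N M N' M' g f (sigma M N x)"
proof -
  note h = tmap_hom(2)[OF objs(1,3,2,4) f g] tmap_hom(2)[OF objs(3,1,4,2) g f]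
  note [simp] = homD[OF f] homD[OF g]
  show ?thesis
  proof (rule tp_ext[where W="tp N' M'", OF _ _ _ _ _ _ x])
    show "lin (tp M N) (tp N' M') (\<lambda>x. sigma M' N' (tmap M N M' N' f g x))"
      by (simp add: linear_comp[OF sigma_lin] homD(1)[OF h(1)])
    show "lin (tp M N) (tp N' M') (\<lambda>x. tmap N M N' M' g f (sigma M N x))"
      by (simp add: sigma_lin homD(8)[OF h(2)])
    fix m n assume [simp]: "m \<in> carrier M" "n \<in> carrier N"
    show "sigma M' N' (tmap M N M' N' f g (p M N m n)) = tmap N M N' M' g f (sigma M N (p M N m n))"
      by (simp add: tmap_p[OF objs(1,3,2,4) f g] sigma_p br_def hom_P[OF _ _ f] hom_Q[OF _ _ g]
          map_SL[where V="tp N M" and W="tp N' M'" and f="tmap N M N' M' g f"]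
          map_SR[where V="tp N M" and W="tp N' M'" and f="tmap N M N' M' g f"] homD(1)[OF h(2)]
          tmap_p[OF objs(3,1,4,2) g f])
  qed simp_all
qed

end

section \<open>The hexagon identities\<close>

context hopf_tensor
begin

text \<open>The antipode reverses the product of the two coaction legs, so the leg of n acts before
  that of m and completes Q(n). In \<open>P_tp\<close> the leg of m acts first and completes
  P(m).\<close>

lemma Q_tp:
  assumes [simp]: "obj M" "obj N" "m \<in> carrier M" "n \<in> carrier N"
  shows "Q (tp M N) (p M N m n) = SR (tp M N) M m (\<lambda>x h. p M N x (ra N (Q N n) (S h)))"
proof -
  let ?V = "tp M N"
  have "Q ?V (p M N m n) = SR ?V M m (\<lambda>x g. SR ?V N n (\<lambda>y h. p M N x (ra N (ra N y (S h)) (S g))))"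
    by (simp add: Q_def SR_p ra_p S_mul ra_ra)
  also have "\<dots> = SR ?V M m (\<lambda>x h. p M N x (ra N (Q N n) (S h)))"
    by (simp add: Q_def map_SR[where V=N and W="?V" and f="\<lambda>z. p M N _ (ra N z _)"])
  finally show ?thesis .
qed

lemma P_tp:
  assumes [simp]: "obj M" "obj N" "m \<in> carrier M" "n \<in> carrier N"
  shows "P (tp M N) (p M N m n) = SL (tp M N) N n (\<lambda>h y. p M N (la M (S h) (P M m)) y)"
proof -
  let ?V = "tp M N"
  have "P ?V (p M N m n) = SL ?V M m (\<lambda>g x. SL ?V N n (\<lambda>h y. p M N (la M (S h) (la M (S g) x)) y))"
    by (simp add: P_def SL_p la_p S_mul la_la)
  also have "\<dots> = SL ?V N n (\<lambda>h y. SL ?V M m (\<lambda>g x. p M N (la M (S h) (la M (S g) x)) y))"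
    by (rule SL_SL_commute; simp)
  also have "\<dots> = SL ?V N n (\<lambda>h y. p M N (la M (S h) (P M m)) y)"
    by (simp add: P_def map_SL[where V=M and W="?V" and f="\<lambda>z. p M N (la M _ z) _"])
  finally show ?thesis .
qed

lemma br_P:
  assumes [simp]: "obj M" "obj N" "m \<in> carrier M" "n \<in> carrier N"
  shows "br M N (P M m) n = SR (tp N M) N n (\<lambda>y k. p N M (Q N y) (ra M (P M m) k))"
  by (simp add: br_def SL_P la_one P_P)

text \<open>On generators both sides are sums of \<open>?G\<close>, with s = e on the left and s =
  S(c) a on the right. The factor S(c) comes from Q on B, the factor a from the adjoint action
  inside Q on C, and the two meet after moving a across the tensor sign.\<close>

lemma hexagon1_map:
  assumes objs [simp]: "obj A" "obj B" "obj C" and x: "x \<in> carrier (tp (tp A B) C)"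
  shows "asc B C A (sigma A (tp B C) (asc A B C x))
    = tmap B (tp A C) B (tp C A) (\<lambda>x. x) (sigma A C)
        (asc B A C (tmap (tp A B) C (tp B A) C (sigma A B) (\<lambda>x. x) x))" (is "?l x = ?r x")
proof (rule tp_ext_left[where f="?l" and g="?r" and W="tp B (tp C A)", OF _ _ _ _ _ _ _ x])
  let ?V = "tp B (tp C A)"
  note homs = tmap_hom(2)[OF _ _ _ _ sigma_hom[of A B] hom_id[of C]] tmap_hom(2)[OF _ _ _ _ hom_id[of B] sigma_hom[of A C]]
  note tmaps = tmap_p[OF _ _ _ _ sigma_hom[of A B] hom_id[of C]] tmap_p[OF _ _ _ _ hom_id[of B] sigma_hom[of A C]]
  note [simp] = asc_lin linear_comp[OF asc_lin] sigma_lin linear_comp[OF sigma_lin] linear_mapsD(1)[OF sigma_lin]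
  show "lin (tp (tp A B) C) ?V ?l" by simp
  show "lin (tp (tp A B) C) ?V ?r" by (simp add: homD(1,8)[OF homs(1)] homD(1,8)[OF homs(2)])
  fix m n q assume [simp]: "m \<in> carrier A" "n \<in> carrier B" "q \<in> carrier C"
  let ?G = "\<lambda>g x w s b h z k. p B (tp C A) (ra B (la B g w) s) (p C A (Q C z) (ra A (la A (S b) (P A x)) (mul h k)))"
  have "?l (p (tp A B) C (p A B m n) q)
    = SL ?V A m (\<lambda>g x. SR ?V B n (\<lambda>y h. SR ?V C q (\<lambda>z k. SR ?V B y (\<lambda>w b. ?G g x w e b h z k))))"
    by (simp add: asc_p sigma_p br_def SR_p Q_tp la_p la_ra p_bal ra_one
        map_SR[where V="tp B C" and W="tp (tp B C) A" and f="\<lambda>t. p (tp B C) A (la (tp B C) _ t) _"]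
        map_SL[where V="tp (tp B C) A" and W="?V" and f="asc B C A"]
        map_SR[where V="tp (tp B C) A" and W="?V" and f="asc B C A"])
  also have "\<dots> = SL ?V A m (\<lambda>g x. SR ?V C q (\<lambda>z k. SR ?V B n (\<lambda>y h. SR ?V B y (\<lambda>w b. ?G g x w e b h z k))))"
    by (rule SL_cong[OF HOL.refl], rule SR_SR_commute; simp)
  finally have l: "?l (p (tp A B) C (p A B m n) q)
    = SL ?V A m (\<lambda>g x. SR ?V C q (\<lambda>z k. SR ?V B n (\<lambda>y h. SR ?V B y (\<lambda>w b. ?G g x w e b h z k))))" .
  have key: "SR ?V B n (\<lambda>y h. SL ?V I h (\<lambda>h1 h2. SL ?V I h1 (\<lambda>a b. SR ?V B y (\<lambda>w c. ?G g x w (mul (S c) a) b h2 z k))))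
    = SR ?V B n (\<lambda>y h. SR ?V B y (\<lambda>w b. ?G g x w e b h z k))"
    if [simp]: "g \<in> carrier I" "x \<in> carrier A" "z \<in> carrier C" "k \<in> carrier I" for g x z k
  proof -
    have "SR ?V B n (\<lambda>y h. SL ?V I h (\<lambda>h1 h2. SL ?V I h1 (\<lambda>a b. SR ?V B y (\<lambda>w c. ?G g x w (mul (S c) a) b h2 z k))))
      = SR ?V B n (\<lambda>y h. SL ?V I h (\<lambda>a r. SL ?V I r (\<lambda>b h2. SR ?V B y (\<lambda>w c. ?G g x w (mul (S c) a) b h2 z k))))"
      by (rule SR_cong[OF HOL.refl], rule SL_coassoc[symmetric]; simp)
    also have "\<dots> = SR ?V B n (\<lambda>y h. SL ?V I h (\<lambda>a r. SR ?V B y (\<lambda>w c. SL ?V I r (\<lambda>b h2. ?G g x w (mul (S c) a) b h2 z k))))"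
      by (rule SR_cong[OF HOL.refl], rule SL_cong[OF HOL.refl], rule SL_SR_commute; simp)
    also have "\<dots> = SR ?V B n (\<lambda>y h. SR ?V B y (\<lambda>w c. SL ?V I h (\<lambda>a r. SL ?V I r (\<lambda>b h2. ?G g x w (mul (S c) a) b h2 z k))))"
      by (rule SR_cong[OF HOL.refl], rule SL_SR_commute; simp)
    also have "\<dots> = SR ?V B n (\<lambda>w r. SL ?V I r (\<lambda>b h2. ?G g x w e b h2 z k))"
      by (rule SR_S_cancel_right[where F="\<lambda>w s r. SL ?V I r (\<lambda>b h2. ?G g x w s b h2 z k)"]; simp)
    also have "\<dots> = SR ?V B n (\<lambda>y h. SR ?V B y (\<lambda>w b. ?G g x w e b h z k))"
      by (rule SR_coassoc[symmetric]; simp)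
    finally show ?thesis .
  qed
  \<comment> \<open>Balance moves h from A to C. What remains in A is left coinvariant, so
    \<open>br_P\<close> applies, and Q of h_1 . z unfolds to the adjoint action.\<close>
  have 1: "sigma A C (p A C (ra A (P A x) h) q) = SL (tp C A) I h (\<lambda>h1 h2. SR (tp C A) C q (\<lambda>z k. SL (tp C A) I h1 (\<lambda>a b.
      la (tp C A) a (p C A (Q C z) (ra A (la A (S b) (P A x)) (mul h2 k))))))"
    if [simp]: "x \<in> carrier A" "h \<in> carrier I" for x h
    by (simp add: p_bal sigma_p br_P SR_la Q_la la_p la_ra
        map_SL[where V=C and W="tp C A" and f="\<lambda>t. p C A t _"])
  have "?r (p (tp A B) C (p A B m n) q)
    = SL ?V A m (\<lambda>g x. SR ?V B n (\<lambda>y h. p B (tp C A) (la B g (Q B y)) (sigma A C (p A C (ra A (P A x) h) q))))"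
    by (simp add: tmaps sigma_p br_def asc_p homD(8)[OF homs(2)]
        map_SL[where V="tp B A" and W="?V" and f="\<lambda>t. tmap B (tp A C) B (tp C A) (\<lambda>x. x) (sigma A C) (asc B A C (p (tp B A) C t q))"]
        map_SR[where V="tp B A" and W="?V" and f="\<lambda>t. tmap B (tp A C) B (tp C A) (\<lambda>x. x) (sigma A C) (asc B A C (p (tp B A) C t q))"])
  also have "\<dots> = SL ?V A m (\<lambda>g x. SR ?V B n (\<lambda>y h. SL ?V I h (\<lambda>h1 h2. SR ?V C q (\<lambda>z k. SL ?V I h1 (\<lambda>a b. SR ?V B y (\<lambda>w c.
      ?G g x w (mul (S c) a) b h2 z k))))))"
    by (simp add: 1 p_bal[symmetric] Q_def[of B] la_ra ra_ra
        map_SL[where V="tp C A" and W="?V" and f="\<lambda>t. p B (tp C A) _ t"]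
        map_SR[where V="tp C A" and W="?V" and f="\<lambda>t. p B (tp C A) _ t"]
        map_SR[where V=B and W="?V" and f="\<lambda>t. p B (tp C A) (ra B (la B _ t) _) _"])
  also have "\<dots> = SL ?V A m (\<lambda>g x. SR ?V B n (\<lambda>y h. SR ?V C q (\<lambda>z k. SL ?V I h (\<lambda>h1 h2. SL ?V I h1 (\<lambda>a b. SR ?V B y (\<lambda>w c.
      ?G g x w (mul (S c) a) b h2 z k))))))"
    by (rule SL_cong[OF HOL.refl], rule SR_cong[OF HOL.refl], rule SL_SR_commute; simp)
  also have "\<dots> = SL ?V A m (\<lambda>g x. SR ?V C q (\<lambda>z k. SR ?V B n (\<lambda>y h. SL ?V I h (\<lambda>h1 h2. SL ?V I h1 (\<lambda>a b. SR ?V B y (\<lambda>w c.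
      ?G g x w (mul (S c) a) b h2 z k))))))"
    by (rule SL_cong[OF HOL.refl], rule SR_SR_commute; simp)
  also have "\<dots> = ?l (p (tp A B) C (p A B m n) q)"
    unfolding l by (simp only: key cong: SL_cong SR_cong)
  finally show "?l (p (tp A B) C (p A B m n) q) = ?r (p (tp A B) C (p A B m n) q)" ..
qed simp_all

text \<open>The mirror image of the first hexagon: the factor in front of w is e on the left and b
  S(f) on the right, where S(f) comes from P on B and b is the last leg produced when h . Q(z) is
  braided past m.\<close>

lemma hexagon2_map:
  assumes objs [simp]: "obj A" "obj B" "obj C" and x: "x \<in> carrier (tp A (tp B C))"
  shows "asc_inv C A B (sigma (tp A B) C (asc_inv A B C x))
    = tmap (tp A C) B (tp C A) B (sigma A C) (\<lambda>x. x)
        (asc_inv A C B (tmap A (tp B C) A (tp C B) (\<lambda>x. x) (sigma B C) x))" (is "?l x = ?r x")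
proof (rule tp_ext_right[where f="?l" and g="?r" and W="tp (tp C A) B", OF _ _ _ _ _ _ _ x])
  let ?V = "tp (tp C A) B"
  note homs = tmap_hom(2)[OF _ _ _ _ sigma_hom[of A C] hom_id[of B]] tmap_hom(2)[OF _ _ _ _ hom_id[of A] sigma_hom[of B C]]
  note tmaps = tmap_p[OF _ _ _ _ sigma_hom[of A C] hom_id[of B]] tmap_p[OF _ _ _ _ hom_id[of A] sigma_hom[of B C]]
  note [simp] = asc_inv_lin linear_comp[OF asc_inv_lin] sigma_lin linear_comp[OF sigma_lin] linear_mapsD(1)[OF sigma_lin]
  show "lin (tp A (tp B C)) ?V ?l" by simp
  show "lin (tp A (tp B C)) ?V ?r" by (simp add: homD(1,8)[OF homs(1)] homD(1,8)[OF homs(2)])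
  fix m n q assume [simp]: "m \<in> carrier A" "n \<in> carrier B" "q \<in> carrier C"
  let ?G = "\<lambda>g x z k c d s w. p (tp C A) B (p C A (la C (mul g c) (Q C z)) (la A (S d) (P A x))) (ra B (la B s w) k)"
  have "?l (p A (tp B C) m (p B C n q))
    = SL ?V A m (\<lambda>g x. SL ?V B n (\<lambda>h y. SR ?V C q (\<lambda>z k. SL ?V B y (\<lambda>l w. ?G g x z k h l e w))))"
    by (simp add: asc_inv_p sigma_p br_def SL_p P_tp ra_p la_one
        map_SL[where V="tp A B" and W="tp C (tp A B)" and f="\<lambda>t. p C (tp A B) _ (ra (tp A B) t _)"]
        map_SL[where V="tp C (tp A B)" and W="?V" and f="asc_inv C A B"]
        map_SR[where V="tp C (tp A B)" and W="?V" and f="asc_inv C A B"])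
  also have "\<dots> = SL ?V A m (\<lambda>g x. SR ?V C q (\<lambda>z k. SL ?V B n (\<lambda>h y. SL ?V B y (\<lambda>l w. ?G g x z k h l e w))))"
    by (rule SL_cong[OF HOL.refl], rule SL_SR_commute; simp)
  also have "\<dots> = SR ?V C q (\<lambda>z k. SL ?V A m (\<lambda>g x. SL ?V B n (\<lambda>h y. SL ?V B y (\<lambda>l w. ?G g x z k h l e w))))"
    by (rule SL_SR_commute; simp)
  finally have l: "?l (p A (tp B C) m (p B C n q))
    = SR ?V C q (\<lambda>z k. SL ?V A m (\<lambda>g x. SL ?V B n (\<lambda>h y. SL ?V B y (\<lambda>l w. ?G g x z k h l e w))))" .
  have key: "SL ?V B n (\<lambda>h y. SL ?V I h (\<lambda>a b. SL ?V I a (\<lambda>c d. SL ?V B y (\<lambda>f w. ?G g x z k c d (mul b (S f)) w))))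
    = SL ?V B n (\<lambda>h y. SL ?V B y (\<lambda>l w. ?G g x z k h l e w))"
    if [simp]: "g \<in> carrier I" "x \<in> carrier A" "z \<in> carrier C" "k \<in> carrier I" for g x z k
  proof -
    have "SL ?V B n (\<lambda>h y. SL ?V I h (\<lambda>a b. SL ?V I a (\<lambda>c d. SL ?V B y (\<lambda>f w. ?G g x z k c d (mul b (S f)) w))))
      = SL ?V B n (\<lambda>h y. SL ?V I h (\<lambda>a b. SL ?V B y (\<lambda>f w. SL ?V I a (\<lambda>c d. ?G g x z k c d (mul b (S f)) w))))"
      by (rule SL_cong[OF HOL.refl], rule SL_cong[OF HOL.refl], rule SL_SL_commute; simp)
    also have "\<dots> = SL ?V B n (\<lambda>a w. SL ?V I a (\<lambda>c d. ?G g x z k c d e w))"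
      by (rule SL_S_cancel_left[where F="\<lambda>a s w. SL ?V I a (\<lambda>c d. ?G g x z k c d s w)"]; simp)
    also have "\<dots> = SL ?V B n (\<lambda>h y. SL ?V B y (\<lambda>l w. ?G g x z k h l e w))"
      by (rule SL_coassoc[symmetric]; simp)
    finally show ?thesis .
  qed
  have 1: "sigma A C (p A C m (la C h (Q C z))) = SL (tp C A) A m (\<lambda>g x. SL (tp C A) I h (\<lambda>a b. SL (tp C A) I a (\<lambda>c d.
      ra (tp C A) (p C A (la C (mul g c) (Q C z)) (la A (S d) (P A x))) b)))"
    if [simp]: "z \<in> carrier C" "h \<in> carrier I" for z h
    by (simp add: sigma_p br_def SR_la SR_Q Q_la Q_Q ra_p la_ra la_la p_bal
        map_SL[where V=C and W="tp C A" and f="\<lambda>t. p C A (la C _ t) _"])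
  have "?r (p A (tp B C) m (p B C n q))
    = SL ?V B n (\<lambda>h y. SR ?V C q (\<lambda>z k. p (tp C A) B (sigma A C (p A C m (la C h (Q C z)))) (ra B (P B y) k)))"
    by (simp add: tmaps sigma_p br_def[of B C] asc_inv_p homD(8)[OF homs(1)]
        map_SL[where V="tp C B" and W="?V" and f="\<lambda>t. tmap (tp A C) B (tp C A) B (sigma A C) (\<lambda>x. x) (asc_inv A C B (p A (tp C B) m t))"]
        map_SR[where V="tp C B" and W="?V" and f="\<lambda>t. tmap (tp A C) B (tp C A) B (sigma A C) (\<lambda>x. x) (asc_inv A C B (p A (tp C B) m t))"])
  also have "\<dots> = SL ?V B n (\<lambda>h y. SR ?V C q (\<lambda>z k. SL ?V A m (\<lambda>g x. SL ?V I h (\<lambda>a b. SL ?V I a (\<lambda>c d. SL ?V B y (\<lambda>f w.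
      ?G g x z k c d (mul b (S f)) w))))))"
    by (simp add: 1 p_bal P_def[of B] la_ra la_la
        map_SL[where V="tp C A" and W="?V" and f="\<lambda>t. p (tp C A) B t _"]
        map_SL[where V=B and W="?V" and f="\<lambda>t. p (tp C A) B _ (ra B (la B _ t) _)"])
  also have "\<dots> = SR ?V C q (\<lambda>z k. SL ?V B n (\<lambda>h y. SL ?V A m (\<lambda>g x. SL ?V I h (\<lambda>a b. SL ?V I a (\<lambda>c d. SL ?V B y (\<lambda>f w.
      ?G g x z k c d (mul b (S f)) w))))))"
    by (rule SL_SR_commute; simp)
  also have "\<dots> = SR ?V C q (\<lambda>z k. SL ?V A m (\<lambda>g x. SL ?V B n (\<lambda>h y. SL ?V I h (\<lambda>a b. SL ?V I a (\<lambda>c d. SL ?V B y (\<lambda>f w.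
      ?G g x z k c d (mul b (S f)) w))))))"
    by (rule SR_cong[OF HOL.refl], rule SL_SL_commute; simp)
  also have "\<dots> = ?l (p A (tp B C) m (p B C n q))"
    unfolding l by (simp only: key cong: SL_cong SR_cong)
  finally show "?l (p A (tp B C) m (p B C n q)) = ?r (p A (tp B C) m (p B C n q))" ..
qed simp_all

end

section \<open>The inverse of the braiding\<close>

lemma bilinear_flip: "F \<in> bilinear_maps K U V W \<Longrightarrow> (\<lambda>a b. F b a) \<in> bilinear_maps K V U W"
  by (auto simp: bilinear_maps_def)

definition flip :: "('m \<Rightarrow> 'u \<Rightarrow> ('u \<times> 'u) list) \<Rightarrow> 'm \<Rightarrow> 'u \<Rightarrow> ('u \<times> 'u) list" where
  "flip f M m = map prod.swap (f M m)"

lemma flip_flip [simp]: "flip (flip f) = f"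
  by (simp add: flip_def fun_eq_iff)

section \<open>The structure with exchanged coactions\<close>

context hopf_base
begin

lemma flip_data: "bimodule_data I (flip rc) (flip lc)"
proof
  fix M m
  show "set ((flip rc) M m) \<subseteq> carrier I \<times> carrier M"
    using rc_carrier[of M m] by (auto simp: flip_def)
  show "set ((flip lc) M m) \<subseteq> carrier M \<times> carrier I"
    using lc_carrier[of M m] by (auto simp: flip_def)
qed

lemma flip_SL: "bimodule_data.SL (flip rc) W M m F = SR W M m (\<lambda>x h. F h x)"
  unfolding bimodule_data.SL_def[OF flip_data] SR_def flip_def by (rule sum_pairs_swap_map)

lemma flip_SR: "bimodule_data.SR (flip lc) W M m F = SL W M m (\<lambda>h x. F x h)"
  unfolding bimodule_data.SR_def[OF flip_data] SL_def flip_def by (rule sum_pairs_swap_map)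

text \<open>The axioms for the two coactions change places. Products keep their order while the
  coproduct of I is reversed along with the coactions, so the compatibilities with the actions are
  again of the required form.\<close>

lemma flip_obj:
  assumes M [simp]: "obj M"
  shows "hopf_bimodule K I la ra (flip rc) (flip lc) tw e eps adm M"
proof (intro hopf_bimodule.intro hopf_bimodule_axioms.intro flip_data)
  show "adm M" by (rule admissible[OF M])
  show "module K M" "bil I M M (la M)" "bil M I M (ra M)" by (simp_all add: la_bil ra_bil)
  fix t show "lin M M (tw M t)" by simp
next
  fix W :: "('k, 'u, 'x) module_scheme" and F assume [simp]: "module K W"
  {
    assume F: "bil I M W F"
    note [simp] = F bilinear_comps[OF F] bilinear_mapsD[OF F]
    show "lin M W (\<lambda>m. bimodule_data.SL (flip rc) W M m F)" by (simp add: flip_SL)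
    fix m assume [simp]: "m \<in> carrier M"
    fix t show "bimodule_data.SL (flip rc) W M (tw M t m) F
      = bimodule_data.SL (flip rc) W M m (\<lambda>a b. F (tw I t a) (tw M t b))" by (simp add: flip_SL SR_tw)
    fix h assume [simp]: "h \<in> carrier I"
    show "bimodule_data.SL (flip rc) W M (la M h m) F = bimodule_data.SL (flip rc) W I h (\<lambda>a b.
      bimodule_data.SL (flip rc) W M m (\<lambda>g x. F (mul a g) (la M b x)))"
      by (simp add: flip_SL SR_la SR_I)
    show "bimodule_data.SL (flip rc) W M (ra M m h) F = bimodule_data.SL (flip rc) W I h (\<lambda>a b.
      bimodule_data.SL (flip rc) W M m (\<lambda>g x. F (mul g a) (ra M x b)))"
      by (simp add: flip_SL SR_ra SR_I)
  }
  {
    assume F: "bil M I W F"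
    note [simp] = F bilinear_comps[OF F] bilinear_mapsD[OF F]
    show "lin M W (\<lambda>m. bimodule_data.SR (flip lc) W M m F)" by (simp add: flip_SR)
    fix m assume [simp]: "m \<in> carrier M"
    fix t show "bimodule_data.SR (flip lc) W M (tw M t m) F
      = bimodule_data.SR (flip lc) W M m (\<lambda>a b. F (tw M t a) (tw I t b))" by (simp add: flip_SR SL_tw)
    fix h assume [simp]: "h \<in> carrier I"
    show "bimodule_data.SR (flip lc) W M (la M h m) F = bimodule_data.SL (flip rc) W I h (\<lambda>a b.
      bimodule_data.SR (flip lc) W M m (\<lambda>x g. F (la M a x) (mul b g)))"
      by (simp add: flip_SL flip_SR SL_la SR_I)
    show "bimodule_data.SR (flip lc) W M (ra M m h) F = bimodule_data.SL (flip rc) W I h (\<lambda>a b.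
      bimodule_data.SR (flip lc) W M m (\<lambda>x g. F (ra M x a) (mul g b)))"
      by (simp add: flip_SL flip_SR SL_ra SR_I)
  }
next
  fix m assume [simp]: "m \<in> carrier M"
  show "la M e m = m" "ra M m e = m" by (simp_all add: la_one ra_one)
  show "bimodule_data.SL (flip rc) M M m (\<lambda>h x. eps h \<odot>\<^bsub>M\<^esub> x) = m" by (simp add: flip_SL SR_counit)
  show "bimodule_data.SR (flip lc) M M m (\<lambda>x h. eps h \<odot>\<^bsub>M\<^esub> x) = m" by (simp add: flip_SR SL_counit)
  {
    fix h t assume [simp]: "h \<in> carrier I"
    show "tw M t (la M h m) = la M (tw I t h) (tw M t m)" "tw M t (ra M m h) = ra M (tw M t m) (tw I t h)"
      by (simp_all add: tw_la tw_ra)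
  }
  {
    fix a b assume [simp]: "a \<in> carrier I" "b \<in> carrier I"
    show "la M a (la M b m) = la M (mul a b) m" "ra M (ra M m a) b = ra M m (mul a b)"
      "la M a (ra M m b) = ra M (la M a m) b"
      by (simp_all add: la_la ra_ra la_ra)
  }
next
  fix W :: "('k, 'u, 'x) module_scheme" and F m assume [simp]: "module K W" "m \<in> carrier M"
  {
    assume F: "tri I I M W F"
    note [simp] = F trilinear_comp[OF F] trilinearD[OF F]
    show "bimodule_data.SL (flip rc) W M m (\<lambda>a x. bimodule_data.SL (flip rc) W M x (\<lambda>b y. F a b y))
      = bimodule_data.SL (flip rc) W M m (\<lambda>h y. bimodule_data.SL (flip rc) W I h (\<lambda>a b. F a b y))"
      unfolding flip_SL SR_I by (rule SR_coassoc; simp)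
  }
  {
    assume F: "tri M I I W F"
    note [simp] = F trilinear_comp[OF F] trilinearD[OF F]
    show "bimodule_data.SR (flip lc) W M m (\<lambda>x b. bimodule_data.SR (flip lc) W M x (\<lambda>y a. F y a b))
      = bimodule_data.SR (flip lc) W M m (\<lambda>y h. bimodule_data.SL (flip rc) W I h (\<lambda>a b. F y a b))"
      unfolding flip_SL flip_SR SR_I by (rule SL_coassoc; simp)
  }
  {
    assume F: "tri I M I W F"
    note [simp] = F trilinear_comp[OF F] trilinearD[OF F]
    show "bimodule_data.SL (flip rc) W M m (\<lambda>a x. bimodule_data.SR (flip lc) W M x (\<lambda>y b. F a y b))
      = bimodule_data.SR (flip lc) W M m (\<lambda>x b. bimodule_data.SL (flip rc) W M x (\<lambda>a y. F a y b))"
      unfolding flip_SL flip_SR by (rule SL_SR[symmetric]; simp)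
  }
qed

lemma flip_base: "hopf_base K I la ra (flip rc) (flip lc) tw e eps adm"
proof (intro hopf_base.intro hopf_base_axioms.intro flip_data flip_obj)
  show "flip lc I = flip rc I" by (simp add: flip_def fun_eq_iff rcI)
qed (simp_all add: flip_SL SR_I SL_e bilinear_flip raI eps_add eps_smult eps_mul tw_e)

lemma obj_flip_iff [simp]: "hopf_bimodule K I la ra (flip rc) (flip lc) tw e eps adm M \<longleftrightarrow> obj M"
  using flip_obj hopf_base.flip_obj[OF flip_base] by auto

end

text \<open>
  Exchanging the two coactions and reversing the comultiplication turns Hopf bimodules into Hopf
  bimodules over the co-opposite Hopf algebra, whose antipode is \<open>S\<^sup>-\<^sup>1\<close>. The braiding of the
  co-opposite structure is the inverse of the braiding.
\<close>

locale hopf_tensor_bij = hopf_tensor K I la ra lc rc tw e eps adm S tp rep p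
  for K :: "('k, 'z) ring_scheme" and I :: "('k, 'u, 'x) module_scheme"
    and la ra lc rc and tw :: "('k, 'u, 'x) module_scheme \<Rightarrow> 't \<Rightarrow> 'u \<Rightarrow> 'u" and e eps adm S
    and tp rep p +
  fixes Si :: "'u \<Rightarrow> 'u"
  assumes Si_closed [simp]: "a \<in> carrier I \<Longrightarrow> Si a \<in> carrier I"
    and Si_S [simp]: "a \<in> carrier I \<Longrightarrow> Si (S a) = a"
    and S_Si [simp]: "a \<in> carrier I \<Longrightarrow> S (Si a) = a"
begin

lemma Si_lin: "lin I I Si"
  by (rule linear_inverse[OF _ _ S_lin]) simp_all

lemma Si_tw: "a \<in> carrier I \<Longrightarrow> Si (tw I t a) = tw I t (Si a)"
  using S_tw[of "Si a" t] Si_S[of "tw I t (Si a)"] by (simp del: Si_S)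

text \<open>S is injective on the carrier. Applying it reverses the product and turns the sum into
  the left antipode axiom. The legs enter in the order of the opposite coproduct, for which
  \<open>Si\<close> is the antipode.\<close>

lemma Si_left:
  assumes [simp]: "a \<in> carrier I"
  shows "SL I I a (\<lambda>y x. mul (Si x) y) = eps a \<odot>\<^bsub>I\<^esub> e"
proof -
  note [simp] = Si_lin linear_comp[OF Si_lin]
  have "S (SL I I a (\<lambda>y x. mul (Si x) y)) = S (eps a \<odot>\<^bsub>I\<^esub> e)"
    by (simp add: map_SL[OF S_lin] S_mul S_left S_smult)
  then have "Si (S (SL I I a (\<lambda>y x. mul (Si x) y))) = Si (S (eps a \<odot>\<^bsub>I\<^esub> e))"
    by (rule arg_cong)
  then show ?thesis by simp
qed

lemma Si_right:
  assumes [simp]: "a \<in> carrier I"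
  shows "SL I I a (\<lambda>y x. mul x (Si y)) = eps a \<odot>\<^bsub>I\<^esub> e"
proof -
  note [simp] = Si_lin linear_comp[OF Si_lin]
  have "S (SL I I a (\<lambda>y x. mul x (Si y))) = S (eps a \<odot>\<^bsub>I\<^esub> e)"
    by (simp add: map_SL[OF S_lin] S_mul S_right S_smult)
  then have "Si (S (SL I I a (\<lambda>y x. mul x (Si y)))) = Si (S (eps a \<odot>\<^bsub>I\<^esub> e))"
    by (rule arg_cong)
  then show ?thesis by simp
qed

end

context hopf_tensor_bij
begin

text \<open>The exchange leaves the actions alone, hence also balance, the tensor product and its
  generators. Only the descriptions of the two coactions on generators change places, so all results
  on the braiding become available for the co-opposite structure.\<close>

sublocale flip: hopf_tensor K I la ra "flip rc" "flip lc" tw e eps adm Si tp rep p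
proof (intro hopf_tensor.intro hopf_tensor_data.intro hopf.intro flip_base hopf_axioms.intro
    hopf_tensor_data_axioms.intro hopf_tensor_axioms.intro)
  fix M N :: "('k, 'u, 'x) module_scheme"
    and W :: "('k, 'u, 'x) module_scheme" and F m n
  assume a: "hopf_bimodule K I la ra (flip rc) (flip lc) tw e eps adm M" "hopf_bimodule K I la ra (flip rc) (flip lc) tw e eps adm N"
  then have [simp]: "obj M" "obj N" by simp_all
  assume [simp]: "module K W"
  {
    assume F: "bil I (tp M N) W F"
    note [simp] = F bilinear_comps[OF F] bilinear_mapsD[OF F]
    show "lin (tp M N) W (\<lambda>x. bimodule_data.SL (flip rc) W (tp M N) x F)"
      by (simp add: flip_SL)
    assume "m \<in> carrier M" "n \<in> carrier N"
    then show "bimodule_data.SL (flip rc) W (tp M N) (p M N m n) F = bimodule_data.SL (flip rc) W M m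
      (\<lambda>g x. bimodule_data.SL (flip rc) W N n (\<lambda>h y. F (mul g h) (p M N x y)))"
      by (simp add: flip_SL SR_p)
  }
  {
    assume F: "bil (tp M N) I W F"
    note [simp] = F bilinear_comps[OF F] bilinear_mapsD[OF F]
    show "lin (tp M N) W (\<lambda>x. bimodule_data.SR (flip lc) W (tp M N) x F)"
      by (simp add: flip_SR)
    assume "m \<in> carrier M" "n \<in> carrier N"
    then show "bimodule_data.SR (flip lc) W (tp M N) (p M N m n) F = bimodule_data.SR (flip lc) W M m
      (\<lambda>x g. bimodule_data.SR (flip lc) W N n (\<lambda>y h. F (p M N x y) (mul g h)))"
      by (simp add: flip_SR SL_p)
  }
qed (simp_all add: flip_SL SR_I Si_lin Si_left Si_right Si_tw rep_carrier tp_admissible p_bil p_bal ST_rep ST_lin ST_p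
    la_tp_bil ra_tp_bil la_p ra_p tw_p)

text \<open>Congruence rules are keyed by the head constant, which \<open>flip.SL\<close> shares
  with \<open>SL\<close>; the rules of the interpretation would otherwise displace the original
  ones.\<close>

declare flip.SL_cong [cong del] flip.SR_cong [cong del] flip.ST_cong [cong del]
declare SL_cong [cong] SR_cong [cong] ST_cong [cong]

lemma flip_Q: "flip.Q M m = SL M M m (\<lambda>h x. ra M x (Si h))"
  by (simp add: flip.Q_def flip_SR)

lemma flip_P: "flip.P M m = SR M M m (\<lambda>x h. la M (Si h) x)"
  by (simp add: flip.P_def flip_SL)

text \<open>Both maps respect the two actions, so m_[-1] and n_(1) can be pulled out, and only the
  value on coinvariants matters. \<open>la_P\<close> and \<open>ra_Q\<close> then reassemble m and
  n.\<close>

lemma flip_br_sigma: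
  assumes objs [simp]: "obj M" "obj N" and x: "x \<in> carrier (tp M N)"
  shows "flip.sigma N M (sigma M N x) = x"
proof (rule tp_ext[where W="tp M N" and f="\<lambda>x. flip.sigma N M (sigma M N x)" and g="\<lambda>x. x", OF _ _ _ _ _ _ x])
  let ?V = "tp N M"
  have fo: "flip.obj M" "flip.obj N" by simp_all
  note hom = flip.homD[OF flip.sigma_hom[OF fo(2,1)]]
  note [simp] = hom(1,7,8)
  show "lin (tp M N) (tp M N) (\<lambda>x. flip.sigma N M (sigma M N x))" by (simp add: sigma_lin)
  fix m n assume [simp]: "m \<in> carrier M" "n \<in> carrier N"
  \<comment> \<open>Q(y) is right coinvariant and P(x) left coinvariant. Both coactions occurring in
    the flipped braiding are trivial on them, so its projections fix them and it only exchanges the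
    factors.\<close>
  have 1: "flip.sigma N M (p N M (Q N y) (P M x)) = p M N (P M x) (Q N y)"
    if [simp]: "x \<in> carrier M" "y \<in> carrier N" for x y
    by (simp add: flip.sigma_p flip.br_def flip_SL flip_SR flip_P flip_Q SR_Q SL_P ra_one la_one)
  have "flip.sigma N M (sigma M N (p M N m n)) = SL (tp M N) M m (\<lambda>g x. SR (tp M N) N n (\<lambda>y k.
      flip.sigma N M (p N M (la N g (Q N y)) (ra M (P M x) k))))"
    by (simp add: sigma_p br_def map_SL[where V="?V" and W="tp M N" and f="flip.sigma N M"]
      map_SR[where V="?V" and W="tp M N" and f="flip.sigma N M"])
  also have "\<dots> = SL (tp M N) M m (\<lambda>g x. SR (tp M N) N n (\<lambda>y k.
      flip.sigma N M (la ?V g (ra ?V (p N M (Q N y) (P M x)) k))))"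
    by (simp add: la_p ra_p)
  also have "\<dots> = SL (tp M N) M m (\<lambda>g x. SR (tp M N) N n (\<lambda>y k. p M N (la M g (P M x)) (ra N (Q N y) k)))"
    by (simp add: hom(2,3) 1, simp add: la_p ra_p)
  also have "\<dots> = SL (tp M N) M m (\<lambda>g x. p M N (la M g (P M x)) n)"
    using map_SR[where V=N and W="tp M N" and f="\<lambda>z. p M N _ z" and m=n and M=N and F="\<lambda>y k. ra N (Q N y) k", symmetric]
    by (simp add: ra_Q)
  also have "\<dots> = p M N m n"
    using map_SL[where V=M and W="tp M N" and f="\<lambda>z. p M N z n" and m=m and M=M and F="\<lambda>g x. la M g (P M x)", symmetric]
    by (simp add: la_P)
  finally show "flip.sigma N M (sigma M N (p M N m n)) = p M N m n" .
qed simp_all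

text \<open>The preceding lemma for the exchanged structure, in which S and \<open>Si\<close> have
  swapped their roles; exchanging the coactions twice returns the original ones.\<close>

lemma sigma_flip_sigma:
  assumes objs [simp]: "obj M" "obj N" and x: "x \<in> carrier (tp N M)"
  shows "sigma M N (flip.sigma N M x) = x"
proof -
  interpret f: hopf_tensor_bij K I la ra "flip rc" "flip lc" tw e eps adm Si tp rep p S
    by unfold_locales simp_all
  show ?thesis
    using f.flip_br_sigma[of N M x] x by simp
qed

end

section \<open>Powers of the structure automorphisms\<close>

lemma twist_zero [simp]: "twist V (0, 0, 0, 0) x = x"
  by (simp add: twist.simps int_iterate_def)

text \<open>The definition changes at zero from powers of f to powers of its inverse. On the half
  line where the exponent decreases in absolute value the step has to cancel one
  application.\<close>

lemma int_iterate_succ: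
  assumes f: "bij_betw f A A" and x: "x \<in> A"
  shows "int_iterate A f n x \<in> A" (is ?a)
    and "int_iterate A f (n + 1) x = f (int_iterate A f n x)" (is ?b)
    and "int_iterate A f (n - 1) x = inv_into A f (int_iterate A f n x)" (is ?c)
proof -
  have fA: "f y \<in> A" if "y \<in> A" for y using f that by (auto simp: bij_betw_def)
  have gA: "inv_into A f y \<in> A" if "y \<in> A" for y using bij_betwE[OF bij_betw_inv_into[OF f]] that by blast
  have fg: "f (inv_into A f y) = y" "inv_into A f (f y) = y" if "y \<in> A" for y
    using bij_betw_inv_into_right[OF f that] bij_betw_inv_into_left[OF f that] by simp_all
  have it: "(f ^^ k) x \<in> A" "(inv_into A f ^^ k) x \<in> A" for k
    using x by (induction k) (auto simp: fA gA)
  show ?a by (simp add: int_iterate_def it)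
  show ?b
  proof (cases "0 \<le> n")
    case True
    then have "nat (n + 1) = Suc (nat n)" by simp
    with True show ?thesis by (simp add: int_iterate_def)
  next
    case False
    then have "nat (- n) = Suc (nat (- (n + 1)))" by simp
    with False show ?thesis by (auto simp: int_iterate_def fg it)
  qed
  show ?c
  proof (cases "0 < n")
    case True
    then have "nat n = Suc (nat (n - 1))" by simp
    with True show ?thesis by (auto simp: int_iterate_def fg it)
  next
    case False
    then have "nat (- (n - 1)) = Suc (nat (- n))" by simp
    with False show ?thesis by (auto simp: int_iterate_def)
  qed
qed

lemma int_iterate_add:
  assumes f: "bij_betw f A A" and x: "x \<in> A"
  shows "int_iterate A f m (int_iterate A f n x) = int_iterate A f (m + n) x"
proof (induction m rule: int_induct[where k=0])
  case base
  show ?case by (simp add: int_iterate_def)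
next
  case (step1 i)
  have "int_iterate A f (i + 1) (int_iterate A f n x) = f (int_iterate A f (i + n) x)"
    using step1 by (simp only: int_iterate_succ(2)[OF f int_iterate_succ(1)[OF f x]])
  also have "\<dots> = int_iterate A f (i + n + 1) x"
    by (simp only: int_iterate_succ(2)[OF f x])
  finally show ?case by (simp only: ac_simps)
next
  case (step2 i)
  have "int_iterate A f (i - 1) (int_iterate A f n x) = inv_into A f (int_iterate A f (i + n) x)"
    using step2 by (simp only: int_iterate_succ(3)[OF f int_iterate_succ(1)[OF f x]])
  also have "\<dots> = int_iterate A f (i + n - 1) x"
    by (simp only: int_iterate_succ(3)[OF f x])
  finally show ?case by (simp add: algebra_simps)
qed

lemma int_iterate_commute:
  assumes f: "bij_betw f A A" and g: "\<And>x. x \<in> A \<Longrightarrow> g x \<in> A"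
    and fg: "\<And>x. x \<in> A \<Longrightarrow> g (f x) = f (g x)" and x: "x \<in> A"
  shows "g (int_iterate A f n x) = int_iterate A f n (g x)"
proof (induction n rule: int_induct[where k=0])
  case base
  show ?case by (simp add: int_iterate_def)
next
  case (step1 i)
  then show ?case
    by (simp add: int_iterate_succ(1,2)[OF f] x g fg)
next
  case (step2 i)
  have y: "int_iterate A f i x \<in> A" by (rule int_iterate_succ(1)[OF f x])
  let ?z = "inv_into A f (int_iterate A f i x)"
  have z: "?z \<in> A" using bij_betwE[OF bij_betw_inv_into[OF f]] y by blast
  have "f (g ?z) = g (int_iterate A f i x)"
    using fg[OF z] bij_betw_inv_into_right[OF f y] by simp
  then have "g ?z = inv_into A f (g (int_iterate A f i x))"
    using bij_betw_inv_into_left[OF f g[OF z]] by simp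
  then show ?case
    using step2 by (simp add: int_iterate_succ(3)[OF f] x g)
qed

lemma linear_int_iterate:
  assumes V: "module K V" and f: "f \<in> linear_automorphisms K V"
  shows "int_iterate (carrier V) f n \<in> linear_maps K V V"
proof -
  interpret V: module K V by (fact V)
  have b: "bij_betw f (carrier V) (carrier V)" and lf: "f \<in> linear_maps K V V"
    using f by (auto simp: linear_automorphisms_def)
  have lg: "inv_into (carrier V) f \<in> linear_maps K V V"
    by (rule linear_inverse[OF V V lf])
      (auto simp: bij_betw_inv_into_right[OF b] bij_betw_inv_into_left[OF b] bij_betwE[OF bij_betw_inv_into[OF b]])
  show ?thesis
  proof (induction n rule: int_induct[where k=0])
    case base
    show ?case using linear_id[of K V] by (simp add: int_iterate_def id_def)
  next
    case (step1 i)
    show ?case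
      by (rule iffD2[OF linear_cong[OF V int_iterate_succ(2)[OF b]] linear_comp[OF lf step1(2)]])
  next
    case (step2 i)
    show ?case
      by (rule iffD2[OF linear_cong[OF V int_iterate_succ(3)[OF b]] linear_comp[OF lg step2(2)]])
  qed
qed

text \<open>The exponents form the group Z^4, generated by four unit vectors. A statement about all
  twists thus needs a check of the four structure maps and closure under composition and
  inversion.\<close>

lemma twist_induct:
  fixes R :: "int \<times> int \<times> int \<times> int \<Rightarrow> bool"
  assumes zero: "R (0, 0, 0, 0)"
    and gen: "R (1, 0, 0, 0)" "R (0, 1, 0, 0)" "R (0, 0, 1, 0)" "R (0, 0, 0, 1)"
    and add: "\<And>s t. R s \<Longrightarrow> R t \<Longrightarrow> R (s + t)" and neg: "\<And>t. R t \<Longrightarrow> R (- t)"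
  shows "R t"
proof -
  have *: "R (f n)" if f: "f 0 = (0, 0, 0, 0)" "\<And>i. f (i + 1) = f i + f 1" "\<And>i. f (i - 1) = f i + - f 1" "R (f 1)"
    for f :: "int \<Rightarrow> int \<times> int \<times> int \<times> int" and n
    by (induction n rule: int_induct[where k=0]) (auto simp: f(1) zero f(2,3) simp del: add_uminus_conv_diff intro!: add neg f(4))
  obtain a b c d where t: "t = (a, b, c, d)" by (cases t)
  have "R (a, 0, 0, 0)" by (rule *[of "\<lambda>a. (a, 0, 0, 0)"]) (simp_all add: gen)
  moreover have "R (0, b, 0, 0)" by (rule *[of "\<lambda>b. (0, b, 0, 0)"]) (simp_all add: gen)
  moreover have "R (0, 0, c, 0)" by (rule *[of "\<lambda>c. (0, 0, c, 0)"]) (simp_all add: gen)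
  moreover have "R (0, 0, 0, d)" by (rule *[of "\<lambda>d. (0, 0, 0, d)"]) (simp_all add: gen)
  ultimately have "R ((a, 0, 0, 0) + ((0, b, 0, 0) + ((0, 0, c, 0) + (0, 0, 0, d))))"
    by (intro add)
  then show ?thesis by (simp add: t)
qed

context bihom_space
begin

lemma module_V: "module K V"
  by unfold_locales

lemma struct_auto:
  "\<alpha> V \<in> linear_automorphisms K V" "\<beta> V \<in> linear_automorphisms K V"
  "\<omega> V \<in> linear_automorphisms K V" "\<psi> V \<in> linear_automorphisms K V"
  using structure_automorphisms by auto

lemma struct_bij:
  "bij_betw (\<alpha> V) (carrier V) (carrier V)" "bij_betw (\<beta> V) (carrier V) (carrier V)"
  "bij_betw (\<omega> V) (carrier V) (carrier V)" "bij_betw (\<psi> V) (carrier V) (carrier V)"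
  using struct_auto by (auto simp: linear_automorphisms_def)

lemma iterate_closed [simp]:
  assumes "x \<in> carrier V"
  shows "int_iterate (carrier V) (\<alpha> V) n x \<in> carrier V" "int_iterate (carrier V) (\<beta> V) n x \<in> carrier V"
    "int_iterate (carrier V) (\<omega> V) n x \<in> carrier V" "int_iterate (carrier V) (\<psi> V) n x \<in> carrier V"
  using int_iterate_succ(1)[OF _ assms] struct_bij by blast+

lemma iterate_commute:
  assumes f: "f \<in> {\<alpha> V, \<beta> V, \<omega> V, \<psi> V}" and g: "g \<in> {\<alpha> V, \<beta> V, \<omega> V, \<psi> V}" and x: "x \<in> carrier V"
  shows "int_iterate (carrier V) g m (int_iterate (carrier V) f n x)
    = int_iterate (carrier V) f n (int_iterate (carrier V) g m x)"
proof -
  have b: "bij_betw f (carrier V) (carrier V)" "bij_betw g (carrier V) (carrier V)"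
    using f g struct_bij by auto
  have c: "f y \<in> carrier V" "g y \<in> carrier V" if "y \<in> carrier V" for y
    using b that by (auto simp: bij_betw_def)
  have 1: "f (int_iterate (carrier V) g m y) = int_iterate (carrier V) g m (f y)" if "y \<in> carrier V" for y
    by (rule int_iterate_commute[where g=f, OF b(2) c(1) structure_commute[OF f g] that])
  show ?thesis
    by (rule int_iterate_commute[where g="int_iterate (carrier V) g m", OF b(1) int_iterate_succ(1)[OF b(2)] 1[symmetric] x])
qed

lemma twist_closed [simp]: "x \<in> carrier V \<Longrightarrow> twist V t x \<in> carrier V"
  by (cases t) (simp add: twist.simps)

text \<open>The twists form an action of Z^4: since all integer iterates commute, equal structure
  maps can be collected and their exponents added.\<close>

lemma twist_twist:
  assumes x: "x \<in> carrier V"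
  shows "twist V s (twist V t x) = twist V (s + t) x"
proof -
  obtain a b c d a' b' c' d' where st: "s = (a, b, c, d)" "t = (a', b', c', d')"
    by (cases s, cases t) auto
  have ab: "int_iterate (carrier V) (\<beta> V) n (int_iterate (carrier V) (\<alpha> V) m y) = int_iterate (carrier V) (\<alpha> V) m (int_iterate (carrier V) (\<beta> V) n y)"
    and ac: "int_iterate (carrier V) (\<omega> V) n (int_iterate (carrier V) (\<alpha> V) m y) = int_iterate (carrier V) (\<alpha> V) m (int_iterate (carrier V) (\<omega> V) n y)"
    and ad: "int_iterate (carrier V) (\<psi> V) n (int_iterate (carrier V) (\<alpha> V) m y) = int_iterate (carrier V) (\<alpha> V) m (int_iterate (carrier V) (\<psi> V) n y)"
    and bc: "int_iterate (carrier V) (\<omega> V) n (int_iterate (carrier V) (\<beta> V) m y) = int_iterate (carrier V) (\<beta> V) m (int_iterate (carrier V) (\<omega> V) n y)"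
    and bd: "int_iterate (carrier V) (\<psi> V) n (int_iterate (carrier V) (\<beta> V) m y) = int_iterate (carrier V) (\<beta> V) m (int_iterate (carrier V) (\<psi> V) n y)"
    and cd: "int_iterate (carrier V) (\<psi> V) n (int_iterate (carrier V) (\<omega> V) m y) = int_iterate (carrier V) (\<omega> V) m (int_iterate (carrier V) (\<psi> V) n y)"
    if "y \<in> carrier V" for m n y
    using that by (simp_all add: iterate_commute)
  show ?thesis
    using x by (simp add: st twist.simps ab ac ad bc bd cd int_iterate_add[OF struct_bij(1)] int_iterate_add[OF struct_bij(2)]
        int_iterate_add[OF struct_bij(3)] int_iterate_add[OF struct_bij(4)])
qed

lemma twist_gen:
  assumes x: "x \<in> carrier V"
  shows "\<alpha> V x = twist V (1, 0, 0, 0) x" "\<beta> V x = twist V (0, 1, 0, 0) x"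
    "\<omega> V x = twist V (0, 0, 1, 0) x" "\<psi> V x = twist V (0, 0, 0, 1) x"
  by (simp_all add: twist.simps int_iterate_def)

lemma twist_lin: "twist V t \<in> linear_maps K V V"
proof -
  obtain a b c d where t: "t = (a, b, c, d)" by (cases t)
  have "(\<lambda>x. twist V (a, b, c, d) x) \<in> linear_maps K V V"
    unfolding twist.simps
    by (intro linear_comp[OF linear_int_iterate[OF module_V struct_auto(1)]]
        linear_comp[OF linear_int_iterate[OF module_V struct_auto(2)]]
        linear_comp[OF linear_int_iterate[OF module_V struct_auto(3)]]
        linear_int_iterate[OF module_V struct_auto(4)])
  then show ?thesis by (simp add: t)
qed

lemma twist_neg: "x \<in> carrier V \<Longrightarrow> twist V (- t) (twist V t x) = x" "x \<in> carrier V \<Longrightarrow> twist V t (twist V (- t) x) = x"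
  by (cases t, simp add: twist_twist)+

end

section \<open>Untwisting BiHom-four-angle Hopf modules\<close>

subsection \<open>Tensor products of vector spaces\<close>

lemma tensor_eq_fields:
  assumes "tensor_eq K V W R xs ys"
    and "carrier V' = carrier V" "zero V' = zero V" "add V' = add V" "smult V' = smult V"
    and "carrier W' = carrier W" "zero W' = zero W" "add W' = add W" "smult W' = smult W"
  shows "tensor_eq K V' W' R xs ys"
  using assms(1)
proof induction
  case (trans xs ys zs)
  show ?case by (rule tensor_eq.trans[OF trans.IH])
next
  case (zero w)
  show ?case using tensor_eq.zero[of w W' K V' R] zero by (simp add: assms)
next
  case (add_left v v' w)
  show ?case using tensor_eq.add_left[of v V' v' w W' K R] add_left by (simp add: assms)
next
  case (add_right v w w')
  show ?case using tensor_eq.add_right[of v V' w W' w' K R] add_right by (simp add: assms)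
next
  case (scalar c v w)
  show ?case using tensor_eq.scalar[of c K v V' w W' R] scalar by (simp add: assms)
qed (simp_all add: assms tensor_eq.refl tensor_eq.sym tensor_eq.append tensor_eq.commute tensor_eq.relation)

lemma tensor_eq_cong:
  assumes "carrier V' = carrier V" "zero V' = zero V" "add V' = add V" "smult V' = smult V"
    and "carrier W' = carrier W" "zero W' = zero W" "add W' = add W" "smult W' = smult W"
  shows "tensor_eq K V' W' R = tensor_eq K V W R"
proof (intro ext iffI)
  fix xs ys
  show "tensor_eq K V' W' R xs ys \<Longrightarrow> tensor_eq K V W R xs ys"
    by (erule tensor_eq_fields) (simp_all add: assms)
  show "tensor_eq K V W R xs ys \<Longrightarrow> tensor_eq K V' W' R xs ys"
    by (erule tensor_eq_fields) (simp_all add: assms)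
qed

text \<open>A space and its enriched record, such as H and \<open>hunit H\<close> or
  \<open>htensor_space\<close> and \<open>htensor\<close>, thereby have literally equal tensor
  products instead of merely isomorphic ones.\<close>

lemma quotient_tensor_cong:
  assumes "carrier V' = carrier V" "zero V' = zero V" "add V' = add V" "smult V' = smult V"
    and "carrier W' = carrier W" "zero W' = zero W" "add W' = add W" "smult W' = smult W"
  shows "tensor_class K V' W' R = tensor_class K V W R" "quotient_tensor K V' W' R = quotient_tensor K V W R"
    "tensor K V' W' = tensor K V W" "pure K V' W' = pure K V W"
proof -
  show 1: "tensor_class K V' W' R = tensor_class K V W R" for R
    by (simp add: fun_eq_iff tensor_class_def tensor_eq_cong[OF assms])
  show 2: "quotient_tensor K V' W' R = quotient_tensor K V W R" for R
    by (simp add: quotient_tensor_def 1 assms)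
  show "tensor K V' W' = tensor K V W" "pure K V' W' = pure K V W"
    by (simp_all add: tensor_def pure_def[abs_def] 1 2)
qed

context
  fixes K :: "('k, 'z) ring_scheme" and V :: "('k, 'a universe, 'x) module_scheme"
    and W :: "('k, 'a universe, 'y) module_scheme"
  assumes V: "module K V" and W: "module K W"
begin

interpretation balanced_tensor K V W "{}"
  by (intro balanced_tensor.intro V W balanced_tensor_axioms.intro) simp

lemma module_tensor: "module K (tensor K V W)"
  by (simp add: tensor_def module_quotient)

lemma pure_bil: "pure K V W \<in> bilinear_maps K V W (tensor K V W)"
  using cls_bilinear by (simp add: tensor_def pure_def[abs_def])

lemma sweedler_tensor_lin:
  "module K U \<Longrightarrow> F \<in> bilinear_maps K V W U \<Longrightarrow> (\<lambda>x. sweedler U x F) \<in> linear_maps K (tensor K V W) U"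
  unfolding tensor_def by (rule sweedler_linear) auto

lemma sweedler_tensor_pure:
  "module K U \<Longrightarrow> F \<in> bilinear_maps K V W U \<Longrightarrow> v \<in> carrier V \<Longrightarrow> w \<in> carrier W
    \<Longrightarrow> sweedler U (pure K V W v w) F = F v w"
  unfolding pure_def by (rule sweedler_pure) auto

lemma sweedler_tensor_id: "x \<in> carrier (tensor K V W) \<Longrightarrow> sweedler (tensor K V W) x (pure K V W) = x"
  using sweedler_cls by (simp add: tensor_def pure_def[abs_def])

lemma summands_tensor: "x \<in> carrier (tensor K V W) \<Longrightarrow> set (summands x) \<subseteq> carrier V \<times> carrier W"
  unfolding tensor_def by (rule cls_summands)

end

subsection \<open>The untwisted structure maps\<close>

text \<open>
  If \<open>H\<close> is a BiHom-bialgebra, then \<open>\<alpha>\<^sup>-\<^sup>1(a) \<beta>\<^sup>-\<^sup>1(b)\<close> and \<open>\<omega>\<^sup>-\<^sup>1(c\<^sub>1) \<otimes> \<psi>\<^sup>-\<^sup>1(c\<^sub>2)\<close> define an ordinary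
  bialgebra, over which the following maps make \<open>M\<close> an ordinary Hopf bimodule.
\<close>

definition ula :: "('k, 'a universe, 'x) bihom_bialgebra_scheme \<Rightarrow> ('k, 'a) fa_object
    \<Rightarrow> 'a universe \<Rightarrow> 'a universe \<Rightarrow> 'a universe" where
  "ula H M h m = lact M (twist H (-1, 0, 0, 0) h) (twist M (0, -1, 0, 0) m)"

definition ura :: "('k, 'a universe, 'x) bihom_bialgebra_scheme \<Rightarrow> ('k, 'a) fa_object
    \<Rightarrow> 'a universe \<Rightarrow> 'a universe \<Rightarrow> 'a universe" where
  "ura H M m h = ract M (twist M (-1, 0, 0, 0) m) (twist H (0, -1, 0, 0) h)"

text \<open>On the carrier the filter keeps every entry, as the proof of \<open>raw_SL\<close>
  shows; it provides the typing that \<open>bimodule_data\<close> demands for every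
  argument.\<close>

definition ulc :: "('k, 'a universe, 'x) bihom_bialgebra_scheme \<Rightarrow> ('k, 'a) fa_object
    \<Rightarrow> 'a universe \<Rightarrow> ('a universe \<times> 'a universe) list" where
  "ulc H M m = filter (\<lambda>y. y \<in> carrier H \<times> carrier M)
     (map (\<lambda>(h, x). (twist H (0, 0, -1, 0) h, twist M (0, 0, 0, -1) x)) (summands (lcoact M m)))"

definition urc :: "('k, 'a universe, 'x) bihom_bialgebra_scheme \<Rightarrow> ('k, 'a) fa_object
    \<Rightarrow> 'a universe \<Rightarrow> ('a universe \<times> 'a universe) list" where
  "urc H M m = filter (\<lambda>y. y \<in> carrier M \<times> carrier H)
     (map (\<lambda>(x, h). (twist M (0, 0, -1, 0) x, twist H (0, 0, 0, -1) h)) (summands (rcoact M m)))"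

definition fa_data :: "('k, 'z) ring_scheme \<Rightarrow> ('k, 'a universe, 'x) bihom_bialgebra_scheme \<Rightarrow> ('k, 'a) fa_object \<Rightarrow> bool"
where
  "fa_data K H M \<longleftrightarrow> bihom_space K M \<and> lact M \<in> bilinear_maps K H M M \<and> ract M \<in> bilinear_maps K M H M \<and>
     lcoact M \<in> linear_maps K M (tensor K H M) \<and> rcoact M \<in> linear_maps K M (tensor K M H)"

section \<open>The algebra as a module over itself\<close>

lemma hunit_simps [simp]:
  "carrier (hunit H) = carrier H" "mult (hunit H) = mult H" "one (hunit H) = one H" "zero (hunit H) = zero H"
  "add (hunit H) = add H" "smult (hunit H) = smult H" "\<alpha> (hunit H) = \<alpha> H" "\<beta> (hunit H) = \<beta> H"
  "\<omega> (hunit H) = \<omega> H" "\<psi> (hunit H) = \<psi> H" "lact (hunit H) = mult H" "ract (hunit H) = mult H"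
  "lcoact (hunit H) = comult H" "rcoact (hunit H) = comult H"
  by (simp_all add: hunit_def)

lemma hunit_maps [simp]:
  "linear_maps K (hunit H) W = linear_maps K H W" "linear_maps K W (hunit H) = linear_maps K W H"
  "bilinear_maps K (hunit H) V W = bilinear_maps K H V W" "bilinear_maps K V (hunit H) W = bilinear_maps K V H W"
  "bilinear_maps K V W (hunit H) = bilinear_maps K V W H"
  "trilinear K (hunit H) V X W = trilinear K H V X W" "trilinear K V (hunit H) X W = trilinear K V H X W"
  "trilinear K V X (hunit H) W = trilinear K V X H W"
  by (simp_all add: linear_maps_def bilinear_maps_def trilinear_def fun_eq_iff)

lemma hunit_tensor [simp]:
  "tensor K (hunit H) V = tensor K H V" "tensor K V (hunit H) = tensor K V H"
  "pure K (hunit H) V = pure K H V" "pure K V (hunit H) = pure K V H"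
  by (rule quotient_tensor_cong; simp)+

lemma twist_hunit [simp]: "twist (hunit H) t = twist H t"
  by (cases t) (simp add: fun_eq_iff twist.simps)

lemma sum_pairs_hunit [simp]: "sum_pairs (hunit H) F xs = sum_pairs H F xs"
  by (simp add: sum_pairs_def)

lemma sweedler_hunit [simp]: "sweedler (hunit H) x F = sweedler H x F"
  by (simp add: sweedler_def)

lemma module_hunit: "module K H \<Longrightarrow> module K (hunit H)"
  by (erule module_cong) simp_all

lemma bihom_space_hunit:
  assumes "bihom_space K H" shows "bihom_space K (hunit H)"
proof -
  interpret bihom_space K H by fact
  have "field K" by unfold_locales
  then show ?thesis
    by (intro bihom_space.intro module_hunit module_V bihom_space_axioms.intro)
      (use structure_automorphisms structure_commute in \<open>auto simp: linear_automorphisms_def\<close>)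
qed

lemma (in bihom_bialgebra) hunit_four_angle: "four_angle_hopf_module K H (hunit H)"
proof (intro four_angle_hopf_module.intro four_angle_hopf_module_axioms.intro bihom_space_hunit)
  show "bihom_bialgebra K H" "bihom_space K H" by unfold_locales
  show "\<And>\<theta> \<theta>' m. (\<theta>, \<theta>') \<in> {(\<alpha> H, \<alpha> (hunit H)), (\<beta> H, \<beta> (hunit H)), (\<omega> H, \<omega> (hunit H)), (\<psi> H, \<psi> (hunit H))}
      \<Longrightarrow> m \<in> carrier (hunit H) \<Longrightarrow> lcoact (hunit H) (\<theta>' m) =
         sweedler (tensor K H (hunit H)) (lcoact (hunit H) m) (\<lambda>h m0. pure K H (hunit H) (\<theta> h) (\<theta>' m0))"
    using structure_comult by auto
  show "\<And>\<theta> \<theta>' m. (\<theta>, \<theta>') \<in> {(\<alpha> H, \<alpha> (hunit H)), (\<beta> H, \<beta> (hunit H)), (\<omega> H, \<omega> (hunit H)), (\<psi> H, \<psi> (hunit H))}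
      \<Longrightarrow> m \<in> carrier (hunit H) \<Longrightarrow> rcoact (hunit H) (\<theta>' m) =
         sweedler (tensor K (hunit H) H) (rcoact (hunit H) m) (\<lambda>m0 h. pure K (hunit H) H (\<theta>' m0) (\<theta> h))"
    using structure_comult by auto
  fix h m assume hm: "h \<in> carrier H" "m \<in> carrier (hunit H)"
  have sc: "sweedler (tensor K H H) (comult H h) (\<lambda>h1 h2. sweedler (tensor K H H) (comult H m) (\<lambda>g1 g2. pure K H H (h1 \<otimes>\<^bsub>H\<^esub> g1) (h2 \<otimes>\<^bsub>H\<^esub> g2)))
    = comult H (h \<otimes>\<^bsub>H\<^esub> m)"
    using hm comult_mult by simp
  show "lcoact (hunit H) (ract (hunit H) m h) = sweedler (tensor K H (hunit H)) (lcoact (hunit H) m) (\<lambda>g m0.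
          sweedler (tensor K H (hunit H)) (comult H h) (\<lambda>h1 h2. pure K H (hunit H) (g \<otimes>\<^bsub>H\<^esub> h1) (ract (hunit H) m0 h2)))"
    using hm comult_mult by simp
qed (use structure_mult in \<open>auto simp: mult_bilinear comult_linear bihom_assoc left_one right_one right_counit left_counit
      bihom_coassoc comult_mult\<close>)

locale untwist = bihom_hopf_algebra K H S
  for K :: "('k, 'z) ring_scheme" and H :: "('k, 'a universe, 'x) bihom_bialgebra_scheme" and S
begin

text \<open>H is represented by the unit object because the abstract theory needs the algebra and
  its modules in one record type.\<close>

sublocale U: bimodule_data K "hunit H" "ula H" "ura H" "ulc H" "urc H" twist "one H" "counit H" "fa_data K H"
  by unfold_locales (auto simp: ulc_def urc_def)

abbreviation adm where "adm M \<equiv> fa_data K H M"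
abbreviation fah :: "('k, 'a) fa_object \<Rightarrow> bool" where "fah M \<equiv> four_angle_hopf_module K H M"
abbreviation hbim where "hbim M \<equiv> hopf_bimodule K (hunit H) (ula H) (ura H) (ulc H) (urc H) twist (one H) (counit H) (fa_data K H) M"
abbreviation lin where "lin V W f \<equiv> f \<in> linear_maps K V W"
abbreviation bil where "bil U V W F \<equiv> F \<in> bilinear_maps K U V W"
abbreviation tri where "tri U V X W F \<equiv> trilinear K U V X W F"

declare U.SL_cong [cong del] U.SR_cong [cong del]

text \<open>The algebra leg is typed by \<open>carrier H\<close>, and \<open>=simp=>\<close> makes
  the simplifier normalise the premises, so that an element of \<open>carrier (hunit H)\<close> is
  known as an element of \<open>carrier H\<close>.\<close>

lemma SL_cong' [cong]:
  assumes "m = m'" "\<And>a b. a \<in> carrier H =simp=> b \<in> carrier M =simp=> F a b = G a b"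
  shows "U.SL W M m F = U.SL W M m' G"
  using assms unfolding simp_implies_def by (intro U.SL_cong) simp_all

lemma SR_cong' [cong]:
  assumes "m = m'" "\<And>a b. a \<in> carrier M =simp=> b \<in> carrier H =simp=> F a b = G a b"
  shows "U.SR W M m F = U.SR W M m' G"
  using assms unfolding simp_implies_def by (intro U.SR_cong) simp_all

lemma SL_closed' [simp]:
  assumes "module K W" "\<And>a b. a \<in> carrier H \<Longrightarrow> b \<in> carrier M \<Longrightarrow> F a b \<in> carrier W"
  shows "U.SL W M m F \<in> carrier W"
  using assms by (intro U.SL_closed) simp_all

lemma SR_closed' [simp]:
  assumes "module K W" "\<And>a b. a \<in> carrier M \<Longrightarrow> b \<in> carrier H \<Longrightarrow> F a b \<in> carrier W"
  shows "U.SR W M m F \<in> carrier W"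
  using assms by (intro U.SR_closed) simp_all

lemma lin_SL' [simp]:
  assumes "module K V" "module K W"
    and "\<And>a b. a \<in> carrier H \<Longrightarrow> b \<in> carrier M \<Longrightarrow> lin V W (\<lambda>x. F x a b)"
  shows "lin V W (\<lambda>x. U.SL W M m (F x))"
  using assms by (intro U.lin_SL) simp_all

lemma lin_SR' [simp]:
  assumes "module K V" "module K W"
    and "\<And>a b. a \<in> carrier M \<Longrightarrow> b \<in> carrier H \<Longrightarrow> lin V W (\<lambda>x. F x a b)"
  shows "lin V W (\<lambda>x. U.SR W M m (F x))"
  using assms by (intro U.lin_SR) simp_all

lemma D_closed [simp]:
  assumes "module K W" "\<And>a b. a \<in> carrier H \<Longrightarrow> b \<in> carrier H \<Longrightarrow> F a b \<in> carrier W"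
  shows "U.SL W (hunit H) m F \<in> carrier W"
  using assms by (intro U.SL_closed) simp_all

lemma D_lin [simp]:
  assumes "module K V" "module K W"
    and "\<And>a b. a \<in> carrier H \<Longrightarrow> b \<in> carrier H \<Longrightarrow> lin V W (\<lambda>x. F x a b)"
  shows "lin V W (\<lambda>x. U.SL W (hunit H) m (F x))"
  using assms by (intro U.lin_SL) simp_all

lemma map_D:
  assumes "lin V W f" "module K V" "module K W"
    and "\<And>a b. a \<in> carrier H \<Longrightarrow> b \<in> carrier H \<Longrightarrow> F a b \<in> carrier V"
  shows "f (U.SL V (hunit H) m F) = U.SL W (hunit H) m (\<lambda>a b. f (F a b))"
  using assms by (intro U.map_SL) simp_all

lemma modH [simp]: "module K H"
  by (rule module_V)

lemma admD:
  assumes "adm M"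
  shows "bihom_space K M" "bil H M M (lact M)" "bil M H M (ract M)"
    "lin M (tensor K H M) (lcoact M)" "lin M (tensor K M H) (rcoact M)"
  using assms by (simp_all add: fa_data_def)

lemma adm_mod [simp]: "adm M \<Longrightarrow> module K M"
  by (rule bihom_space.module_V[OF admD(1)])

lemma adm_tensor [simp]: "adm M \<Longrightarrow> module K (tensor K H M)" "adm M \<Longrightarrow> module K (tensor K M H)"
  "module K (tensor K H H)"
  by (simp_all add: module_tensor)

lemma adm_I [simp]: "adm (hunit H)"
  unfolding fa_data_def using mult_bilinear comult_linear by (simp add: bihom_space_hunit[OF bihom_space_axioms])

lemma closed [simp]:
  "\<lbrakk>adm M; h \<in> carrier H; m \<in> carrier M\<rbrakk> \<Longrightarrow> lact M h m \<in> carrier M"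
  "\<lbrakk>adm M; h \<in> carrier H; m \<in> carrier M\<rbrakk> \<Longrightarrow> ract M m h \<in> carrier M"
  "\<lbrakk>adm M; m \<in> carrier M\<rbrakk> \<Longrightarrow> lcoact M m \<in> carrier (tensor K H M)"
  "\<lbrakk>adm M; m \<in> carrier M\<rbrakk> \<Longrightarrow> rcoact M m \<in> carrier (tensor K M H)"
  "\<lbrakk>adm M; m \<in> carrier M\<rbrakk> \<Longrightarrow> twist M t m \<in> carrier M"
  "\<lbrakk>a \<in> carrier H; b \<in> carrier H\<rbrakk> \<Longrightarrow> a \<otimes>\<^bsub>H\<^esub> b \<in> carrier H"
  "a \<in> carrier H \<Longrightarrow> comult H a \<in> carrier (tensor K H H)"
  "\<lbrakk>module K V; module K W; v \<in> carrier V; w \<in> carrier W\<rbrakk> \<Longrightarrow> pure K V W v w \<in> carrier (tensor K V W)"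
  by (rule bilinear_mapsD(3)[OF admD(2)] bilinear_mapsD(3)[OF admD(3)] linear_mapsD(1)[OF admD(4)] linear_mapsD(1)[OF admD(5)]
      bihom_space.twist_closed[OF admD(1)] bilinear_mapsD(3)[OF mult_bilinear] linear_mapsD(1)[OF comult_linear]
      bilinear_mapsD(3)[OF pure_bil]; assumption)+

lemma tws:
  "\<lbrakk>adm M; x \<in> carrier M\<rbrakk> \<Longrightarrow> twist M s (twist M t x) = twist M (s + t) x"
  "\<lbrakk>adm M; x \<in> carrier M\<rbrakk> \<Longrightarrow> \<alpha> M x = twist M (1, 0, 0, 0) x"
  "\<lbrakk>adm M; x \<in> carrier M\<rbrakk> \<Longrightarrow> \<beta> M x = twist M (0, 1, 0, 0) x"
  "\<lbrakk>adm M; x \<in> carrier M\<rbrakk> \<Longrightarrow> \<omega> M x = twist M (0, 0, 1, 0) x"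
  "\<lbrakk>adm M; x \<in> carrier M\<rbrakk> \<Longrightarrow> \<psi> M x = twist M (0, 0, 0, 1) x"
  by (rule bihom_space.twist_twist[OF admD(1)] bihom_space.twist_gen[OF admD(1)]; assumption)+

lemmas twH = twist_twist twist_gen

lemma lin_rules [simp]:
  "lin V V (\<lambda>x. x)"
  "\<lbrakk>adm M; h \<in> carrier H; lin V M g\<rbrakk> \<Longrightarrow> lin V M (\<lambda>x. lact M h (g x))"
  "\<lbrakk>adm M; m \<in> carrier M; lin V H g\<rbrakk> \<Longrightarrow> lin V M (\<lambda>x. lact M (g x) m)"
  "\<lbrakk>adm M; h \<in> carrier H; lin V M g\<rbrakk> \<Longrightarrow> lin V M (\<lambda>x. ract M (g x) h)"
  "\<lbrakk>adm M; m \<in> carrier M; lin V H g\<rbrakk> \<Longrightarrow> lin V M (\<lambda>x. ract M m (g x))"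
  "\<lbrakk>a \<in> carrier H; lin V H g\<rbrakk> \<Longrightarrow> lin V H (\<lambda>x. a \<otimes>\<^bsub>H\<^esub> g x)"
  "\<lbrakk>a \<in> carrier H; lin V H g\<rbrakk> \<Longrightarrow> lin V H (\<lambda>x. g x \<otimes>\<^bsub>H\<^esub> a)"
  "\<lbrakk>adm M; lin V M g\<rbrakk> \<Longrightarrow> lin V M (\<lambda>x. twist M t (g x))"
  "lin V H g \<Longrightarrow> lin V H (\<lambda>x. twist H t (g x))"
  "\<lbrakk>module K W; module K W'; w \<in> carrier W; lin V W' g\<rbrakk> \<Longrightarrow> lin V (tensor K W W') (\<lambda>x. pure K W W' w (g x))"
  "\<lbrakk>module K W; module K W'; w' \<in> carrier W'; lin V W g\<rbrakk> \<Longrightarrow> lin V (tensor K W W') (\<lambda>x. pure K W W' (g x) w')"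
  "\<lbrakk>adm M; lin V M g\<rbrakk> \<Longrightarrow> lin V (tensor K H M) (\<lambda>x. lcoact M (g x))"
  "\<lbrakk>adm M; lin V M g\<rbrakk> \<Longrightarrow> lin V (tensor K M H) (\<lambda>x. rcoact M (g x))"
  "lin V H g \<Longrightarrow> lin V (tensor K H H) (\<lambda>x. comult H (g x))"
  by (rule linear_id bilinear_comps[OF admD(2)] bilinear_comps[OF admD(3)] bilinear_comps[OF mult_bilinear]
      linear_comp[OF bihom_space.twist_lin[OF admD(1)]] linear_comp[OF twist_lin] bilinear_comps[OF pure_bil]
      linear_comp[OF admD(4)] linear_comp[OF admD(5)] linear_comp[OF comult_linear]; assumption)+

lemmas bilI [simp] = bilinear_mapsI[of _ _ K]
lemmas triI [simp] = trilinearI[of _ _ _ K]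

text \<open>The dictionary for left coactions: the BiHom legs are \<omega>(h) and \<psi>(x), where h
  and x are the legs of the ordinary coaction. \<open>raw_SR\<close> and \<open>raw_D\<close> are
  the dictionaries for the right coaction and the coproduct.\<close>

lemma raw_SL:
  assumes M [simp]: "adm M" and m [simp]: "m \<in> carrier M"
  shows "sweedler W (lcoact M m) F = U.SL W M m (\<lambda>h x. F (twist H (0, 0, 1, 0) h) (twist M (0, 0, 0, 1) x))"
proof -
  have s: "set (summands (lcoact M m)) \<subseteq> carrier H \<times> carrier M"
    by (rule summands_tensor[of K]) simp_all
  then have "ulc H M m = map (\<lambda>(h, x). (twist H (0, 0, -1, 0) h, twist M (0, 0, 0, -1) x)) (summands (lcoact M m))"
    unfolding ulc_def by (intro filter_True) auto
  then show ?thesis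
    using s by (auto simp: U.SL_def sweedler_def sum_pairs_map tws twH intro!: sum_pairs_fun_cong)
qed

lemma raw_SR:
  assumes M [simp]: "adm M" and m [simp]: "m \<in> carrier M"
  shows "sweedler W (rcoact M m) F = U.SR W M m (\<lambda>x h. F (twist M (0, 0, 1, 0) x) (twist H (0, 0, 0, 1) h))"
proof -
  have s: "set (summands (rcoact M m)) \<subseteq> carrier M \<times> carrier H"
    by (rule summands_tensor[of K]) simp_all
  then have "urc H M m = map (\<lambda>(x, h). (twist M (0, 0, -1, 0) x, twist H (0, 0, 0, -1) h)) (summands (rcoact M m))"
    unfolding urc_def by (intro filter_True) auto
  then show ?thesis
    using s by (auto simp: U.SR_def sweedler_def sum_pairs_map tws twH intro!: sum_pairs_fun_cong)
qed

lemma raw_D: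
  "h \<in> carrier H \<Longrightarrow> sweedler W (comult H h) F
    = U.SL W (hunit H) h (\<lambda>a b. F (twist H (0, 0, 1, 0) a) (twist H (0, 0, 0, 1) b))"
  using raw_SL[OF adm_I, of h W F] by simp

lemma urc_I: "urc H (hunit H) = ulc H (hunit H)" and ura_I: "ura H (hunit H) = ula H (hunit H)"
  by (simp_all add: fun_eq_iff urc_def ulc_def ura_def ula_def)

lemma lcoact_eq:
  "\<lbrakk>adm M; m \<in> carrier M\<rbrakk> \<Longrightarrow> lcoact M m
    = U.SL (tensor K H M) M m (\<lambda>h x. pure K H M (twist H (0, 0, 1, 0) h) (twist M (0, 0, 0, 1) x))"
  using sweedler_tensor_id[of K H M "lcoact M m"] by (simp add: raw_SL)

lemma rcoact_eq:
  "\<lbrakk>adm M; m \<in> carrier M\<rbrakk> \<Longrightarrow> rcoact M m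
    = U.SR (tensor K M H) M m (\<lambda>x h. pure K M H (twist M (0, 0, 1, 0) x) (twist H (0, 0, 0, 1) h))"
  using sweedler_tensor_id[of K M H "rcoact M m"] by (simp add: raw_SR)

lemma SL_arg:
  assumes M [simp]: "adm M" and W [simp]: "module K W" and g: "lin V M g" and F: "bil H M W F"
  shows "lin V W (\<lambda>x. U.SL W M (g x) F)"
proof -
  note [simp] = bilinear_comps[OF F]
  let ?F = "\<lambda>h x. F (twist H (0, 0, -1, 0) h) (twist M (0, 0, 0, -1) x)"
  have "lin M W (\<lambda>m. sweedler W (lcoact M m) ?F)"
    by (rule linear_comp[OF sweedler_tensor_lin[of K H M]]) simp_all
  then have "lin M W (\<lambda>m. U.SL W M m F)"
    by (rule iffD1[OF linear_cong, rotated -1]) (simp_all add: raw_SL tws twH)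
  then show ?thesis by (rule linear_comp[OF _ g])
qed

lemma SR_arg:
  assumes M [simp]: "adm M" and W [simp]: "module K W" and g: "lin V M g" and F: "bil M H W F"
  shows "lin V W (\<lambda>x. U.SR W M (g x) F)"
proof -
  note [simp] = bilinear_comps[OF F]
  let ?F = "\<lambda>x h. F (twist M (0, 0, -1, 0) x) (twist H (0, 0, 0, -1) h)"
  have "lin M W (\<lambda>m. sweedler W (rcoact M m) ?F)"
    by (rule linear_comp[OF sweedler_tensor_lin[of K M H]]) simp_all
  then have "lin M W (\<lambda>m. U.SR W M m F)"
    by (rule iffD1[OF linear_cong, rotated -1]) (simp_all add: raw_SR tws twH)
  then show ?thesis by (rule linear_comp[OF _ g])
qed

lemma D_arg [simp]:
  assumes "module K W" "lin V H g" "bil H H W F"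
  shows "lin V W (\<lambda>x. U.SL W (hunit H) (g x) F)"
  using SL_arg[OF adm_I] assms by simp

declare SL_arg [simp] SR_arg [simp]

lemma map_SL:
  assumes "lin V W f" "module K V" "module K W"
    and "\<And>a b. a \<in> carrier H \<Longrightarrow> b \<in> carrier M \<Longrightarrow> F a b \<in> carrier V"
  shows "f (U.SL V M m F) = U.SL W M m (\<lambda>a b. f (F a b))"
  using assms by (intro U.map_SL) simp_all

lemma map_SR:
  assumes "lin V W f" "module K V" "module K W"
    and "\<And>a b. a \<in> carrier M \<Longrightarrow> b \<in> carrier H \<Longrightarrow> F a b \<in> carrier V"
  shows "f (U.SR V M m F) = U.SR W M m (\<lambda>a b. f (F a b))"
  using assms by (intro U.map_SR) simp_all

text \<open>The coassociativity axioms are equations in right-bracketed threefold tensor products.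
  This lift evaluates them on an arbitrary trilinear map.\<close>

lemma lift3:
  assumes [simp]: "module K U" "module K V" "module K X" "module K W" and G: "tri U V X W G"
  shows "lin (tensor K U (tensor K V X)) W (\<lambda>z. sweedler W z (\<lambda>a y. sweedler W y (G a)))"
    and "\<lbrakk>a \<in> carrier U; y \<in> carrier (tensor K V X)\<rbrakk>
      \<Longrightarrow> sweedler W (pure K U (tensor K V X) a y) (\<lambda>a y. sweedler W y (G a)) = sweedler W y (G a)"
    and "\<lbrakk>a \<in> carrier U; v \<in> carrier V; x \<in> carrier X\<rbrakk> \<Longrightarrow> sweedler W (pure K V X v x) (G a) = G a v x"
proof -
  note [simp] = trilinearD[OF G]
  have b: "bil U (tensor K V X) W (\<lambda>a y. sweedler W y (G a))"
  proof (rule bilinear_mapsI)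
    fix u assume "u \<in> carrier U"
    then show "lin (tensor K V X) W (\<lambda>y. sweedler W y (G u))" by (simp add: sweedler_tensor_lin)
  next
    fix y assume y: "y \<in> carrier (tensor K V X)"
    have "set (summands y) \<subseteq> carrier V \<times> carrier X" by (rule summands_tensor[OF _ _ y]) simp_all
    then show "lin U W (\<lambda>a. sweedler W y (G a))"
      unfolding sweedler_def by (intro linear_sum_pairs) auto
  qed
  show "lin (tensor K U (tensor K V X)) W (\<lambda>z. sweedler W z (\<lambda>a y. sweedler W y (G a)))"
    by (rule sweedler_tensor_lin[OF _ _ _ b]) (simp_all add: module_tensor)
  show "\<lbrakk>a \<in> carrier U; y \<in> carrier (tensor K V X)\<rbrakk>
      \<Longrightarrow> sweedler W (pure K U (tensor K V X) a y) (\<lambda>a y. sweedler W y (G a)) = sweedler W y (G a)"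
    by (rule sweedler_tensor_pure[OF _ _ _ b]) (simp_all add: module_tensor)
  show "\<lbrakk>a \<in> carrier U; v \<in> carrier V; x \<in> carrier X\<rbrakk> \<Longrightarrow> sweedler W (pure K V X v x) (G a) = G a v x"
    by (rule sweedler_tensor_pure) simp_all
qed

subsection \<open>From BiHom-modules to ordinary Hopf bimodules\<close>

context
  fixes M assumes M: "fah M"
begin

lemma adm_fah [simp]: "adm M"
proof -
  interpret M: four_angle_hopf_module K H M by (rule M)
  show ?thesis
    by (simp add: fa_data_def M.lact_bilinear M.ract_bilinear M.lcoact_linear M.rcoact_linear M.M.bihom_space_axioms)
qed

lemma tw_lact: "\<lbrakk>h \<in> carrier H; m \<in> carrier M\<rbrakk> \<Longrightarrow> twist M t (lact M h m) = lact M (twist H t h) (twist M t m)"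
proof (induction t arbitrary: h m rule: twist_induct)
  case 5
  show ?case using four_angle_hopf_module.structure_lact[OF M, of "\<psi> H" "\<psi> M" h m] 5 by (simp add: tws twH)
next
  case 4
  show ?case using four_angle_hopf_module.structure_lact[OF M, of "\<omega> H" "\<omega> M" h m] 4 by (simp add: tws twH)
next
  case 3
  show ?case using four_angle_hopf_module.structure_lact[OF M, of "\<beta> H" "\<beta> M" h m] 3 by (simp add: tws twH)
next
  case 2
  show ?case using four_angle_hopf_module.structure_lact[OF M, of "\<alpha> H" "\<alpha> M" h m] 2 by (simp add: tws twH)
next
  case (6 s t)
  then show ?case
    using tws(1)[OF adm_fah, of "lact M h m" s t] by (simp add: tws(1)[symmetric] twist_twist[symmetric])
next
  case (7 t)
  \<comment> \<open>The action is written as the twist by t of an action on arguments moved back by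
    t, to which the hypothesis for t applies.\<close>
  have "twist M (- t) (lact M h m) = twist M (- t) (twist M t (lact M (twist H (- t) h) (twist M (- t) m)))"
    using 7 by (simp add: twist_neg bihom_space.twist_neg[OF admD(1)])
  then show ?case
    using 7(2,3) by (simp add: bihom_space.twist_neg[OF admD(1)])
qed simp

lemma tw_ract: "\<lbrakk>h \<in> carrier H; m \<in> carrier M\<rbrakk> \<Longrightarrow> twist M t (ract M m h) = ract M (twist M t m) (twist H t h)"
proof (induction t arbitrary: h m rule: twist_induct)
  case 5
  show ?case using four_angle_hopf_module.structure_ract[OF M, of "\<psi> H" "\<psi> M" h m] 5 by (simp add: tws twH)
next
  case 4
  show ?case using four_angle_hopf_module.structure_ract[OF M, of "\<omega> H" "\<omega> M" h m] 4 by (simp add: tws twH)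
next
  case 3
  show ?case using four_angle_hopf_module.structure_ract[OF M, of "\<beta> H" "\<beta> M" h m] 3 by (simp add: tws twH)
next
  case 2
  show ?case using four_angle_hopf_module.structure_ract[OF M, of "\<alpha> H" "\<alpha> M" h m] 2 by (simp add: tws twH)
next
  case (6 s t)
  then show ?case
    using tws(1)[OF adm_fah, of "ract M m h" s t] by (simp add: tws(1)[symmetric] twist_twist[symmetric])
next
  case (7 t)
  have "twist M (- t) (ract M m h) = twist M (- t) (twist M t (ract M (twist M (- t) m) (twist H (- t) h)))"
    using 7 by (simp add: twist_neg bihom_space.twist_neg[OF admD(1)])
  then show ?case
    using 7(2,3) by (simp add: bihom_space.twist_neg[OF admD(1)])
qed simp

lemma SL_struct:
  assumes W [simp]: "module K W" and F: "bil H M W F" and m [simp]: "m \<in> carrier M"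
    and th: "(\<theta>, \<theta>', t) \<in> {(\<alpha> H, \<alpha> M, (1, 0, 0, 0)), (\<beta> H, \<beta> M, (0, 1, 0, 0)), (\<omega> H, \<omega> M, (0, 0, 1, 0)), (\<psi> H, \<psi> M, (0, 0, 0, 1))}"
  shows "U.SL W M (twist M t m) F = U.SL W M m (\<lambda>a b. F (twist H t a) (twist M t b))"
proof -
  note [simp] = bilinear_comps[OF F]
  \<comment> \<open>The inverse powers cancel those inserted by \<open>raw_SL\<close>, so evaluating
    \<open>?f\<close> on the BiHom coaction gives the ordinary Sweedler sum of F.\<close>
  let ?F = "\<lambda>h x. F (twist H (0, 0, -1, 0) h) (twist M (0, 0, 0, -1) x)"
  let ?f = "\<lambda>z. sweedler W z ?F"
  have tt: "(0, 0, - 1, 0) + (t + (0, 0, 1, 0)) = t" "(0, 0, 0, - 1) + (t + (0, 0, 0, 1)) = t"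
    by (cases t; simp)+
  have t: "\<theta> h = twist H t h" "\<theta>' x = twist M t x" if "h \<in> carrier H" "x \<in> carrier M" for h x
    using th that by (auto simp: twH tws)
  have f: "lin (tensor K H M) W ?f" by (rule sweedler_tensor_lin) simp_all
  have p: "?f (pure K H M a b) = ?F a b" if "a \<in> carrier H" "b \<in> carrier M" for a b
    by (rule sweedler_tensor_pure) (simp_all add: that)
  have "lcoact M (\<theta>' m) = sweedler (tensor K H M) (lcoact M m) (\<lambda>h m0. pure K H M (\<theta> h) (\<theta>' m0))"
    by (rule four_angle_hopf_module.structure_lcoact[OF M _ m]) (use th in auto)
  then have "?f (lcoact M (\<theta>' m)) = ?f (sweedler (tensor K H M) (lcoact M m) (\<lambda>h m0. pure K H M (\<theta> h) (\<theta>' m0)))"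
    by simp
  also have "?f (lcoact M (\<theta>' m)) = U.SL W M (twist M t m) F"
    using t[of "one H"] by (simp add: raw_SL tws twH one_closed)
  also have "?f (sweedler (tensor K H M) (lcoact M m) (\<lambda>h m0. pure K H M (\<theta> h) (\<theta>' m0)))
    = U.SL W M m (\<lambda>a b. F (twist H t a) (twist M t b))"
    by (simp add: raw_SL t map_SL[OF f] p tws twH tt)
  finally show ?thesis .
qed

lemma SR_struct:
  assumes W [simp]: "module K W" and F: "bil M H W F" and m [simp]: "m \<in> carrier M"
    and th: "(\<theta>, \<theta>', t) \<in> {(\<alpha> H, \<alpha> M, (1, 0, 0, 0)), (\<beta> H, \<beta> M, (0, 1, 0, 0)), (\<omega> H, \<omega> M, (0, 0, 1, 0)), (\<psi> H, \<psi> M, (0, 0, 0, 1))}"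
  shows "U.SR W M (twist M t m) F = U.SR W M m (\<lambda>a b. F (twist M t a) (twist H t b))"
proof -
  note [simp] = bilinear_comps[OF F]
  let ?F = "\<lambda>x h. F (twist M (0, 0, -1, 0) x) (twist H (0, 0, 0, -1) h)"
  let ?f = "\<lambda>z. sweedler W z ?F"
  have tt: "(0, 0, - 1, 0) + (t + (0, 0, 1, 0)) = t" "(0, 0, 0, - 1) + (t + (0, 0, 0, 1)) = t"
    by (cases t; simp)+
  have t: "\<theta> h = twist H t h" "\<theta>' x = twist M t x" if "h \<in> carrier H" "x \<in> carrier M" for h x
    using th that by (auto simp: twH tws)
  have f: "lin (tensor K M H) W ?f" by (rule sweedler_tensor_lin) simp_all
  have p: "?f (pure K M H b a) = ?F b a" if "a \<in> carrier H" "b \<in> carrier M" for a b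
    by (rule sweedler_tensor_pure) (simp_all add: that)
  have "rcoact M (\<theta>' m) = sweedler (tensor K M H) (rcoact M m) (\<lambda>m0 h. pure K M H (\<theta>' m0) (\<theta> h))"
    by (rule four_angle_hopf_module.structure_rcoact[OF M _ m]) (use th in auto)
  then have "?f (rcoact M (\<theta>' m)) = ?f (sweedler (tensor K M H) (rcoact M m) (\<lambda>m0 h. pure K M H (\<theta>' m0) (\<theta> h)))"
    by simp
  also have "?f (rcoact M (\<theta>' m)) = U.SR W M (twist M t m) F"
    using t[of "one H"] by (simp add: raw_SR tws twH one_closed)
  also have "?f (sweedler (tensor K M H) (rcoact M m) (\<lambda>m0 h. pure K M H (\<theta>' m0) (\<theta> h)))
    = U.SR W M m (\<lambda>a b. F (twist M t a) (twist H t b))"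
    by (simp add: raw_SR t map_SR[OF f] p tws twH tt)
  finally show ?thesis .
qed

text \<open>The four generating twists are covered by \<open>SL_struct\<close>. The induction
  generalises over the test map because splitting off one twist composes F with it.\<close>

lemma SL_twist:
  assumes W [simp]: "module K W"
  shows "\<lbrakk>bil H M W F; m \<in> carrier M\<rbrakk> \<Longrightarrow> U.SL W M (twist M t m) F = U.SL W M m (\<lambda>a b. F (twist H t a) (twist M t b))"
proof (induction t arbitrary: F m rule: twist_induct)
  case (6 s t)
  note [simp] = bilinear_comps[OF 6(3)] 6(4)
  have "U.SL W M (twist M (s + t) m) F = U.SL W M (twist M s (twist M t m)) F" by (simp add: tws)
  also have "\<dots> = U.SL W M m (\<lambda>a b. F (twist H s (twist H t a)) (twist M s (twist M t b)))"
    by (simp add: 6(1,3) 6(2)[of "\<lambda>a b. F (twist H s a) (twist M s b)"])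
  finally show ?case by (simp add: tws twH)
next
  case (7 t)
  note [simp] = bilinear_comps[OF 7(2)] 7(3)
  have "U.SL W M m (\<lambda>a b. F (twist H (- t) a) (twist M (- t) b))
    = U.SL W M (twist M t (twist M (- t) m)) (\<lambda>a b. F (twist H (- t) a) (twist M (- t) b))"
    by (simp add: bihom_space.twist_neg[OF admD(1)])
  also have "\<dots> = U.SL W M (twist M (- t) m) F"
    by (subst 7(1)) (simp_all add: twist_neg bihom_space.twist_neg[OF admD(1)])
  finally show ?case ..
qed (use SL_struct[OF W] in auto)

lemma SR_twist:
  assumes W [simp]: "module K W"
  shows "\<lbrakk>bil M H W F; m \<in> carrier M\<rbrakk> \<Longrightarrow> U.SR W M (twist M t m) F = U.SR W M m (\<lambda>a b. F (twist M t a) (twist H t b))"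
proof (induction t arbitrary: F m rule: twist_induct)
  case (6 s t)
  note [simp] = bilinear_comps[OF 6(3)] 6(4)
  have "U.SR W M (twist M (s + t) m) F = U.SR W M (twist M s (twist M t m)) F" by (simp add: tws)
  also have "\<dots> = U.SR W M m (\<lambda>a b. F (twist M s (twist M t a)) (twist H s (twist H t b)))"
    by (simp add: 6(1,3) 6(2)[of "\<lambda>a b. F (twist M s a) (twist H s b)"])
  finally show ?case by (simp add: tws twH)
next
  case (7 t)
  note [simp] = bilinear_comps[OF 7(2)] 7(3)
  have "U.SR W M m (\<lambda>a b. F (twist M (- t) a) (twist H (- t) b))
    = U.SR W M (twist M t (twist M (- t) m)) (\<lambda>a b. F (twist M (- t) a) (twist H (- t) b))"
    by (simp add: bihom_space.twist_neg[OF admD(1)])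
  also have "\<dots> = U.SR W M (twist M (- t) m) F"
    by (subst 7(1)) (simp_all add: twist_neg bihom_space.twist_neg[OF admD(1)])
  finally show ?case ..
qed (use SR_struct[OF W] in auto)

end

lemma D_twist:
  "\<lbrakk>module K W; bil H H W F; h \<in> carrier H\<rbrakk>
    \<Longrightarrow> U.SL W (hunit H) (twist H t h) F = U.SL W (hunit H) h (\<lambda>a b. F (twist H t a) (twist H t b))"
  using SL_twist[OF hunit_four_angle, of W F h t] by simp

lemma mul_eq: "U.mul a b = twist H (-1, 0, 0, 0) a \<otimes>\<^bsub>H\<^esub> twist H (0, -1, 0, 0) b"
  by (simp add: U.mul_def ula_def)

lemma tw_mult: "\<lbrakk>a \<in> carrier H; b \<in> carrier H\<rbrakk> \<Longrightarrow> twist H t (a \<otimes>\<^bsub>H\<^esub> b) = twist H t a \<otimes>\<^bsub>H\<^esub> twist H t b"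
  using tw_lact[OF hunit_four_angle, of a b t] by simp

context
  fixes M assumes M: "fah M"
begin

interpretation M: four_angle_hopf_module K H M by (rule M)

lemma admM [simp]: "adm M" by (rule adm_fah[OF M])

lemmas twM = tw_lact[OF M] tw_ract[OF M]

context
  fixes W :: "('k, 'u, 't) module_scheme" and m
  assumes W [simp]: "module K W" and m [simp]: "m \<in> carrier M"
begin

lemma SL_coassoc_fah:
  assumes F: "tri H H M W F"
  shows "U.SL W M m (\<lambda>a x. U.SL W M x (\<lambda>b y. F a b y)) = U.SL W M m (\<lambda>h y. U.SL W (hunit H) h (\<lambda>a b. F a b y))"
proof -
  note [simp] = F trilinear_comp[OF F] trilinearD[OF F]
  \<comment> \<open>On both sides of BiHom coassociativity the three ordinary legs carry \<omega>^2,
    \<omega> \<psi> and \<psi>^2: one power comes from each coaction or coproduct and one from the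
    map applied to an outer leg. G removes them.\<close>
  define G where "G a b c = F (twist H (0, 0, -2, 0) a) (twist H (0, 0, -1, -1) b) (twist M (0, 0, 0, -2) c)" for a b c
  let ?X = "tensor K H M"
  let ?Y = "tensor K H (tensor K H M)"
  let ?f = "\<lambda>z. sweedler W z (\<lambda>a y. sweedler W y (G a))"
  have G: "tri H H M W G" unfolding G_def[abs_def] by simp
  note [simp] = trilinear_comp[OF G] trilinearD[OF G] module_tensor
  note f = lift3[OF modH modH adm_mod[OF admM] W G]
  have "?f (sweedler ?Y (lcoact M m) (\<lambda>h x. pure K H ?X (\<omega> H h) (lcoact M x)))
    = U.SL W M m (\<lambda>a x. U.SL W M x (\<lambda>b y. F a b y))"
    by (simp add: raw_SL map_SL[OF f(1)] f(2,3) SL_twist[OF M] tws twH) (simp add: G_def tws twH)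
  moreover have "?f (sweedler ?Y (lcoact M m) (\<lambda>h x. sweedler ?Y (comult H h) (\<lambda>a b. pure K H ?X a (pure K H M b (\<psi> M x)))))
    = U.SL W M m (\<lambda>h y. U.SL W (hunit H) h (\<lambda>a b. F a b y))"
    by (simp add: raw_SL raw_D map_D[OF f(1)] map_SL[OF f(1)] f(2,3) D_twist tws twH) (simp add: G_def tws twH)
  ultimately show ?thesis using M.lcoact_coassoc[OF m] by simp
qed

lemma SR_coassoc_fah:
  assumes F: "tri M H H W F"
  shows "U.SR W M m (\<lambda>x b. U.SR W M x (\<lambda>y a. F y a b)) = U.SR W M m (\<lambda>y h. U.SL W (hunit H) h (\<lambda>a b. F y a b))"
proof -
  note [simp] = F trilinear_comp[OF F] trilinearD[OF F]
  define G where "G a b c = F (twist M (0, 0, -2, 0) a) (twist H (0, 0, -1, -1) b) (twist H (0, 0, 0, -2) c)" for a b c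
  let ?X = "tensor K H H"
  let ?Y = "tensor K M (tensor K H H)"
  let ?f = "\<lambda>z. sweedler W z (\<lambda>a y. sweedler W y (G a))"
  have G: "tri M H H W G" unfolding G_def[abs_def] by simp
  note [simp] = trilinear_comp[OF G] trilinearD[OF G] module_tensor
  note f = lift3[OF adm_mod[OF admM] modH modH W G]
  have "?f (sweedler ?Y (rcoact M m) (\<lambda>x h. pure K M ?X (\<omega> M x) (comult H h)))
    = U.SR W M m (\<lambda>y h. U.SL W (hunit H) h (\<lambda>a b. F y a b))"
    by (simp add: raw_SR raw_D map_D[OF f(1)] map_SR[OF f(1)] f(2,3) D_twist tws twH) (simp add: G_def tws twH)
  moreover have "?f (sweedler ?Y (rcoact M m) (\<lambda>x h. sweedler ?Y (rcoact M x) (\<lambda>y g. pure K M ?X y (pure K H H g (\<psi> H h)))))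
    = U.SR W M m (\<lambda>x b. U.SR W M x (\<lambda>y a. F y a b))"
    by (simp add: raw_SR map_SR[OF f(1)] f(2,3) SR_twist[OF M] tws twH) (simp add: G_def tws twH)
  ultimately show ?thesis using M.rcoact_coassoc[OF m] by simp
qed

lemma SL_SR_fah:
  assumes F: "tri H M H W F"
  shows "U.SL W M m (\<lambda>a x. U.SR W M x (\<lambda>y b. F a y b)) = U.SR W M m (\<lambda>x b. U.SL W M x (\<lambda>a y. F a y b))"
proof -
  note [simp] = F trilinear_comp[OF F] trilinearD[OF F]
  define G where "G a b c = F (twist H (0, 0, -2, 0) a) (twist M (0, 0, -1, -1) b) (twist H (0, 0, 0, -2) c)" for a b c
  let ?X = "tensor K M H"
  let ?Y = "tensor K H (tensor K M H)"
  let ?f = "\<lambda>z. sweedler W z (\<lambda>a y. sweedler W y (G a))"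
  have G: "tri H M H W G" unfolding G_def[abs_def] by simp
  note [simp] = trilinear_comp[OF G] trilinearD[OF G] module_tensor
  note f = lift3[OF modH adm_mod[OF admM] modH W G]
  have "?f (sweedler ?Y (lcoact M m) (\<lambda>h x. pure K H ?X (\<omega> H h) (rcoact M x)))
    = U.SL W M m (\<lambda>a x. U.SR W M x (\<lambda>y b. F a y b))"
    by (simp add: raw_SL raw_SR map_SL[OF f(1)] f(2,3) SR_twist[OF M] tws twH) (simp add: G_def tws twH)
  moreover have "?f (sweedler ?Y (rcoact M m) (\<lambda>x k. sweedler ?Y (lcoact M x) (\<lambda>h y. pure K H ?X h (pure K M H y (\<psi> H k)))))
    = U.SR W M m (\<lambda>x b. U.SL W M x (\<lambda>a y. F a y b))"
    by (simp add: raw_SL raw_SR map_SR[OF f(1)] map_SL[OF f(1)] f(2,3) SL_twist[OF M] tws twH) (simp add: G_def tws twH)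
  ultimately show ?thesis using M.bicomodule[OF m] by simp
qed

context
  fixes h assumes h [simp]: "h \<in> carrier H"
begin

lemma SL_lact_fah:
  assumes F: "bil H M W F"
  shows "U.SL W M (lact M h m) F = U.SL W (hunit H) h (\<lambda>a b. U.SL W M m (\<lambda>g x. F (a \<otimes>\<^bsub>H\<^esub> g) (lact M b x)))"
proof -
  note [simp] = bilinear_comps[OF F] bilinear_mapsD[OF F]
  let ?F = "\<lambda>h x. F (twist H (0, 0, -1, 0) h) (twist M (0, 0, 0, -1) x)"
  let ?f = "\<lambda>z. sweedler W z ?F"
  have f: "lin (tensor K H M) W ?f" by (rule sweedler_tensor_lin) simp_all
  have p: "?f (pure K H M a b) = ?F a b" if "a \<in> carrier H" "b \<in> carrier M" for a b
    by (rule sweedler_tensor_pure) (simp_all add: that)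
  have "?f (lcoact M (lact M h m)) = U.SL W M (lact M h m) F"
    by (simp add: raw_SL tws twH)
  moreover have "?f (sweedler (tensor K H M) (comult H h) (\<lambda>a b. sweedler (tensor K H M) (lcoact M m) (\<lambda>g x.
      pure K H M (a \<otimes>\<^bsub>H\<^esub> g) (lact M b x)))) = U.SL W (hunit H) h (\<lambda>a b. U.SL W M m (\<lambda>g x. F (a \<otimes>\<^bsub>H\<^esub> g) (lact M b x)))"
    by (simp add: raw_SL raw_D map_D[OF f] map_SL[OF f] p tws twH twM tw_mult)
  ultimately show ?thesis using M.lcoact_lact[OF h m] by simp
qed

lemma SL_ract_fah:
  assumes F: "bil H M W F"
  shows "U.SL W M (ract M m h) F = U.SL W (hunit H) h (\<lambda>a b. U.SL W M m (\<lambda>g x. F (g \<otimes>\<^bsub>H\<^esub> a) (ract M x b)))"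
proof -
  note [simp] = bilinear_comps[OF F] bilinear_mapsD[OF F]
  let ?F = "\<lambda>h x. F (twist H (0, 0, -1, 0) h) (twist M (0, 0, 0, -1) x)"
  let ?f = "\<lambda>z. sweedler W z ?F"
  have f: "lin (tensor K H M) W ?f" by (rule sweedler_tensor_lin) simp_all
  have p: "?f (pure K H M a b) = ?F a b" if "a \<in> carrier H" "b \<in> carrier M" for a b
    by (rule sweedler_tensor_pure) (simp_all add: that)
  have "?f (lcoact M (ract M m h)) = U.SL W M (ract M m h) F"
    by (simp add: raw_SL tws twH)
  moreover have "?f (sweedler (tensor K H M) (lcoact M m) (\<lambda>g x. sweedler (tensor K H M) (comult H h) (\<lambda>a b.
      pure K H M (g \<otimes>\<^bsub>H\<^esub> a) (ract M x b)))) = U.SL W M m (\<lambda>g x. U.SL W (hunit H) h (\<lambda>a b. F (g \<otimes>\<^bsub>H\<^esub> a) (ract M x b)))"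
    by (simp add: raw_SL raw_D map_D[OF f] map_SL[OF f] p tws twH twM tw_mult)
  moreover have "U.SL W M m (\<lambda>g x. U.SL W (hunit H) h (\<lambda>a b. F (g \<otimes>\<^bsub>H\<^esub> a) (ract M x b)))
    = U.SL W (hunit H) h (\<lambda>a b. U.SL W M m (\<lambda>g x. F (g \<otimes>\<^bsub>H\<^esub> a) (ract M x b)))"
    by (rule U.SL_SL_commute; simp)
  ultimately show ?thesis using M.lcoact_ract[OF h m] by simp
qed

lemma SR_lact_fah:
  assumes F: "bil M H W F"
  shows "U.SR W M (lact M h m) F = U.SL W (hunit H) h (\<lambda>a b. U.SR W M m (\<lambda>x g. F (lact M a x) (b \<otimes>\<^bsub>H\<^esub> g)))"
proof -
  note [simp] = bilinear_comps[OF F] bilinear_mapsD[OF F]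
  let ?F = "\<lambda>x h. F (twist M (0, 0, -1, 0) x) (twist H (0, 0, 0, -1) h)"
  let ?f = "\<lambda>z. sweedler W z ?F"
  have f: "lin (tensor K M H) W ?f" by (rule sweedler_tensor_lin) simp_all
  have p: "?f (pure K M H a b) = ?F a b" if "a \<in> carrier M" "b \<in> carrier H" for a b
    by (rule sweedler_tensor_pure) (simp_all add: that)
  have "?f (rcoact M (lact M h m)) = U.SR W M (lact M h m) F"
    by (simp add: raw_SR tws twH)
  moreover have "?f (sweedler (tensor K M H) (comult H h) (\<lambda>a b. sweedler (tensor K M H) (rcoact M m) (\<lambda>x g.
      pure K M H (lact M a x) (b \<otimes>\<^bsub>H\<^esub> g)))) = U.SL W (hunit H) h (\<lambda>a b. U.SR W M m (\<lambda>x g. F (lact M a x) (b \<otimes>\<^bsub>H\<^esub> g)))"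
    by (simp add: raw_SR raw_D map_D[OF f] map_SL[OF f] map_SR[OF f] p tws twH twM tw_mult)
  ultimately show ?thesis using M.rcoact_lact[OF h m] by simp
qed

lemma SR_ract_fah:
  assumes F: "bil M H W F"
  shows "U.SR W M (ract M m h) F = U.SL W (hunit H) h (\<lambda>a b. U.SR W M m (\<lambda>x g. F (ract M x a) (g \<otimes>\<^bsub>H\<^esub> b)))"
proof -
  note [simp] = bilinear_comps[OF F] bilinear_mapsD[OF F]
  let ?F = "\<lambda>x h. F (twist M (0, 0, -1, 0) x) (twist H (0, 0, 0, -1) h)"
  let ?f = "\<lambda>z. sweedler W z ?F"
  have f: "lin (tensor K M H) W ?f" by (rule sweedler_tensor_lin) simp_all
  have p: "?f (pure K M H a b) = ?F a b" if "a \<in> carrier M" "b \<in> carrier H" for a b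
    by (rule sweedler_tensor_pure) (simp_all add: that)
  have "?f (rcoact M (ract M m h)) = U.SR W M (ract M m h) F"
    by (simp add: raw_SR tws twH)
  moreover have "?f (sweedler (tensor K M H) (rcoact M m) (\<lambda>x g. sweedler (tensor K M H) (comult H h) (\<lambda>a b.
      pure K M H (ract M x a) (g \<otimes>\<^bsub>H\<^esub> b)))) = U.SR W M m (\<lambda>x g. U.SL W (hunit H) h (\<lambda>a b. F (ract M x a) (g \<otimes>\<^bsub>H\<^esub> b)))"
    by (simp add: raw_SR raw_D map_D[OF f] map_SL[OF f] map_SR[OF f] p tws twH twM tw_mult)
  moreover have "U.SR W M m (\<lambda>x g. U.SL W (hunit H) h (\<lambda>a b. F (ract M x a) (g \<otimes>\<^bsub>H\<^esub> b)))
    = U.SL W (hunit H) h (\<lambda>a b. U.SR W M m (\<lambda>x g. F (ract M x a) (g \<otimes>\<^bsub>H\<^esub> b)))"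
    by (rule U.SL_SR_commute[symmetric]; simp)
  ultimately show ?thesis using M.rcoact_ract[OF h m] by simp
qed

end

end

end

end

text \<open>
  The identities of \<open>hopf_bimodule\<close> are tested against maps into objects \<open>W\<close> of the record type of
  the modules. Any vector space can be put into that type.
\<close>

definition emb :: "('k, 'a universe, 'y) module_scheme \<Rightarrow> ('k, 'a) fa_object" where
  "emb W = \<lparr>carrier = carrier W, mult = mult W, one = one W, zero = zero W, add = add W, smult = smult W,
     \<alpha> = id, \<beta> = id, \<omega> = id, \<psi> = id, lact = (\<lambda>h m. m), ract = (\<lambda>m h. m), lcoact = id, rcoact = id\<rparr>"

lemma emb_simps [simp]:
  "carrier (emb W) = carrier W" "zero (emb W) = zero W" "add (emb W) = add W" "smult (emb W) = smult W"
  by (simp_all add: emb_def)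

lemma emb_maps [simp]:
  "linear_maps K V (emb W) = linear_maps K V W" "bilinear_maps K U V (emb W) = bilinear_maps K U V W"
  "trilinear K U V X (emb W) = trilinear K U V X W" "sum_pairs (emb W) F xs = sum_pairs W F xs"
  by (simp_all add: linear_maps_def bilinear_maps_def trilinear_def fun_eq_iff sum_pairs_def)

lemma module_emb [simp]: "module K W \<Longrightarrow> module K (emb W)"
  by (erule module_cong) simp_all

section \<open>The untwisted Hopf algebra and its antipode\<close>

context untwist
begin

lemma SL_emb [simp]: "U.SL (emb W) M m F = U.SL W M m F" "U.SR (emb W) M m F = U.SR W M m F"
  "U.SL (hunit H) M m F = U.SL H M m F" "U.SR (hunit H) M m F = U.SR H M m F"
  by (simp_all add: U.SL_def U.SR_def)

lemma tw_one: "twist H t \<one>\<^bsub>H\<^esub> = \<one>\<^bsub>H\<^esub>"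
proof (induction t rule: twist_induct)
  case (7 t)
  then show ?case using twist_neg(1)[OF one_closed, of t] by simp
qed (use structure_one one_closed in \<open>auto simp: twist_gen[symmetric] twist_twist[symmetric]\<close>)

lemma tw_counit: "a \<in> carrier H \<Longrightarrow> counit H (twist H t a) = counit H a"
proof (induction t arbitrary: a rule: twist_induct)
  case (7 t)
  then show ?case using 7(1)[of "twist H (- t) a"] by (simp add: twist_neg)
qed (use structure_counit in \<open>auto simp: twist_gen[symmetric] twist_twist[symmetric]\<close>)

lemma tw_S: "a \<in> carrier H \<Longrightarrow> S (twist H t a) = twist H t (S a)"
proof (induction t arbitrary: a rule: twist_induct)
  case (7 t)
  have "S a \<in> carrier H" "S (twist H (- t) a) \<in> carrier H" using 7(2) linear_mapsD(1)[OF antipode_linear] by simp_all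
  then show ?case using 7(1)[of "twist H (- t) a"] 7(2) by (metis twist_closed twist_neg)
qed (use antipode_commute linear_mapsD(1)[OF antipode_linear] in \<open>auto simp: twist_gen[symmetric] twist_twist[symmetric]\<close>)

lemma counit_lin [simp]:
  assumes W: "module K W" and V: "module K V" and w: "w \<in> carrier W"
  shows "lin V H g \<Longrightarrow> lin V W (\<lambda>x. counit H (g x) \<odot>\<^bsub>W\<^esub> w)"
proof -
  interpret W: module K W by fact
  assume g: "lin V H g"
  show "lin V W (\<lambda>x. counit H (g x) \<odot>\<^bsub>W\<^esub> w)"
    using w funcset_mem[OF counit_closed] by (intro linear_mapsI)
      (simp_all add: linear_mapsD[OF g] counit_add counit_smult W.smult_l_distr W.smult_assoc1)
qed

lemma scale_lin [simp]:
  assumes W: "module K W" and V: "module K V" and c: "c \<in> carrier K"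
  shows "lin V W g \<Longrightarrow> lin V W (\<lambda>x. c \<odot>\<^bsub>W\<^esub> g x)"
proof -
  interpret W: module K W by fact
  assume g: "lin V W g"
  show "lin V W (\<lambda>x. c \<odot>\<^bsub>W\<^esub> g x)"
    using c by (intro linear_mapsI)
      (simp_all add: linear_mapsD[OF g] W.smult_r_distr W.smult_assoc1[symmetric] m_comm)
qed

lemma counit_in [simp]: "a \<in> carrier H \<Longrightarrow> counit H a \<in> carrier K"
  using counit_closed by auto

lemma fah_hbim:
  assumes M: "fah M"
  shows "hbim M"
proof (intro hopf_bimodule.intro hopf_bimodule_axioms.intro U.bimodule_data_axioms)
  interpret M: four_angle_hopf_module K H M by (rule M)
  note [simp] = admM[OF M]
  note tw = twM[OF M] tws twH tw_mult
  show "adm M" "module K M" by simp_all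
  show "bil (hunit H) M M (ula H M)" by (simp add: ula_def[abs_def])
  show "bil M (hunit H) M (ura H M)" by (simp add: ura_def[abs_def])
  show "lin M M (twist M t)" for t by simp
  {
    fix W :: "('k, 'a) fa_object" and F assume [simp]: "module K W"
    {
      assume F': "bil (hunit H) M W F"
      then have F: "bil H M W F" by simp
      note [simp] = bilinear_comps[OF F] bilinear_mapsD[OF F]
      show "lin M W (\<lambda>m. U.SL W M m F)" by simp
      fix m assume m [simp]: "m \<in> carrier M"
      show "U.SL W M (twist M t m) F = U.SL W M m (\<lambda>a b. F (twist (hunit H) t a) (twist M t b))" for t
        by (simp add: SL_twist[OF M])
      fix h assume h: "h \<in> carrier (hunit H)"
      then have [simp]: "h \<in> carrier H" by simp
      show "U.SL W M (ula H M h m) F = U.SL W (hunit H) h (\<lambda>a b. U.SL W M m (\<lambda>g x. F (U.mul a g) (ula H M b x)))"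
        by (simp add: ula_def SL_lact_fah[OF M] D_twist SL_twist[OF M] mul_eq)
      show "U.SL W M (ura H M m h) F = U.SL W (hunit H) h (\<lambda>a b. U.SL W M m (\<lambda>g x. F (U.mul g a) (ura H M x b)))"
        by (simp add: ura_def SL_ract_fah[OF M] D_twist SL_twist[OF M] mul_eq)
    }
    {
      assume F': "bil M (hunit H) W F"
      then have F: "bil M H W F" by simp
      note [simp] = bilinear_comps[OF F] bilinear_mapsD[OF F]
      show "lin M W (\<lambda>m. U.SR W M m F)" by simp
      fix m assume m [simp]: "m \<in> carrier M"
      show "U.SR W M (twist M t m) F = U.SR W M m (\<lambda>a b. F (twist M t a) (twist (hunit H) t b))" for t
        by (simp add: SR_twist[OF M])
      fix h assume h: "h \<in> carrier (hunit H)"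
      then have [simp]: "h \<in> carrier H" by simp
      show "U.SR W M (ula H M h m) F = U.SL W (hunit H) h (\<lambda>a b. U.SR W M m (\<lambda>x g. F (ula H M a x) (U.mul b g)))"
        by (simp add: ula_def SR_lact_fah[OF M] D_twist SR_twist[OF M] mul_eq)
      show "U.SR W M (ura H M m h) F = U.SL W (hunit H) h (\<lambda>a b. U.SR W M m (\<lambda>x g. F (ura H M x a) (U.mul g b)))"
        by (simp add: ura_def SR_ract_fah[OF M] D_twist SR_twist[OF M] mul_eq)
    }
  }
  {
    fix W :: "('k, 'a) fa_object" and F m assume W: "module K W" and m: "m \<in> carrier M"
    show "tri (hunit H) (hunit H) M W F \<Longrightarrow> U.SL W M m (\<lambda>a x. U.SL W M x (\<lambda>b y. F a b y))
      = U.SL W M m (\<lambda>h y. U.SL W (hunit H) h (\<lambda>a b. F a b y))"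
      by (rule SL_coassoc_fah[OF M W m]) simp
    show "tri M (hunit H) (hunit H) W F \<Longrightarrow> U.SR W M m (\<lambda>x b. U.SR W M x (\<lambda>y a. F y a b))
      = U.SR W M m (\<lambda>y h. U.SL W (hunit H) h (\<lambda>a b. F y a b))"
      by (rule SR_coassoc_fah[OF M W m]) simp
    show "tri (hunit H) M (hunit H) W F \<Longrightarrow> U.SL W M m (\<lambda>a x. U.SR W M x (\<lambda>y b. F a y b))
      = U.SR W M m (\<lambda>x b. U.SL W M x (\<lambda>a y. F a y b))"
      by (rule SL_SR_fah[OF M W m]) simp
  }
  fix m assume m [simp]: "m \<in> carrier M"
  show "ula H M \<one>\<^bsub>H\<^esub> m = m"
    using M.lact_one[of "twist M (0, -1, 0, 0) m"] by (simp add: ula_def tw_one tw)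
  show "ura H M m \<one>\<^bsub>H\<^esub> = m"
    using M.ract_one[of "twist M (-1, 0, 0, 0) m"] by (simp add: ura_def tw_one tw)
  have [simp]: "\<And>c x. c \<in> carrier K \<Longrightarrow> x \<in> carrier M \<Longrightarrow> c \<odot>\<^bsub>M\<^esub> x \<in> carrier M"
    by (rule module.smult_closed) simp_all
  show "U.SL M M m (\<lambda>h x. counit H h \<odot>\<^bsub>M\<^esub> x) = m"
    using M.lcoact_counit[of "twist M (0, 0, 0, -1) m"]
    by (simp add: raw_SL tw_counit SL_twist[OF M] tw)
  show "U.SR M M m (\<lambda>x h. counit H h \<odot>\<^bsub>M\<^esub> x) = m"
    using M.rcoact_counit[of "twist M (0, 0, -1, 0) m"]
    by (simp add: raw_SR tw_counit SR_twist[OF M] tw)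
  {
    fix a b assume "a \<in> carrier (hunit H)" "b \<in> carrier (hunit H)"
    then have [simp]: "a \<in> carrier H" "b \<in> carrier H" by simp_all
    show "twist M t (ula H M a m) = ula H M (twist (hunit H) t a) (twist M t m)" for t
      by (cases t) (simp add: ula_def tw add.commute)
    show "twist M t (ura H M m a) = ura H M (twist M t m) (twist (hunit H) t a)" for t
      by (cases t) (simp add: ura_def tw add.commute)
    show "ula H M a (ula H M b m) = ula H M (U.mul a b) m"
      \<comment> \<open>The arguments are chosen so that \<alpha> of the first is \<alpha>^-1(a) and
        the inner action is \<beta>^-1 of the ordinary action of b on m. The exponents in the next
        two identities are found in the same way.\<close>
      using M.lact_assoc[of "twist H (-2, 0, 0, 0) a" "twist H (-1, -1, 0, 0) b" "twist M (0, -2, 0, 0) m"]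
      by (simp add: ula_def mul_eq tw)
    show "ura H M (ura H M m a) b = ura H M m (U.mul a b)"
      using M.ract_assoc[of "twist H (-1, -1, 0, 0) a" "twist H (0, -2, 0, 0) b" "twist M (-2, 0, 0, 0) m"]
      by (simp add: ura_def mul_eq tw)
    show "ula H M a (ura H M m b) = ura H M (ula H M a m) b"
      using M.bimodule[of "twist H (-2, 0, 0, 0) a" "twist H (0, -2, 0, 0) b" "twist M (-1, -1, 0, 0) m"]
      by (simp add: ula_def ura_def tw)
  }
qed

lemma hopf_base_U: "hopf_base K (hunit H) (ula H) (ura H) (ulc H) (urc H) twist \<one>\<^bsub>H\<^esub> (counit H) (fa_data K H)"
proof (intro hopf_base.intro hopf_base_axioms.intro U.bimodule_data_axioms)
  show "hbim (hunit H)" by (rule fah_hbim[OF hunit_four_angle])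
  fix W :: "('k, 'a) fa_object" and F assume [simp]: "module K W" and F': "bil (hunit H) (hunit H) W F"
  then have F: "bil H H W F" by simp
  note [simp] = bilinear_comps[OF F] bilinear_mapsD[OF F] one_closed
  let ?F = "\<lambda>h x. F (twist H (0, 0, -1, 0) h) (twist H (0, 0, 0, -1) x)"
  have "U.SL W (hunit H) \<one>\<^bsub>H\<^esub> F = sweedler W (comult H \<one>\<^bsub>H\<^esub>) ?F"
    by (simp add: raw_D twH)
  also have "\<dots> = ?F \<one>\<^bsub>H\<^esub> \<one>\<^bsub>H\<^esub>"
    unfolding comult_one by (rule sweedler_tensor_pure[of K]) simp_all
  finally show "U.SL W (hunit H) \<one>\<^bsub>H\<^esub> F = F \<one>\<^bsub>H\<^esub> \<one>\<^bsub>H\<^esub>" by (simp add: tw_one)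
qed (simp_all add: ura_I urc_I one_closed counit_add counit_smult counit_one mul_eq counit_mult tw_counit tw_one)

text \<open>The exponents are read off from the left antipode axiom. Applying \<beta>^-1 \<psi>^-1
  to it turns the second factor into \<beta>^-1 of an ordinary leg; the first factor then has to be
  \<alpha>^-1 of the ordinary antipode.\<close>

definition uS where "uS a = twist H (1, -1, 1, -1) (S a)"

lemma S_in [simp]: "a \<in> carrier H \<Longrightarrow> S a \<in> carrier H"
  by (rule linear_mapsD(1)[OF antipode_linear])

lemma S_lin_comp [simp]: "lin V H g \<Longrightarrow> lin V H (\<lambda>x. S (g x))"
  by (rule linear_comp[OF antipode_linear])

lemma uS_left:
  assumes [simp]: "a \<in> carrier H"
  shows "U.SL H (hunit H) a (\<lambda>x y. U.mul (uS x) y) = counit H a \<odot>\<^bsub>H\<^esub> \<one>\<^bsub>H\<^esub>"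
proof -
  have "twist H (0, -1, 0, -1) (sweedler H (comult H a) (\<lambda>x y. S x \<otimes>\<^bsub>H\<^esub> y)) = counit H a \<odot>\<^bsub>H\<^esub> \<one>\<^bsub>H\<^esub>"
    by (simp add: antipode_left linear_mapsD(3)[OF twist_lin] one_closed tw_one)
  then show ?thesis
    by (simp add: raw_D map_D[OF twist_lin] tw_mult twH tw_S mul_eq uS_def)
qed

lemma uS_right':
  assumes [simp]: "a \<in> carrier H"
  shows "U.SL H (hunit H) a (\<lambda>x y. U.mul x (twist H (-1, 1, -1, 1) (S y))) = counit H a \<odot>\<^bsub>H\<^esub> \<one>\<^bsub>H\<^esub>"
proof -
  have "twist H (-1, 0, -1, 0) (sweedler H (comult H a) (\<lambda>x y. x \<otimes>\<^bsub>H\<^esub> S y)) = counit H a \<odot>\<^bsub>H\<^esub> \<one>\<^bsub>H\<^esub>"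
    by (simp add: antipode_right linear_mapsD(3)[OF twist_lin] one_closed tw_one)
  then show ?thesis
    by (simp add: raw_D map_D[OF twist_lin] tw_mult twH tw_S mul_eq)
qed

text \<open>
  The left and the right antipode identity untwist with inverse powers of the structure maps;
  their agreement is the uniqueness of the convolution inverse.
\<close>

lemma uS_eq: "a \<in> carrier H \<Longrightarrow> uS a = twist H (-1, 1, -1, 1) (S a)"
  by (rule hopf_base.convolution_inverse_unique[OF hopf_base_U])
    (simp_all add: uS_def[abs_def] uS_left[unfolded uS_def] uS_right')

lemma uS_right:
  assumes [simp]: "a \<in> carrier H"
  shows "U.SL H (hunit H) a (\<lambda>x y. U.mul x (uS y)) = counit H a \<odot>\<^bsub>H\<^esub> \<one>\<^bsub>H\<^esub>"
  using uS_right' by (simp add: uS_eq)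

lemma hopf_U: "hopf K (hunit H) (ula H) (ura H) (ulc H) (urc H) twist \<one>\<^bsub>H\<^esub> (counit H) (fa_data K H) uS"
  by (intro hopf.intro hopf_axioms.intro hopf_base_U)
    (simp_all add: uS_left uS_right, simp_all add: uS_def[abs_def] tw_S twH add.commute)

end

subsection \<open>From ordinary Hopf bimodules to BiHom-modules\<close>

context untwist
begin

lemma comult_eq:
  assumes "h \<in> carrier H"
  shows "comult H h
    = U.SL (tensor K H H) (hunit H) h (\<lambda>a b. pure K H H (twist H (0, 0, 1, 0) a) (twist H (0, 0, 0, 1) b))"
  using lcoact_eq[OF adm_I, of h] assms unfolding hunit_simps hunit_tensor twist_hunit by blast

context
  fixes V assumes V: "hbim V"
begin

lemma admV [simp]: "adm V"
  by (rule hopf_bimodule.admissible[OF V])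

lemma tw_lact_V: "\<lbrakk>h \<in> carrier H; m \<in> carrier V\<rbrakk> \<Longrightarrow> twist V t (lact V h m) = lact V (twist H t h) (twist V t m)"
  using hopf_bimodule.tw_la[OF V, of "twist H (1, 0, 0, 0) h" "twist V (0, 1, 0, 0) m" t]
  by (cases t) (simp add: ula_def tws twH)

lemma tw_ract_V: "\<lbrakk>h \<in> carrier H; m \<in> carrier V\<rbrakk> \<Longrightarrow> twist V t (ract V m h) = ract V (twist V t m) (twist H t h)"
  using hopf_bimodule.tw_ra[OF V, of "twist H (0, 1, 0, 0) h" "twist V (1, 0, 0, 0) m" t]
  by (cases t) (simp add: ura_def tws twH)

lemma lact_ula: "\<lbrakk>h \<in> carrier H; m \<in> carrier V\<rbrakk> \<Longrightarrow> lact V h m = ula H V (twist H (1, 0, 0, 0) h) (twist V (0, 1, 0, 0) m)"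
  by (simp add: ula_def tws twH)

lemma ract_ura: "\<lbrakk>h \<in> carrier H; m \<in> carrier V\<rbrakk> \<Longrightarrow> ract V m h = ura H V (twist V (1, 0, 0, 0) m) (twist H (0, 1, 0, 0) h)"
  by (simp add: ura_def tws twH)

context
  fixes W :: "('k, 'a universe, 'y) module_scheme" and m
  assumes W [simp]: "module K W" and m [simp]: "m \<in> carrier V"
begin

lemma SL_tw_V: "bil H V W F \<Longrightarrow> U.SL W V (twist V t m) F = U.SL W V m (\<lambda>a b. F (twist H t a) (twist V t b))"
  using hopf_bimodule.SL_tw[OF V, of "emb W" F m t] by simp

lemma SR_tw_V: "bil V H W F \<Longrightarrow> U.SR W V (twist V t m) F = U.SR W V m (\<lambda>a b. F (twist V t a) (twist H t b))"
  using hopf_bimodule.SR_tw[OF V, of "emb W" F m t] by simp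

lemma SL_coassoc_V: "tri H H V W F \<Longrightarrow> U.SL W V m (\<lambda>a x. U.SL W V x (F a)) = U.SL W V m (\<lambda>h y. U.SL W (hunit H) h (\<lambda>a b. F a b y))"
  using hopf_bimodule.SL_coassoc[OF V, of "emb W" F m] by simp

lemma SR_coassoc_V: "tri V H H W F \<Longrightarrow> U.SR W V m (\<lambda>x b. U.SR W V x (\<lambda>y a. F y a b)) = U.SR W V m (\<lambda>y h. U.SL W (hunit H) h (F y))"
  using hopf_bimodule.SR_coassoc[OF V, of "emb W" F m] by simp

lemma SL_SR_V: "tri H V H W F \<Longrightarrow> U.SL W V m (\<lambda>a x. U.SR W V x (F a)) = U.SR W V m (\<lambda>x b. U.SL W V x (\<lambda>a y. F a y b))"
  using hopf_bimodule.SL_SR[OF V, of "emb W" F m] by simp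

end

context
  fixes W :: "('k, 'a universe, 'y) module_scheme" and m h
  assumes W [simp]: "module K W" and m [simp]: "m \<in> carrier V" and h [simp]: "h \<in> carrier H"
begin

lemma SL_lact_V:
  assumes F: "bil H V W F"
  shows "U.SL W V (lact V h m) F = U.SL W (hunit H) h (\<lambda>a b. U.SL W V m (\<lambda>g x. F (a \<otimes>\<^bsub>H\<^esub> g) (lact V b x)))"
proof -
  note [simp] = bilinear_comps[OF F] bilinear_mapsD[OF F]
  have "U.SL W V (ula H V (twist H (1, 0, 0, 0) h) (twist V (0, 1, 0, 0) m)) F
    = U.SL W (hunit H) (twist H (1, 0, 0, 0) h) (\<lambda>a b. U.SL W V (twist V (0, 1, 0, 0) m) (\<lambda>g x. F (U.mul a g) (ula H V b x)))"
    using hopf_bimodule.SL_la[OF V, of "emb W" F "twist H (1, 0, 0, 0) h" "twist V (0, 1, 0, 0) m"] F by simp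
  then show ?thesis
    by (simp add: lact_ula[of h m]) (simp add: mul_eq ula_def SL_tw_V D_twist tws twH)
qed

lemma SR_lact_V:
  assumes F: "bil V H W F"
  shows "U.SR W V (lact V h m) F = U.SL W (hunit H) h (\<lambda>a b. U.SR W V m (\<lambda>x g. F (lact V a x) (b \<otimes>\<^bsub>H\<^esub> g)))"
proof -
  note [simp] = bilinear_comps[OF F] bilinear_mapsD[OF F]
  have "U.SR W V (ula H V (twist H (1, 0, 0, 0) h) (twist V (0, 1, 0, 0) m)) F
    = U.SL W (hunit H) (twist H (1, 0, 0, 0) h) (\<lambda>a b. U.SR W V (twist V (0, 1, 0, 0) m) (\<lambda>x g. F (ula H V a x) (U.mul b g)))"
    using hopf_bimodule.SR_la[OF V, of "emb W" F "twist H (1, 0, 0, 0) h" "twist V (0, 1, 0, 0) m"] F by simp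
  then show ?thesis
    by (simp add: lact_ula[of h m]) (simp add: mul_eq ula_def SR_tw_V D_twist tws twH)
qed

lemma SL_ract_V:
  assumes F: "bil H V W F"
  shows "U.SL W V (ract V m h) F = U.SL W V m (\<lambda>g x. U.SL W (hunit H) h (\<lambda>a b. F (g \<otimes>\<^bsub>H\<^esub> a) (ract V x b)))"
proof -
  note [simp] = bilinear_comps[OF F] bilinear_mapsD[OF F]
  have "U.SL W V (ura H V (twist V (1, 0, 0, 0) m) (twist H (0, 1, 0, 0) h)) F
    = U.SL W (hunit H) (twist H (0, 1, 0, 0) h) (\<lambda>a b. U.SL W V (twist V (1, 0, 0, 0) m) (\<lambda>g x. F (U.mul g a) (ura H V x b)))"
    using hopf_bimodule.SL_ra[OF V, of "emb W" F "twist H (0, 1, 0, 0) h" "twist V (1, 0, 0, 0) m"] F by simp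
  also have "\<dots> = U.SL W (hunit H) h (\<lambda>a b. U.SL W V m (\<lambda>g x. F (g \<otimes>\<^bsub>H\<^esub> a) (ract V x b)))"
    by (simp add: mul_eq ura_def SL_tw_V D_twist tws twH)
  also have "\<dots> = U.SL W V m (\<lambda>g x. U.SL W (hunit H) h (\<lambda>a b. F (g \<otimes>\<^bsub>H\<^esub> a) (ract V x b)))"
    by (rule U.SL_SL_commute; simp)
  finally show ?thesis by (simp add: ract_ura[of h m])
qed

lemma SR_ract_V:
  assumes F: "bil V H W F"
  shows "U.SR W V (ract V m h) F = U.SR W V m (\<lambda>x g. U.SL W (hunit H) h (\<lambda>a b. F (ract V x a) (g \<otimes>\<^bsub>H\<^esub> b)))"
proof -
  note [simp] = bilinear_comps[OF F] bilinear_mapsD[OF F]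
  have "U.SR W V (ura H V (twist V (1, 0, 0, 0) m) (twist H (0, 1, 0, 0) h)) F
    = U.SL W (hunit H) (twist H (0, 1, 0, 0) h) (\<lambda>a b. U.SR W V (twist V (1, 0, 0, 0) m) (\<lambda>x g. F (ura H V x a) (U.mul g b)))"
    using hopf_bimodule.SR_ra[OF V, of "emb W" F "twist H (0, 1, 0, 0) h" "twist V (1, 0, 0, 0) m"] F by simp
  also have "\<dots> = U.SL W (hunit H) h (\<lambda>a b. U.SR W V m (\<lambda>x g. F (ract V x a) (g \<otimes>\<^bsub>H\<^esub> b)))"
    by (simp add: mul_eq ura_def SR_tw_V D_twist tws twH)
  also have "\<dots> = U.SR W V m (\<lambda>x g. U.SL W (hunit H) h (\<lambda>a b. F (ract V x a) (g \<otimes>\<^bsub>H\<^esub> b)))"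
    by (rule U.SL_SR_commute; simp)
  finally show ?thesis by (simp add: ract_ura[of h m])
qed

end

text \<open>This converse is what makes the tensor product an object. Its axioms are known in
  ordinary form, and equations in tensor spaces are recovered by taking pure tensors as test
  maps.\<close>

lemma hbim_fah: "fah V"
proof (intro four_angle_hopf_module.intro four_angle_hopf_module_axioms.intro)
  note tw = tw_lact_V tw_ract_V tws twH tw_mult
  show "bihom_bialgebra K H" by unfold_locales
  show "bihom_space K V" "bil H V V (lact V)" "bil V H V (ract V)" "lin V (tensor K H V) (lcoact V)" "lin V (tensor K V H) (rcoact V)"
    by (rule admD[OF admV])+
  have [simp]: "\<And>c x. c \<in> carrier K \<Longrightarrow> x \<in> carrier V \<Longrightarrow> c \<odot>\<^bsub>V\<^esub> x \<in> carrier V"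
    by (rule module.smult_closed) simp_all
  {
    fix \<theta> \<theta>' m assume th: "(\<theta>, \<theta>') \<in> {(\<alpha> H, \<alpha> V), (\<beta> H, \<beta> V), (\<omega> H, \<omega> V), (\<psi> H, \<psi> V)}" and m [simp]: "m \<in> carrier V"
    \<comment> \<open>Each pair of structure maps is the twist by one and the same unit vector on H
      and on V, so one argument covers all four pairs.\<close>
    obtain t where t: "\<And>h. h \<in> carrier H \<Longrightarrow> \<theta> h = twist H t h" "\<And>x. x \<in> carrier V \<Longrightarrow> \<theta>' x = twist V t x"
    proof -
      from th consider "\<theta> = \<alpha> H" "\<theta>' = \<alpha> V" | "\<theta> = \<beta> H" "\<theta>' = \<beta> V"
        | "\<theta> = \<omega> H" "\<theta>' = \<omega> V" | "\<theta> = \<psi> H" "\<theta>' = \<psi> V" by auto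
      then show thesis
      proof cases
        case 1 then show thesis by (intro that[of "(1, 0, 0, 0)"]) (simp_all add: twH tws)
      next
        case 2 then show thesis by (intro that[of "(0, 1, 0, 0)"]) (simp_all add: twH tws)
      next
        case 3 then show thesis by (intro that[of "(0, 0, 1, 0)"]) (simp_all add: twH tws)
      next
        case 4 then show thesis by (intro that[of "(0, 0, 0, 1)"]) (simp_all add: twH tws)
      qed
    qed
    show "lcoact V (\<theta>' m) = sweedler (tensor K H V) (lcoact V m) (\<lambda>h m0. pure K H V (\<theta> h) (\<theta>' m0))"
      by (simp add: t raw_SL, simp add: lcoact_eq SL_tw_V tw add.commute)
    show "rcoact V (\<theta>' m) = sweedler (tensor K V H) (rcoact V m) (\<lambda>m0 h. pure K V H (\<theta>' m0) (\<theta> h))"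
      by (simp add: t raw_SR, simp add: rcoact_eq SR_tw_V tw add.commute)
    fix h assume [simp]: "h \<in> carrier H"
    show "lact V (\<theta> h) (\<theta>' m) = \<theta>' (lact V h m)" by (simp add: t tw)
    show "ract V (\<theta>' m) (\<theta> h) = \<theta>' (ract V m h)" by (simp add: t tw)
  }
  fix m assume m [simp]: "m \<in> carrier V"
  show "lact V \<one>\<^bsub>H\<^esub> m = \<beta> V m"
    using hopf_bimodule.la_one[OF V, of "twist V (0, 1, 0, 0) m"] by (simp add: lact_ula one_closed tw_one tw)
  show "ract V m \<one>\<^bsub>H\<^esub> = \<alpha> V m"
    using hopf_bimodule.ra_one[OF V, of "twist V (1, 0, 0, 0) m"] by (simp add: ract_ura one_closed tw_one tw)
  {
    fix h g assume [simp]: "h \<in> carrier H" "g \<in> carrier H"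
    show "lact V (\<alpha> H h) (lact V g m) = lact V (h \<otimes>\<^bsub>H\<^esub> g) (\<beta> V m)"
      \<comment> \<open>The positive exponents are the negatives of those used in the untwisting
        direction, so that the twists in \<open>ula\<close> are cancelled.\<close>
      using hopf_bimodule.la_la[OF V, of "twist H (2, 0, 0, 0) h" "twist H (1, 1, 0, 0) g" "twist V (0, 2, 0, 0) m"]
      by (simp add: ula_def mul_eq tw)
    show "ract V (ract V m h) (\<beta> H g) = ract V (\<alpha> V m) (h \<otimes>\<^bsub>H\<^esub> g)"
      using hopf_bimodule.ra_ra[OF V, of "twist H (1, 1, 0, 0) h" "twist H (0, 2, 0, 0) g" "twist V (2, 0, 0, 0) m"]
      by (simp add: ura_def mul_eq tw)
    show "lact V (\<alpha> H h) (ract V m g) = ract V (lact V h m) (\<beta> H g)"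
      using hopf_bimodule.la_ra[OF V, of "twist H (2, 0, 0, 0) h" "twist H (0, 2, 0, 0) g" "twist V (1, 1, 0, 0) m"]
      by (simp add: ula_def ura_def tw)
  }
  show "sweedler V (rcoact V m) (\<lambda>m0 m1. counit H m1 \<odot>\<^bsub>V\<^esub> m0) = \<omega> V m"
    using hopf_bimodule.SR_counit[OF V, of "twist V (0, 0, 1, 0) m"] by (simp add: raw_SR tw_counit SR_tw_V tw)
  show "sweedler V (lcoact V m) (\<lambda>h m0. counit H h \<odot>\<^bsub>V\<^esub> m0) = \<psi> V m"
    using hopf_bimodule.SL_counit[OF V, of "twist V (0, 0, 0, 1) m"] by (simp add: raw_SL tw_counit SL_tw_V tw)
  note [simp] = module_tensor
  show "sweedler (tensor K V (tensor K H H)) (rcoact V m) (\<lambda>m0 m1. pure K V (tensor K H H) (\<omega> V m0) (comult H m1))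
      = sweedler (tensor K V (tensor K H H)) (rcoact V m) (\<lambda>m0 m1. sweedler (tensor K V (tensor K H H)) (rcoact V m0)
              (\<lambda>m00 m01. pure K V (tensor K H H) m00 (pure K H H m01 (\<psi> H m1))))"
  proof -
    let ?Y = "tensor K V (tensor K H H)"
    \<comment> \<open>The test map carries the powers \<omega>^2, \<omega> \<psi> and \<psi>^2 that
      the BiHom form of coassociativity produces on the three legs.\<close>
    let ?F = "\<lambda>y a b. pure K V (tensor K H H) (twist V (0, 0, 2, 0) y) (pure K H H (twist H (0, 0, 1, 1) a) (twist H (0, 0, 0, 2) b))"
    have p: "pure K V (tensor K H H) y (U.SL (tensor K H H) (hunit H) h F) = U.SL ?Y (hunit H) h (\<lambda>a b. pure K V (tensor K H H) y (F a b))"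
      if "y \<in> carrier V" "\<And>a b. a \<in> carrier H \<Longrightarrow> b \<in> carrier H \<Longrightarrow> F a b \<in> carrier (tensor K H H)" for y h F
      by (rule map_D) (simp_all add: that)
    have "sweedler ?Y (rcoact V m) (\<lambda>m0 m1. pure K V (tensor K H H) (\<omega> V m0) (comult H m1))
      = U.SR ?Y V m (\<lambda>y h. U.SL ?Y (hunit H) h (?F y))"
      by (simp add: raw_SR tw, simp add: comult_eq D_twist tw p)
    also have "\<dots> = U.SR ?Y V m (\<lambda>x b. U.SR ?Y V x (\<lambda>y a. ?F y a b))"
      by (rule SR_coassoc_V[symmetric]; simp)
    also have "\<dots> = sweedler ?Y (rcoact V m) (\<lambda>m0 m1. sweedler ?Y (rcoact V m0) (\<lambda>m00 m01. pure K V (tensor K H H) m00 (pure K H H m01 (\<psi> H m1))))"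
      by (simp add: raw_SR SR_tw_V tw)
    finally show ?thesis .
  qed
  show "sweedler (tensor K H (tensor K H V)) (lcoact V m) (\<lambda>h m0. pure K H (tensor K H V) (\<omega> H h) (lcoact V m0))
      = sweedler (tensor K H (tensor K H V)) (lcoact V m) (\<lambda>h m0. sweedler (tensor K H (tensor K H V)) (comult H h)
              (\<lambda>h1 h2. pure K H (tensor K H V) h1 (pure K H V h2 (\<psi> V m0))))"
  proof -
    let ?Y = "tensor K H (tensor K H V)"
    let ?F = "\<lambda>a b y. pure K H (tensor K H V) (twist H (0, 0, 2, 0) a) (pure K H V (twist H (0, 0, 1, 1) b) (twist V (0, 0, 0, 2) y))"
    have p: "pure K H (tensor K H V) y (U.SL (tensor K H V) V h F) = U.SL ?Y V h (\<lambda>a b. pure K H (tensor K H V) y (F a b))"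
      if "y \<in> carrier H" "\<And>a b. a \<in> carrier H \<Longrightarrow> b \<in> carrier V \<Longrightarrow> F a b \<in> carrier (tensor K H V)" for y h F
      by (rule map_SL) (simp_all add: that)
    have "sweedler ?Y (lcoact V m) (\<lambda>h m0. pure K H (tensor K H V) (\<omega> H h) (lcoact V m0))
      = U.SL ?Y V m (\<lambda>a x. U.SL ?Y V x (?F a))"
      by (simp add: raw_SL tw, simp add: lcoact_eq SL_tw_V tw p)
    also have "\<dots> = U.SL ?Y V m (\<lambda>h y. U.SL ?Y (hunit H) h (\<lambda>a b. ?F a b y))"
      by (rule SL_coassoc_V; simp)
    also have "\<dots> = sweedler ?Y (lcoact V m) (\<lambda>h m0. sweedler ?Y (comult H h) (\<lambda>h1 h2. pure K H (tensor K H V) h1 (pure K H V h2 (\<psi> V m0))))"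
      by (simp add: raw_SL raw_D D_twist tw)
    finally show ?thesis .
  qed
  show "sweedler (tensor K H (tensor K V H)) (lcoact V m) (\<lambda>h m0. pure K H (tensor K V H) (\<omega> H h) (rcoact V m0))
        = sweedler (tensor K H (tensor K V H)) (rcoact V m) (\<lambda>m0 m1. sweedler (tensor K H (tensor K V H)) (lcoact V m0)
              (\<lambda>h m00. pure K H (tensor K V H) h (pure K V H m00 (\<psi> H m1))))"
  proof -
    let ?Y = "tensor K H (tensor K V H)"
    let ?F = "\<lambda>a y b. pure K H (tensor K V H) (twist H (0, 0, 2, 0) a) (pure K V H (twist V (0, 0, 1, 1) y) (twist H (0, 0, 0, 2) b))"
    have p: "pure K H (tensor K V H) y (U.SR (tensor K V H) V h F) = U.SR ?Y V h (\<lambda>a b. pure K H (tensor K V H) y (F a b))"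
      if "y \<in> carrier H" "\<And>a b. a \<in> carrier V \<Longrightarrow> b \<in> carrier H \<Longrightarrow> F a b \<in> carrier (tensor K V H)" for y h F
      by (rule map_SR) (simp_all add: that)
    have "sweedler ?Y (lcoact V m) (\<lambda>h m0. pure K H (tensor K V H) (\<omega> H h) (rcoact V m0))
      = U.SL ?Y V m (\<lambda>a x. U.SR ?Y V x (?F a))"
      by (simp add: raw_SL tw, simp add: rcoact_eq SR_tw_V tw p)
    also have "\<dots> = U.SR ?Y V m (\<lambda>x b. U.SL ?Y V x (\<lambda>a y. ?F a y b))"
      by (rule SL_SR_V; simp)
    also have "\<dots> = sweedler ?Y (rcoact V m) (\<lambda>m0 m1. sweedler ?Y (lcoact V m0) (\<lambda>h m00. pure K H (tensor K V H) h (pure K V H m00 (\<psi> H m1))))"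
      by (simp add: raw_SR raw_SL SL_tw_V tw)
    finally show ?thesis .
  qed
  fix h assume h [simp]: "h \<in> carrier H"
  show "lcoact V (lact V h m) = sweedler (tensor K H V) (comult H h) (\<lambda>h1 h2. sweedler (tensor K H V) (lcoact V m)
      (\<lambda>g m0. pure K H V (h1 \<otimes>\<^bsub>H\<^esub> g) (lact V h2 m0)))"
    by (simp add: raw_SL raw_D, simp add: lcoact_eq SL_lact_V tw)
  show "rcoact V (lact V h m) = sweedler (tensor K V H) (comult H h) (\<lambda>h1 h2. sweedler (tensor K V H) (rcoact V m)
      (\<lambda>m0 g. pure K V H (lact V h1 m0) (h2 \<otimes>\<^bsub>H\<^esub> g)))"
    by (simp add: raw_SR raw_D, simp add: rcoact_eq SR_lact_V tw)
  show "lcoact V (ract V m h) = sweedler (tensor K H V) (lcoact V m) (\<lambda>g m0. sweedler (tensor K H V) (comult H h)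
      (\<lambda>h1 h2. pure K H V (g \<otimes>\<^bsub>H\<^esub> h1) (ract V m0 h2)))"
    by (simp add: raw_SL raw_D, simp add: lcoact_eq SL_ract_V tw)
  show "rcoact V (ract V m h) = sweedler (tensor K V H) (rcoact V m) (\<lambda>m0 g. sweedler (tensor K V H) (comult H h)
      (\<lambda>h1 h2. pure K V H (ract V m0 h1) (g \<otimes>\<^bsub>H\<^esub> h2)))"
    by (simp add: raw_SR raw_D, simp add: rcoact_eq SR_ract_V tw)
qed

end

lemma fah_iff: "fah M \<longleftrightarrow> hbim M"
  using fah_hbim hbim_fah by blast

end

section \<open>The tensor product of BiHom-four-angle Hopf modules\<close>

locale untwist_tensor = untwist K H S
  for K :: "('k, 'z) ring_scheme" and H :: "('k, 'a universe, 'x) bihom_bialgebra_scheme" and S +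
  fixes t1 t2 t3 t4 :: int
begin

abbreviation tp :: "('k, 'a) fa_object \<Rightarrow> ('k, 'a) fa_object \<Rightarrow> ('k, 'a) fa_object" where
  "tp M N \<equiv> htensor K H (t1, t2, t3, t4) M N"

abbreviation hp :: "('k, 'a) fa_object \<Rightarrow> ('k, 'a) fa_object \<Rightarrow> 'a universe \<Rightarrow> 'a universe \<Rightarrow> 'a universe" where
  "hp M N m n \<equiv> hpure K H M N m n"

text \<open>
  The actions and coactions of the tensor product contain powers of the structure maps, which
  disappear if the generators are parametrised as follows.
\<close>

definition p where
  "p M N m n = hp M N (twist M (- t1 - 1, - t2, - t3, - t4) m) (twist N (- t1, - t2 - 1, - t3, - t4) n)"

definition rep where
  "rep M N x = filter (\<lambda>y. y \<in> carrier M \<times> carrier N)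
     (map (\<lambda>(m, n). (twist M (t1 + 1, t2, t3, t4) m, twist N (t1, t2 + 1, t3, t4) n)) (summands x))"

lemma tp_fields:
  "carrier (tp M N) = carrier (htensor_space K H M N)" "zero (tp M N) = zero (htensor_space K H M N)"
  "add (tp M N) = add (htensor_space K H M N)" "smult (tp M N) = smult (htensor_space K H M N)"
  by (simp_all add: htensor_def Let_def)

lemma sum_pairs_tp: "sum_pairs (htensor_space K H M N) F xs = sum_pairs (tp M N) F xs"
  by (simp add: sum_pairs_def tp_fields)

lemma sweedler_tp: "sweedler (htensor_space K H M N) x F = sweedler (tp M N) x F"
  by (simp add: sweedler_def sum_pairs_tp)

lemma tensor_tp:
  "tensor K W (htensor_space K H M N) = tensor K W (tp M N)" "tensor K (htensor_space K H M N) W = tensor K (tp M N) W"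
  "pure K W (htensor_space K H M N) = pure K W (tp M N)" "pure K (htensor_space K H M N) W = pure K (tp M N) W"
  by (rule quotient_tensor_cong; simp add: tp_fields)+

lemma linear_maps_tp:
  "linear_maps K (htensor_space K H M N) W = linear_maps K (tp M N) W"
  "linear_maps K W (htensor_space K H M N) = linear_maps K W (tp M N)"
  "bilinear_maps K U V (htensor_space K H M N) = bilinear_maps K U V (tp M N)"
  by (simp_all add: linear_maps_def bilinear_maps_def tp_fields)

lemma tp_ops:
  "\<alpha> (tp M N) x = sweedler (tp M N) x (\<lambda>m n. hp M N (\<alpha> M m) (\<alpha> N n))"
  "\<beta> (tp M N) x = sweedler (tp M N) x (\<lambda>m n. hp M N (\<beta> M m) (\<beta> N n))"
  "\<omega> (tp M N) x = sweedler (tp M N) x (\<lambda>m n. hp M N (\<omega> M m) (\<omega> N n))"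
  "\<psi> (tp M N) x = sweedler (tp M N) x (\<lambda>m n. hp M N (\<psi> M m) (\<psi> N n))"
  "lact (tp M N) h x = sweedler (tp M N) x (\<lambda>m n.
     hp M N (lact M (twist H (- t1, - t2, - t3, - t4) (twist H (-1, 0, 0, 0) h)) m) (\<beta> N n))"
  "ract (tp M N) x h = sweedler (tp M N) x (\<lambda>m n.
     hp M N (\<alpha> M m) (ract N n (twist H (- t1, - t2, - t3, - t4) (twist H (0, -1, 0, 0) h))))"
  "lcoact (tp M N) x = sweedler (tensor K H (tp M N)) x (\<lambda>m n. sweedler (tensor K H (tp M N)) (lcoact M m) (\<lambda>g m0.
     sweedler (tensor K H (tp M N)) (lcoact N n) (\<lambda>h n0.
       pure K H (tp M N) (twist H (t1, t2, t3, t4) (g \<otimes>\<^bsub>H\<^esub> h)) (hp M N m0 n0))))"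
  "rcoact (tp M N) x = sweedler (tensor K (tp M N) H) x (\<lambda>m n. sweedler (tensor K (tp M N) H) (rcoact M m) (\<lambda>m0 g.
     sweedler (tensor K (tp M N) H) (rcoact N n) (\<lambda>n0 h.
       pure K (tp M N) H (hp M N m0 n0) (twist H (t1, t2, t3, t4) (g \<otimes>\<^bsub>H\<^esub> h)))))"
  unfolding sweedler_tp[symmetric] tensor_tp[symmetric] by (simp_all add: htensor_def Let_def)

context
  fixes M N assumes M: "fah M" and N: "fah N"
begin

lemma adm_MN [simp]: "adm M" "adm N"
  by (rule admM[OF M], rule admM[OF N])

text \<open>Scaling m in a defining relation scales both left factors, because the right action and
  \<alpha> are linear.\<close>

lemma balanced_tensor_htensor: "balanced_tensor K M N (balancing H M N)"
proof (intro balanced_tensor.intro balanced_tensor_axioms.intro)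
  show "module K M" "module K N" by simp_all
  fix v w v' w' c assume r: "((v, w), (v', w')) \<in> balancing H M N" and c: "c \<in> carrier K"
  obtain m h n where mhn: "v = ract M m h" "w = \<beta> N n" "v' = \<alpha> M m" "w' = lact N h n"
    "m \<in> carrier M" "h \<in> carrier H" "n \<in> carrier N"
    using r by (auto simp: balancing_def)
  have "c \<odot>\<^bsub>M\<^esub> v = ract M (c \<odot>\<^bsub>M\<^esub> m) h" "c \<odot>\<^bsub>M\<^esub> v' = \<alpha> M (c \<odot>\<^bsub>M\<^esub> m)" "c \<odot>\<^bsub>M\<^esub> m \<in> carrier M"
    using mhn c bilinear_smult(2)[OF admD(3)[OF adm_MN(1)]] module.smult_closed[of K M c m]
      linear_mapsD(3)[OF bihom_space.twist_lin[OF admD(1)[OF adm_MN(1)]]]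
    by (simp_all add: tws)
  then show "((c \<odot>\<^bsub>M\<^esub> v, w), (c \<odot>\<^bsub>M\<^esub> v', w')) \<in> balancing H M N"
    using mhn by (auto simp: balancing_def)
qed

lemmas bt = balanced_tensor_htensor

lemma mod_tp [simp]: "module K (tp M N)"
  by (rule module_cong[OF balanced_tensor.module_quotient[OF bt]]) (simp_all add: tp_fields htensor_space_def)

lemma hp_bil: "bil M N (tp M N) (hpure K H M N)"
  using balanced_tensor.cls_bilinear[OF bt] linear_maps_tp(3)[of M N M N]
  by (simp add: hpure_def[abs_def] htensor_space_def)

lemma hp_closed [simp]: "\<lbrakk>m \<in> carrier M; n \<in> carrier N\<rbrakk> \<Longrightarrow> hp M N m n \<in> carrier (tp M N)"
  by (rule bilinear_mapsD(3)[OF hp_bil])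

lemma hp_lin [simp]:
  "\<lbrakk>lin V M g; n \<in> carrier N\<rbrakk> \<Longrightarrow> lin V (tp M N) (\<lambda>x. hp M N (g x) n)"
  "\<lbrakk>lin V N g; m \<in> carrier M\<rbrakk> \<Longrightarrow> lin V (tp M N) (\<lambda>x. hp M N m (g x))"
  by (rule bilinear_comps[OF hp_bil]; assumption)+

lemma hp_rel:
  "\<lbrakk>m \<in> carrier M; h \<in> carrier H; n \<in> carrier N\<rbrakk>
    \<Longrightarrow> hp M N (ract M m h) (twist N (0, 1, 0, 0) n) = hp M N (twist M (1, 0, 0, 0) m) (lact N h n)"
  unfolding hpure_def tws(2)[OF adm_MN(1), symmetric] tws(3)[OF adm_MN(2), symmetric]
  by (rule balanced_tensor.cls_relation[OF bt], auto simp: balancing_def)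
    (simp_all add: tws)

definition rbal where
  "rbal F \<longleftrightarrow> (\<forall>m\<in>carrier M. \<forall>h\<in>carrier H. \<forall>n\<in>carrier N.
     F (ract M m h) (twist N (0, 1, 0, 0) n) = F (twist M (1, 0, 0, 0) m) (lact N h n))"

lemma rbal_rel: "rbal F \<Longrightarrow> ((v, w), (v', w')) \<in> balancing H M N \<Longrightarrow> F v w = F v' w'"
  by (auto simp: rbal_def balancing_def tws(2,3))

lemma sw_lin: "\<lbrakk>module K W; bil M N W F; rbal F\<rbrakk> \<Longrightarrow> lin (tp M N) W (\<lambda>x. sweedler W x F)"
  using balanced_tensor.sweedler_linear[OF bt, of W F] linear_maps_tp(1)[of M N W] rbal_rel[of F]
  unfolding htensor_space_def by blast

lemma sw_hp: "\<lbrakk>module K W; bil M N W F; rbal F; m \<in> carrier M; n \<in> carrier N\<rbrakk> \<Longrightarrow> sweedler W (hp M N m n) F = F m n"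
  unfolding hpure_def
  by (rule balanced_tensor.sweedler_pure[OF bt _ _ rbal_rel])

lemma sw_id: "x \<in> carrier (tp M N) \<Longrightarrow> sweedler (tp M N) x (hpure K H M N) = x"
  using balanced_tensor.sweedler_cls[OF bt, of x]
  by (simp add: tp_fields htensor_space_def hpure_def[abs_def] sweedler_def sum_pairs_def)

lemma summands_tp: "x \<in> carrier (tp M N) \<Longrightarrow> set (summands x) \<subseteq> carrier M \<times> carrier N"
  using balanced_tensor.cls_summands(1)[OF bt, of x] by (simp add: tp_fields htensor_space_def)

lemma hp_ext:
  assumes "module K W" "lin (tp M N) W f" "lin (tp M N) W g"
    and "\<And>m n. m \<in> carrier M \<Longrightarrow> n \<in> carrier N \<Longrightarrow> f (hp M N m n) = g (hp M N m n)" and "x \<in> carrier (tp M N)"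
  shows "f x = g x"
  using balanced_tensor.linear_ext[OF bt assms(1), of f g x] assms linear_maps_tp(1)[of M N W]
  by (simp add: hpure_def htensor_space_def tp_fields)

lemma sweedler_tp_cong:
  assumes "x \<in> carrier (tp M N)" "\<And>m n. m \<in> carrier M \<Longrightarrow> n \<in> carrier N \<Longrightarrow> F m n = G m n"
  shows "sweedler W x F = sweedler W x G"
  unfolding sweedler_def using summands_tp[OF assms(1)] assms(2) by (intro sum_pairs_fun_cong) blast

lemma sw_lin_param:
  assumes x: "x \<in> carrier (tp M N)" and V: "module K V" and W: "module K W"
    and "\<And>m n. m \<in> carrier M \<Longrightarrow> n \<in> carrier N \<Longrightarrow> lin V W (\<lambda>y. F y m n)"
  shows "lin V W (\<lambda>y. sweedler W x (F y))"
  unfolding sweedler_def using summands_tp[OF x] assms(4) by (intro linear_sum_pairs W V) blast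

subsection \<open>The structure automorphisms\<close>

text \<open>A candidate for all twists of the tensor product at once. \<open>twist\<close> itself
  involves inverses of the structure maps of the quotient, whose bijectivity is first obtained from
  \<open>twt\<close>; \<open>twist_tp\<close> identifies the two afterwards.\<close>

definition twt where "twt t x = sweedler (tp M N) x (\<lambda>m n. hp M N (twist M t m) (twist N t n))"

lemmas twMN = twM[OF M] twM[OF N] tws twH tw_mult

lemma twt_rbal: "rbal (\<lambda>m n. hp M N (twist M t m) (twist N t n))"
  unfolding rbal_def
proof (intro ballI)
  fix m h n assume [simp]: "m \<in> carrier M" "h \<in> carrier H" "n \<in> carrier N"
  show "hp M N (twist M t (ract M m h)) (twist N t (twist N (0, 1, 0, 0) n))
    = hp M N (twist M t (twist M (1, 0, 0, 0) m)) (twist N t (lact N h n))"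
    using hp_rel[of "twist M t m" "twist H t h" "twist N t n"] by (simp add: twMN add.commute)
qed

lemma twt_lin: "lin (tp M N) (tp M N) (twt t)"
  unfolding twt_def by (rule sw_lin[OF _ _ twt_rbal]) simp_all

lemma twt_hp: "\<lbrakk>m \<in> carrier M; n \<in> carrier N\<rbrakk> \<Longrightarrow> twt t (hp M N m n) = hp M N (twist M t m) (twist N t n)"
  unfolding twt_def by (rule sw_hp[OF _ _ twt_rbal]) simp_all

lemma twt_closed [simp]: "x \<in> carrier (tp M N) \<Longrightarrow> twt t x \<in> carrier (tp M N)"
  by (rule linear_mapsD(1)[OF twt_lin])

lemma twt_twt: "x \<in> carrier (tp M N) \<Longrightarrow> twt s (twt t x) = twt (s + t) x"
  by (rule hp_ext[where f="\<lambda>x. twt s (twt t x)" and W="tp M N"])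
    (simp_all add: linear_comp[OF twt_lin] twt_lin twt_hp tws)

lemma twt_0: "x \<in> carrier (tp M N) \<Longrightarrow> twt 0 x = x"
  by (rule hp_ext[where g="\<lambda>x. x" and W="tp M N"]) (simp_all add: twt_lin twt_hp zero_prod_def)

lemma struct_tp:
  assumes x: "x \<in> carrier (tp M N)"
  shows "\<alpha> (tp M N) x = twt (1, 0, 0, 0) x" "\<beta> (tp M N) x = twt (0, 1, 0, 0) x"
    "\<omega> (tp M N) x = twt (0, 0, 1, 0) x" "\<psi> (tp M N) x = twt (0, 0, 0, 1) x"
  unfolding tp_ops twt_def by (rule sweedler_tp_cong[OF x]; simp add: tws)+

lemma twt_auto:
  assumes f: "\<And>x. x \<in> carrier (tp M N) \<Longrightarrow> f x = twt t x"
  shows "f \<in> linear_automorphisms K (tp M N)"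
proof -
  have "lin (tp M N) (tp M N) f" by (rule iffD2[OF linear_cong[OF _ f] twt_lin]) simp_all
  moreover have "bij_betw f (carrier (tp M N)) (carrier (tp M N))"
    by (rule bij_betw_byWitness[where f'="twt (- t)"]) (auto simp: f twt_twt twt_0)
  ultimately show ?thesis by (simp add: linear_automorphisms_def)
qed

lemma bihom_space_tp: "bihom_space K (tp M N)"
proof (intro bihom_space.intro bihom_space_axioms.intro mod_tp)
  show "field K" by unfold_locales
  show "{\<alpha> (tp M N), \<beta> (tp M N), \<omega> (tp M N), \<psi> (tp M N)} \<subseteq> linear_automorphisms K (tp M N)"
    using twt_auto[OF struct_tp(1)] twt_auto[OF struct_tp(2)] twt_auto[OF struct_tp(3)] twt_auto[OF struct_tp(4)]
    by simp
  fix \<theta> \<theta>' x assume a: "\<theta> \<in> {\<alpha> (tp M N), \<beta> (tp M N), \<omega> (tp M N), \<psi> (tp M N)}"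
    "\<theta>' \<in> {\<alpha> (tp M N), \<beta> (tp M N), \<omega> (tp M N), \<psi> (tp M N)}" and [simp]: "x \<in> carrier (tp M N)"
  have ex: "\<exists>t. \<forall>x\<in>carrier (tp M N). \<theta> x = twt t x" if "\<theta> \<in> {\<alpha> (tp M N), \<beta> (tp M N), \<omega> (tp M N), \<psi> (tp M N)}" for \<theta>
  proof -
    from that consider "\<theta> = \<alpha> (tp M N)" | "\<theta> = \<beta> (tp M N)" | "\<theta> = \<omega> (tp M N)" | "\<theta> = \<psi> (tp M N)"
      by auto
    then show ?thesis
      by cases (use struct_tp in blast)+
  qed
  obtain s t where "\<forall>x\<in>carrier (tp M N). \<theta> x = twt s x" "\<forall>x\<in>carrier (tp M N). \<theta>' x = twt t x"
    using ex[OF a(1)] ex[OF a(2)] by blast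
  then show "\<theta> (\<theta>' x) = \<theta>' (\<theta> x)" by (simp add: twt_twt add.commute)
qed

lemma twist_tp: "x \<in> carrier (tp M N) \<Longrightarrow> twist (tp M N) t x = twt t x"
proof (induction t arbitrary: x rule: twist_induct)
  case 1
  then show ?case using twt_0 by (simp add: zero_prod_def)
next
  case (6 s t)
  then show ?case by (simp add: bihom_space.twist_twist[OF bihom_space_tp, symmetric] twt_twt)
next
  case (7 t)
  have "twist (tp M N) (- t) x = twist (tp M N) (- t) (twist (tp M N) t (twt (- t) x))"
    using 7 by (simp add: twt_twt twt_0)
  also have "\<dots> = twt (- t) x"
    using 7(2) bihom_space.twist_neg(1)[OF bihom_space_tp] by simp
  finally show ?case .
qed (simp_all add: bihom_space.twist_gen[OF bihom_space_tp, symmetric] struct_tp)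

lemma twist_hp: "\<lbrakk>m \<in> carrier M; n \<in> carrier N\<rbrakk> \<Longrightarrow> twist (tp M N) t (hp M N m n) = hp M N (twist M t m) (twist N t n)"
  by (simp add: twist_tp twt_hp)

end

end

section \<open>Untwisted actions under coactions and twists\<close>

context untwist
begin

lemma u_closed [simp]:
  "\<lbrakk>adm M; h \<in> carrier H; m \<in> carrier M\<rbrakk> \<Longrightarrow> ula H M h m \<in> carrier M"
  "\<lbrakk>adm M; h \<in> carrier H; m \<in> carrier M\<rbrakk> \<Longrightarrow> ura H M m h \<in> carrier M"
  "\<lbrakk>a \<in> carrier H; b \<in> carrier H\<rbrakk> \<Longrightarrow> U.mul a b \<in> carrier H"
  by (simp_all add: ula_def ura_def mul_eq)

lemma u_lin [simp]:
  "\<lbrakk>adm M; h \<in> carrier H; lin V M g\<rbrakk> \<Longrightarrow> lin V M (\<lambda>x. ula H M h (g x))"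
  "\<lbrakk>adm M; m \<in> carrier M; lin V H g\<rbrakk> \<Longrightarrow> lin V M (\<lambda>x. ula H M (g x) m)"
  "\<lbrakk>adm M; h \<in> carrier H; lin V M g\<rbrakk> \<Longrightarrow> lin V M (\<lambda>x. ura H M (g x) h)"
  "\<lbrakk>adm M; m \<in> carrier M; lin V H g\<rbrakk> \<Longrightarrow> lin V M (\<lambda>x. ura H M m (g x))"
  "\<lbrakk>a \<in> carrier H; lin V H g\<rbrakk> \<Longrightarrow> lin V H (\<lambda>x. U.mul a (g x))"
  "\<lbrakk>a \<in> carrier H; lin V H g\<rbrakk> \<Longrightarrow> lin V H (\<lambda>x. U.mul (g x) a)"
  by (simp_all add: ula_def ura_def mul_eq)

lemma u_mul_assoc: "\<lbrakk>a \<in> carrier H; b \<in> carrier H; c \<in> carrier H\<rbrakk> \<Longrightarrow> U.mul (U.mul a b) c = U.mul a (U.mul b c)"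
  using hopf_base.mul_assoc[OF hopf_base_U] by simp

context
  fixes V :: "('k, 'a) fa_object" and m h
  assumes V: "fah V" and m: "m \<in> carrier V" and h: "h \<in> carrier H"
begin

lemmas hb = fah_hbim[OF V]

lemma tw_ula: "twist V t (ula H V h m) = ula H V (twist H t h) (twist V t m)"
  and tw_ura: "twist V t (ura H V m h) = ura H V (twist V t m) (twist H t h)"
  and ula_ura: "g \<in> carrier H \<Longrightarrow> ula H V g (ura H V m h) = ura H V (ula H V g m) h"
  using hopf_bimodule.tw_la[OF hb, of h m t] hopf_bimodule.tw_ra[OF hb, of h m t]
    hopf_bimodule.la_ra[OF hb, of g h m] m h by simp_all

context
  fixes W :: "('k, 'a universe, 'y) module_scheme"
  assumes W: "module K W"
begin

lemma SL_ula: "bil H V W F \<Longrightarrow> U.SL W V (ula H V h m) F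
    = U.SL W (hunit H) h (\<lambda>a b. U.SL W V m (\<lambda>g x. F (U.mul a g) (ula H V b x)))"
  and SL_ura: "bil H V W F \<Longrightarrow> U.SL W V (ura H V m h) F
    = U.SL W (hunit H) h (\<lambda>a b. U.SL W V m (\<lambda>g x. F (U.mul g a) (ura H V x b)))"
  and SR_ula: "bil V H W F \<Longrightarrow> U.SR W V (ula H V h m) F
    = U.SL W (hunit H) h (\<lambda>a b. U.SR W V m (\<lambda>x g. F (ula H V a x) (U.mul b g)))"
  and SR_ura: "bil V H W F \<Longrightarrow> U.SR W V (ura H V m h) F
    = U.SL W (hunit H) h (\<lambda>a b. U.SR W V m (\<lambda>x g. F (ura H V x a) (U.mul g b)))"
  using hopf_bimodule.SL_la[OF hb, of "emb W" F h m] hopf_bimodule.SL_ra[OF hb, of "emb W" F h m]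
    hopf_bimodule.SR_la[OF hb, of "emb W" F h m] hopf_bimodule.SR_ra[OF hb, of "emb W" F h m] W m h by simp_all

end

end

end

section \<open>Structure maps of the tensor product on its generators\<close>

context untwist_tensor
begin

context
  fixes M N assumes M: "fah M" and N: "fah N"
begin

lemma admMN [simp]: "adm M" "adm N"
  by (rule admM[OF M], rule admM[OF N])

lemmas hpl [simp] = mod_tp[OF M N] hp_closed[OF M N] hp_lin[OF M N]
lemmas twMN' = twM[OF M] twM[OF N] tws twH tw_mult twist_hp[OF M N]
lemmas twu = tw_ula[OF M] tw_ura[OF M] tw_ula[OF N] tw_ura[OF N] tws twH
lemmas spaceV = bihom_space_tp[OF M N]

lemma twV [simp]:
  "x \<in> carrier (tp M N) \<Longrightarrow> twist (tp M N) t x \<in> carrier (tp M N)"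
  "lin V (tp M N) g \<Longrightarrow> lin V (tp M N) (\<lambda>x. twist (tp M N) t (g x))"
  by (rule bihom_space.twist_closed[OF spaceV] linear_comp[OF bihom_space.twist_lin[OF spaceV]]; assumption)+

lemma hp_p: "\<lbrakk>m \<in> carrier M; n \<in> carrier N\<rbrakk>
    \<Longrightarrow> hp M N m n = p M N (twist M (t1 + 1, t2, t3, t4) m) (twist N (t1, t2 + 1, t3, t4) n)"
  by (simp add: p_def tws)

lemma p_closed [simp]: "\<lbrakk>m \<in> carrier M; n \<in> carrier N\<rbrakk> \<Longrightarrow> p M N m n \<in> carrier (tp M N)"
  by (simp add: p_def)

lemma p_lin [simp]:
  "\<lbrakk>lin V M g; n \<in> carrier N\<rbrakk> \<Longrightarrow> lin V (tp M N) (\<lambda>x. p M N (g x) n)"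
  "\<lbrakk>lin V N g; m \<in> carrier M\<rbrakk> \<Longrightarrow> lin V (tp M N) (\<lambda>x. p M N m (g x))"
  by (simp_all add: p_def)

lemma tw_p: "\<lbrakk>m \<in> carrier M; n \<in> carrier N\<rbrakk> \<Longrightarrow> twist (tp M N) t (p M N m n) = p M N (twist M t m) (twist N t n)"
  by (simp add: p_def twist_hp[OF M N] tws add.commute)

lemma p_bal:
  assumes [simp]: "m \<in> carrier M" "h \<in> carrier H" "n \<in> carrier N"
  shows "p M N (ura H M m h) n = p M N m (ula H N h n)"
  \<comment> \<open>Expanding p and the ordinary action, the left-hand side pairs T^-1
    \<alpha>^-2(m) acted on by T^-1 \<alpha>^-1 \<beta>^-1(h) with \<beta> of T^-1 \<beta>^-2(n);
    these are the arguments of the defining relation.\<close>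
  using hp_rel[OF M N, of "twist M (- t1 - 2, - t2, - t3, - t4) m" "twist H (- t1 - 1, - t2 - 1, - t3, - t4) h"
      "twist N (- t1, - t2 - 2, - t3, - t4) n"]
  by (simp add: p_def ura_def ula_def twMN' diff_conv_add_uminus ac_simps del: add_uminus_conv_diff uminus_add_conv_diff)

text \<open>The shifts by T \<alpha> and T \<beta> undo those in p. They turn a map balanced for the
  ordinary actions into one respecting the BiHom relations, so the universal property can be stated
  for the generators p.\<close>

lemma rbalI:
  assumes F: "\<And>m h n. \<lbrakk>m \<in> carrier M; h \<in> carrier H; n \<in> carrier N\<rbrakk> \<Longrightarrow> F (ura H M m h) n = F m (ula H N h n)"
  shows "rbal M N (\<lambda>m n. F (twist M (t1 + 1, t2, t3, t4) m) (twist N (t1, t2 + 1, t3, t4) n))"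
  unfolding rbal_def[OF M N]
proof (intro ballI)
  fix m h n assume [simp]: "m \<in> carrier M" "h \<in> carrier H" "n \<in> carrier N"
  have 1: "twist M (t1 + 1, t2, t3, t4) (ract M m h) = ura H M (twist M (t1 + 2, t2, t3, t4) m) (twist H (t1 + 1, t2 + 1, t3, t4) h)"
    by (simp add: ura_def twMN' add.commute)
  have 2: "twist N (t1, t2 + 1, t3, t4) (lact N h n) = ula H N (twist H (t1 + 1, t2 + 1, t3, t4) h) (twist N (t1, t2 + 2, t3, t4) n)"
    by (simp add: ula_def twMN' add.commute)
  show "F (twist M (t1 + 1, t2, t3, t4) (ract M m h)) (twist N (t1, t2 + 1, t3, t4) (twist N (0, 1, 0, 0) n))
    = F (twist M (t1 + 1, t2, t3, t4) (twist M (1, 0, 0, 0) m)) (twist N (t1, t2 + 1, t3, t4) (lact N h n))"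
    unfolding 1 2 by (simp add: F tws add.commute)
qed

context
  fixes W :: "('k, 'a universe, 'y) module_scheme" and F
  assumes W [simp]: "module K W" and F: "bil M N W F"
    and bal: "\<And>m h n. \<lbrakk>m \<in> carrier M; h \<in> carrier H; n \<in> carrier N\<rbrakk> \<Longrightarrow> F (ura H M m h) n = F m (ula H N h n)"
begin

lemma lift_bil: "bil M N W (\<lambda>m n. F (twist M (t1 + 1, t2, t3, t4) m) (twist N (t1, t2 + 1, t3, t4) n))"
  by (intro bilI bilinear_comps[OF F]) simp_all

lemma lift_lin: "lin (tp M N) W (\<lambda>x. sweedler W x (\<lambda>m n. F (twist M (t1 + 1, t2, t3, t4) m) (twist N (t1, t2 + 1, t3, t4) n)))"
  by (rule sw_lin[OF M N W lift_bil rbalI[OF bal]])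

lemma lift_p: "\<lbrakk>m \<in> carrier M; n \<in> carrier N\<rbrakk>
    \<Longrightarrow> sweedler W (p M N m n) (\<lambda>m n. F (twist M (t1 + 1, t2, t3, t4) m) (twist N (t1, t2 + 1, t3, t4) n)) = F m n"
  unfolding p_def by (subst sw_hp[OF M N W lift_bil rbalI[OF bal]]) (simp_all add: tws)

end

text \<open>The action is given by a sum over chosen representatives. Writing its summand through a
  map balanced for the ordinary actions gives independence of the choice, linearity and the value on
  generators together.\<close>

lemma lact_tp:
  assumes h [simp]: "h \<in> carrier H"
  shows "lin (tp M N) (tp M N) (lact (tp M N) h)"
    and "\<lbrakk>m \<in> carrier M; n \<in> carrier N\<rbrakk> \<Longrightarrow> lact (tp M N) h (p M N m n)
      = p M N (ula H M (twist H (1, 0, 0, 0) h) (twist M (0, 1, 0, 0) m)) (twist N (0, 1, 0, 0) n)"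
proof -
  let ?F = "\<lambda>m n. p M N (ula H M (twist H (1, 0, 0, 0) h) (twist M (0, 1, 0, 0) m)) (twist N (0, 1, 0, 0) n)"
  have b: "bil M N (tp M N) ?F" by simp
  have bal: "?F (ura H M m k) n = ?F m (ula H N k n)" if [simp]: "m \<in> carrier M" "k \<in> carrier H" "n \<in> carrier N" for m k n
    by (simp add: twu ula_ura[OF M] p_bal)
  have eq: "lact (tp M N) h x = sweedler (tp M N) x (\<lambda>m n. ?F (twist M (t1 + 1, t2, t3, t4) m) (twist N (t1, t2 + 1, t3, t4) n))"
    if "x \<in> carrier (tp M N)" for x
    unfolding tp_ops by (rule sweedler_tp_cong[OF M N that]) (simp add: hp_p ula_def twMN' algebra_simps)
  show "lin (tp M N) (tp M N) (lact (tp M N) h)"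
    by (rule iffD2[OF linear_cong[OF _ eq] lift_lin[OF _ b bal]]) simp_all
  show "\<lbrakk>m \<in> carrier M; n \<in> carrier N\<rbrakk> \<Longrightarrow> lact (tp M N) h (p M N m n) = ?F m n"
    by (simp only: eq p_closed lift_p[OF mod_tp[OF M N] b bal])
qed

lemma ract_tp:
  assumes h [simp]: "h \<in> carrier H"
  shows "lin (tp M N) (tp M N) (\<lambda>x. ract (tp M N) x h)"
    and "\<lbrakk>m \<in> carrier M; n \<in> carrier N\<rbrakk> \<Longrightarrow> ract (tp M N) (p M N m n) h
      = p M N (twist M (1, 0, 0, 0) m) (ura H N (twist N (1, 0, 0, 0) n) (twist H (0, 1, 0, 0) h))"
proof -
  let ?F = "\<lambda>m n. p M N (twist M (1, 0, 0, 0) m) (ura H N (twist N (1, 0, 0, 0) n) (twist H (0, 1, 0, 0) h))"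
  have b: "bil M N (tp M N) ?F" by simp
  have bal: "?F (ura H M m k) n = ?F m (ula H N k n)" if [simp]: "m \<in> carrier M" "k \<in> carrier H" "n \<in> carrier N" for m k n
    by (simp add: twu ula_ura[OF N, symmetric] p_bal)
  have eq: "ract (tp M N) x h = sweedler (tp M N) x (\<lambda>m n. ?F (twist M (t1 + 1, t2, t3, t4) m) (twist N (t1, t2 + 1, t3, t4) n))"
    if "x \<in> carrier (tp M N)" for x
    unfolding tp_ops by (rule sweedler_tp_cong[OF M N that]) (simp add: hp_p ura_def twMN' algebra_simps)
  show "lin (tp M N) (tp M N) (\<lambda>x. ract (tp M N) x h)"
    by (rule iffD2[OF linear_cong[OF _ eq] lift_lin[OF _ b bal]]) simp_all
  show "\<lbrakk>m \<in> carrier M; n \<in> carrier N\<rbrakk> \<Longrightarrow> ract (tp M N) (p M N m n) h = ?F m n"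
    by (simp only: eq p_closed lift_p[OF mod_tp[OF M N] b bal])
qed

lemma tens_mod [simp]: "module K (tensor K H (tp M N))" "module K (tensor K (tp M N) H)"
  by (simp_all add: module_tensor)

lemma lcoact_tp:
  shows "lin (tp M N) (tensor K H (tp M N)) (lcoact (tp M N))"
    and "\<lbrakk>m \<in> carrier M; n \<in> carrier N\<rbrakk> \<Longrightarrow> lcoact (tp M N) (p M N m n)
      = U.SL (tensor K H (tp M N)) M m (\<lambda>g x. U.SL (tensor K H (tp M N)) N n (\<lambda>h y.
          pure K H (tp M N) (twist H (0, 0, 1, 0) (U.mul g h)) (twist (tp M N) (0, 0, 0, 1) (p M N x y))))"
proof -
  let ?W = "tensor K H (tp M N)"
  let ?P = "\<lambda>g x. pure K H (tp M N) (twist H (0, 0, 1, 0) g) (twist (tp M N) (0, 0, 0, 1) x)"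
  let ?F = "\<lambda>m n. U.SL ?W M m (\<lambda>g x. U.SL ?W N n (\<lambda>h y. ?P (U.mul g h) (p M N x y)))"
  have b: "bil M N ?W ?F" by simp
  \<comment> \<open>One leg of k is absorbed between the coaction legs of m and n, the other moves
    across the tensor sign; both sides reach the same form.\<close>
  have bal: "?F (ura H M m k) n = ?F m (ula H N k n)" if [simp]: "m \<in> carrier M" "k \<in> carrier H" "n \<in> carrier N" for m k n
  proof -
    have "?F (ura H M m k) n = U.SL ?W (hunit H) k (\<lambda>a b. U.SL ?W M m (\<lambda>g x. U.SL ?W N n (\<lambda>h y.
        ?P (U.mul g (U.mul a h)) (p M N x (ula H N b y)))))"
      by (simp add: SL_ura[OF M] u_mul_assoc p_bal)
    also have "\<dots> = U.SL ?W M m (\<lambda>g x. U.SL ?W (hunit H) k (\<lambda>a b. U.SL ?W N n (\<lambda>h y.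
        ?P (U.mul g (U.mul a h)) (p M N x (ula H N b y)))))"
      by (rule U.SL_SL_commute; simp)
    also have "\<dots> = ?F m (ula H N k n)"
      by (simp add: SL_ula[OF N])
    finally show ?thesis .
  qed
  have eq: "lcoact (tp M N) x = sweedler ?W x (\<lambda>m n. ?F (twist M (t1 + 1, t2, t3, t4) m) (twist N (t1, t2 + 1, t3, t4) n))"
    if "x \<in> carrier (tp M N)" for x
    unfolding tp_ops by (rule sweedler_tp_cong[OF M N that])
      (simp add: raw_SL SL_twist[OF M] SL_twist[OF N] hp_p tw_p mul_eq twMN' algebra_simps)
  show "lin (tp M N) ?W (lcoact (tp M N))"
    by (rule iffD2[OF linear_cong[OF _ eq] lift_lin[OF _ b bal]]) simp_all
  show "\<lbrakk>m \<in> carrier M; n \<in> carrier N\<rbrakk> \<Longrightarrow> lcoact (tp M N) (p M N m n) = ?F m n"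
    by (simp only: eq p_closed lift_p[OF tens_mod(1) b bal])
qed

lemma rcoact_tp:
  shows "lin (tp M N) (tensor K (tp M N) H) (rcoact (tp M N))"
    and "\<lbrakk>m \<in> carrier M; n \<in> carrier N\<rbrakk> \<Longrightarrow> rcoact (tp M N) (p M N m n)
      = U.SR (tensor K (tp M N) H) M m (\<lambda>x g. U.SR (tensor K (tp M N) H) N n (\<lambda>y h.
          pure K (tp M N) H (twist (tp M N) (0, 0, 1, 0) (p M N x y)) (twist H (0, 0, 0, 1) (U.mul g h))))"
proof -
  let ?W = "tensor K (tp M N) H"
  let ?P = "\<lambda>x g. pure K (tp M N) H (twist (tp M N) (0, 0, 1, 0) x) (twist H (0, 0, 0, 1) g)"
  let ?F = "\<lambda>m n. U.SR ?W M m (\<lambda>x g. U.SR ?W N n (\<lambda>y h. ?P (p M N x y) (U.mul g h)))"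
  have b: "bil M N ?W ?F" by simp
  have bal: "?F (ura H M m k) n = ?F m (ula H N k n)" if [simp]: "m \<in> carrier M" "k \<in> carrier H" "n \<in> carrier N" for m k n
  proof -
    have "?F (ura H M m k) n = U.SL ?W (hunit H) k (\<lambda>a b. U.SR ?W M m (\<lambda>x g. U.SR ?W N n (\<lambda>y h.
        ?P (p M N x (ula H N a y)) (U.mul g (U.mul b h)))))"
      by (simp add: SR_ura[OF M] u_mul_assoc p_bal)
    also have "\<dots> = U.SR ?W M m (\<lambda>x g. U.SL ?W (hunit H) k (\<lambda>a b. U.SR ?W N n (\<lambda>y h.
        ?P (p M N x (ula H N a y)) (U.mul g (U.mul b h)))))"
      by (rule U.SL_SR_commute; simp)
    also have "\<dots> = ?F m (ula H N k n)"
      by (simp add: SR_ula[OF N])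
    finally show ?thesis .
  qed
  have eq: "rcoact (tp M N) x = sweedler ?W x (\<lambda>m n. ?F (twist M (t1 + 1, t2, t3, t4) m) (twist N (t1, t2 + 1, t3, t4) n))"
    if "x \<in> carrier (tp M N)" for x
    unfolding tp_ops by (rule sweedler_tp_cong[OF M N that])
      (simp add: raw_SR SR_twist[OF M] SR_twist[OF N] hp_p tw_p mul_eq twMN' algebra_simps)
  show "lin (tp M N) ?W (rcoact (tp M N))"
    by (rule iffD2[OF linear_cong[OF _ eq] lift_lin[OF _ b bal]]) simp_all
  show "\<lbrakk>m \<in> carrier M; n \<in> carrier N\<rbrakk> \<Longrightarrow> rcoact (tp M N) (p M N m n) = ?F m n"
    by (simp only: eq p_closed lift_p[OF tens_mod(2) b bal])
qed

lemma adm_tp [simp]: "adm (tp M N)"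
  unfolding fa_data_def
proof (intro conjI spaceV lcoact_tp rcoact_tp bilinear_mapsI lact_tp ract_tp)
  fix x assume x: "x \<in> carrier (tp M N)"
  show "lin H (tp M N) (\<lambda>h. lact (tp M N) h x)"
    unfolding tp_ops by (rule sw_lin_param[OF M N x]) (simp_all add: tws)
  show "lin H (tp M N) (ract (tp M N) x)"
    unfolding tp_ops[abs_def] by (rule sw_lin_param[OF M N x]) (simp_all add: tws)
qed

context
  fixes m n assumes m [simp]: "m \<in> carrier M" and n [simp]: "n \<in> carrier N"
begin

lemma ula_p: "h \<in> carrier H \<Longrightarrow> ula H (tp M N) h (p M N m n) = p M N (ula H M h m) n"
  by (simp add: ula_def[of H "tp M N"] tw_p lact_tp tws twH)

lemma ura_p: "h \<in> carrier H \<Longrightarrow> ura H (tp M N) (p M N m n) h = p M N m (ura H N n h)"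
  by (simp add: ura_def[of H "tp M N"] tw_p ract_tp tws twH)

lemma SL_p:
  assumes W [simp]: "module K W" and F: "bil H (tp M N) W F"
  shows "U.SL W (tp M N) (p M N m n) F = U.SL W M m (\<lambda>g x. U.SL W N n (\<lambda>h y. F (U.mul g h) (p M N x y)))"
proof -
  note [simp] = bilinear_comps[OF F] bilinear_mapsD[OF F]
  let ?F = "\<lambda>h x. F (twist H (0, 0, -1, 0) h) (twist (tp M N) (0, 0, 0, -1) x)"
  let ?f = "\<lambda>z. sweedler W z ?F"
  have f: "lin (tensor K H (tp M N)) W ?f" by (rule sweedler_tensor_lin) simp_all
  have q: "?f (pure K H (tp M N) a b) = ?F a b" if "a \<in> carrier H" "b \<in> carrier (tp M N)" for a b
    by (rule sweedler_tensor_pure) (simp_all add: that)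
  have "U.SL W (tp M N) (p M N m n) F = ?f (lcoact (tp M N) (p M N m n))"
    by (simp add: raw_SL tws twH)
  also have "\<dots> = U.SL W M m (\<lambda>g x. U.SL W N n (\<lambda>h y. F (U.mul g h) (p M N x y)))"
    unfolding lcoact_tp(2)[OF m n] by (simp add: map_SL[OF f] q tws twH)
  finally show ?thesis .
qed

lemma SR_p:
  assumes W [simp]: "module K W" and F: "bil (tp M N) H W F"
  shows "U.SR W (tp M N) (p M N m n) F = U.SR W M m (\<lambda>x g. U.SR W N n (\<lambda>y h. F (p M N x y) (U.mul g h)))"
proof -
  note [simp] = bilinear_comps[OF F] bilinear_mapsD[OF F]
  let ?F = "\<lambda>x h. F (twist (tp M N) (0, 0, -1, 0) x) (twist H (0, 0, 0, -1) h)"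
  let ?f = "\<lambda>z. sweedler W z ?F"
  have f: "lin (tensor K (tp M N) H) W ?f" by (rule sweedler_tensor_lin) simp_all
  have q: "?f (pure K (tp M N) H a b) = ?F a b" if "a \<in> carrier (tp M N)" "b \<in> carrier H" for a b
    by (rule sweedler_tensor_pure) (simp_all add: that)
  have "U.SR W (tp M N) (p M N m n) F = ?f (rcoact (tp M N) (p M N m n))"
    by (simp add: raw_SR tws twH)
  also have "\<dots> = U.SR W M m (\<lambda>x g. U.SR W N n (\<lambda>y h. F (p M N x y) (U.mul g h)))"
    unfolding rcoact_tp(2)[OF m n] by (simp add: map_SR[OF f] q tws twH)
  finally show ?thesis .
qed

end

lemma sum_pairs_rep:
  assumes "x \<in> carrier (tp M N)"
  shows "sum_pairs W F (rep M N x) = sweedler W x (\<lambda>m n. F (twist M (t1 + 1, t2, t3, t4) m) (twist N (t1, t2 + 1, t3, t4) n))"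
proof -
  have "rep M N x = map (\<lambda>(m, n). (twist M (t1 + 1, t2, t3, t4) m, twist N (t1, t2 + 1, t3, t4) n)) (summands x)"
    unfolding rep_def using summands_tp[OF M N assms] by (intro filter_True) auto
  then show ?thesis by (simp add: sweedler_def sum_pairs_map)
qed

end

lemma hopf_tensor_data_U: "hopf_tensor_data K (hunit H) (ula H) (ura H) (ulc H) (urc H) twist \<one>\<^bsub>H\<^esub> (counit H) (fa_data K H) uS rep"
  by (intro hopf_tensor_data.intro hopf_tensor_data_axioms.intro hopf_U) (auto simp: rep_def)

lemma ST_eq:
  fixes M N :: "('k, 'a) fa_object"
  shows "hopf_tensor_data.ST rep W M N x F = sum_pairs W F (rep M N x)"
  by (rule hopf_tensor_data.ST_def[OF hopf_tensor_data_U])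

lemma hopf_tensor_U: "hopf_tensor K (hunit H) (ula H) (ura H) (ulc H) (urc H) twist \<one>\<^bsub>H\<^esub> (counit H) (fa_data K H) uS tp rep p"
proof (intro hopf_tensor.intro hopf_tensor_axioms.intro hopf_tensor_data_U)
  fix M N assume "hbim M" "hbim N"
  then have M: "fah M" and N: "fah N" by (simp_all add: fah_iff)
  note [simp] = admMN[OF M N] adm_tp[OF M N] p_closed[OF M N] p_lin[OF M N]
  show "adm (tp M N)" "module K (tp M N)" by simp_all
  show "bil M N (tp M N) (p M N)" by simp
  show "bil (hunit H) (tp M N) (tp M N) (ula H (tp M N))" "bil (tp M N) (hunit H) (tp M N) (ura H (tp M N))" by simp_all
  show "lin (tp M N) (tp M N) (twist (tp M N) t)" for t by simp
  {
    fix x assume x: "x \<in> carrier (tp M N)"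
    have "sweedler (tp M N) x (\<lambda>m n. p M N (twist M (t1 + 1, t2, t3, t4) m) (twist N (t1, t2 + 1, t3, t4) n)) = sweedler (tp M N) x (hpure K H M N)"
      by (rule sweedler_tp_cong[OF M N x]) (simp add: hp_p[OF M N])
    then show "hopf_tensor_data.ST rep (tp M N) M N x (p M N) = x"
      by (simp add: ST_eq sum_pairs_rep[OF M N x] sw_id[OF M N x])
  }
  {
    fix W :: "('k, 'a) fa_object" and F assume W: "module K W" and F: "bil M N W F"
      and "hopf_tensor_data.balanced (hunit H) (ula H) (ura H) M N F"
    then have bal: "\<And>m h n. \<lbrakk>m \<in> carrier M; h \<in> carrier H; n \<in> carrier N\<rbrakk> \<Longrightarrow> F (ura H M m h) n = F m (ula H N h n)"
      unfolding hopf_tensor_data.balanced_def[OF hopf_tensor_data_U] by simp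
    show "lin (tp M N) W (\<lambda>x. hopf_tensor_data.ST rep W M N x F)"
      by (rule iffD2[OF linear_cong[OF _ ] lift_lin[OF M N W F bal]]) (simp_all add: ST_eq sum_pairs_rep[OF M N])
    fix m n assume "m \<in> carrier M" "n \<in> carrier N"
    then show "hopf_tensor_data.ST rep W M N (p M N m n) F = F m n"
      by (simp add: ST_eq sum_pairs_rep[OF M N] lift_p[OF M N W F bal])
  }
  {
    fix W :: "('k, 'a) fa_object" and F assume [simp]: "module K W"
    show "bil (hunit H) (tp M N) W F \<Longrightarrow> lin (tp M N) W (\<lambda>x. U.SL W (tp M N) x F)" by simp
    show "bil (tp M N) (hunit H) W F \<Longrightarrow> lin (tp M N) W (\<lambda>x. U.SR W (tp M N) x F)" by simp
    fix m n assume "m \<in> carrier M" "n \<in> carrier N"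
    then show "bil (hunit H) (tp M N) W F \<Longrightarrow> U.SL W (tp M N) (p M N m n) F = U.SL W M m (\<lambda>g x. U.SL W N n (\<lambda>h y. F (U.mul g h) (p M N x y)))"
      "bil (tp M N) (hunit H) W F \<Longrightarrow> U.SR W (tp M N) (p M N m n) F = U.SR W M m (\<lambda>x g. U.SR W N n (\<lambda>y h. F (p M N x y) (U.mul g h)))"
      by (simp_all add: SL_p[OF M N] SR_p[OF M N])
  }
  fix m h n assume [simp]: "m \<in> carrier M" "n \<in> carrier N"
  show "twist (tp M N) t (p M N m n) = p M N (twist M t m) (twist N t n)" for t by (simp add: tw_p[OF M N])
  assume "h \<in> carrier (hunit H)"
  then show "p M N (ura H M m h) n = p M N m (ula H N h n)"
    "ula H (tp M N) h (p M N m n) = p M N (ula H M h m) n"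
    "ura H (tp M N) (p M N m n) h = p M N m (ura H N n h)"
    by (simp_all add: p_bal[OF M N] ula_p[OF M N] ura_p[OF M N])
qed

end

section \<open>The category of BiHom-four-angle Hopf modules\<close>

locale untwist_bij = untwist_tensor K H S t1 t2 t3 t4
  for K :: "('k, 'z) ring_scheme" and H :: "('k, 'a universe, 'x) bihom_bialgebra_scheme" and S and t1 t2 t3 t4 :: int +
  assumes bij: "bij_betw S (carrier H) (carrier H)"
begin

text \<open>The inverse of \<open>uS\<close>, so the twist is undone before S is.\<close>

definition uSi where "uSi a = inv_into (carrier H) S (twist H (-1, 1, -1, 1) a)"

lemma inv_S_in [simp]: "a \<in> carrier H \<Longrightarrow> inv_into (carrier H) S a \<in> carrier H"
  using bij by (simp add: bij_betw_def inv_into_into)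

lemma inv_S [simp]:
  "a \<in> carrier H \<Longrightarrow> S (inv_into (carrier H) S a) = a" "a \<in> carrier H \<Longrightarrow> inv_into (carrier H) S (S a) = a"
  using bij_betw_inv_into_right[OF bij] bij_betw_inv_into_left[OF bij] by auto

sublocale B: hopf_tensor_bij K "hunit H" "ula H" "ura H" "ulc H" "urc H" twist "one H" "counit H" "fa_data K H" uS tp rep p uSi
  by (intro hopf_tensor_bij.intro hopf_tensor_U hopf_tensor_bij_axioms.intro)
    (simp_all add: uSi_def uS_def tw_S twH)

declare B.ST_cong [cong del]
  B.flip.SL_cong [cong del] B.flip.SR_cong [cong del] B.flip.ST_cong [cong del]
declare SL_cong' [cong] SR_cong' [cong]

lemma tw_inv_S: "a \<in> carrier H \<Longrightarrow> twist H t (inv_into (carrier H) S a) = inv_into (carrier H) S (twist H t a)"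
  using tw_S[of "inv_into (carrier H) S a" t] inv_S(2)[of "twist H t (inv_into (carrier H) S a)"] by (simp del: inv_S(2))

abbreviation bhom where "bhom M N f \<equiv> B.hom M N f"
abbreviation tmor where "tmor \<equiv> hmap K H (t1, t2, t3, t4)"
abbreviation tasc :: "('k, 'a) fa_object \<Rightarrow> _" where "tasc \<equiv> hassoc K H (t1, t2, t3, t4)"
abbreviation tlun :: "('k, 'a) fa_object \<Rightarrow> _" where "tlun \<equiv> hlunit K H (t1, t2, t3, t4)"
abbreviation trun :: "('k, 'a) fa_object \<Rightarrow> _" where "trun \<equiv> hrunit K H (t1, t2, t3, t4)"

text \<open>Restricting the map to the source makes every arrow extensional, so that equality of
  arrows becomes equality on the carrier, \<open>arr_eq\<close>.\<close>

definition arr :: "('k, 'a) fa_object \<Rightarrow> ('k, 'a) fa_object \<Rightarrow> _ \<Rightarrow> (('k, 'a) fa_object, 'a universe) arrow" where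
  "arr M N f = \<lparr>source = M, target = N, map_of_arrow = restrict f (carrier M)\<rparr>"

lemma arr_simps [simp]: "source (arr M N f) = M" "target (arr M N f) = N" "x \<in> carrier M \<Longrightarrow> map_of_arrow (arr M N f) x = f x"
  by (simp_all add: arr_def)

lemma arr_eq: "arr M N f = arr M N g \<longleftrightarrow> (\<forall>x\<in>carrier M. f x = g x)"
  by (auto simp: arr_def restrict_def fun_eq_iff)

lemma id_arr: "fa_id M = arr M M (\<lambda>x. x)"
  by (simp add: fa_id_def arr_def)

lemma comp_arr:
  assumes "\<And>x. x \<in> carrier M \<Longrightarrow> f x \<in> carrier N"
  shows "fa_comp (arr N R g) (arr M N f) = arr M R (\<lambda>x. g (f x))"
  using assms by (auto simp: fa_comp_def arr_def compose_def restrict_def fun_eq_iff)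

context
  fixes M N assumes M: "fah M" and N: "fah N"
begin

lemma objMN [simp]: "hbim M" "hbim N" "adm M" "adm N"
  by (simp_all add: fah_hbim M N)

text \<open>Together with \<open>hom_arr\<close> this identifies the arrows of the category with
  morphisms of ordinary Hopf bimodules. The proof works with the restricted map because that is the
  map stored in the arrow.\<close>

lemma arr_hom:
  assumes f: "bhom M N f"
  shows "arr M N f \<in> fa_hom K H M N"
proof -
  let ?g = "restrict f (carrier M)"
  have g: "bhom M N ?g" by (rule B.hom_cong[OF _ f]) simp_all
  note h = B.homD[OF g]
  have el: "lact M h m = ula H M (twist H (1, 0, 0, 0) h) (twist M (0, 1, 0, 0) m)"
    "ract M m h = ura H M (twist M (1, 0, 0, 0) m) (twist H (0, 1, 0, 0) h)"
    if "adm M" "m \<in> carrier M" "h \<in> carrier H" for M :: "('k, 'a) fa_object" and m h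
    using that by (simp_all add: ula_def ura_def tws twH)
  have a: "?g (lact M x m) = lact N x (?g m)" "?g (ract M m x) = ract N (?g m) x" if [simp]: "x \<in> carrier H" "m \<in> carrier M" for x m
    using h(2)[of "twist H (1, 0, 0, 0) x" "twist M (0, 1, 0, 0) m"] h(3)[of "twist H (0, 1, 0, 0) x" "twist M (1, 0, 0, 0) m"]
      h(4)[of m] h(7)[of m] by (simp_all add: el del: restrict_apply restrict_apply')
  have c: "lcoact N (?g m) = sweedler (tensor K H N) (lcoact M m) (\<lambda>h m0. pure K H N h (?g m0))"
    "rcoact N (?g m) = sweedler (tensor K N H) (rcoact M m) (\<lambda>m0 h. pure K N H (?g m0) h)" if m [simp]: "m \<in> carrier M" for m
  proof -
    have [simp]: "?g m \<in> carrier N" by (rule h(7)[OF m])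
    \<comment> \<open>Colinearity is tested on pure tensors themselves. Their target is a plain
      vector space, which \<open>emb\<close> brings into the type of the objects.\<close>
    have "lcoact N (?g m) = U.SL (emb (tensor K H N)) N (?g m) (\<lambda>h x. pure K H N (twist H (0, 0, 1, 0) h) (twist N (0, 0, 0, 1) x))"
      by (simp add: lcoact_eq del: restrict_apply restrict_apply')
    also have "\<dots> = U.SL (emb (tensor K H N)) M m (\<lambda>h x. pure K H N (twist H (0, 0, 1, 0) h) (twist N (0, 0, 0, 1) (?g x)))"
      by (rule h(5)) simp_all
    finally show "lcoact N (?g m) = sweedler (tensor K H N) (lcoact M m) (\<lambda>h m0. pure K H N h (?g m0))"
      by (simp add: raw_SL h(4) del: restrict_apply restrict_apply')
    have "rcoact N (?g m) = U.SR (emb (tensor K N H)) N (?g m) (\<lambda>x h. pure K N H (twist N (0, 0, 1, 0) x) (twist H (0, 0, 0, 1) h))"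
      by (simp add: rcoact_eq del: restrict_apply restrict_apply')
    also have "\<dots> = U.SR (emb (tensor K N H)) M m (\<lambda>x h. pure K N H (twist N (0, 0, 1, 0) (?g x)) (twist H (0, 0, 0, 1) h))"
      by (rule h(6)) simp_all
    finally show "rcoact N (?g m) = sweedler (tensor K N H) (rcoact M m) (\<lambda>m0 h. pure K N H (?g m0) h)"
      by (simp add: raw_SR h(4) del: restrict_apply restrict_apply')
  qed
  have "\<forall>m\<in>carrier M. ?g (\<alpha> M m) = \<alpha> N (?g m) \<and> ?g (\<beta> M m) = \<beta> N (?g m) \<and> ?g (\<omega> M m) = \<omega> N (?g m) \<and> ?g (\<psi> M m) = \<psi> N (?g m)"
    using h(4,7) by (simp add: tws del: restrict_apply restrict_apply')
  then show ?thesis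
    unfolding fa_hom_def arr_def using h(1) a c by blast
qed

lemma hom_arr:
  assumes "a \<in> fa_hom K H M N"
  obtains f where "a = arr M N f" "bhom M N f"
proof -
  obtain f where f: "a = \<lparr>source = M, target = N, map_of_arrow = f\<rparr>" "f \<in> extensional (carrier M)" "lin M N f"
    "\<And>m. m \<in> carrier M \<Longrightarrow> f (\<alpha> M m) = \<alpha> N (f m) \<and> f (\<beta> M m) = \<beta> N (f m) \<and> f (\<omega> M m) = \<omega> N (f m) \<and> f (\<psi> M m) = \<psi> N (f m)"
    "\<And>h m. h \<in> carrier H \<Longrightarrow> m \<in> carrier M \<Longrightarrow> f (lact M h m) = lact N h (f m) \<and> f (ract M m h) = ract N (f m) h"
    "\<And>m. m \<in> carrier M \<Longrightarrow> lcoact N (f m) = sweedler (tensor K H N) (lcoact M m) (\<lambda>h m0. pure K H N h (f m0))"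
    "\<And>m. m \<in> carrier M \<Longrightarrow> rcoact N (f m) = sweedler (tensor K N H) (rcoact M m) (\<lambda>m0 h. pure K N H (f m0) h)"
    using assms unfolding fa_hom_def by blast
  note [simp] = linear_mapsD(1)[OF f(3)] linear_comp[OF f(3)]
  \<comment> \<open>A morphism is only assumed to commute with the four structure maps; inverse
    powers follow by cancelling on the source and on the target.\<close>
  have tw: "f (twist M t m) = twist N t (f m)" if "m \<in> carrier M" for t m
    using that
  proof (induction t arbitrary: m rule: twist_induct)
    case (6 s t)
    have "f (twist M (s + t) m) = f (twist M s (twist M t m))" using 6(3) by (simp add: tws)
    also have "\<dots> = twist N s (twist N t (f m))" using 6 by simp
    finally show ?case using 6(3) by (simp add: tws)
  next
    case (7 t)
    have "twist N (- t) (f m) = twist N (- t) (f (twist M t (twist M (- t) m)))"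
      using 7(2) bihom_space.twist_neg(2)[OF admD(1)[OF admM[OF M]]] by simp
    also have "\<dots> = twist N (- t) (twist N t (f (twist M (- t) m)))"
      using 7 by simp
    also have "\<dots> = f (twist M (- t) m)"
      using 7(2) bihom_space.twist_neg(1)[OF admD(1)[OF admM[OF N]]] by simp
    finally show ?case by simp
  qed (use f(4) in \<open>simp_all add: tws\<close>)
  have "bhom M N f"
    unfolding B.hom_def
  proof (intro conjI ballI allI impI)
    show "lin M N f" by (rule f(3))
    fix m assume [simp]: "m \<in> carrier M"
    show "f (twist M t m) = twist N t (f m)" for t by (simp add: tw)
    fix h assume "h \<in> carrier (hunit H)"
    then show "f (ula H M h m) = ula H N h (f m)" "f (ura H M m h) = ura H N (f m) h"
      by (simp_all add: ula_def ura_def f(5) tw)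
  next
    fix W :: "('k, 'a) fa_object" and F m assume [simp]: "module K W" and "bil (hunit H) N W F" and [simp]: "m \<in> carrier M"
    then have F: "bil H N W F" by simp
    note [simp] = bilinear_comps[OF F] bilinear_mapsD[OF F]
    let ?F = "\<lambda>h x. F (twist H (0, 0, -1, 0) h) (twist N (0, 0, 0, -1) x)"
    let ?f = "\<lambda>z. sweedler W z ?F"
    have l: "lin (tensor K H N) W ?f" by (rule sweedler_tensor_lin) simp_all
    have q: "?f (pure K H N a b) = ?F a b" if "a \<in> carrier H" "b \<in> carrier N" for a b
      by (rule sweedler_tensor_pure) (simp_all add: that)
    have "U.SL W N (f m) F = ?f (lcoact N (f m))"
      by (simp add: raw_SL tws twH)
    also have "\<dots> = U.SL W M m (\<lambda>h x. F h (f x))"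
      by (simp only: f(6) \<open>m \<in> carrier M\<close>) (simp add: raw_SL map_SL[OF l] q tw tws twH)
    finally show "U.SL W N (f m) F = U.SL W M m (\<lambda>h x. F h (f x))" .
  next
    fix W :: "('k, 'a) fa_object" and F m assume [simp]: "module K W" and "bil N (hunit H) W F" and [simp]: "m \<in> carrier M"
    then have F: "bil N H W F" by simp
    note [simp] = bilinear_comps[OF F] bilinear_mapsD[OF F]
    let ?F = "\<lambda>x h. F (twist N (0, 0, -1, 0) x) (twist H (0, 0, 0, -1) h)"
    let ?f = "\<lambda>z. sweedler W z ?F"
    have l: "lin (tensor K N H) W ?f" by (rule sweedler_tensor_lin) simp_all
    have q: "?f (pure K N H a b) = ?F a b" if "a \<in> carrier N" "b \<in> carrier H" for a b
      by (rule sweedler_tensor_pure) (simp_all add: that)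
    have "U.SR W N (f m) F = ?f (rcoact N (f m))"
      by (simp add: raw_SR tws twH)
    also have "\<dots> = U.SR W M m (\<lambda>x h. F (f x) h)"
      by (simp only: f(7) \<open>m \<in> carrier M\<close>) (simp add: raw_SR map_SR[OF l] q tw tws twH)
    finally show "U.SR W N (f m) F = U.SR W M m (\<lambda>x h. F (f x) h)" .
  qed
  moreover have "a = arr M N f" using f(1,2) by (simp add: arr_def extensional_restrict)
  ultimately show thesis by (rule that[rotated])
qed

end

lemma fah_I [simp]: "fah (hunit H)"
  by (rule hunit_four_angle)

lemma fah_tp [simp]: "\<lbrakk>fah M; fah N\<rbrakk> \<Longrightarrow> fah (tp M N)"
  unfolding fah_iff by (rule B.obj_tp)

subsection \<open>The structure morphisms\<close>

lemma ST_sw: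
  fixes M N :: "('k, 'a) fa_object"
  assumes "fah M" "fah N" "x \<in> carrier (tp M N)"
  shows "B.ST W M N x F = sweedler W x (\<lambda>m n. F (twist M (t1 + 1, t2, t3, t4) m) (twist N (t1, t2 + 1, t3, t4) n))"
  using sum_pairs_rep[OF assms] by (simp add: B.ST_def)

text \<open>In an iterated tensor product the outer shift twists an element of the inner tensor
  product. This moves such a twist into the inner Sweedler sum.\<close>

lemma lift_twist:
  fixes M N W :: "('k, 'a) fa_object"
  assumes M: "fah M" and N: "fah N" and W [simp]: "module K W" and F: "bil M N W F"
    and bal: "\<And>m h n. \<lbrakk>m \<in> carrier M; h \<in> carrier H; n \<in> carrier N\<rbrakk> \<Longrightarrow> F (ura H M m h) n = F m (ula H N h n)"
    and x: "x \<in> carrier (tp M N)"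
  shows "B.ST W M N (twist (tp M N) t x) F = B.ST W M N x (\<lambda>m n. F (twist M t m) (twist N t n))"
proof (rule B.tp_ext[where W=W and f="\<lambda>x. B.ST W M N (twist (tp M N) t x) F", OF _ _ _ _ _ _ x])
  note [simp] = fah_hbim[OF M] fah_hbim[OF N] bilinear_comps[OF F] admM[OF M] admM[OF N] F bal
    tw_ula[OF M] tw_ura[OF M] tw_ula[OF N] tw_ura[OF N]
  have [simp]: "B.balanced M N F" "B.balanced M N (\<lambda>m n. F (twist M t m) (twist N t n))"
    by (rule B.balancedI, simp)+
  show "lin (tp M N) W (\<lambda>x. B.ST W M N (twist (tp M N) t x) F)"
    by (rule B.lin_ST_arg) simp_all
  show "lin (tp M N) W (\<lambda>x. B.ST W M N x (\<lambda>m n. F (twist M t m) (twist N t n)))"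
    by (rule B.ST_lin) simp_all
  fix m n assume [simp]: "m \<in> carrier M" "n \<in> carrier N"
  show "B.ST W M N (twist (tp M N) t (p M N m n)) F = B.ST W M N (p M N m n) (\<lambda>m n. F (twist M t m) (twist N t n))"
    by (simp add: B.ST_p B.tw_p)
qed (simp_all add: fah_hbim M N)

lemma hmap_arr:
  assumes o: "fah M" "fah N" "fah M'" "fah N'" and f: "bhom M M' f" and g: "bhom N N' g"
  shows "tmor (arr M M' f) (arr N N' g) = arr (tp M N) (tp M' N') (B.tmap M N M' N' f g)"
proof -
  note [simp] = fah_hbim[OF o(1)] fah_hbim[OF o(2)] fah_hbim[OF o(3)] fah_hbim[OF o(4)]
    admM[OF o(1)] admM[OF o(2)] B.homD(4,7)[OF f] B.homD(4,7)[OF g]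
  have "sweedler (tp M' N') x (\<lambda>m n. hp M' N' (map_of_arrow (arr M M' f) m) (map_of_arrow (arr N N' g) n)) = B.tmap M N M' N' f g x"
    if x: "x \<in> carrier (tp M N)" for x
    unfolding B.tmap_def ST_sw[OF o(1,2) x]
    by (rule sweedler_tp_cong[OF o(1,2) x]) (simp add: hp_p[OF o(3,4)])
  then show ?thesis
    by (simp add: hmap_def Let_def arr_def restrict_def fun_eq_iff)
qed

text \<open>In terms of pure tensors the outer shift contributes T \<alpha> to both m and n. After
  rebracketing, m keeps the surplus T \<alpha>, while the extra T^-1 \<beta>^-1 of the new outer
  pair cancels against n and stays on q.\<close>

lemma hassoc_arr:
  assumes o: "fah M" "fah N" "fah R"
  shows "tasc M N R = arr (tp (tp M N) R) (tp M (tp N R)) (B.asc M N R)"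
proof -
  note [simp] = fah_hbim[OF o(1)] fah_hbim[OF o(2)] fah_hbim[OF o(3)] admM[OF o(1)] admM[OF o(2)] admM[OF o(3)]
  let ?W = "tp M (tp N R)"
  have "sweedler ?W x (\<lambda>y q. sweedler ?W y (\<lambda>m n. hp M (tp N R) (twist M (t1, t2, t3, t4) (\<alpha> M m))
      (hp N R n (twist R (twist_inv (t1, t2, t3, t4)) (twist R (0, -1, 0, 0) q))))) = B.asc M N R x"
    if x: "x \<in> carrier (tp (tp M N) R)" for x
    unfolding B.asc_def ST_sw[OF fah_tp[OF o(1,2)] o(3) x]
  proof (rule sweedler_tp_cong[OF fah_tp[OF o(1,2)] o(3) x])
    fix y q assume y: "y \<in> carrier (tp M N)" and [simp]: "q \<in> carrier R"
    let ?q = "twist R (t1, t2 + 1, t3, t4) q"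
    have "B.ST ?W M N (twist (tp M N) (t1 + 1, t2, t3, t4) y) (\<lambda>m n. p M (tp N R) m (p N R n ?q))
      = B.ST ?W M N y (\<lambda>m n. p M (tp N R) (twist M (t1 + 1, t2, t3, t4) m) (p N R (twist N (t1 + 1, t2, t3, t4) n) ?q))"
    proof (rule lift_twist[OF o(1,2) _ _ _ y])
      show "p M (tp N R) (ura H M m h) (p N R n ?q) = p M (tp N R) m (p N R (ula H N h n) ?q)"
        if "m \<in> carrier M" "h \<in> carrier H" "n \<in> carrier N" for m h n
        using that by (simp add: B.p_bal B.la_p)
    qed simp_all
    also have "\<dots> = sweedler ?W y (\<lambda>m n. hp M (tp N R) (twist M (t1, t2, t3, t4) (\<alpha> M m))
      (hp N R n (twist R (twist_inv (t1, t2, t3, t4)) (twist R (0, -1, 0, 0) q))))"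
      unfolding ST_sw[OF o(1,2) y]
      by (rule sweedler_tp_cong[OF o(1,2) y])
        (simp add: hp_p[OF o(1) fah_tp[OF o(2,3)]] hp_p[OF o(2,3)] tws B.tw_p add.commute add.left_commute)
    finally show "sweedler ?W y (\<lambda>m n. hp M (tp N R) (twist M (t1, t2, t3, t4) (\<alpha> M m))
        (hp N R n (twist R (twist_inv (t1, t2, t3, t4)) (twist R (0, -1, 0, 0) q))))
      = B.ST ?W M N (twist (tp M N) (t1 + 1, t2, t3, t4) y) (\<lambda>m n. p M (tp N R) m (p N R n ?q))"
      by simp
  qed
  then show ?thesis
    by (simp add: hassoc_def Let_def arr_def restrict_def fun_eq_iff)
qed

lemma hlunit_arr:
  assumes o: "fah M"
  shows "tlun M = arr (tp (hunit H) M) M (B.lun M)"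
proof -
  note [simp] = fah_hbim[OF o] admM[OF o]
  have "sweedler M x (\<lambda>h m. twist M (t1, t2, t3, t4) (lact M h m)) = B.lun M x" if x: "x \<in> carrier (tp (hunit H) M)" for x
    unfolding B.lun_def ST_sw[OF fah_I o x]
    by (rule sweedler_tp_cong[OF fah_I o x]) (simp add: ula_def twM[OF o] tws twH)
  then show ?thesis
    by (simp add: hlunit_def Let_def arr_def restrict_def fun_eq_iff)
qed

lemma hrunit_arr:
  assumes o: "fah M"
  shows "trun M = arr (tp M (hunit H)) M (B.run M)"
proof -
  note [simp] = fah_hbim[OF o] admM[OF o]
  have "sweedler M x (\<lambda>m h. twist M (t1, t2, t3, t4) (ract M m h)) = B.run M x" if x: "x \<in> carrier (tp M (hunit H))" for x
    unfolding B.run_def ST_sw[OF o fah_I x]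
    by (rule sweedler_tp_cong[OF o fah_I x]) (simp add: ura_def twM[OF o] tws twH)
  then show ?thesis
    by (simp add: hrunit_def Let_def arr_def restrict_def fun_eq_iff)
qed

end

context untwist_bij
begin

subsection \<open>The braiding\<close>

lemma uS_lin: "lin V H g \<Longrightarrow> lin V H (\<lambda>x. uS (g x))"
  by (simp add: uS_def)

lemma inv_S_lin: "lin V H g \<Longrightarrow> lin V H (\<lambda>x. inv_into (carrier H) S (g x))"
  by (rule linear_comp[OF linear_inverse[OF _ _ antipode_linear]]) simp_all

lemma uSi_lin: "lin V H g \<Longrightarrow> lin V H (\<lambda>x. uSi (g x))"
  by (simp add: uSi_def inv_S_lin)

lemma uS_in: "a \<in> carrier H \<Longrightarrow> uS a \<in> carrier H" and uSi_in: "a \<in> carrier H \<Longrightarrow> uSi a \<in> carrier H"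
  by (simp_all add: uS_def uSi_def)

text \<open>By \<open>uS_eq\<close> either sign of the exponents represents \<open>uS\<close>, so
  its inverse also has two forms; the formula for the inverse braiding uses one form for each of its
  antipodes.\<close>

lemma uSi_eq: "a \<in> carrier H \<Longrightarrow> uSi a = inv_into (carrier H) S (twist H (1, -1, 1, -1) a)"
  using B.Si_S[of "inv_into (carrier H) S (twist H (1, -1, 1, -1) a)"] by (simp add: uS_eq twH del: B.Si_S)

lemmas uS_simps = uS_lin uSi_lin uS_in uSi_in inv_S_lin

text \<open>Inserting the definitions of P and Q nests a second coaction inside each coaction of m
  and n. Coassociativity on both sides replaces these by coproducts of the coaction legs, the shape
  of the explicit formulas.\<close>

lemma sum_swap:
  fixes M N W :: "('k, 'a) fa_object"
  assumes M: "fah M" and N: "fah N" and m [simp]: "m \<in> carrier M" and n [simp]: "n \<in> carrier N" and W [simp]: "module K W"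
    and L [simp]: "\<And>c w z d k. \<lbrakk>c \<in> carrier H; w \<in> carrier M; z \<in> carrier N; d \<in> carrier H; k \<in> carrier H\<rbrakk> \<Longrightarrow> lin H W (\<lambda>a. G a c w z d k)"
      "\<And>a w z d k. \<lbrakk>a \<in> carrier H; w \<in> carrier M; z \<in> carrier N; d \<in> carrier H; k \<in> carrier H\<rbrakk> \<Longrightarrow> lin H W (\<lambda>c. G a c w z d k)"
      "\<And>a c z d k. \<lbrakk>a \<in> carrier H; c \<in> carrier H; z \<in> carrier N; d \<in> carrier H; k \<in> carrier H\<rbrakk> \<Longrightarrow> lin M W (\<lambda>w. G a c w z d k)"
      "\<And>a c w d k. \<lbrakk>a \<in> carrier H; c \<in> carrier H; w \<in> carrier M; d \<in> carrier H; k \<in> carrier H\<rbrakk> \<Longrightarrow> lin N W (\<lambda>z. G a c w z d k)"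
      "\<And>a c w z k. \<lbrakk>a \<in> carrier H; c \<in> carrier H; w \<in> carrier M; z \<in> carrier N; k \<in> carrier H\<rbrakk> \<Longrightarrow> lin H W (\<lambda>d. G a c w z d k)"
      "\<And>a c w z d. \<lbrakk>a \<in> carrier H; c \<in> carrier H; w \<in> carrier M; z \<in> carrier N; d \<in> carrier H\<rbrakk> \<Longrightarrow> lin H W (\<lambda>k. G a c w z d k)"
  shows "U.SL W M m (\<lambda>a x. U.SR W N n (\<lambda>y k. U.SL W M x (\<lambda>c w. U.SR W N y (\<lambda>z d. G a c w z d k))))
    = U.SL W M m (\<lambda>g w. U.SL W (hunit H) g (\<lambda>a c. U.SR W N n (\<lambda>z h. U.SL W (hunit H) h (\<lambda>d k. G a c w z d k))))"
proof -
  note [simp] = admM[OF M] admM[OF N]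
  have [simp]: "G a c w z d k \<in> carrier W"
    if "a \<in> carrier H" "c \<in> carrier H" "w \<in> carrier M" "z \<in> carrier N" "d \<in> carrier H" "k \<in> carrier H" for a c w z d k
    using linear_mapsD(1)[OF L(1)] that by blast
  have "U.SL W M m (\<lambda>a x. U.SR W N n (\<lambda>y k. U.SL W M x (\<lambda>c w. U.SR W N y (\<lambda>z d. G a c w z d k))))
    = U.SL W M m (\<lambda>a x. U.SL W M x (\<lambda>c w. U.SR W N n (\<lambda>y k. U.SR W N y (\<lambda>z d. G a c w z d k))))"
    by (rule U.SL_cong[OF HOL.refl], rule U.SL_SR_commute[symmetric]) simp_all
  also have "\<dots> = U.SL W M m (\<lambda>g w. U.SL W (hunit H) g (\<lambda>a c. U.SR W N n (\<lambda>y k. U.SR W N y (\<lambda>z d. G a c w z d k))))"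
    by (rule hopf_bimodule.SL_coassoc[OF fah_hbim[OF M]]) simp_all
  also have "\<dots> = U.SL W M m (\<lambda>g w. U.SL W (hunit H) g (\<lambda>a c. U.SR W N n (\<lambda>z h. U.SL W (hunit H) h (\<lambda>d k. G a c w z d k))))"
    by (rule SL_cong'[OF HOL.refl], unfold simp_implies_def, rule SL_cong'[OF HOL.refl], unfold simp_implies_def,
        rule hopf_bimodule.SR_coassoc[OF fah_hbim[OF N]]) simp_all
  finally show ?thesis .
qed

context
  fixes M N m n assumes M: "fah M" and N: "fah N" and m [simp]: "m \<in> carrier M" and n [simp]: "n \<in> carrier N"
begin

lemma sigma_hp: "B.sigma M N (hp M N m n) = braid_formula K H S M N m n"
proof -
  note [simp] = fah_hbim[OF M] fah_hbim[OF N] admM[OF M] admM[OF N] uS_simps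
    p_closed[OF N M] p_lin[OF N M] hp_lin[OF N M] hp_closed[OF N M]
  let ?m = "twist M (t1 + 1, t2, t3, t4) m" and ?n = "twist N (t1, t2 + 1, t3, t4) n"
  let ?V = "tp N M"
  let ?G = "\<lambda>a c w z d k. p N M (ula H N a (ura H N z (uS d))) (ura H M (ula H M (uS c) w) k)"
  have "B.sigma M N (hp M N m n) = B.br M N ?m ?n"
    by (simp add: hp_p[OF M N] B.sigma_p)
  also have "\<dots> = U.SL ?V M ?m (\<lambda>a x. U.SR ?V N ?n (\<lambda>y k. U.SL ?V M x (\<lambda>c w. p N M (ula H N a (B.Q N y)) (ura H M (ula H M (uS c) w) k))))"
    by (simp add: B.br_def B.P_def map_SL[where V=M and W="?V" and f="\<lambda>z. p N M _ (ura H M z _)"])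
  also have "\<dots> = U.SL ?V M ?m (\<lambda>a x. U.SR ?V N ?n (\<lambda>y k. U.SL ?V M x (\<lambda>c w. U.SR ?V N y (\<lambda>z d. ?G a c w z d k))))"
    by (simp add: B.Q_def map_SR[where V=N and W="?V" and f="\<lambda>z. p N M (ula H N _ z) _"])
  also have "\<dots> = U.SL ?V M ?m (\<lambda>g w. U.SL ?V (hunit H) g (\<lambda>a c. U.SR ?V N ?n (\<lambda>z h. U.SL ?V (hunit H) h (\<lambda>d k. ?G a c w z d k))))"
    by (rule sum_swap[OF M N]) simp_all
  \<comment> \<open>The second antipode is rewritten by \<open>uS_eq\<close>. With the defining
    exponents on the first antipode and the negated ones on the second, the twists combine to the
    powers in the formula.\<close>
  also have "\<dots> = U.SL ?V M ?m (\<lambda>g w. U.SL ?V (hunit H) g (\<lambda>a c. U.SR ?V N ?n (\<lambda>z h. U.SL ?V (hunit H) h (\<lambda>d k.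
      p N M (ura H N (ula H N a z) (uS d)) (ula H M (twist H (-1, 1, -1, 1) (S c)) (ura H M w k))))))"
    by (simp add: ula_ura[OF M] ula_ura[OF N] uS_eq)
  also have "\<dots> = braid_formula K H S M N m n"
    unfolding braid_formula_def Let_def sweedler_tp
    by (simp add: raw_SL raw_SR raw_D SL_twist[OF M] SR_twist[OF N] D_twist)
      (simp add: hp_p[OF N M] ula_def ura_def uS_def twM[OF M] twM[OF N] tws twH tw_S
        diff_conv_add_uminus ac_simps del: add_uminus_conv_diff uminus_add_conv_diff)
  finally show ?thesis .
qed

text \<open>In the exchanged structure the right coaction of N is its left one. The flipped braiding
  therefore takes n_(1) out on the left and m_[-1] out on the right, and the antipodes become
  inverse antipodes.\<close>

lemma tau_hp: "B.flip.sigma N M (hp N M n m) = braid_inv_formula K H S M N n m"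
proof -
  note [simp] = fah_hbim[OF M] fah_hbim[OF N] admM[OF M] admM[OF N] uS_simps
    p_closed[OF M N] p_lin[OF M N] hp_lin[OF M N] hp_closed[OF M N]
  let ?n = "twist N (t1 + 1, t2, t3, t4) n" and ?m = "twist M (t1, t2 + 1, t3, t4) m"
  let ?V = "tp M N"
  let ?G = "\<lambda>k h z z' h' g. p M N (ula H M g (ura H M z (uSi h))) (ura H N (ula H N (uSi h') z') k)"
  have "B.flip.sigma N M (hp N M n m) = B.flip.br N M ?n ?m"
    by (simp add: hp_p[OF N M] B.flip.sigma_p)
  also have "\<dots> = U.SR ?V N ?n (\<lambda>x g. U.SL ?V M ?m (\<lambda>k y. p M N (ula H M g (B.flip.Q M y)) (ura H N (B.flip.P N x) k)))"
    by (simp add: B.flip.br_def B.flip_SL B.flip_SR)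
  also have "\<dots> = U.SL ?V M ?m (\<lambda>k y. U.SR ?V N ?n (\<lambda>x g. p M N (ula H M g (B.flip.Q M y)) (ura H N (B.flip.P N x) k)))"
    by (rule U.SL_SR_commute[symmetric]) simp_all
  also have "\<dots> = U.SL ?V M ?m (\<lambda>k y. U.SR ?V N ?n (\<lambda>x g. U.SL ?V M y (\<lambda>h z. p M N (ula H M g (ura H M z (uSi h))) (ura H N (B.flip.P N x) k))))"
    by (simp add: B.flip_Q map_SL[where V=M and W="?V" and f="\<lambda>z. p M N (ula H M _ z) _"])
  also have "\<dots> = U.SL ?V M ?m (\<lambda>k y. U.SR ?V N ?n (\<lambda>x g. U.SL ?V M y (\<lambda>h z. U.SR ?V N x (\<lambda>z' h'. ?G k h z z' h' g))))"
    by (simp add: B.flip_P map_SR[where V=N and W="?V" and f="\<lambda>z. p M N _ (ura H N z _)"])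
  also have "\<dots> = U.SL ?V M ?m (\<lambda>g w. U.SL ?V (hunit H) g (\<lambda>a c. U.SR ?V N ?n (\<lambda>z h. U.SL ?V (hunit H) h (\<lambda>d k. ?G a c w z d k))))"
    by (rule sum_swap[OF M N]) simp_all
  also have "\<dots> = U.SL ?V M ?m (\<lambda>g w. U.SL ?V (hunit H) g (\<lambda>a c. U.SR ?V N ?n (\<lambda>z h. U.SL ?V (hunit H) h (\<lambda>d k.
      p M N (ura H M (ula H M k w) (inv_into (carrier H) S (twist H (1, -1, 1, -1) c))) (ula H N (uSi d) (ura H N z a))))))"
    by (simp add: ula_ura[OF M] ula_ura[OF N] uSi_eq)
  also have "\<dots> = braid_inv_formula K H S M N n m"
    unfolding braid_inv_formula_def Let_def sweedler_tp
    by (simp add: raw_SL raw_SR raw_D SL_twist[OF M] SR_twist[OF N] D_twist)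
      (simp add: hp_p[OF M N] ula_def ura_def uSi_def twM[OF M] twM[OF N] tws twH tw_inv_S
        diff_conv_add_uminus ac_simps del: add_uminus_conv_diff uminus_add_conv_diff)
  finally show ?thesis .
qed

end

end

subsection \<open>The braided monoidal category\<close>

text \<open>Two inverses of f agree, so the description operator returns the given one; the second
  hexagon speaks of the inverse associativity through this operator.\<close>

lemma (in category) inverse_arrow_eq:
  assumes A: "A \<in> Obj" and B: "B \<in> Obj" and fg: "inverse_arrows A B f g"
  shows "inverse_arrow A B f = g"
  unfolding inverse_arrow_def
proof (rule the_equality[of "inverse_arrows A B f", OF fg])
  fix g' assume g': "inverse_arrows A B f g'"
  have "g' = (g \<cdot> f) \<cdot> g'"
    using fg g' A B by (simp add: inverse_arrows_def id_left)
  also have "\<dots> = g \<cdot> (f \<cdot> g')"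
    using comp_assoc[OF B A B A, of g' f g] fg g' by (simp add: inverse_arrows_def)
  also have "\<dots> = g"
    using fg g' A B by (simp add: inverse_arrows_def id_right)
  finally show "g' = g" .
qed

context untwist_bij
begin

abbreviation Obj where "Obj \<equiv> fa_obj K H"
abbreviation Hom where "Hom \<equiv> fa_hom K H"

lemma Obj_iff [simp]: "M \<in> Obj \<longleftrightarrow> fah M"
  by (simp add: fa_obj_def)

lemma category_fa: "category Obj Hom fa_id fa_comp"
proof
  show "A = A' \<and> B = B'" if "f \<in> Hom A B" "f \<in> Hom A' B'" for f A B A' B'
    using that by (auto simp: fa_hom_def)
  show "fa_id A \<in> Hom A A" if "A \<in> Obj" for A
    using that by (simp add: id_arr arr_hom B.hom_id)
  note [simp] = comp_arr
  fix A B f assume o: "A \<in> Obj" "B \<in> Obj" and f: "f \<in> Hom A B"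
  have oAB: "fah A" "fah B" using o by simp_all
  obtain f' where f' [simp]: "f = arr A B f'" "bhom A B f'" by (rule hom_arr[OF oAB f])
  show "fa_comp f (fa_id A) = f" "fa_comp (fa_id B) f = f"
    by (simp_all add: id_arr B.homD(7)[OF f'(2)])
  fix C g assume oC: "C \<in> Obj" and g: "g \<in> Hom B C"
  have C: "fah C" using oC by simp
  obtain g' where g' [simp]: "g = arr B C g'" "bhom B C g'" by (rule hom_arr[OF oAB(2) C g])
  show "fa_comp g f \<in> Hom A C"
    using arr_hom[OF oAB(1) C B.hom_comp[OF f'(2) g'(2)]] by (simp add: B.homD(7)[OF f'(2)])
  fix D h assume oD: "D \<in> Obj" and h: "h \<in> Hom C D"
  have D: "fah D" using oD by simp
  obtain h' where h' [simp]: "h = arr C D h'" "bhom C D h'" by (rule hom_arr[OF C D h])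
  show "fa_comp h (fa_comp g f) = fa_comp (fa_comp h g) f"
    by (simp add: B.homD(7)[OF f'(2)] B.homD(7)[OF g'(2)])
qed

sublocale cat: category Obj Hom fa_id fa_comp
  by (rule category_fa)

lemmas hom_closed [simp] = B.homD(7)[OF B.asc_hom] B.homD(7)[OF B.asc_inv_hom] B.homD(7)[OF B.lun_hom] B.homD(7)[OF B.run_hom]
  B.homD(7)[OF B.sigma_hom] B.flip.homD(7)[OF B.flip.sigma_hom] B.homD(7)[OF B.tmap_hom(2)]

lemma inverse_arr:
  assumes "fah M" "fah N" "bhom M N f" "bhom N M g"
    and "\<And>x. x \<in> carrier M \<Longrightarrow> g (f x) = x" "\<And>y. y \<in> carrier N \<Longrightarrow> f (g y) = y"
  shows "cat.inverse_arrows M N (arr M N f) (arr N M g)"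
  unfolding cat.inverse_arrows_def
  using assms B.homD(7)[OF assms(3)] B.homD(7)[OF assms(4)] by (simp add: arr_hom id_arr arr_eq comp_arr)

lemma iso_arr:
  assumes "fah M" "fah N" "bhom M N f" "bhom N M g"
    and "\<And>x. x \<in> carrier M \<Longrightarrow> g (f x) = x" "\<And>y. y \<in> carrier N \<Longrightarrow> f (g y) = y"
  shows "cat.iso_arrow M N (arr M N f)"
  unfolding cat.iso_arrow_def using inverse_arr[OF assms] by blast

lemma asc_inverse_arr:
  assumes o: "fah M" "fah N" "fah R"
  shows "cat.inverse_arrows (tp (tp M N) R) (tp M (tp N R))
    (arr (tp (tp M N) R) (tp M (tp N R)) (B.asc M N R)) (arr (tp M (tp N R)) (tp (tp M N) R) (B.asc_inv M N R))"
  by (rule inverse_arr) (simp_all add: o fah_hbim B.asc_hom B.asc_inv_hom B.asc_inverse)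

lemma monoidal_fa: "monoidal_category Obj Hom fa_id fa_comp tp tmor (hunit H)
  tasc tlun trun"
proof (intro monoidal_category.intro category_fa monoidal_category_axioms.intro)
  note [simp] = fah_hbim hassoc_arr hlunit_arr hrunit_arr id_arr hmap_arr arr_eq
    B.asc_hom B.lun_hom B.run_hom B.hom_id B.tmap_hom(2) comp_arr
  show "hunit H \<in> Obj" by simp
  fix M N assume o: "M \<in> Obj" "N \<in> Obj"
  then have o' [simp]: "fah M" "fah N" by simp_all
  show "tp M N \<in> Obj" by simp
  show "tmor (fa_id M) (fa_id N) = fa_id (tp M N)" by (simp add: B.tmap_id)
  show "cat.iso_arrow (tp (hunit H) M) M (tlun M)"
    unfolding hlunit_arr[OF o'(1)]
    by (rule iso_arr[where g="\<lambda>x. p (hunit H) M \<one>\<^bsub>H\<^esub> x"], simp_all add: B.lun_inverse)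
      (rule B.hom_inverse[OF _ _ B.lun_hom], simp_all add: B.lun_inverse one_closed)
  show "cat.iso_arrow (tp M (hunit H)) M (trun M)"
    unfolding hrunit_arr[OF o'(1)]
    by (rule iso_arr[where g="\<lambda>x. p M (hunit H) x \<one>\<^bsub>H\<^esub>"], simp_all add: B.run_inverse)
      (rule B.hom_inverse[OF _ _ B.run_hom], simp_all add: B.run_inverse one_closed)
  show "fa_comp (tmor (fa_id M) (tlun N)) (tasc M (hunit H) N)
      = tmor (trun M) (fa_id N)"
    by (simp add: B.triangle_map)
  {
    fix f assume "f \<in> Hom M N"
    then obtain f' where f' [simp]: "f = arr M N f'" "bhom M N f'" by (rule hom_arr[OF o'])
    note [simp] = B.homD(7)[OF f'(2)]
    show "fa_comp (tlun N) (tmor (fa_id (hunit H)) f)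
      = fa_comp f (tlun M)"
      by (simp add: B.lun_natural)
    show "fa_comp (trun N) (tmor f (fa_id (hunit H)))
      = fa_comp f (trun M)"
      by (simp add: B.run_natural)
  }
  fix M' N' assume "M' \<in> Obj" "N' \<in> Obj"
  then have o'' [simp]: "fah M'" "fah N'" by simp_all
  {
    fix f g assume "f \<in> Hom M N" "g \<in> Hom M' N'"
    then obtain f' g' where f' [simp]: "f = arr M N f'" "bhom M N f'" "g = arr M' N' g'" "bhom M' N' g'"
      using hom_arr o' o'' by metis
    note [simp] = B.homD(7)[OF f'(2)] B.homD(7)[OF f'(4)]
    show "tmor f g \<in> Hom (tp M M') (tp N N')"
      using arr_hom[OF fah_tp[OF o'(1) o''(1)] fah_tp[OF o'(2) o''(2)]] by simp
    fix R R' h k assume "R \<in> Obj" "R' \<in> Obj" "h \<in> Hom N R" "k \<in> Hom N' R'"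
    then obtain h' k' where h' [simp]: "fah R" "fah R'" "h = arr N R h'" "bhom N R h'" "k = arr N' R' k'" "bhom N' R' k'"
      using hom_arr o' o'' unfolding Obj_iff by metis
    show "tmor (fa_comp h f) (fa_comp k g)
      = fa_comp (tmor h k) (tmor f g)"
      using B.hom_comp[OF f'(2) h'(4)] B.hom_comp[OF f'(4) h'(6)]
      by (simp add: B.tmap_comp[where f'=h' and g'=k' and M'=N and N'=N'])
  }
  {
    fix f g R R' h assume "f \<in> Hom M N" "g \<in> Hom M' N'" "R \<in> Obj" "R' \<in> Obj" "h \<in> Hom R R'"
    then obtain f' g' h' where [simp]: "f = arr M N f'" "bhom M N f'" "g = arr M' N' g'" "bhom M' N' g'"
      "fah R" "fah R'" "h = arr R R' h'" "bhom R R' h'"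
      using hom_arr o' o'' unfolding Obj_iff by metis
    show "fa_comp (tasc N N' R') (tmor (tmor f g) h)
      = fa_comp (tmor f (tmor g h)) (tasc M M' R)"
      by (simp add: B.asc_natural)
  }
  show "cat.iso_arrow (tp (tp M N) M') (tp M (tp N M')) (tasc M N M')"
    using asc_inverse_arr[OF o' o''(1)] unfolding cat.iso_arrow_def by auto
  show "fa_comp (tmor (fa_id M) (tasc N M' N'))
      (fa_comp (tasc M (tp N M') N') (tmor (tasc M N M') (fa_id N')))
    = fa_comp (tasc M N (tp M' N')) (tasc (tp M N) M' N')"
    by (simp add: B.pentagon_map)
qed

section \<open>The braiding and its inverse as arrows\<close>

definition braid where "braid M N = arr (tp M N) (tp N M) (B.sigma M N)"
definition braid_inv where "braid_inv M N = arr (tp N M) (tp M N) (B.flip.sigma N M)"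

text \<open>The flipped braiding is a priori colinear for the exchanged coactions. As the inverse of
  the braiding it is a morphism for the original ones.\<close>

lemma sigma_bhom:
  assumes [simp]: "fah M" "fah N"
  shows "bhom (tp M N) (tp N M) (B.sigma M N)" "bhom (tp N M) (tp M N) (B.flip.sigma N M)"
proof -
  note [simp] = fah_hbim
  show 1: "bhom (tp M N) (tp N M) (B.sigma M N)" by (simp add: B.sigma_hom)
  show "bhom (tp N M) (tp M N) (B.flip.sigma N M)"
    by (rule B.hom_inverse[OF _ _ 1]) (simp_all add: B.flip_br_sigma B.sigma_flip_sigma B.flip.homD(7)[OF B.flip.sigma_hom])
qed

lemma braid_inverse:
  assumes o: "fah M" "fah N"
  shows "cat.inverse_arrows (tp M N) (tp N M) (braid M N) (braid_inv M N)"
  unfolding braid_def braid_inv_def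
  by (rule inverse_arr) (simp_all add: o fah_hbim sigma_bhom B.flip_br_sigma B.sigma_flip_sigma)

lemma inverse_hassoc:
  "\<lbrakk>fah M; fah N; fah R\<rbrakk> \<Longrightarrow> cat.inverse_arrow (tp (tp M N) R) (tp M (tp N R)) (tasc M N R)
    = arr (tp M (tp N R)) (tp (tp M N) R) (B.asc_inv M N R)"
  using cat.inverse_arrow_eq[OF _ _ asc_inverse_arr] by (simp add: hassoc_arr)

lemma braided_fa: "braided_monoidal_category Obj Hom fa_id fa_comp tp tmor (hunit H)
  tasc tlun trun braid"
proof (intro braided_monoidal_category.intro monoidal_fa braided_monoidal_category_axioms.intro)
  note [simp] = fah_hbim id_arr hmap_arr arr_eq
    B.asc_hom B.asc_inv_hom B.hom_id B.tmap_hom(2) sigma_bhom(1) comp_arr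
  fix M N assume "M \<in> Obj" "N \<in> Obj"
  then have o [simp]: "fah M" "fah N" by simp_all
  show "cat.iso_arrow (tp M N) (tp N M) (braid M N)"
    using braid_inverse[OF o] unfolding cat.iso_arrow_def by blast
  {
    fix M' N' f g assume "M' \<in> Obj" "N' \<in> Obj" "f \<in> Hom M M'" "g \<in> Hom N N'"
    then obtain f' g' where [simp]: "fah M'" "fah N'" "f = arr M M' f'" "bhom M M' f'" "g = arr N N' g'" "bhom N N' g'"
      using hom_arr o unfolding Obj_iff by metis
    show "fa_comp (braid M' N') (tmor f g) = fa_comp (tmor g f) (braid M N)"
      by (simp add: braid_def B.sigma_natural)
  }
  fix R assume "R \<in> Obj"
  then have [simp]: "fah R" by simp
  show "fa_comp (tasc N R M) (fa_comp (braid M (tp N R)) (tasc M N R))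
    = fa_comp (tmor (fa_id N) (braid M R))
        (fa_comp (tasc N M R) (tmor (braid M N) (fa_id R)))"
    by (simp add: hassoc_arr braid_def B.hexagon1_map)
  show "fa_comp (cat.inverse_arrow (tp (tp R M) N) (tp R (tp M N)) (tasc R M N))
      (fa_comp (braid (tp M N) R)
        (cat.inverse_arrow (tp (tp M N) R) (tp M (tp N R)) (tasc M N R)))
    = fa_comp (tmor (braid M R) (fa_id N))
        (fa_comp (cat.inverse_arrow (tp (tp M R) N) (tp M (tp R N)) (tasc M R N))
          (tmor (fa_id M) (braid N R)))"
    by (simp add: inverse_hassoc braid_def B.hexagon2_map)
qed

end

theorem theorem4p8:
  fixes K :: "('k, 'z) ring_scheme"
    and H :: "('k, 'a universe, 'x) bihom_bialgebra_scheme"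
    and S :: "'a universe \<Rightarrow> 'a universe"
    and T :: "int \<times> int \<times> int \<times> int"
  assumes "bihom_hopf_algebra K H S"
    and "bij_betw S (carrier H) (carrier H)"
  shows "\<exists>\<sigma> \<tau> :: ('k, 'a) fa_object \<Rightarrow> ('k, 'a) fa_object
               \<Rightarrow> (('k, 'a) fa_object, 'a universe) arrow.
    braided_monoidal_category (fa_obj K H) (fa_hom K H) fa_id fa_comp
      (htensor K H T) (hmap K H T) (hunit H) (hassoc K H T) (hlunit K H T) (hrunit K H T) \<sigma> \<and>
    (\<forall>M\<in>fa_obj K H. \<forall>N\<in>fa_obj K H.
       \<sigma> M N \<in> fa_hom K H (htensor K H T M N) (htensor K H T N M) \<and>
       \<tau> M N \<in> fa_hom K H (htensor K H T N M) (htensor K H T M N) \<and>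
       fa_comp (\<tau> M N) (\<sigma> M N) = fa_id (htensor K H T M N) \<and>
       fa_comp (\<sigma> M N) (\<tau> M N) = fa_id (htensor K H T N M) \<and>
       (\<forall>m\<in>carrier M. \<forall>n\<in>carrier N.
          map_of_arrow (\<sigma> M N) (hpure K H M N m n) = braid_formula K H S M N m n \<and>
          map_of_arrow (\<tau> M N) (hpure K H N M n m) = braid_inv_formula K H S M N n m)) \<and>
    (\<forall>M\<in>fa_obj K H. \<forall>N\<in>fa_obj K H. \<forall>P\<in>fa_obj K H. \<forall>m\<in>carrier M. \<forall>n\<in>carrier N. \<forall>p\<in>carrier P.
       map_of_arrow (hassoc K H T M N P) (hpure K H (htensor K H T M N) P (hpure K H M N m n) p)
         = hpure K H M (htensor K H T N P) (twist M T (\<alpha> M m))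
             (hpure K H N P n (twist P (twist_inv T) (twist P (0, -1, 0, 0) p)))) \<and>
    (\<forall>M\<in>fa_obj K H. \<forall>h\<in>carrier H. \<forall>m\<in>carrier M.
       map_of_arrow (hlunit K H T M) (hpure K H (hunit H) M h m) = twist M T (lact M h m) \<and>
       map_of_arrow (hrunit K H T M) (hpure K H M (hunit H) m h) = twist M T (ract M m h))"
proof -
  obtain t1 t2 t3 t4 where T: "T = (t1, t2, t3, t4)" by (cases T)
  interpret untwist_bij K H S t1 t2 t3 t4
    using assms by (intro untwist_bij.intro untwist_tensor.intro untwist.intro untwist_bij_axioms.intro)
  show ?thesis
    unfolding T
  proof (rule exI[of _ braid], rule exI[of _ braid_inv], intro conjI ballI)
    show "braided_monoidal_category Obj Hom fa_id fa_comp tp tmor (hunit H)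
      tasc tlun trun braid"
      by (rule braided_fa)
    fix M assume "M \<in> Obj"
    then have M: "fah M" by simp
    note [simp] = admM[OF M] fah_hbim[OF M]
    {
      fix N assume "N \<in> Obj"
      then have N: "fah N" by simp
      note inv = braid_inverse[OF M N, unfolded cat.inverse_arrows_def]
      show "braid M N \<in> Hom (tp M N) (tp N M)" "braid_inv M N \<in> Hom (tp N M) (tp M N)"
        "fa_comp (braid_inv M N) (braid M N) = fa_id (tp M N)" "fa_comp (braid M N) (braid_inv M N) = fa_id (tp N M)"
        using inv by simp_all
      {
        fix m n assume mn [simp]: "m \<in> carrier M" "n \<in> carrier N"
        show "map_of_arrow (braid M N) (hp M N m n) = braid_formula K H S M N m n"
          "map_of_arrow (braid_inv M N) (hp N M n m) = braid_inv_formula K H S M N n m"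
          using sigma_hp[OF M N mn] tau_hp[OF M N mn] by (simp_all add: braid_def braid_inv_def hp_closed[OF M N] hp_closed[OF N M])
      }
      fix P m n q assume "P \<in> Obj" and [simp]: "m \<in> carrier M" "n \<in> carrier N" "q \<in> carrier P"
      then have P: "fah P" by simp
      note [simp] = admM[OF N] admM[OF P] fah_hbim[OF N] fah_hbim[OF P] hp_closed[OF M N] hp_closed[OF fah_tp[OF M N] P] adm_tp[OF M N]
      \<comment> \<open>Both pure tensors are rewritten as generators, where the outer one twists
        the inner by T \<alpha>; rebracketing is then plain, and returning to pure tensors leaves
        the powers in the claim.\<close>
      have "map_of_arrow (tasc M N P) (hp (tp M N) P (hp M N m n) q)
        = p M (tp N P) (twist M (t1 + 1, t2, t3, t4) (twist M (t1 + 1, t2, t3, t4) m))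
            (p N P (twist N (t1 + 1, t2, t3, t4) (twist N (t1, t2 + 1, t3, t4) n)) (twist P (t1, t2 + 1, t3, t4) q))"
        by (simp add: hassoc_arr[OF M N P]) (simp add: hp_p[OF fah_tp[OF M N] P] hp_p[OF M N] B.tw_p B.asc_p)
      then show "map_of_arrow (tasc M N P) (hp (tp M N) P (hp M N m n) q)
        = hp M (tp N P) (twist M (t1, t2, t3, t4) (\<alpha> M m))
            (hp N P n (twist P (twist_inv (t1, t2, t3, t4)) (twist P (0, -1, 0, 0) q)))"
        by (simp add: hp_p[OF M fah_tp[OF N P]] hp_p[OF N P] hp_closed[OF N P] B.tw_p tws add.commute add.left_commute)
    }
    fix h m assume [simp]: "h \<in> carrier H" "m \<in> carrier M"
    show "map_of_arrow (tlun M) (hp (hunit H) M h m) = twist M (t1, t2, t3, t4) (lact M h m)"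
      by (simp add: hlunit_arr[OF M] hp_closed[OF fah_I M]) (simp add: hp_p[OF fah_I M] B.lun_p ula_def twM[OF M] tws twH)
    show "map_of_arrow (trun M) (hp M (hunit H) m h) = twist M (t1, t2, t3, t4) (ract M m h)"
      by (simp add: hrunit_arr[OF M] hp_closed[OF M fah_I]) (simp add: hp_p[OF M fah_I] B.run_p ura_def twM[OF M] tws twH)
  qed
qed

end
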